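(* Let the observations be $y_t=u_t+z_t^{\gamma_n}\xi_t$, $t=1-p,\dots,n$, as described in the context. Let $\hat{\bm\beta}_n^y=(\hat\beta^y_{1n},\dots,\hat\beta^y_{pn})^T$ be an estimator of $\bm\beta$ based on $y_{1-p},\dots,y_n$, define residuals $\hat\varepsilon_t^y=y_t-\hat\beta^y_{1n}y_{t-1}-\dots-\hat\beta^y_{pn}y_{t-p}$, $t=1,\dots,n$. Fix $m\ge1$ and points $0=x_0<x_1<\dots<x_m=\infty$ with $p_j^+:=P(x_j)-P(x_{j-1})>0$, $j=1,\dots,m$. Let $B_j^+=(x_{j-1},x_j]$, $B_j^-=(-x_j,-x_{j-1}]$ (with $B_m^+=(x_{m-1},\infty)$, $B_m^-=(-\infty,-x_{m-1}]$), let $\hat\nu_j^{\pm}$ be the number of residuals $\hat\varepsilon_1^y,\dots,\hat\varepsilon_n^y$ lying in $B_j^{\pm}$, and $$\hat\chi_n^2=\sum_{j=1}^m\frac{(\hat\nu_j^+-\hat\nu_j^-)^2}{2\hat\nu_j^+}.$$ Let $F_m(x,\lambda^2)$ denote the d.f. of the noncentral chi-square distribution with $m$ degrees of freedom and noncentrality parameter $\lambda^2$, and $|\cdot|$ the Euclidean norm. Fix arbitrary finite $R\ge0$, $\Gamma\ge0$. 1. Suppose the hypothesis $\mathbb S$ holds (i.e. $\rho=0$, innovation d.f. $P$ symmetric about zero), $P$ has zero mean and finite variance and is twice differentiable with bounded second derivative, and Condition (iv) holds with $\rho=0$. Then $$\sup_{x\in\mathbb R,\ \gamma\le\Gamma}\big|\mathbb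 P(\hat\chi_n^2\le x)-F_m(x,\lambda^2)\big|\to0,\quad n\to\infty,$$ where $\lambda^2=\gamma^2\,|\mathcal P^{-1/2}\bm\delta(\Pi)|^2$. 2. Suppose the alternative $\mathbb A_n(\rho)$ holds with $\rho>0$, and Conditions (i), (ii), (iv) hold. Then $$\sup_{x\in\mathbb R,\ \gamma\le\Gamma,\ \rho\le R}\big|\mathbb P(\hat\chi_n^2\le x)-F_m(x,\lambda^2)\big|\to0,\quad n\to\infty,$$ where $$\lambda^2=\big|\mathcal P^{-1/2}\,[\rho(\bm q^+-\bm q^-)+\gamma\,\bm\delta(\Pi)]\big|^2.$$
   Context: $AR(p)$ model: $u_t=\beta_1u_{t-1}+\dots+\beta_pu_{t-p}+\varepsilon_t$, $t\in\mathbb Z$, with known order $p$, unknown $\bm\beta=(\beta_1,\dots,\beta_p)^T$ such that all roots of $z^p-\beta_1z^{p-1}-\dots-\beta_p=0$ lie inside the unit disk, and i.i.d. innovations $\{\varepsilon_t\}$ with mean $0$, finite positive variance and d.f. $G$; $\{u_t\}$ is the stationary solution. Contaminated observations: $y_t=u_t+z_t^{\gamma_n}\xi_t$, $t=1-p,\dots,n$, where $\{z_t^{\gamma_n}\}$ are i.i.d. Bernoulli with success probability $\gamma_n=\min\{1,\gamma n^{-1/2}\}$, $\gamma\ge0$ unknown; $\{\xi_t\}$ are i.i.d. with an arbitrary unknown distribution $\Pi$ (gross errors); the sequences $\{u_t\},\{z_t^{\gamma_n}\},\{\xi_t\}$ are independent. Local alternatives: for $\rho\ge0$, $\mathbb A_n(\rho)$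 means $G(x)=A_n(x):=(1-\rho_n)P(x)+\rho_nQ(x)$ with $\rho_n=\min\{1,\rho n^{-1/2}\}$, $P$ an unknown d.f. symmetric about zero, $Q$ an unknown non-symmetric d.f.; $\rho=0$ is the symmetry hypothesis $\mathbb S$: $\varepsilon_1\overset{d}{=}-\varepsilon_1$. Condition (i): $P$ and $Q$ have zero means and finite variances. Condition (ii): $P$ and $Q$ are twice differentiable with bounded second derivatives. Condition (iv): under $\mathbb A_n(\rho)$, $n^{1/2}(\hat{\bm\beta}^y_n-\bm\beta)=O_P(1)$ as $n\to\infty$, uniformly in $\rho\le R$, $\gamma\le\Gamma$ (for all finite $R,\Gamma\ge0$). Notation: $\Delta(x,\Pi)=\sum_{j=0}^p[\mathbb E\,P(x+\beta_j\xi_1)-P(x)]$ with $\beta_0=-1$; $\delta_j(\Pi)=\Delta(x_j,\Pi)-\Delta(x_{j-1},\Pi)-[\Delta(-x_{j-1},\Pi)-\Delta(-x_j,\Pi)]$, $\bm\delta(\Pi)=(\delta_1(\Pi),\dots,\delta_m(\Pi))^T$; $q_j^+=Q(x_j)-Q(x_{j-1})$, $q_j^-=Q(-x_{j-1})-Q(-x_j)$, $\bm q^{\pm}=(q_1^\pm,\dots,q_m^\pm)^T$; $\mathcal P=\mathrm{diag}\{2p_1^+,\dots,2p_m^+\}$. *)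

theory Defs
  imports "HOL-Probability.Probability"
begin

definition is_real_distr :: "real measure \<Rightarrow> bool" where
  "is_real_distr D \<longleftrightarrow> prob_space D \<and> sets D = sets borel"

definition symmetric_distr :: "real measure \<Rightarrow> bool" where
  "symmetric_distr D \<longleftrightarrow> distr D borel uminus = D"

definition zero_mean_finite_var :: "real measure \<Rightarrow> bool" where
  "zero_mean_finite_var D \<longleftrightarrow>
     integrable D (\<lambda>x. x) \<and> (\<integral>x. x \<partial>D) = 0 \<and> integrable D (\<lambda>x. x\<^sup>2)"

definition twice_diff_bounded :: "real measure \<Rightarrow> bool" where
  "twice_diff_bounded D \<longleftrightarrow>
     (\<exists>f f' B. \<forall>x. (cdf D has_real_derivative f x) (at x)
                \<and> (f has_real_derivative f' x) (at x) \<and> \<bar>f' x\<bar> \<le> B)"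

definition mix_distr :: "real \<Rightarrow> real measure \<Rightarrow> real measure \<Rightarrow> real measure" where
  "mix_distr r P Q = measure_of UNIV (sets borel)
     (\<lambda>A. ennreal ((1 - r) * measure P A + r * measure Q A))"

definition rate :: "real \<Rightarrow> nat \<Rightarrow> real" where
  "rate c n = min 1 (c / sqrt (real n))"

definition causal_coeffs :: "nat \<Rightarrow> (nat \<Rightarrow> real) \<Rightarrow> bool" where
  "causal_coeffs p \<beta> \<longleftrightarrow>
     (\<forall>w::complex. w ^ p - (\<Sum>i=1..p. complex_of_real (\<beta> i) * w ^ (p - i)) = 0 \<longrightarrow> cmod w < 1)"

definition strictly_stationary :: "'a measure \<Rightarrow> (int \<Rightarrow> 'a \<Rightarrow> real) \<Rightarrow> bool" where
  "strictly_stationary M u \<longleftrightarrow>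
     (\<forall>t k. distr M (PiM {..<k} (\<lambda>_. borel)) (\<lambda>\<omega>. \<lambda>i\<in>{..<k}. u (t + int i) \<omega>)
          = distr M (PiM {..<k} (\<lambda>_. borel)) (\<lambda>\<omega>. \<lambda>i\<in>{..<k}. u (int i) \<omega>))"

definition AR_contam_model ::
  "nat \<Rightarrow> (nat \<Rightarrow> real) \<Rightarrow> real measure \<Rightarrow> real measure \<Rightarrow> real \<Rightarrow> 'a measure \<Rightarrow>
   (int \<Rightarrow> 'a \<Rightarrow> real) \<Rightarrow> (int \<Rightarrow> 'a \<Rightarrow> real) \<Rightarrow> (int \<Rightarrow> 'a \<Rightarrow> real) \<Rightarrow>
   (int \<Rightarrow> 'a \<Rightarrow> real) \<Rightarrow> bool" where
  "AR_contam_model p \<beta> G GE g M eps z xi u \<longleftrightarrow>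
     prob_space M \<and>
     is_real_distr G \<and> zero_mean_finite_var G \<and> (\<integral>x. x\<^sup>2 \<partial>G) > 0 \<and>
     is_real_distr GE \<and>
     prob_space.indep_vars M (\<lambda>_. borel)
       (\<lambda>k. case k of Inl t \<Rightarrow> eps t | Inr (Inl t) \<Rightarrow> z t | Inr (Inr t) \<Rightarrow> xi t) UNIV \<and>
     (\<forall>t. distr M borel (eps t) = G) \<and>
     (\<forall>t. distr M borel (xi t) = GE) \<and>
     (\<forall>t. \<forall>\<omega>\<in>space M. z t \<omega> \<in> {0, 1}) \<and>
     (\<forall>t. measure M {\<omega>\<in>space M. z t \<omega> = 1} = g) \<and>
     (\<forall>t. u t \<in> borel_measurable M) \<and>
     (\<forall>t. \<forall>\<omega>\<in>space M. u t \<omega> = (\<Sum>i=1..p. \<beta> i * u (t - int i) \<omega>) + eps t \<omega>) \<and>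
     strictly_stationary M u"

definition yobs :: "(int \<Rightarrow> 'a \<Rightarrow> real) \<Rightarrow> (int \<Rightarrow> 'a \<Rightarrow> real) \<Rightarrow> (int \<Rightarrow> 'a \<Rightarrow> real) \<Rightarrow> int \<Rightarrow> 'a \<Rightarrow> real" where
  "yobs u z xi t \<omega> = u t \<omega> + z t \<omega> * xi t \<omega>"

definition est_of :: "nat \<Rightarrow> nat \<Rightarrow> (nat \<Rightarrow> (int \<Rightarrow> real) \<Rightarrow> nat \<Rightarrow> real) \<Rightarrow> (int \<Rightarrow> real) \<Rightarrow> nat \<Rightarrow> real" where
  "est_of p n est y = est n (restrict y {1 - int p..int n})"

text \<open>Cells; x :: nat => real gives x_0,...,x_{m-1}, and x_m = infinity.\<close>
definition bin_plus :: "(nat \<Rightarrow> real) \<Rightarrow> nat \<Rightarrow> nat \<Rightarrow> real set" where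
  "bin_plus x m j = (if j = m then {x (m - 1)<..} else {x (j - 1)<..x j})"

definition bin_minus :: "(nat \<Rightarrow> real) \<Rightarrow> nat \<Rightarrow> nat \<Rightarrow> real set" where
  "bin_minus x m j = (if j = m then {..- x (m - 1)} else {- x j<..- x (j - 1)})"

definition residual :: "nat \<Rightarrow> (nat \<Rightarrow> real) \<Rightarrow> (int \<Rightarrow> real) \<Rightarrow> int \<Rightarrow> real" where
  "residual p bh y t = y t - (\<Sum>i=1..p. bh i * y (t - int i))"

definition chi2_stat :: "nat \<Rightarrow> nat \<Rightarrow> (nat \<Rightarrow> real) \<Rightarrow> nat \<Rightarrow> (nat \<Rightarrow> real) \<Rightarrow> (int \<Rightarrow> real) \<Rightarrow> real" where
  "chi2_stat p m x n bh y =
     (\<Sum>j=1..m.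
        let nup = real (card {t\<in>{1..int n}. residual p bh y t \<in> bin_plus x m j});
            num = real (card {t\<in>{1..int n}. residual p bh y t \<in> bin_minus x m j})
        in (nup - num)\<^sup>2 / (2 * nup))"

text \<open>F_m(x, lambda2) = P(sum_{i<m} (Z_i + mu_i)^2 <= x), Z_i iid N(0,1), |mu|^2 = lambda2.\<close>
definition ncchisq_cdf :: "nat \<Rightarrow> real \<Rightarrow> real \<Rightarrow> real" where
  "ncchisq_cdf m lam2 x =
     measure (PiM {..<m} (\<lambda>_. density lborel std_normal_density))
       {v \<in> space (PiM {..<m} (\<lambda>_. density lborel std_normal_density)).
          (\<Sum>i<m. (v i + (if i = 0 then sqrt lam2 else 0))\<^sup>2) \<le> x}"

definition Delta :: "nat \<Rightarrow> (nat \<Rightarrow> real) \<Rightarrow> real measure \<Rightarrow> real measure \<Rightarrow> real \<Rightarrow> real" where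
  "Delta p \<beta> P GE x =
     (\<Sum>j=0..p. (\<integral>s. cdf P (x + (if j = 0 then -1 else \<beta> j) * s) \<partial>GE) - cdf P x)"

text \<open>delta_j(GE); for j = m we use Delta(+-infinity, GE) = 0 (limit value).\<close>
definition delta_j :: "nat \<Rightarrow> (nat \<Rightarrow> real) \<Rightarrow> real measure \<Rightarrow> real measure \<Rightarrow> (nat \<Rightarrow> real) \<Rightarrow> nat \<Rightarrow> nat \<Rightarrow> real" where
  "delta_j p \<beta> P GE x m j =
     (if j = m then
        (0 - Delta p \<beta> P GE (x (m - 1))) - (Delta p \<beta> P GE (- x (m - 1)) - 0)
      else
        (Delta p \<beta> P GE (x j) - Delta p \<beta> P GE (x (j - 1)))
        - (Delta p \<beta> P GE (- x (j - 1)) - Delta p \<beta> P GE (- x j)))"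

end

theory Submission
  imports Defs "HOL-Complex_Analysis.Complex_Analysis"
begin

text \<open>
  A failure of the uniform limit produces a sequence of sample sizes \<open>n\<close>, parameters \<open>\<gamma>\<close>, \<open>\<rho>\<close> and levels
  \<open>y\<close> along which the difference of the distribution functions stays away from 0; by compactness \<open>\<gamma>\<close>, \<open>\<rho>\<close>
  and \<open>exp (- y)\<close> (cut off at 2) may be assumed to converge. Along such a sequence a residual lies below
  \<open>y\<close> iff the innovation \<open>\<epsilon>\<^sub>t\<close> lies below a threshold that depends on the past of the innovations and on the
  contamination only. Hence the residual counts minus the innovation counts split into a martingale, which
  is negligible because the thresholds are close to \<open>y\<close>, and a compensator, whose Taylor expansion
  leaves \<open>\<gamma> \<Delta>(y, \<Pi>)\<close>: the term linear in the estimation error carries the factor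
  \<open>n\<^sup>-\<^sup>1 \<Sum> u\<^sub>t\<close>, which tends to 0. A finite net makes this uniform in the estimator.

  Thus the normalised count differences are, up to \<open>o\<^sub>P(1)\<close>, sums of independent vectors plus
  a shift. Their characteristic functions converge to that of a shifted Gaussian vector; averaging over a
  Gaussian argument gives the Laplace transform of the squared norm, and the values of
  the Laplace transform at the integers are the moments of the \<open>[0,1]\<close>-valued variable \<open>exp (- \<chi>\<^sup>2)\<close>,
  which determine its limit law by Weierstrass approximation.
\<close>

section \<open>Moments, Laplace transforms and Gaussian vectors\<close>

text \<open>The obstacle is that the estimator uses the whole sample, so a threshold with the
  estimated coefficients plugged in is not a function of the past, and the martingale argument does
  not apply to it. That argument is therefore run for a fixed vector \<tau> of rescaled errors, and
  the random one is compared pathwise with a nearby net point through the monotonicity of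
  \<open>below\<close>. Scaling: about sqrt n of the n positions are contaminated, and each of them
  affects at most p + 1 residuals. The resulting shift of the counts has order sqrt n, the order of
  the random fluctuations, hence a finite noncentrality. The gross errors may have no moments, so
  they enter the estimates through truncations at 1. Moments of \<open>u\<close> are not given
  either; they come from identifying \<open>u\<close> almost surely with its causal series. Symmetry
  of \<open>P\<close> makes mirrored cells equally likely, so that under an alternative the mean of
  a count difference comes from \<open>Q\<close> alone and is again of order sqrt n.\<close>

lemma moments_imp_expectation_continuous:
  fixes M :: "nat \<Rightarrow> 'a measure" and V :: "nat \<Rightarrow> 'a \<Rightarrow> real"
    and L :: "'b measure" and W :: "'b \<Rightarrow> real" and f :: "real \<Rightarrow> real"
  assumes M: "\<And>k. prob_space (M k)" and L: "prob_space L"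
    and V[measurable]: "\<And>k. V k \<in> borel_measurable (M k)" and W[measurable]: "W \<in> borel_measurable L"
    and V01: "\<And>k \<omega>. \<omega> \<in> space (M k) \<Longrightarrow> V k \<omega> \<in> {0..1}"
    and W01: "\<And>\<omega>. \<omega> \<in> space L \<Longrightarrow> W \<omega> \<in> {0..1}"
    and mom: "\<And>a. (\<lambda>k. \<integral>\<omega>. V k \<omega> ^ a \<partial>M k) \<longlonglongrightarrow> (\<integral>\<omega>. W \<omega> ^ a \<partial>L)"
    and f: "continuous_on UNIV f"
  shows "(\<lambda>k. \<integral>\<omega>. f (V k \<omega>) \<partial>M k) \<longlonglongrightarrow> (\<integral>\<omega>. f (W \<omega>) \<partial>L)"
proof (rule tendstoI)
  fix e :: real assume e: "e > 0"
  obtain q where q: "real_polynomial_function q" "\<And>x. x \<in> {0..1} \<Longrightarrow> \<bar>f x - q x\<bar> < e / 3"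
    using Stone_Weierstrass_real_polynomial_function[of "{0..1::real}" f "e / 3"] e f
    by (auto intro: continuous_on_subset)
  obtain a N where qa: "q = (\<lambda>x. \<Sum>i\<le>N. a i * x ^ i)"
    using q(1) by (auto simp: real_polynomial_function_iff_sum)
  have fm[measurable]: "f \<in> borel_measurable borel"
    using f by (rule borel_measurable_continuous_onI)
  have "bounded (f ` {0..1})"
    using f by (intro compact_imp_bounded compact_continuous_image) (auto intro: continuous_on_subset)
  then obtain F where F: "\<And>x. x \<in> {0..1} \<Longrightarrow> \<bar>f x\<bar> \<le> F"
    unfolding bounded_iff by (metis imageI real_norm_def)
  \<comment> \<open>Stated for an arbitrary [0,1]-valued variable because it serves every
    \<open>V k\<close> and also \<open>W\<close>; with the convergence of finitely many moments this
    makes three errors of size e / 3.\<close>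
  have approx: "\<bar>(\<integral>\<omega>. f (X \<omega>) \<partial>N') - (\<Sum>i\<le>N. a i * (\<integral>\<omega>. X \<omega> ^ i \<partial>N'))\<bar> \<le> e / 3"
    if "prob_space N'" and [measurable]: "X \<in> borel_measurable N'"
      and X: "\<And>\<omega>. \<omega> \<in> space N' \<Longrightarrow> X \<omega> \<in> {0..1}" for N' :: "'c measure" and X
  proof -
    interpret prob_space N' by fact
    have int_pow: "integrable N' (\<lambda>\<omega>. X \<omega> ^ i)" for i
      using X by (intro integrable_const_bound[of _ 1]) (auto intro!: power_le_one AE_I2)
    have int_f: "integrable N' (\<lambda>\<omega>. f (X \<omega>))"
      using X F by (intro integrable_const_bound[of _ F]) (auto intro!: AE_I2)
    have int_q: "integrable N' (\<lambda>\<omega>. q (X \<omega>))"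
      unfolding qa using int_pow by auto
    have "(\<Sum>i\<le>N. a i * (\<integral>\<omega>. X \<omega> ^ i \<partial>N')) = (\<integral>\<omega>. q (X \<omega>) \<partial>N')"
      unfolding qa using int_pow by simp
    moreover have "\<bar>(\<integral>\<omega>. f (X \<omega>) - q (X \<omega>) \<partial>N')\<bar> \<le> (\<integral>\<omega>. e / 3 \<partial>N')"
      using q(2) X int_f int_q e
      by (intro order_trans[OF integral_abs_bound] integral_mono) (auto simp: less_imp_le)
    ultimately show ?thesis
      using int_f int_q by (simp add: prob_space)
  qed
  have "(\<lambda>k. \<Sum>i\<le>N. a i * (\<integral>\<omega>. V k \<omega> ^ i \<partial>M k)) \<longlonglongrightarrow> (\<Sum>i\<le>N. a i * (\<integral>\<omega>. W \<omega> ^ i \<partial>L))"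
    by (intro tendsto_sum tendsto_mult tendsto_const mom)
  then have "\<forall>\<^sub>F k in sequentially. dist (\<Sum>i\<le>N. a i * (\<integral>\<omega>. V k \<omega> ^ i \<partial>M k))
      (\<Sum>i\<le>N. a i * (\<integral>\<omega>. W \<omega> ^ i \<partial>L)) < e / 3"
    using e by (intro tendstoD) auto
  then show "\<forall>\<^sub>F k in sequentially. dist (\<integral>\<omega>. f (V k \<omega>) \<partial>M k) (\<integral>\<omega>. f (W \<omega>) \<partial>L) < e"
  proof eventually_elim
    case (elim k)
    with approx[OF M V V01, of k] approx[OF L W W01] show ?case
      unfolding dist_real_def by linarith
  qed
qed

lemma ramp_indicator_bounds:
  fixes a d v :: real
  assumes "d > 0"
  shows "indicator {a + d..} v \<le> max 0 (min 1 ((v - a) / d))"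
    and "max 0 (min 1 ((v - a) / d)) \<le> indicator {a..} v"
  using assms by (auto simp: indicator_def field_simps max_def min_def)

text \<open>An indicator is squeezed between two ramps of width \<open>d\<close>, to which the
  convergence for continuous functions applies. Absence of an atom at \<open>c\<close> makes the
  limit distribution function continuous there, so the ramps cost less than e / 2; the moving levels
  \<open>C k\<close> are absorbed because they end up within \<open>d\<close> of
  \<open>c\<close>.\<close>

lemma moments_imp_prob_ge:
  fixes M :: "nat \<Rightarrow> 'a measure" and V :: "nat \<Rightarrow> 'a \<Rightarrow> real"
    and L :: "'b measure" and W :: "'b \<Rightarrow> real"
  assumes M: "\<And>k. prob_space (M k)" and L: "prob_space L"
    and V[measurable]: "\<And>k. V k \<in> borel_measurable (M k)" and W[measurable]: "W \<in> borel_measurable L"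
    and V01: "\<And>k \<omega>. \<omega> \<in> space (M k) \<Longrightarrow> V k \<omega> \<in> {0..1}"
    and W01: "\<And>\<omega>. \<omega> \<in> space L \<Longrightarrow> W \<omega> \<in> {0..1}"
    and mom: "\<And>a. (\<lambda>k. \<integral>\<omega>. V k \<omega> ^ a \<partial>M k) \<longlonglongrightarrow> (\<integral>\<omega>. W \<omega> ^ a \<partial>L)"
    and atom: "measure L {\<omega> \<in> space L. W \<omega> = c} = 0" and c: "C \<longlonglongrightarrow> c"
  shows "(\<lambda>k. measure (M k) {\<omega> \<in> space (M k). V k \<omega> \<ge> C k}) \<longlonglongrightarrow> measure L {\<omega> \<in> space L. W \<omega> \<ge> c}"
proof (rule tendstoI)
  fix e :: real assume e: "e > 0"
  interpret L: prob_space L by fact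
  interpret D: real_distribution "distr L borel W"
    by (rule L.real_distribution_distr) fact
  have "measure (distr L borel W) {c} = 0"
    using atom by (subst measure_distr) (auto simp: vimage_def Int_def conj_commute)
  then have "isCont (cdf (distr L borel W)) c"
    by (simp add: D.isCont_cdf)
  then obtain d0 where d0: "d0 > 0"
    "\<And>x. \<bar>x - c\<bar> < d0 \<Longrightarrow> \<bar>cdf (distr L borel W) x - cdf (distr L borel W) c\<bar> < e / 2"
    using e unfolding continuous_at_eps_delta dist_real_def by (meson half_gt_zero)
  \<comment> \<open>The ramps rise on [c - 2d, c - d] and [c + d, c + 2d]; one more step to c - 3d
    turns a closed half-line into an open one, and all these points must stay within
    \<open>d0\<close> of \<open>c\<close>.\<close>
  define d where "d = d0 / 4"
  have d: "d > 0" "3 * d < d0" using d0 by (auto simp: d_def)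
  have cdfW: "cdf (distr L borel W) x = measure L {\<omega> \<in> space L. W \<omega> \<le> x}" for x
    unfolding cdf_def by (subst measure_distr) (auto simp: vimage_def Int_def conj_commute)
  have compl: "measure L {\<omega> \<in> space L. W \<omega> > x} = 1 - cdf (distr L borel W) x" for x
    unfolding cdfW by (subst L.prob_compl[symmetric]) (auto intro!: arg_cong[where f="measure L"])
  have ge_c: "measure L {\<omega> \<in> space L. W \<omega> \<ge> c} = 1 - cdf (distr L borel W) c"
  proof -
    have "measure L {\<omega> \<in> space L. W \<omega> \<ge> c}
        = measure L ({\<omega> \<in> space L. W \<omega> > c} \<union> {\<omega> \<in> space L. W \<omega> = c})"
      by (auto intro!: arg_cong[where f="measure L"])
    also have "\<dots> = measure L {\<omega> \<in> space L. W \<omega> > c}"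
      using atom by (subst L.finite_measure_Union) auto
    finally show ?thesis by (simp add: compl)
  qed
  let ?r = "\<lambda>a v. max 0 (min 1 ((v - a) / d))"
  have cont: "continuous_on UNIV (?r a)" for a
    using d by (auto intro!: continuous_intros)
  have conv: "(\<lambda>k. \<integral>\<omega>. ?r a (V k \<omega>) \<partial>M k) \<longlonglongrightarrow> (\<integral>\<omega>. ?r a (W \<omega>) \<partial>L)" for a
    by (rule moments_imp_expectation_continuous[OF M L V W V01 W01 mom cont])
  have lower: "measure N' {\<omega> \<in> space N'. X \<omega> \<ge> a + d} \<le> (\<integral>\<omega>. ?r a (X \<omega>) \<partial>N')"
    and upper: "(\<integral>\<omega>. ?r a (X \<omega>) \<partial>N') \<le> measure N' {\<omega> \<in> space N'. X \<omega> \<ge> a}"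
    if "prob_space N'" and [measurable]: "X \<in> borel_measurable N'" for N' :: "'c measure" and X a
  proof -
    interpret prob_space N' by fact
    have int: "integrable N' (\<lambda>\<omega>. ?r a (X \<omega>))"
      by (intro integrable_const_bound[of _ 1]) auto
    have eq: "measure N' {\<omega> \<in> space N'. X \<omega> \<ge> b} = (\<integral>\<omega>. indicator {b..} (X \<omega>) \<partial>N')" for b
    proof -
      have "(\<integral>\<omega>. indicator {b..} (X \<omega>) \<partial>N') = (\<integral>\<omega>. indicator {\<omega> \<in> space N'. X \<omega> \<ge> b} \<omega> \<partial>N')"
        by (intro Bochner_Integration.integral_cong) (auto simp: indicator_def)
      also have "\<dots> = measure N' {\<omega> \<in> space N'. X \<omega> \<ge> b}"
        by (subst Bochner_Integration.integral_indicator) (auto simp: Int_def intro!: arg_cong[where f="measure N'"])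
      finally show ?thesis ..
    qed
    have int2: "integrable N' (\<lambda>\<omega>. indicator {b..} (X \<omega>) :: real)" for b
      by (intro integrable_const_bound[of _ 1]) auto
    show "measure N' {\<omega> \<in> space N'. X \<omega> \<ge> a + d} \<le> (\<integral>\<omega>. ?r a (X \<omega>) \<partial>N')"
      unfolding eq by (intro integral_mono int int2 ramp_indicator_bounds d)
    show "(\<integral>\<omega>. ?r a (X \<omega>) \<partial>N') \<le> measure N' {\<omega> \<in> space N'. X \<omega> \<ge> a}"
      unfolding eq by (intro integral_mono int int2 ramp_indicator_bounds d)
  qed
  have 1: "(\<integral>\<omega>. ?r (c - 2 * d) (W \<omega>) \<partial>L) < measure L {\<omega> \<in> space L. W \<omega> \<ge> c} + e / 2"
  proof -
    have "(\<integral>\<omega>. ?r (c - 2 * d) (W \<omega>) \<partial>L) \<le> measure L {\<omega> \<in> space L. W \<omega> \<ge> c - 2 * d}"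
      by (rule upper[OF L W])
    also have "\<dots> \<le> measure L {\<omega> \<in> space L. W \<omega> > c - 3 * d}"
      using d by (intro L.finite_measure_mono) auto
    also have "\<dots> < measure L {\<omega> \<in> space L. W \<omega> \<ge> c} + e / 2"
      using d0(2)[of "c - 3 * d", unfolded abs_less_iff] d unfolding compl ge_c by simp
    finally show ?thesis .
  qed
  have 2: "(\<integral>\<omega>. ?r (c + d) (W \<omega>) \<partial>L) > measure L {\<omega> \<in> space L. W \<omega> \<ge> c} - e / 2"
  proof -
    have "measure L {\<omega> \<in> space L. W \<omega> \<ge> c} - e / 2 < measure L {\<omega> \<in> space L. W \<omega> > c + 2 * d}"
      using d0(2)[of "c + 2 * d", unfolded abs_less_iff] d unfolding compl ge_c by simp
    also have "\<dots> \<le> measure L {\<omega> \<in> space L. W \<omega> \<ge> c + d + d}"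
      by (intro L.finite_measure_mono) auto
    also have "\<dots> \<le> (\<integral>\<omega>. ?r (c + d) (W \<omega>) \<partial>L)"
      by (rule lower[OF L W])
    finally show ?thesis .
  qed
  have "\<forall>\<^sub>F k in sequentially. \<bar>C k - c\<bar> < d"
    using tendstoD[OF c d(1)] by (simp add: dist_real_def)
  moreover have "\<forall>\<^sub>F k in sequentially. (\<integral>\<omega>. ?r (c - 2 * d) (V k \<omega>) \<partial>M k)
       < measure L {\<omega> \<in> space L. W \<omega> \<ge> c} + e / 2"
    by (rule order_tendstoD(2)[OF conv 1])
  moreover have "\<forall>\<^sub>F k in sequentially. (\<integral>\<omega>. ?r (c + d) (V k \<omega>) \<partial>M k)
       > measure L {\<omega> \<in> space L. W \<omega> \<ge> c} - e / 2"
    by (rule order_tendstoD(1)[OF conv 2])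
  ultimately show "\<forall>\<^sub>F k in sequentially. dist (measure (M k) {\<omega> \<in> space (M k). V k \<omega> \<ge> C k})
      (measure L {\<omega> \<in> space L. W \<omega> \<ge> c}) < e"
  proof eventually_elim
    case (elim k)
    interpret Mk: prob_space "M k" by (rule M)
    have "measure (M k) {\<omega> \<in> space (M k). V k \<omega> \<ge> C k} \<le> measure (M k) {\<omega> \<in> space (M k). V k \<omega> \<ge> c - 2 * d + d}"
      using elim d by (intro Mk.finite_measure_mono) auto
    also note lower[OF M V]
    finally have u: "measure (M k) {\<omega> \<in> space (M k). V k \<omega> \<ge> C k} < measure L {\<omega> \<in> space L. W \<omega> \<ge> c} + e / 2"
      using elim by linarith
    have "measure (M k) {\<omega> \<in> space (M k). V k \<omega> \<ge> c + d} \<le> measure (M k) {\<omega> \<in> space (M k). V k \<omega> \<ge> C k}"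
      using elim d by (intro Mk.finite_measure_mono) auto
    with upper[OF M[of k] V[of k], of "c + d"] u elim show ?case
      by (auto simp: dist_real_def)
  qed
qed

section \<open>Laplace transforms of squared norms as Gaussian averages of characteristic
  functions\<close>

lemma sum_iexp_prod:
  "finite J \<Longrightarrow> iexp (\<Sum>j\<in>J. f j) = (\<Prod>j\<in>J. iexp (f j))"
  by (simp add: sum_distrib_left exp_sum)

text \<open>The standard normal characteristic function at sqrt (2 a) s, read backwards; it makes
  the exponent linear in \<open>s\<close>.\<close>

lemma exp_square_gaussian_transform:
  fixes s a :: real
  assumes "a \<ge> 0"
  shows "complex_of_real (exp (- (a * s\<^sup>2))) = (\<integral>g. iexp (sqrt (2 * a) * g * s) \<partial>std_normal_distribution)"
proof -
  have "(\<integral>g. iexp (sqrt (2 * a) * g * s) \<partial>std_normal_distribution) = char std_normal_distribution (sqrt (2 * a) * s)"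
    unfolding char_def by (intro Bochner_Integration.integral_cong) (auto simp: mult_ac)
  then show ?thesis
    using assms by (simp add: char_std_normal_distribution power_mult_distrib)
qed

text \<open>Linearising the square in each coordinate introduces independent Gaussian variables
  \<open>g\<close>; after exchanging the integrals, the inner one is the characteristic function of
  the vector \<open>X\<close> at the random point sqrt (2 a) g.\<close>

lemma laplace_square_norm_eq_gaussian_char:
  fixes X :: "'i \<Rightarrow> 'a \<Rightarrow> real" and a :: real
  assumes M: "prob_space M" and J: "finite J" and [measurable]: "\<And>j. j \<in> J \<Longrightarrow> X j \<in> borel_measurable M"
    and a: "a \<ge> 0"
  shows "complex_of_real (\<integral>\<omega>. exp (- (a * (\<Sum>j\<in>J. (X j \<omega>)\<^sup>2))) \<partial>M)
    = (\<integral>g. (\<integral>\<omega>. iexp (\<Sum>j\<in>J. sqrt (2 * a) * g j * X j \<omega>) \<partial>M) \<partial>PiM J (\<lambda>_. std_normal_distribution))"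
proof -
  interpret M: prob_space M by fact
  interpret N: real_distribution std_normal_distribution by (rule real_dist_normal_dist)
  interpret PN: product_prob_space "\<lambda>_. std_normal_distribution" J ..
  let ?P = "PiM J (\<lambda>_. std_normal_distribution)"
  interpret P: prob_space ?P by (rule prob_space_PiM) (rule N.prob_space_axioms)
  interpret pair_prob_space M ?P ..
  have int: "integrable (M \<Otimes>\<^sub>M ?P) (\<lambda>(\<omega>, g). iexp (\<Sum>j\<in>J. sqrt (2 * a) * g j * X j \<omega>))"
    by (intro P.integrable_const_bound[of _ 1]) (auto simp: split_beta')
  have "complex_of_real (\<integral>\<omega>. exp (- (a * (\<Sum>j\<in>J. (X j \<omega>)\<^sup>2))) \<partial>M)
     = (\<integral>\<omega>. complex_of_real (exp (- (a * (\<Sum>j\<in>J. (X j \<omega>)\<^sup>2)))) \<partial>M)"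
    by simp
  also have "\<dots> = (\<integral>\<omega>. (\<integral>g. iexp (\<Sum>j\<in>J. sqrt (2 * a) * g j * X j \<omega>) \<partial>?P) \<partial>M)"
  proof (rule Bochner_Integration.integral_cong, rule refl)
    fix \<omega>
    have "complex_of_real (exp (- (a * (\<Sum>j\<in>J. (X j \<omega>)\<^sup>2)))) = (\<Prod>j\<in>J. complex_of_real (exp (- (a * (X j \<omega>)\<^sup>2))))"
      using J by (simp add: exp_sum sum_distrib_left sum_negf[symmetric] del: sum_negf)
    also have "\<dots> = (\<Prod>j\<in>J. \<integral>g. iexp (sqrt (2 * a) * g * X j \<omega>) \<partial>std_normal_distribution)"
      using exp_square_gaussian_transform[OF a] by simp
    also have "\<dots> = (\<integral>g. (\<Prod>j\<in>J. iexp (sqrt (2 * a) * g j * X j \<omega>)) \<partial>?P)"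
      using J by (intro PN.product_integral_prod[symmetric] N.integrable_const_bound[of _ 1]) auto
    finally show "complex_of_real (exp (- (a * (\<Sum>j\<in>J. (X j \<omega>)\<^sup>2))))
        = (\<integral>g. iexp (\<Sum>j\<in>J. sqrt (2 * a) * g j * X j \<omega>) \<partial>?P)"
      by (simp only: sum_iexp_prod[OF J])
  qed
  also have "\<dots> = (\<integral>g. (\<integral>\<omega>. iexp (\<Sum>j\<in>J. sqrt (2 * a) * g j * X j \<omega>) \<partial>M) \<partial>?P)"
    by (rule Fubini_integral[OF int, symmetric])
  finally show ?thesis .
qed

text \<open>Both Laplace transforms are averages of characteristic functions over the same Gaussian
  law. Characteristic functions are bounded by 1, so pointwise convergence passes through the
  average by dominated convergence.\<close>

lemma char_conv_imp_laplace_square_norm_conv: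
  fixes X :: "nat \<Rightarrow> 'i \<Rightarrow> 'a \<Rightarrow> real" and Y :: "'i \<Rightarrow> 'b \<Rightarrow> real" and a :: real
  assumes M: "\<And>k. prob_space (M k)" and L: "prob_space L" and J: "finite J" and a: "a \<ge> 0"
    and X[measurable]: "\<And>k j. j \<in> J \<Longrightarrow> X k j \<in> borel_measurable (M k)"
    and Y[measurable]: "\<And>j. j \<in> J \<Longrightarrow> Y j \<in> borel_measurable L"
    and char: "\<And>\<theta>. (\<lambda>k. \<integral>\<omega>. iexp (\<Sum>j\<in>J. \<theta> j * X k j \<omega>) \<partial>M k)
        \<longlonglongrightarrow> (\<integral>\<omega>. iexp (\<Sum>j\<in>J. \<theta> j * Y j \<omega>) \<partial>L)"
  shows "(\<lambda>k. \<integral>\<omega>. exp (- (a * (\<Sum>j\<in>J. (X k j \<omega>)\<^sup>2))) \<partial>M k)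
    \<longlonglongrightarrow> (\<integral>\<omega>. exp (- (a * (\<Sum>j\<in>J. (Y j \<omega>)\<^sup>2))) \<partial>L)"
proof -
  interpret N: real_distribution std_normal_distribution by (rule real_dist_normal_dist)
  let ?P = "PiM J (\<lambda>_. std_normal_distribution)"
  interpret P: prob_space ?P by (rule prob_space_PiM) (rule N.prob_space_axioms)
  have meas: "(\<lambda>g. \<integral>\<omega>. iexp (\<Sum>j\<in>J. sqrt (2 * a) * g j * Z j \<omega>) \<partial>N') \<in> borel_measurable ?P"
    if "prob_space N'" and [measurable]: "\<And>j. j \<in> J \<Longrightarrow> Z j \<in> borel_measurable N'"
    for N' :: "'c measure" and Z
  proof -
    interpret prob_space N' by fact
    show ?thesis
      by (rule borel_measurable_lebesgue_integral) (auto simp: split_beta')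
  qed
  have "(\<lambda>k. \<integral>g. (\<integral>\<omega>. iexp (\<Sum>j\<in>J. sqrt (2 * a) * g j * X k j \<omega>) \<partial>M k) \<partial>?P)
    \<longlonglongrightarrow> (\<integral>g. (\<integral>\<omega>. iexp (\<Sum>j\<in>J. sqrt (2 * a) * g j * Y j \<omega>) \<partial>L) \<partial>?P)"
  proof (rule integral_dominated_convergence[where w="\<lambda>_. 1"])
    show "AE g in ?P. (\<lambda>k. \<integral>\<omega>. iexp (\<Sum>j\<in>J. sqrt (2 * a) * g j * X k j \<omega>) \<partial>M k)
        \<longlonglongrightarrow> (\<integral>\<omega>. iexp (\<Sum>j\<in>J. sqrt (2 * a) * g j * Y j \<omega>) \<partial>L)"
      by (rule AE_I2) (rule char)
    show "AE g in ?P. cmod (\<integral>\<omega>. iexp (\<Sum>j\<in>J. sqrt (2 * a) * g j * X k j \<omega>) \<partial>M k) \<le> 1" for k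
    proof (rule AE_I2)
      fix g
      interpret prob_space "M k" by (rule M)
      have "cmod (\<integral>\<omega>. iexp (\<Sum>j\<in>J. sqrt (2 * a) * g j * X k j \<omega>) \<partial>M k)
          \<le> (\<integral>\<omega>. cmod (iexp (\<Sum>j\<in>J. sqrt (2 * a) * g j * X k j \<omega>)) \<partial>M k)"
        by (rule integral_norm_bound)
      also have "\<dots> = 1" by (simp add: prob_space del: of_real_sum)
      finally show "cmod (\<integral>\<omega>. iexp (\<Sum>j\<in>J. sqrt (2 * a) * g j * X k j \<omega>) \<partial>M k) \<le> 1" .
    qed
  qed (simp_all only: meas M L X Y integrable_const finite_measure.integrable_const P.finite_measure_axioms)
  then have "(\<lambda>k. complex_of_real (\<integral>\<omega>. exp (- (a * (\<Sum>j\<in>J. (X k j \<omega>)\<^sup>2))) \<partial>M k))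
    \<longlonglongrightarrow> complex_of_real (\<integral>\<omega>. exp (- (a * (\<Sum>j\<in>J. (Y j \<omega>)\<^sup>2))) \<partial>L)"
    using laplace_square_norm_eq_gaussian_char[OF M J X a] laplace_square_norm_eq_gaussian_char[OF L J Y a]
    by simp
  then show ?thesis by (simp add: tendsto_of_real_iff)
qed

text \<open>Completing the square: the normal density times the exponential is a constant multiple
  of the normal density with mean \<open>c\<close> and variance 1 / (1 + 2 a), which integrates to
  1.\<close>

lemma laplace_shifted_square_std_normal:
  fixes a \<mu> :: real
  assumes a: "a \<ge> 0"
  shows "(\<integral>x. exp (- (a * (x + \<mu>)\<^sup>2)) \<partial>std_normal_distribution)
    = exp (- (a * \<mu>\<^sup>2 / (1 + 2 * a))) / sqrt (1 + 2 * a)"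
proof -
  define \<sigma> where "\<sigma> = 1 / sqrt (1 + 2 * a)"
  define c where "c = - (2 * a * \<mu> / (1 + 2 * a))"
  have pos: "1 + 2 * a > 0" using a by simp
  have \<sigma>: "\<sigma> > 0" "\<sigma>\<^sup>2 = 1 / (1 + 2 * a)" using pos by (auto simp: \<sigma>_def power_divide)
  have "std_normal_density x * exp (- (a * (x + \<mu>)\<^sup>2))
      = exp (- (a * \<mu>\<^sup>2 / (1 + 2 * a))) / sqrt (1 + 2 * a) * normal_density c \<sigma> x" for x
  proof -
    have e: "- x\<^sup>2 / 2 - a * (x + \<mu>)\<^sup>2 = - (a * \<mu>\<^sup>2 / (1 + 2 * a)) - (x - c)\<^sup>2 / (2 * \<sigma>\<^sup>2)"
      unfolding \<sigma>(2) c_def using pos by (simp add: divide_simps) algebra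
    have s: "sqrt (2 * pi * \<sigma>\<^sup>2) = sqrt (2 * pi) / sqrt (1 + 2 * a)"
      unfolding \<sigma>(2) by (simp add: real_sqrt_divide real_sqrt_mult)
    have "std_normal_density x * exp (- (a * (x + \<mu>)\<^sup>2)) = exp (- x\<^sup>2 / 2 - a * (x + \<mu>)\<^sup>2) / sqrt (2 * pi)"
      by (simp add: std_normal_density_def exp_add[symmetric])
    also have "\<dots> = exp (- (a * \<mu>\<^sup>2 / (1 + 2 * a))) * exp (- ((x - c)\<^sup>2 / (2 * \<sigma>\<^sup>2))) / sqrt (2 * pi)"
      unfolding e by (simp add: exp_add[symmetric])
    also have "\<dots> = exp (- (a * \<mu>\<^sup>2 / (1 + 2 * a))) / sqrt (1 + 2 * a) * normal_density c \<sigma> x"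
      unfolding normal_density_def s using pos by (simp add: field_simps)
    finally show ?thesis .
  qed
  then show ?thesis
    using \<sigma> by (subst integral_density) (auto simp: )
qed

text \<open>Only the squared length of \<mu> survives, which is why a noncentral chi-square law can
  be represented with the whole shift in one coordinate.\<close>

lemma laplace_shifted_square_norm_std_normal:
  fixes \<mu> :: "'i \<Rightarrow> real" and a :: real
  assumes J: "finite J" and a: "a \<ge> 0"
  shows "(\<integral>v. exp (- (a * (\<Sum>j\<in>J. (v j + \<mu> j)\<^sup>2))) \<partial>PiM J (\<lambda>_. std_normal_distribution))
    = exp (- (a * (\<Sum>j\<in>J. (\<mu> j)\<^sup>2) / (1 + 2 * a))) / sqrt (1 + 2 * a) ^ card J"
proof -
  interpret N: real_distribution std_normal_distribution by (rule real_dist_normal_dist)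
  interpret PN: product_prob_space "\<lambda>_. std_normal_distribution" J ..
  have "(\<integral>v. exp (- (a * (\<Sum>j\<in>J. (v j + \<mu> j)\<^sup>2))) \<partial>PiM J (\<lambda>_. std_normal_distribution))
      = (\<integral>v. (\<Prod>j\<in>J. exp (- (a * (v j + \<mu> j)\<^sup>2))) \<partial>PiM J (\<lambda>_. std_normal_distribution))"
    using J by (simp add: exp_sum[symmetric] sum_distrib_left sum_negf)
  also have "\<dots> = (\<Prod>j\<in>J. \<integral>x. exp (- (a * (x + \<mu> j)\<^sup>2)) \<partial>std_normal_distribution)"
    using J a by (intro PN.product_integral_prod N.integrable_const_bound[of _ 1]) auto
  also have "\<dots> = exp (- (a * (\<Sum>j\<in>J. (\<mu> j)\<^sup>2) / (1 + 2 * a))) / sqrt (1 + 2 * a) ^ card J"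
    using J by (simp add: laplace_shifted_square_std_normal[OF a] prod_dividef exp_sum[symmetric]
        sum_distrib_left sum_divide_distrib sum_negf)
  finally show ?thesis .
qed

lemma char_shifted_std_normal_vector:
  fixes \<mu> \<theta> :: "'i \<Rightarrow> real"
  assumes J: "finite J"
  shows "(\<integral>v. iexp (\<Sum>j\<in>J. \<theta> j * (v j + \<mu> j)) \<partial>PiM J (\<lambda>_. std_normal_distribution))
    = exp (- (\<Sum>j\<in>J. (\<theta> j)\<^sup>2) / 2 + \<i> * (\<Sum>j\<in>J. \<theta> j * \<mu> j))"
proof -
  interpret N: real_distribution std_normal_distribution by (rule real_dist_normal_dist)
  interpret PN: product_prob_space "\<lambda>_. std_normal_distribution" J ..
  have 1: "(\<integral>x. iexp (\<theta> j * (x + \<mu> j)) \<partial>std_normal_distribution)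
      = exp (- (complex_of_real (\<theta> j))\<^sup>2 / 2 + \<i> * (\<theta> j * \<mu> j))" for j
  proof -
    have "(\<integral>x. iexp (\<theta> j * (x + \<mu> j)) \<partial>std_normal_distribution)
       = (\<integral>x. iexp (\<theta> j * x) * iexp (\<theta> j * \<mu> j) \<partial>std_normal_distribution)"
      by (intro Bochner_Integration.integral_cong) (auto simp: exp_add[symmetric] algebra_simps)
    also have "\<dots> = char std_normal_distribution (\<theta> j) * iexp (\<theta> j * \<mu> j)"
      unfolding char_def by simp
    also have "\<dots> = exp (- (complex_of_real (\<theta> j))\<^sup>2 / 2) * iexp (\<theta> j * \<mu> j)"
      unfolding char_std_normal_distribution by (simp add: exp_of_real[symmetric])
    finally show ?thesis by (simp only: exp_add)
  qed
  have "(\<integral>v. iexp (\<Sum>j\<in>J. \<theta> j * (v j + \<mu> j)) \<partial>PiM J (\<lambda>_. std_normal_distribution))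
      = (\<integral>v. (\<Prod>j\<in>J. iexp (\<theta> j * (v j + \<mu> j))) \<partial>PiM J (\<lambda>_. std_normal_distribution))"
    by (simp only: sum_iexp_prod[OF J])
  also have "\<dots> = (\<Prod>j\<in>J. \<integral>x. iexp (\<theta> j * (x + \<mu> j)) \<partial>std_normal_distribution)"
    using J by (intro PN.product_integral_prod N.integrable_const_bound[of _ 1]) auto
  also have "\<dots> = exp (\<Sum>j\<in>J. - (complex_of_real (\<theta> j))\<^sup>2 / 2 + \<i> * (\<theta> j * \<mu> j))"
    unfolding 1 using J by (rule exp_sum[symmetric])
  also have "\<dots> = exp (- (\<Sum>j\<in>J. (\<theta> j)\<^sup>2) / 2 + \<i> * (\<Sum>j\<in>J. \<theta> j * \<mu> j))"
    by (simp add: sum_subtractf sum_distrib_left sum_divide_distrib)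
  finally show ?thesis .
qed

text \<open>With all coordinates but one fixed, the event leaves at most two values for the
  remaining coordinate, a null set for the normal law; integration over the other coordinates
  preserves this. Nonemptiness of \<open>J\<close> provides that coordinate.\<close>

lemma shifted_square_norm_std_normal_no_atom:
  fixes \<mu> :: "'i \<Rightarrow> real"
  assumes J: "finite J" "J \<noteq> {}"
  shows "measure (PiM J (\<lambda>_. std_normal_distribution))
    {v \<in> space (PiM J (\<lambda>_. std_normal_distribution)). (\<Sum>j\<in>J. (v j + \<mu> j)\<^sup>2) = y} = 0"
proof -
  interpret N: real_distribution std_normal_distribution by (rule real_dist_normal_dist)
  interpret PN: product_prob_space "\<lambda>_. std_normal_distribution" J ..
  obtain i I where I: "J = insert i I" "i \<notin> I" "finite I"
    using J by (metis all_not_in_conv finite_insert mk_disjoint_insert)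
  let ?P = "\<lambda>J. PiM J (\<lambda>_. std_normal_distribution)"
  let ?A = "{v \<in> space (?P J). (\<Sum>j\<in>J. (v j + \<mu> j)\<^sup>2) = y}"
  have A[measurable]: "?A \<in> sets (?P J)" by measurable
  have null: "emeasure std_normal_distribution B = 0" if "finite B" for B
  proof -
    have "B \<in> null_sets lborel" using that by (simp add: finite_imp_null_set_lborel)
    then have "B \<in> null_sets std_normal_distribution"
      using absolutely_continuousI_density[of std_normal_density lborel]
      by (auto simp: absolutely_continuous_def)
    then show ?thesis by auto
  qed
  have "emeasure (?P J) ?A = (\<integral>\<^sup>+v. indicator ?A v \<partial>?P J)"
    using A by simp
  also have "\<dots> = (\<integral>\<^sup>+x. (\<integral>\<^sup>+t. indicator ?A (x(i := t)) \<partial>std_normal_distribution) \<partial>?P I)"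
    using I A unfolding I(1) by (intro PN.product_nn_integral_insert) auto
  also have "\<dots> \<le> (\<integral>\<^sup>+x. 0 \<partial>?P I)"
  proof (rule nn_integral_mono)
    fix x :: "'i \<Rightarrow> real"
    let ?r = "y - (\<Sum>j\<in>I. (x j + \<mu> j)\<^sup>2)"
    let ?B = "{sqrt ?r - \<mu> i, - sqrt ?r - \<mu> i}"
    have "(\<integral>\<^sup>+t. indicator ?A (x(i := t)) \<partial>std_normal_distribution)
        \<le> (\<integral>\<^sup>+t. indicator ?B t \<partial>std_normal_distribution)"
    proof (rule nn_integral_mono)
      fix t :: real
      have "t \<in> ?B" if "(\<Sum>j\<in>J. ((x(i := t)) j + \<mu> j)\<^sup>2) = y"
      proof -
        have "(\<Sum>j\<in>I. ((x(i := t)) j + \<mu> j)\<^sup>2) = (\<Sum>j\<in>I. (x j + \<mu> j)\<^sup>2)"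
          using I by (intro sum.cong) auto
        then have "(t + \<mu> i)\<^sup>2 = ?r" using that I by simp
        then have "\<bar>t + \<mu> i\<bar> = sqrt ?r" by (metis real_sqrt_abs)
        then show ?thesis by auto
      qed
      then show "indicator ?A (x(i := t)) \<le> (indicator ?B t :: ennreal)"
        by (auto simp: indicator_def)
    qed
    also have "\<dots> = emeasure std_normal_distribution ?B" by (rule nn_integral_indicator) auto
    also have "\<dots> = 0" by (rule null) auto
    finally show "(\<integral>\<^sup>+t. indicator ?A (x(i := t)) \<partial>std_normal_distribution) \<le> 0" .
  qed
  finally show ?thesis by (simp add: measure_def)
qed

section \<open>The causal representation of the autoregression\<close>

text \<open>The numbers \<psi> are the power series coefficients of 1 / Q, where Q is the reversed
  characteristic polynomial. Its zeros are inverses of characteristic roots, hence lie outside the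
  closed unit disk; so the radius of convergence exceeds 1 and the coefficients are absolutely
  summable. Indexing by \<open>int\<close>, with zeros below 0, lets one recursion hold for all k >=
  1, also when k < p.\<close>

lemma causal_coeffs_power_series:
  assumes "causal_coeffs p \<beta>"
  shows "\<exists>\<psi> :: int \<Rightarrow> real. (\<forall>k<0. \<psi> k = 0) \<and> \<psi> 0 = 1 \<and>
    (\<forall>k\<ge>1. \<psi> k = (\<Sum>i=1..p. \<beta> i * \<psi> (k - int i))) \<and> summable (\<lambda>n. \<bar>\<psi> (int n)\<bar>)"
proof -
  define Q :: "complex poly" where "Q = 1 - (\<Sum>i=1..p. monom (of_real (\<beta> i)) i)"
  have poly_Q: "poly Q w = 1 - (\<Sum>i=1..p. of_real (\<beta> i) * w ^ i)" for w
    by (simp add: Q_def poly_sum poly_monom)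
  have coeff_Q: "coeff Q k = (if k = 0 then 1 else if k \<le> p then - of_real (\<beta> k) else 0)" for k
    by (auto simp: Q_def coeff_sum if_distrib[where f="\<lambda>x. x = _"] cong: if_cong)
  have Q0: "Q \<noteq> 0"
    using coeff_Q[of 0] by auto
  have root: "norm w > 1" if "poly Q w = 0" for w
  proof -
    have "w \<noteq> 0" using that by (auto simp: poly_Q)
    have "(inverse w) ^ p - (\<Sum>i=1..p. of_real (\<beta> i) * (inverse w) ^ (p - i)) = inverse w ^ p * poly Q w"
    proof -
      have "(inverse w) ^ (p - i) = inverse w ^ p * w ^ i" if "i \<in> {1..p}" for i
        using that \<open>w \<noteq> 0\<close> by (simp add: power_diff field_simps power_inverse)
      then have "(\<Sum>i=1..p. of_real (\<beta> i) * (inverse w) ^ (p - i)) = (\<Sum>i=1..p. inverse w ^ p * (of_real (\<beta> i) * w ^ i))"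
        by (intro sum.cong) auto
      then show ?thesis
        unfolding poly_Q by (simp add: sum_distrib_left right_diff_distrib)
    qed
    then have "cmod (inverse w) < 1"
      using assms that unfolding causal_coeffs_def by auto
    then show ?thesis using \<open>w \<noteq> 0\<close> by (simp add: norm_inverse norm_divide field_simps)
  qed
  \<comment> \<open>The entry 2 keeps the set nonempty when Q has no zeros; any number above 1 would
    do.\<close>
  define r where "r = Min (insert 2 (norm ` {w. poly Q w = 0}))"
  have fin: "finite {w. poly Q w = 0}" using Q0 by (rule poly_roots_finite)
  have r: "r > 1" unfolding r_def using fin root by (subst Min_gr_iff) auto
  have nz: "eval_fps (fps_of_poly Q) w \<noteq> 0" if "ereal (norm w) < ereal r" for w
  proof
    assume "eval_fps (fps_of_poly Q) w = 0"
    then have "poly Q w = 0" by simp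
    then have "r \<le> norm w" unfolding r_def using fin by (intro Min_le) auto
    with that show False by simp
  qed
  define f where "f = inverse (fps_of_poly Q)"
  have "fps_conv_radius f \<ge> ereal r"
  proof -
    have "min (ereal r) (fps_conv_radius (fps_of_poly Q)) \<le> fps_conv_radius f"
      unfolding f_def by (rule fps_conv_radius_inverse) (rule nz)
    then show ?thesis by simp
  qed
  then have rad: "conv_radius (fps_nth f) > 1"
    using r unfolding fps_conv_radius_def by (auto intro: less_le_trans[of 1 "ereal r"])
  have sum1: "summable (\<lambda>n. norm (fps_nth f n))"
    using abs_summable_in_conv_radius[of 1 "fps_nth f"] rad by (simp add: one_ereal_def)
  have f0: "fps_nth f 0 = 1"
    unfolding f_def by (simp add: coeff_Q)
  have rec: "fps_nth f k = (\<Sum>i=1..k. (if i \<le> p then of_real (\<beta> i) else 0) * fps_nth f (k - i))" if "k \<ge> 1" for k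
  proof -
    have "fps_of_poly Q * f = 1"
      unfolding f_def by (rule inverse_mult_eq_1') (simp add: coeff_Q)
    then have "0 = fps_nth (fps_of_poly Q * f) k" using that by simp
    also have "\<dots> = (\<Sum>i=0..k. coeff Q i * fps_nth f (k - i))"
      by (simp add: fps_mult_nth)
    also have "\<dots> = fps_nth f k + (\<Sum>i=1..k. coeff Q i * fps_nth f (k - i))"
      by (subst sum.atLeast_Suc_atMost) (auto simp: coeff_Q)
    also have "(\<Sum>i=1..k. coeff Q i * fps_nth f (k - i)) = - (\<Sum>i=1..k. (if i \<le> p then of_real (\<beta> i) else 0) * fps_nth f (k - i))"
      unfolding sum_negf[symmetric] by (intro sum.cong) (auto simp: coeff_Q)
    finally show ?thesis by simp
  qed
  define \<psi> :: "int \<Rightarrow> real" where "\<psi> k = (if k < 0 then 0 else Re (fps_nth f (nat k)))" for k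
  have "\<psi> k = (\<Sum>i=1..p. \<beta> i * \<psi> (k - int i))" if "k \<ge> 1" for k
  proof -
    have "\<psi> k = (\<Sum>i=1..nat k. (if i \<le> p then \<beta> i else 0) * Re (fps_nth f (nat k - i)))"
      using rec[of "nat k"] that unfolding \<psi>_def by (auto intro!: sum.cong)
    also have "\<dots> = (\<Sum>i\<in>{1..nat k} \<inter> {1..p}. \<beta> i * \<psi> (k - int i))"
      using that by (intro sum.mono_neutral_cong_right) (auto simp: \<psi>_def nat_diff_distrib')
    also have "\<dots> = (\<Sum>i=1..p. \<beta> i * \<psi> (k - int i))"
      by (intro sum.mono_neutral_cong_left) (auto simp: \<psi>_def)
    finally show ?thesis .
  qed
  moreover have "summable (\<lambda>n. \<bar>\<psi> (int n)\<bar>)"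
    by (rule summable_comparison_test'[OF sum1, of 0]) (auto simp: \<psi>_def abs_Re_le_cmod)
  ultimately show ?thesis
    using f0 by (intro exI[of _ \<psi>]) (auto simp: \<psi>_def)
qed

section \<open>Noise variables, the sigma-algebras they generate, independence\<close>

definition noise :: "(int \<Rightarrow> 'a \<Rightarrow> real) \<Rightarrow> (int \<Rightarrow> 'a \<Rightarrow> real) \<Rightarrow> (int \<Rightarrow> 'a \<Rightarrow> real) \<Rightarrow>
    int + int + int \<Rightarrow> 'a \<Rightarrow> real" where
  "noise eps z xi k = (case k of Inl t \<Rightarrow> eps t | Inr (Inl t) \<Rightarrow> z t | Inr (Inr t) \<Rightarrow> xi t)"

text \<open>Innovations, Bernoulli variables and gross errors share one index type, a disjoint sum,
  so independence between the three kinds and between times becomes one and the same matter: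
  disjointness of index sets.\<close>

definition noise_algebra :: "'a measure \<Rightarrow> (int \<Rightarrow> 'a \<Rightarrow> real) \<Rightarrow> (int \<Rightarrow> 'a \<Rightarrow> real) \<Rightarrow>
    (int \<Rightarrow> 'a \<Rightarrow> real) \<Rightarrow> (int + int + int) set \<Rightarrow> 'a measure" where
  "noise_algebra M eps z xi J = vimage_algebra (space M)
     (\<lambda>\<omega>. \<lambda>k\<in>J. noise eps z xi k \<omega>) (PiM J (\<lambda>_. borel))"

text \<open>The part of the model that mentions neither \<open>u\<close> and \<beta> nor moments of
  the innovation law.\<close>

locale contam_noise = prob_space M
  for M :: "'a measure" and G GE :: "real measure" and g :: real
    and eps z xi :: "int \<Rightarrow> 'a \<Rightarrow> real" +
  assumes G: "is_real_distr G" and GE: "is_real_distr GE"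
    and indep: "indep_vars (\<lambda>_. borel) (noise eps z xi) UNIV"
    and eps_distr: "\<And>t. distr M borel (eps t) = G"
    and xi_distr: "\<And>t. distr M borel (xi t) = GE"
    and z01: "\<And>t \<omega>. \<omega> \<in> space M \<Longrightarrow> z t \<omega> \<in> {0, 1}"
    and z_prob: "\<And>t. measure M {\<omega>\<in>space M. z t \<omega> = 1} = g"
begin

abbreviation "\<F> \<equiv> noise_algebra M eps z xi"

lemma noise_measurable[measurable]: "noise eps z xi k \<in> borel_measurable M"
  using indep by (simp add: indep_vars_def)

lemma eps_measurable[measurable]: "eps t \<in> borel_measurable M"
  using noise_measurable[of "Inl t"] by (simp add: noise_def)

lemma z_measurable[measurable]: "z t \<in> borel_measurable M"
  using noise_measurable[of "Inr (Inl t)"] by (simp add: noise_def)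

lemma xi_measurable[measurable]: "xi t \<in> borel_measurable M"
  using noise_measurable[of "Inr (Inr t)"] by (simp add: noise_def)

lemma space_\<F>[simp]: "space (\<F> J) = space M"
  by (simp add: noise_algebra_def)

lemma \<F>_noise: "k \<in> J \<Longrightarrow> noise eps z xi k \<in> borel_measurable (\<F> J)"
proof -
  assume k: "k \<in> J"
  have "(\<lambda>\<omega>. \<lambda>k\<in>J. noise eps z xi k \<omega>) \<in> measurable (\<F> J) (PiM J (\<lambda>_. borel))"
    unfolding noise_algebra_def by (rule measurable_vimage_algebra1) (auto simp: space_PiM)
  from measurable_compose[OF this measurable_component_singleton[OF k]] show ?thesis
    using k by simp
qed

lemma \<F>_eps: "Inl t \<in> J \<Longrightarrow> eps t \<in> borel_measurable (\<F> J)"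
  using \<F>_noise[of "Inl t"] by (simp add: noise_def)

lemma \<F>_z: "Inr (Inl t) \<in> J \<Longrightarrow> z t \<in> borel_measurable (\<F> J)"
  using \<F>_noise[of "Inr (Inl t)"] by (simp add: noise_def)

lemma \<F>_xi: "Inr (Inr t) \<in> J \<Longrightarrow> xi t \<in> borel_measurable (\<F> J)"
  using \<F>_noise[of "Inr (Inr t)"] by (simp add: noise_def)

lemma \<F>_mono:
  assumes "X \<in> measurable (\<F> J) N" "J \<subseteq> J'"
  shows "X \<in> measurable (\<F> J') N"
proof -
  have "(\<lambda>\<omega>. \<omega>) \<in> measurable (\<F> J') (\<F> J)"
    unfolding noise_algebra_def[of _ _ _ _ J]
    using assms(2) by (intro measurable_vimage_algebra2) (auto intro!: measurable_restrict \<F>_noise)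
  from measurable_compose[OF this assms(1)] show ?thesis .
qed

lemma \<F>_measurable:
  assumes "X \<in> measurable (\<F> J) N"
  shows "X \<in> measurable M N"
proof -
  have "(\<lambda>\<omega>. \<omega>) \<in> measurable M (\<F> J)"
    unfolding noise_algebra_def[of _ _ _ _ J]
    by (intro measurable_vimage_algebra2) (auto intro!: measurable_restrict)
  from measurable_compose[OF this assms(1)] show ?thesis .
qed

lemma \<F>_preimages:
  assumes "X \<in> measurable (\<F> J) S"
  shows "{X -` C \<inter> space M |C. C \<in> sets S}
    \<subseteq> {(\<lambda>\<omega>. \<lambda>k\<in>J. noise eps z xi k \<omega>) -` D \<inter> space M |D. D \<in> sets (PiM J (\<lambda>_. borel))}"
proof -
  have "sets (\<F> J) = {(\<lambda>\<omega>. \<lambda>k\<in>J. noise eps z xi k \<omega>) -` D \<inter> space M |D. D \<in> sets (PiM J (\<lambda>_. borel))}"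
    unfolding noise_algebra_def by (rule sets_vimage_algebra2) (auto simp: space_PiM)
  then show ?thesis
    using measurable_sets[OF assms] by auto
qed

text \<open>Either variable generates only preimages under a restricted noise vector, and the
  vectors over disjoint index sets are independent.\<close>

lemma \<F>_indep:
  assumes AB: "A \<inter> B = {}" and X: "X \<in> measurable (\<F> A) S" and Y: "Y \<in> measurable (\<F> B) T"
  shows "indep_var S X T Y"
proof -
  have "indep_var (PiM A (\<lambda>_. borel)) (\<lambda>\<omega>. \<lambda>k\<in>A. noise eps z xi k \<omega>)
      (PiM B (\<lambda>_. borel)) (\<lambda>\<omega>. \<lambda>k\<in>B. noise eps z xi k \<omega>)"
    using AB by (intro indep_var_restrict[OF indep]) auto
  then show ?thesis
    unfolding indep_var_eq indep_set_def
    using \<F>_measurable[OF X] \<F>_measurable[OF Y]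
    by (auto elim!: indep_sets_mono_sets split: bool.split
        intro!: sigma_sets_mono'[OF \<F>_preimages[OF X], THEN subsetD] sigma_sets_mono'[OF \<F>_preimages[OF Y], THEN subsetD])
qed

lemma indep_expectation_mult:
  fixes X Y :: "'a \<Rightarrow> real"
  assumes "A \<inter> B = {}" "X \<in> borel_measurable (\<F> A)" "Y \<in> borel_measurable (\<F> B)"
    and "integrable M X" "integrable M Y"
  shows "expectation (\<lambda>\<omega>. X \<omega> * Y \<omega>) = expectation X * expectation Y"
    and "integrable M (\<lambda>\<omega>. X \<omega> * Y \<omega>)"
  using indep_var_lebesgue_integral[OF \<F>_indep[OF assms(1-3)] assms(4,5)]
    indep_var_integrable[OF \<F>_indep[OF assms(1-3)] assms(4,5)] by auto

end

section \<open>The stationary solution as a causal series\<close>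

lemma min_one_abs_sum_le:
  fixes f :: "'i \<Rightarrow> real"
  assumes "finite A"
  shows "min 1 \<bar>\<Sum>i\<in>A. f i\<bar> \<le> (\<Sum>i\<in>A. min 1 \<bar>f i\<bar>)"
  using assms
proof (induction A rule: finite_induct)
  case (insert i A)
  have "min 1 \<bar>f i + sum f A\<bar> \<le> min 1 \<bar>f i\<bar> + min 1 \<bar>sum f A\<bar>"
    by (auto simp: min_def)
  with insert show ?case by simp
qed simp

lemma (in prob_space) expectation_abs_le_sqrt:
  fixes X :: "'a \<Rightarrow> real"
  assumes X[measurable]: "X \<in> borel_measurable M" and "integrable M (\<lambda>\<omega>. (X \<omega>)\<^sup>2)"
  shows "expectation (\<lambda>\<omega>. \<bar>X \<omega>\<bar>) \<le> sqrt (expectation (\<lambda>\<omega>. (X \<omega>)\<^sup>2))"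
proof -
  have X1: "integrable M (\<lambda>\<omega>. \<bar>X \<omega>\<bar>)"
    using square_integrable_imp_integrable[OF X assms(2)] by simp
  have "0 \<le> variance (\<lambda>\<omega>. \<bar>X \<omega>\<bar>)" by simp
  also have "\<dots> = expectation (\<lambda>\<omega>. (X \<omega>)\<^sup>2) - (expectation (\<lambda>\<omega>. \<bar>X \<omega>\<bar>))\<^sup>2"
    using X1 assms(2) by (subst variance_eq) auto
  finally show ?thesis
    by (intro real_le_rsqrt) simp
qed

lemma (in prob_space) second_moment_orthogonal_sum:
  fixes D :: "'i \<Rightarrow> 'a \<Rightarrow> real"
  assumes T: "finite T" and [measurable]: "\<And>t. t \<in> T \<Longrightarrow> D t \<in> borel_measurable M"
    and sq: "\<And>t. t \<in> T \<Longrightarrow> integrable M (\<lambda>\<omega>. (D t \<omega>)\<^sup>2)"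
    and orth: "\<And>s t. s \<in> T \<Longrightarrow> t \<in> T \<Longrightarrow> s \<noteq> t \<Longrightarrow> expectation (\<lambda>\<omega>. D s \<omega> * D t \<omega>) = 0"
  shows "expectation (\<lambda>\<omega>. (\<Sum>t\<in>T. D t \<omega>)\<^sup>2) = (\<Sum>t\<in>T. expectation (\<lambda>\<omega>. (D t \<omega>)\<^sup>2))"
    and "integrable M (\<lambda>\<omega>. (\<Sum>t\<in>T. D t \<omega>)\<^sup>2)"
proof -
  have int: "integrable M (\<lambda>\<omega>. D s \<omega> * D t \<omega>)" if "s \<in> T" "t \<in> T" for s t
  proof (rule Bochner_Integration.integrable_bound)
    show "integrable M (\<lambda>\<omega>. (D s \<omega>)\<^sup>2 + (D t \<omega>)\<^sup>2)" using sq that by auto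
    have "\<bar>D s \<omega> * D t \<omega>\<bar> \<le> (D s \<omega>)\<^sup>2 + (D t \<omega>)\<^sup>2" for \<omega>
      using sum_squares_bound[of "\<bar>D s \<omega>\<bar>" "\<bar>D t \<omega>\<bar>"] zero_le_power2[of "D s \<omega>"] zero_le_power2[of "D t \<omega>"]
      by (simp only: abs_mult power2_abs)
    then show "AE \<omega> in M. norm (D s \<omega> * D t \<omega>) \<le> norm ((D s \<omega>)\<^sup>2 + (D t \<omega>)\<^sup>2)" by auto
  qed (use that in measurable)
  have eq: "(\<Sum>t\<in>T. D t \<omega>)\<^sup>2 = (\<Sum>s\<in>T. \<Sum>t\<in>T. D s \<omega> * D t \<omega>)" for \<omega>
    by (simp add: power2_eq_square sum_product)
  show "integrable M (\<lambda>\<omega>. (\<Sum>t\<in>T. D t \<omega>)\<^sup>2)"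
    unfolding eq using int by auto
  have "expectation (\<lambda>\<omega>. (\<Sum>t\<in>T. D t \<omega>)\<^sup>2) = (\<Sum>s\<in>T. \<Sum>t\<in>T. expectation (\<lambda>\<omega>. D s \<omega> * D t \<omega>))"
    unfolding eq using int by (subst Bochner_Integration.integral_sum; auto intro!: sum.cong)
  also have "\<dots> = (\<Sum>s\<in>T. \<Sum>t\<in>T. if t = s then expectation (\<lambda>\<omega>. (D s \<omega>)\<^sup>2) else 0)"
    using orth by (intro sum.cong refl) (auto simp: power2_eq_square)
  also have "\<dots> = (\<Sum>t\<in>T. expectation (\<lambda>\<omega>. (D t \<omega>)\<^sup>2))"
    using T by simp
  finally show "expectation (\<lambda>\<omega>. (\<Sum>t\<in>T. D t \<omega>)\<^sup>2) = (\<Sum>t\<in>T. expectation (\<lambda>\<omega>. (D t \<omega>)\<^sup>2))" .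
qed

lemma AE_summable_of_summable_integral:
  fixes f :: "nat \<Rightarrow> 'a \<Rightarrow> real"
  assumes int: "\<And>k. integrable M (f k)" and nn: "\<And>k \<omega>. f k \<omega> \<ge> 0"
    and s: "summable (\<lambda>k. \<integral>\<omega>. f k \<omega> \<partial>M)"
  shows "AE \<omega> in M. summable (\<lambda>k. f k \<omega>)"
proof -
  have [measurable]: "f k \<in> borel_measurable M" for k using int by auto
  have "(\<integral>\<^sup>+\<omega>. (\<Sum>k. ennreal (f k \<omega>)) \<partial>M) = (\<Sum>k. \<integral>\<^sup>+\<omega>. ennreal (f k \<omega>) \<partial>M)"
    by (rule nn_integral_suminf) auto
  also have "\<dots> = (\<Sum>k. ennreal (\<integral>\<omega>. f k \<omega> \<partial>M))"
    using int nn by (simp add: nn_integral_eq_integral)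
  also have "\<dots> \<noteq> top"
    using s nn by (intro ennreal_suminf_neq_top) (auto intro!: integral_nonneg)
  finally have "AE \<omega> in M. (\<Sum>k. ennreal (f k \<omega>)) \<noteq> \<infinity>"
    by (intro nn_integral_PInf_AE) auto
  then show ?thesis
    by eventually_elim (auto intro!: summable_suminf_not_top nn)
qed

text \<open>Induction on \<open>K\<close>: the recursion is applied to the oldest value in the
  remainder, and the recursion for \<psi> matches the coefficients. The number of remainder terms
  does not depend on \<open>K\<close>, and their coefficients are \<psi> at indices close to
  \<open>K\<close>, so they fade as \<open>K\<close> grows.\<close>

lemma AR_recursion_unrolled:
  fixes u e :: "int \<Rightarrow> real" and \<psi> :: "int \<Rightarrow> real"
  assumes rec: "\<And>t. u t = (\<Sum>i=1..p. \<beta> i * u (t - int i)) + e t"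
    and neg: "\<And>k. k < 0 \<Longrightarrow> \<psi> k = 0" and zero: "\<psi> 0 = 1"
    and \<psi>: "\<And>k. k \<ge> 1 \<Longrightarrow> \<psi> k = (\<Sum>i=1..p. \<beta> i * \<psi> (k - int i))"
  shows "u t = (\<Sum>k<Suc K. \<psi> (int k) * e (t - int k))
    + (\<Sum>i=1..p. \<beta> i * (\<Sum>l=1..i. \<psi> (int (Suc K) - int l) * u (t - int (Suc K) + int l - int i)))"
proof (induction K)
  case 0
  have "(\<Sum>l=1..i. \<psi> (1 - int l) * u (t - 1 + int l - int i)) = u (t - int i)" if "i \<in> {1..p}" for i
  proof -
    have "(\<Sum>l=1..i. \<psi> (1 - int l) * u (t - 1 + int l - int i)) = (\<Sum>l\<in>{1}. \<psi> (1 - int l) * u (t - 1 + int l - int i))"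
      using that by (intro sum.mono_neutral_right) (auto intro!: neg)
    then show ?thesis using zero by simp
  qed
  then have "(\<Sum>i=1..p. \<beta> i * (\<Sum>l=1..i. \<psi> (1 - int l) * u (t - 1 + int l - int i))) = (\<Sum>i=1..p. \<beta> i * u (t - int i))"
    by (intro sum.cong) auto
  then show ?case using rec[of t] zero by simp
next
  case (Suc K)
  let ?k = "int (Suc K)"
  \<comment> \<open>Raising \<open>K\<close> by one shifts the summation index, so only two boundary
    terms change; summed over \<open>i\<close>, the first is evaluated by the recursion for
    \<open>u\<close>, the second by that for \<psi>.\<close>
  have inner: "(\<Sum>l=1..i. \<psi> (?k + 1 - int l) * u (t - (?k + 1) + int l - int i))
      = (\<Sum>l=1..i. \<psi> (?k - int l) * u (t - ?k + int l - int i))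
        + \<psi> ?k * u (t - ?k - int i) - \<psi> (?k - int i) * u (t - ?k)" for i
  proof -
    define f where "f l = \<psi> (?k - int l) * u (t - ?k + int l - int i)" for l
    have "(\<Sum>l=1..i. \<psi> (?k + 1 - int l) * u (t - (?k + 1) + int l - int i)) = (\<Sum>l=Suc 0..i. f (l - 1))"
      unfolding f_def by (intro sum.cong) (auto simp: of_nat_diff algebra_simps)
    also have "\<dots> = (\<Sum>l<i. f l)"
      by (rule sum.reindex_bij_witness[of _ Suc "\<lambda>l. l - 1"]) auto
    also have "\<dots> = (\<Sum>l=1..i. f l) + f 0 - f i"
    proof -
      have "(\<Sum>l<i. f l) + f i = (\<Sum>l\<in>{..i}. f l)"
        by (simp add: lessThan_Suc_atMost[symmetric])
      also have "\<dots> = f 0 + (\<Sum>l=1..i. f l)"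
        by (simp add: atMost_atLeast0 sum.atLeast_Suc_atMost)
      finally show ?thesis by simp
    qed
    finally show ?thesis by (simp add: f_def)
  qed
  have "(\<Sum>i=1..p. \<beta> i * (\<Sum>l=1..i. \<psi> (?k + 1 - int l) * u (t - (?k + 1) + int l - int i)))
     = (\<Sum>i=1..p. \<beta> i * (\<Sum>l=1..i. \<psi> (?k - int l) * u (t - ?k + int l - int i)))
       + \<psi> ?k * (\<Sum>i=1..p. \<beta> i * u (t - ?k - int i)) - (\<Sum>i=1..p. \<beta> i * \<psi> (?k - int i)) * u (t - ?k)"
    unfolding inner by (simp add: algebra_simps sum.distrib sum_subtractf sum_distrib_left sum_distrib_right)
  also have "(\<Sum>i=1..p. \<beta> i * \<psi> (?k - int i)) = \<psi> ?k"
    by (rule \<psi>[symmetric]) simp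
  also have "(\<Sum>i=1..p. \<beta> i * u (t - ?k - int i)) = u (t - ?k) - e (t - ?k)"
    using rec[of "t - ?k"] by simp
  finally have "(\<Sum>i=1..p. \<beta> i * (\<Sum>l=1..i. \<psi> (?k + 1 - int l) * u (t - (?k + 1) + int l - int i)))
     = (\<Sum>i=1..p. \<beta> i * (\<Sum>l=1..i. \<psi> (?k - int l) * u (t - ?k + int l - int i))) - \<psi> ?k * e (t - ?k)"
    by (simp add: algebra_simps)
  moreover have "int (Suc (Suc K)) = ?k + 1" by simp
  ultimately show ?case
    using Suc.IH by (simp only: sum.lessThan_Suc[of _ "Suc K"])
qed

lemma strictly_stationary_distr:
  assumes st: "strictly_stationary M u" and [measurable]: "\<And>t. u t \<in> borel_measurable M"
  shows "distr M borel (u t) = distr M borel (u 0)"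
proof -
  have "distr (distr M (PiM {..<1} (\<lambda>_. borel)) (\<lambda>\<omega>. \<lambda>i\<in>{..<1}. u (s + int i) \<omega>)) borel (\<lambda>f. f 0)
      = distr M borel (u s)" for s
    by (subst distr_distr) (auto simp: comp_def)
  from this[of t] this[of 0] st show ?thesis
    unfolding strictly_stationary_def by (metis add_0)
qed

context contam_noise
begin

context
  fixes \<psi> :: "int \<Rightarrow> real" and S :: real
  assumes \<psi>_summable: "summable (\<lambda>n. \<bar>\<psi> (int n)\<bar>)"
    and G_mean: "zero_mean_finite_var G" and G_var: "(\<integral>x. x\<^sup>2 \<partial>G) \<le> S"
begin

lemma eps_moments:
  "integrable M (eps t)" "expectation (eps t) = 0" "integrable M (\<lambda>\<omega>. (eps t \<omega>)\<^sup>2)"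
  "expectation (\<lambda>\<omega>. (eps t \<omega>)\<^sup>2) = (\<integral>x. x\<^sup>2 \<partial>G)"
  using G_mean unfolding zero_mean_finite_var_def eps_distr[of t, symmetric]
  by (auto simp: integrable_distr_eq integral_distr)

definition causal_sum :: "int \<Rightarrow> 'a \<Rightarrow> real" where
  "causal_sum t \<omega> = (\<Sum>k. \<psi> (int k) * eps (t - int k) \<omega>)"

lemma causal_sum_measurable_past: "causal_sum t \<in> borel_measurable (\<F> (Inl ` {..t}))"
proof -
  have [measurable]: "eps (t - int k) \<in> borel_measurable (\<F> (Inl ` {..t}))" for k
    by (rule \<F>_eps) auto
  show ?thesis unfolding causal_sum_def[abs_def] by measurable
qed

lemma causal_sum_measurable[measurable]: "causal_sum t \<in> borel_measurable M"
  by (rule \<F>_measurable[OF causal_sum_measurable_past])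

lemma AE_causal_sum_summable: "AE \<omega> in M. summable (\<lambda>k. \<bar>\<psi> (int k)\<bar> * \<bar>eps (t - int k) \<omega>\<bar>)"
proof (rule AE_summable_of_summable_integral)
  have "expectation (\<lambda>\<omega>. \<bar>eps s \<omega>\<bar>) = (\<integral>x. \<bar>x\<bar> \<partial>G)" for s
    unfolding eps_distr[of s, symmetric] by (subst integral_distr) auto
  then have "(\<lambda>k. expectation (\<lambda>\<omega>. \<bar>\<psi> (int k)\<bar> * \<bar>eps (t - int k) \<omega>\<bar>)) = (\<lambda>k. \<bar>\<psi> (int k)\<bar> * (\<integral>x. \<bar>x\<bar> \<partial>G))"
    by simp
  then show "summable (\<lambda>k. expectation (\<lambda>\<omega>. \<bar>\<psi> (int k)\<bar> * \<bar>eps (t - int k) \<omega>\<bar>))"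
    using summable_mult2[OF \<psi>_summable] by simp
qed (use eps_moments in auto)

text \<open>Cauchy-Schwarz with weights sqrt |\<psi> k| bounds the square of a partial sum by the
  total weight times the series \<open>\<Sum>k. q k \<omega>\<close>, whose expectation is computed
  termwise. The innovation law enters the bound only through \<open>S\<close>.\<close>

lemma causal_sum_second_moment:
  "integrable M (\<lambda>\<omega>. (causal_sum t \<omega>)\<^sup>2)"
  "expectation (\<lambda>\<omega>. (causal_sum t \<omega>)\<^sup>2) \<le> (\<Sum>n. \<bar>\<psi> (int n)\<bar>)\<^sup>2 * S"
proof -
  define \<Psi> where "\<Psi> = (\<Sum>n. \<bar>\<psi> (int n)\<bar>)"
  have \<Psi>0: "\<Psi> \<ge> 0" unfolding \<Psi>_def by (rule suminf_nonneg[OF \<psi>_summable]) auto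
  define q where "q k \<omega> = \<bar>\<psi> (int k)\<bar> * (eps (t - int k) \<omega>)\<^sup>2" for k \<omega>
  have q_int: "integrable M (q k)" for k unfolding q_def using eps_moments by auto
  have q_E: "expectation (q k) = \<bar>\<psi> (int k)\<bar> * (\<integral>x. x\<^sup>2 \<partial>G)" for k
    unfolding q_def using eps_moments by simp
  have q_s: "summable (\<lambda>k. expectation (q k))"
    unfolding q_E using summable_mult2[OF \<psi>_summable] by simp
  have q_nn: "q k \<omega> \<ge> 0" for k \<omega> unfolding q_def by simp
  have q_AE: "AE \<omega> in M. summable (\<lambda>k. q k \<omega>)"
    by (rule AE_summable_of_summable_integral[OF q_int q_nn q_s])
  have T_int: "integrable M (\<lambda>\<omega>. \<Sum>k. q k \<omega>)" and T_E: "expectation (\<lambda>\<omega>. \<Sum>k. q k \<omega>) = (\<Sum>k. expectation (q k))"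
  proof -
    have n: "(\<lambda>k. norm (q k \<omega>)) = (\<lambda>k. q k \<omega>)" for \<omega> using q_nn by simp
    have "summable (\<lambda>k. expectation (\<lambda>\<omega>. norm (q k \<omega>)))" using q_s q_nn by simp
    with q_AE[folded n]
    show "integrable M (\<lambda>\<omega>. \<Sum>k. q k \<omega>)" "expectation (\<lambda>\<omega>. \<Sum>k. q k \<omega>) = (\<Sum>k. expectation (q k))"
      by (rule integrable_suminf[OF q_int], rule integral_suminf[OF q_int])
  qed
  have bound: "AE \<omega> in M. (causal_sum t \<omega>)\<^sup>2 \<le> \<Psi> * (\<Sum>k. q k \<omega>)"
    using q_AE AE_causal_sum_summable[of t]
  proof eventually_elim
    case (elim \<omega>)
    have s: "summable (\<lambda>k. \<psi> (int k) * eps (t - int k) \<omega>)"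
      using elim(2) by (simp add: summable_rabs_cancel abs_mult)
    have "(\<Sum>k<n. \<psi> (int k) * eps (t - int k) \<omega>)\<^sup>2 \<le> \<Psi> * (\<Sum>k. q k \<omega>)" for n
    proof -
      have "\<bar>\<Sum>k<n. \<psi> (int k) * eps (t - int k) \<omega>\<bar> \<le> (\<Sum>k<n. sqrt \<bar>\<psi> (int k)\<bar> * (sqrt \<bar>\<psi> (int k)\<bar> * \<bar>eps (t - int k) \<omega>\<bar>))"
        by (rule order_trans[OF sum_abs]) (simp add: abs_mult mult.assoc[symmetric])
      from power_mono[OF this abs_ge_zero, of 2]
      have "(\<Sum>k<n. \<psi> (int k) * eps (t - int k) \<omega>)\<^sup>2
          \<le> (\<Sum>k<n. sqrt \<bar>\<psi> (int k)\<bar> * (sqrt \<bar>\<psi> (int k)\<bar> * \<bar>eps (t - int k) \<omega>\<bar>))\<^sup>2"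
        by (simp only: power2_abs)
      also have "\<dots> \<le> (\<Sum>k<n. (sqrt \<bar>\<psi> (int k)\<bar>)\<^sup>2) * (\<Sum>k<n. (sqrt \<bar>\<psi> (int k)\<bar> * \<bar>eps (t - int k) \<omega>\<bar>)\<^sup>2)"
        by (rule Cauchy_Schwarz_ineq_sum)
      also have "\<dots> = (\<Sum>k<n. \<bar>\<psi> (int k)\<bar>) * (\<Sum>k<n. q k \<omega>)"
        by (simp add: q_def power_mult_distrib)
      also have "\<dots> \<le> \<Psi> * (\<Sum>k. q k \<omega>)"
        unfolding \<Psi>_def using \<psi>_summable elim(1) q_nn
        by (intro mult_mono sum_le_suminf suminf_nonneg sum_nonneg) auto
      finally show ?thesis .
    qed
    moreover have "(\<lambda>n. (\<Sum>k<n. \<psi> (int k) * eps (t - int k) \<omega>)\<^sup>2) \<longlonglongrightarrow> (causal_sum t \<omega>)\<^sup>2"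
      unfolding causal_sum_def using summable_LIMSEQ[OF s] by (intro tendsto_power)
    ultimately show ?case
      by (intro LIMSEQ_le_const2) auto
  qed
  show int: "integrable M (\<lambda>\<omega>. (causal_sum t \<omega>)\<^sup>2)"
  proof (rule Bochner_Integration.integrable_bound[OF integrable_mult_right[OF T_int, of \<Psi>]])
    show "AE \<omega> in M. norm ((causal_sum t \<omega>)\<^sup>2) \<le> norm (\<Psi> * (\<Sum>k. q k \<omega>))"
      using bound
    proof eventually_elim
      case (elim \<omega>)
      then show ?case
        using zero_le_power2[of "causal_sum t \<omega>"] unfolding real_norm_def by linarith
    qed
  qed measurable
  have "expectation (\<lambda>\<omega>. (causal_sum t \<omega>)\<^sup>2) \<le> expectation (\<lambda>\<omega>. \<Psi> * (\<Sum>k. q k \<omega>))"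
    using bound by (intro integral_mono_AE int integrable_mult_right T_int) auto
  also have "\<dots> = \<Psi> * (\<Psi> * (\<integral>x. x\<^sup>2 \<partial>G))"
    using T_E unfolding q_E suminf_mult2[OF \<psi>_summable, folded \<Psi>_def, symmetric] by simp
  also have "\<dots> \<le> \<Psi>\<^sup>2 * S"
    using \<Psi>0 G_var by (simp add: power2_eq_square mult.assoc mult_left_mono)
  finally show "expectation (\<lambda>\<omega>. (causal_sum t \<omega>)\<^sup>2) \<le> (\<Sum>n. \<bar>\<psi> (int n)\<bar>)\<^sup>2 * S"
    by (simp add: \<Psi>_def)
qed

lemma eps_sum_abs_moment:
  assumes "finite T"
  shows "expectation (\<lambda>\<omega>. \<bar>\<Sum>t\<in>T. eps t \<omega>\<bar>) \<le> sqrt (real (card T) * S)"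
    and "integrable M (\<lambda>\<omega>. \<bar>\<Sum>t\<in>T. eps t \<omega>\<bar>)"
proof -
  have orth: "expectation (\<lambda>\<omega>. eps s \<omega> * eps t \<omega>) = 0" if "s \<noteq> t" for s t
  proof -
    have "expectation (\<lambda>\<omega>. eps s \<omega> * eps t \<omega>) = expectation (eps s) * expectation (eps t)"
      by (rule indep_expectation_mult(1)[of "{Inl s}" "{Inl t}"]) (use that eps_moments in \<open>auto intro!: \<F>_eps\<close>)
    then show ?thesis using eps_moments by simp
  qed
  note * = second_moment_orthogonal_sum[OF assms, of eps, OF _ _ orth]
  have "expectation (\<lambda>\<omega>. \<bar>\<Sum>t\<in>T. eps t \<omega>\<bar>) \<le> sqrt (expectation (\<lambda>\<omega>. (\<Sum>t\<in>T. eps t \<omega>)\<^sup>2))"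
    using * eps_moments by (intro expectation_abs_le_sqrt) auto
  also have "\<dots> \<le> sqrt (real (card T) * S)"
    using *(1) eps_moments G_var by (simp add: mult_left_mono)
  finally show "expectation (\<lambda>\<omega>. \<bar>\<Sum>t\<in>T. eps t \<omega>\<bar>) \<le> sqrt (real (card T) * S)" .
  show "integrable M (\<lambda>\<omega>. \<bar>\<Sum>t\<in>T. eps t \<omega>\<bar>)" using eps_moments by auto
qed

lemma AE_eq_causal_sum:
  assumes rec: "\<And>t \<omega>. \<omega> \<in> space M \<Longrightarrow> u t \<omega> = (\<Sum>i=1..p. \<beta> i * u (t - int i) \<omega>) + eps t \<omega>"
    and st: "strictly_stationary M u" and um[measurable]: "\<And>t. u t \<in> borel_measurable M"
    and neg: "\<And>k. k < 0 \<Longrightarrow> \<psi> k = 0" and zero: "\<psi> 0 = 1"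
    and \<psi>: "\<And>k. k \<ge> 1 \<Longrightarrow> \<psi> k = (\<Sum>i=1..p. \<beta> i * \<psi> (k - int i))"
  shows "AE \<omega> in M. u t \<omega> = causal_sum t \<omega>"
proof -
  define s where "s K \<omega> = (\<Sum>k<Suc K. \<psi> (int k) * eps (t - int k) \<omega>)" for K \<omega>
  have [measurable]: "s K \<in> borel_measurable M" for K unfolding s_def by measurable
  define b where "b K = (\<Sum>i=1..p. \<Sum>l=1..i. expectation (\<lambda>\<omega>. min 1 \<bar>\<beta> i * \<psi> (int (Suc K) - int l) * u 0 \<omega>\<bar>))" for K
  have min_int: "integrable M (\<lambda>\<omega>. min 1 \<bar>f \<omega>\<bar>)" if "f \<in> borel_measurable M" for f :: "'a \<Rightarrow> real"
    using that by (intro integrable_const_bound[of _ 1]) auto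
  have le: "expectation (\<lambda>\<omega>. min 1 \<bar>u t \<omega> - s K \<omega>\<bar>) \<le> b K" for K
  proof -
    \<comment> \<open>Only the one-dimensional law of \<open>u\<close> matters here, so stationarity
      replaces every time index by 0 and leaves \<open>K\<close> in the coefficients alone.\<close>
    have same: "expectation (\<lambda>\<omega>. min 1 \<bar>c * u r \<omega>\<bar>) = expectation (\<lambda>\<omega>. min 1 \<bar>c * u 0 \<omega>\<bar>)" for c r
    proof -
      have "expectation (\<lambda>\<omega>. min 1 \<bar>c * u r \<omega>\<bar>) = (\<integral>x. min 1 \<bar>c * x\<bar> \<partial>distr M borel (u r))"
        by (subst integral_distr) auto
      also have "\<dots> = (\<integral>x. min 1 \<bar>c * x\<bar> \<partial>distr M borel (u 0))"
        by (subst strictly_stationary_distr[OF st um, of r]) (rule refl)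
      also have "\<dots> = expectation (\<lambda>\<omega>. min 1 \<bar>c * u 0 \<omega>\<bar>)"
        by (subst integral_distr) auto
      finally show ?thesis .
    qed
    define h where "h i l \<omega> = min 1 \<bar>\<beta> i * \<psi> (int (Suc K) - int l) * u (t - int (Suc K) + int l - int i) \<omega>\<bar>" for i l \<omega>
    have h_int: "integrable M (h i l)" for i l
      unfolding h_def by (rule min_int) measurable
    have "expectation (\<lambda>\<omega>. min 1 \<bar>u t \<omega> - s K \<omega>\<bar>) \<le> expectation (\<lambda>\<omega>. \<Sum>i=1..p. \<Sum>l=1..i. h i l \<omega>)"
    proof (rule integral_mono)
      show "integrable M (\<lambda>\<omega>. \<Sum>i=1..p. \<Sum>l=1..i. h i l \<omega>)"
        by (intro Bochner_Integration.integrable_sum h_int)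
      show "integrable M (\<lambda>\<omega>. min 1 \<bar>u t \<omega> - s K \<omega>\<bar>)"
        by (rule min_int) measurable
      fix \<omega> assume \<omega>: "\<omega> \<in> space M"
      let ?r = "\<lambda>i l. \<psi> (int (Suc K) - int l) * u (t - int (Suc K) + int l - int i) \<omega>"
      have "u t \<omega> - s K \<omega> = (\<Sum>i=1..p. \<beta> i * (\<Sum>l=1..i. ?r i l))"
        using AR_recursion_unrolled[of "\<lambda>t. u t \<omega>" \<beta> p "\<lambda>t. eps t \<omega>" \<psi> t K, OF rec[OF \<omega>] neg zero \<psi>]
        unfolding s_def by linarith
      then have "min 1 \<bar>u t \<omega> - s K \<omega>\<bar> = min 1 \<bar>\<Sum>i=1..p. \<beta> i * (\<Sum>l=1..i. ?r i l)\<bar>"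
        by (rule arg_cong)
      also have "\<dots> \<le> (\<Sum>i=1..p. min 1 \<bar>\<beta> i * (\<Sum>l=1..i. ?r i l)\<bar>)"
        by (rule min_one_abs_sum_le) simp
      also have "\<dots> \<le> (\<Sum>i=1..p. \<Sum>l=1..i. h i l \<omega>)"
        unfolding sum_distrib_left h_def mult.assoc by (intro sum_mono min_one_abs_sum_le) simp
      finally show "min 1 \<bar>u t \<omega> - s K \<omega>\<bar> \<le> (\<Sum>i=1..p. \<Sum>l=1..i. h i l \<omega>)" .
    qed
    also have "\<dots> = (\<Sum>i=1..p. expectation (\<lambda>\<omega>. \<Sum>l=1..i. h i l \<omega>))"
      by (intro Bochner_Integration.integral_sum Bochner_Integration.integrable_sum h_int)
    also have "\<dots> = (\<Sum>i=1..p. \<Sum>l=1..i. expectation (h i l))"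
      by (intro sum.cong refl Bochner_Integration.integral_sum h_int)
    also have "\<dots> = b K"
      unfolding b_def h_def by (intro sum.cong refl same)
    finally show ?thesis .
  qed
  have "b \<longlonglongrightarrow> (\<Sum>i=1..p. \<Sum>l=1..i. 0)"
    unfolding b_def
  proof (intro tendsto_sum)
    fix i l
    have "(\<lambda>n. \<psi> (int n)) \<longlonglongrightarrow> 0"
      using summable_LIMSEQ_zero[OF \<psi>_summable] by (simp add: tendsto_rabs_zero_iff)
    then have "(\<lambda>n. \<psi> (int n - int l + 1)) \<longlonglongrightarrow> 0"
    proof -
      assume *: "(\<lambda>n. \<psi> (int n)) \<longlonglongrightarrow> 0"
      have "(\<lambda>n. \<psi> (int (n + l) - int l + 1)) \<longlonglongrightarrow> 0"
        using LIMSEQ_Suc[OF *] by (simp add: add.commute)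
      then show ?thesis by (rule LIMSEQ_offset)
    qed
    then have c: "(\<lambda>K. \<psi> (int (Suc K) - int l)) \<longlonglongrightarrow> 0"
      by (simp add: algebra_simps)
    have "(\<lambda>K. expectation (\<lambda>\<omega>. min 1 \<bar>\<beta> i * \<psi> (int (Suc K) - int l) * u 0 \<omega>\<bar>)) \<longlonglongrightarrow> expectation (\<lambda>\<omega>. 0)"
    proof (rule integral_dominated_convergence[where w="\<lambda>_. 1"])
      have "(\<lambda>K. min 1 \<bar>\<beta> i * \<psi> (int (Suc K) - int l) * u 0 \<omega>\<bar>) \<longlonglongrightarrow> min 1 \<bar>\<beta> i * 0 * u 0 \<omega>\<bar>" for \<omega>
        by (intro tendsto_intros c)
      from tendsto_eq_rhs[OF this]
      show "AE \<omega> in M. (\<lambda>K. min 1 \<bar>\<beta> i * \<psi> (int (Suc K) - int l) * u 0 \<omega>\<bar>) \<longlonglongrightarrow> 0"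
        by (intro AE_I2) simp
      show "AE \<omega> in M. norm (min 1 \<bar>\<beta> i * \<psi> (int (Suc K) - int l) * u 0 \<omega>\<bar>) \<le> 1" for K
        by (intro AE_I2) simp
    qed (intro integrable_const borel_measurable_min borel_measurable_abs borel_measurable_times borel_measurable_diff borel_measurable_const um causal_sum_measurable, (measurable)?)
    then show "(\<lambda>K. expectation (\<lambda>\<omega>. min 1 \<bar>\<beta> i * \<psi> (int (Suc K) - int l) * u 0 \<omega>\<bar>)) \<longlonglongrightarrow> 0"
      by (rule tendsto_eq_rhs) simp
  qed
  then have b0: "b \<longlonglongrightarrow> 0" by simp
  have lim: "(\<lambda>K. expectation (\<lambda>\<omega>. min 1 \<bar>u t \<omega> - s K \<omega>\<bar>)) \<longlonglongrightarrow> expectation (\<lambda>\<omega>. min 1 \<bar>u t \<omega> - causal_sum t \<omega>\<bar>)"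
  proof (rule integral_dominated_convergence[where w="\<lambda>_. 1"])
    show "AE \<omega> in M. (\<lambda>K. min 1 \<bar>u t \<omega> - s K \<omega>\<bar>) \<longlonglongrightarrow> min 1 \<bar>u t \<omega> - causal_sum t \<omega>\<bar>"
      using AE_causal_sum_summable[of t]
    proof eventually_elim
      case (elim \<omega>)
      have "summable (\<lambda>k. \<psi> (int k) * eps (t - int k) \<omega>)"
        using elim by (simp add: summable_rabs_cancel abs_mult)
      from LIMSEQ_Suc[OF summable_LIMSEQ[OF this]] show ?case
        unfolding causal_sum_def s_def by (intro tendsto_intros)
    qed
    show "AE \<omega> in M. norm (min 1 \<bar>u t \<omega> - s K \<omega>\<bar>) \<le> 1" for K
      by (intro AE_I2) simp
  qed (intro integrable_const borel_measurable_min borel_measurable_abs borel_measurable_times borel_measurable_diff borel_measurable_const um causal_sum_measurable, (measurable)?)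
  have "expectation (\<lambda>\<omega>. min 1 \<bar>u t \<omega> - causal_sum t \<omega>\<bar>) \<le> 0"
    by (rule LIMSEQ_le[OF lim b0]) (use le in auto)
  then have "expectation (\<lambda>\<omega>. min 1 \<bar>u t \<omega> - causal_sum t \<omega>\<bar>) = 0"
    by (intro antisym integral_nonneg) auto
  then have "AE \<omega> in M. min 1 \<bar>u t \<omega> - causal_sum t \<omega>\<bar> = 0"
    by (subst (asm) integral_nonneg_eq_0_iff_AE) (auto intro!: min_int)
  then show ?thesis
    by eventually_elim (auto simp: min_def split: if_splits)
qed

end

end

lemma AR_contam_model_noise:
  assumes "AR_contam_model p \<beta> G GE g M eps z xi u"
  shows "contam_noise M G GE g eps z xi"
proof -
  have "noise eps z xi = (\<lambda>k. case k of Inl t \<Rightarrow> eps t | Inr (Inl t) \<Rightarrow> z t | Inr (Inr t) \<Rightarrow> xi t)"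
    by (auto simp: noise_def fun_eq_iff)
  with assms show ?thesis
    unfolding AR_contam_model_def contam_noise_def contam_noise_axioms_def by auto
qed

section \<open>Uniform bounds for the autoregression and its sums\<close>

lemma shifted_sum_diff:
  fixes u :: "int \<Rightarrow> real"
  shows "(\<Sum>t=1..int n. u (t - j - int i)) - (\<Sum>t=1..int n. u (t - j))
    = (\<Sum>l<i. u (- j - int l) - u (int n - j - int l))"
proof (induction i)
  case (Suc i)
  have tele: "(\<Sum>t=1..int n. w (t - 1)) - (\<Sum>t=1..int n. w t) = w 0 - w (int n)" for w :: "int \<Rightarrow> real"
  proof (induction n)
    case (Suc n)
    have "{1..int (Suc n)} = insert (int (Suc n)) {1..int n}" by auto
    then show ?case using Suc by simp
  qed simp
  have "(\<Sum>t=1..int n. u (t - j - int (Suc i))) - (\<Sum>t=1..int n. u (t - j - int i))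
      = u (- j - int i) - u (int n - j - int i)"
    using tele[of "\<lambda>t. u (t - j - int i)"] by (simp add: algebra_simps)
  with Suc show ?case by simp
qed simp

text \<open>Otherwise 1 would be a characteristic root on the unit circle. This permits division by
  1 minus the sum of the coefficients when sums of \<open>u\<close> are bounded.\<close>

lemma causal_coeffs_sum_ne_1:
  assumes "causal_coeffs p \<beta>"
  shows "(\<Sum>i=1..p. \<beta> i) \<noteq> 1"
proof
  assume "(\<Sum>i=1..p. \<beta> i) = 1"
  then have "(\<Sum>i=1..p. complex_of_real (\<beta> i)) = 1" by (metis of_real_1 of_real_sum)
  then show False using assms unfolding causal_coeffs_def by (auto dest!: spec[of _ 1])
qed

text \<open>When the autoregression is summed over time, every lagged sum of \<open>u\<close>
  differs from the unlagged one by boundary terms only. So the sum of \<open>u\<close> inherits the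
  order sqrt n from the sum of the uncorrelated innovations.\<close>

lemma AR_sum_abs_le:
  fixes u e :: "int \<Rightarrow> real"
  assumes rec: "\<And>t. u t = (\<Sum>i=1..p. \<beta> i * u (t - int i)) + e t"
  shows "\<bar>1 - (\<Sum>i=1..p. \<beta> i)\<bar> * \<bar>\<Sum>t=1..int n. u (t - j)\<bar>
    \<le> \<bar>\<Sum>t=1..int n. e (t - j)\<bar> + (\<Sum>i=1..p. \<bar>\<beta> i\<bar> * (\<Sum>l<i. \<bar>u (- j - int l)\<bar> + \<bar>u (int n - j - int l)\<bar>))"
proof -
  let ?A = "\<Sum>t=1..int n. u (t - j)"
  have "?A = (\<Sum>t=1..int n. \<Sum>i=1..p. \<beta> i * u (t - j - int i)) + (\<Sum>t=1..int n. e (t - j))"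
    by (subst rec) (simp add: sum.distrib)
  also have "(\<Sum>t=1..int n. \<Sum>i=1..p. \<beta> i * u (t - j - int i)) = (\<Sum>i=1..p. \<beta> i * (\<Sum>t=1..int n. u (t - j - int i)))"
    by (subst sum.swap) (simp add: sum_distrib_left)
  also have "\<dots> = (\<Sum>i=1..p. \<beta> i * (?A + (\<Sum>l<i. u (- j - int l) - u (int n - j - int l))))"
  proof (intro sum.cong refl)
    fix i
    show "\<beta> i * (\<Sum>t=1..int n. u (t - j - int i)) = \<beta> i * (?A + (\<Sum>l<i. u (- j - int l) - u (int n - j - int l)))"
      using shifted_sum_diff[of u j i n] by (intro arg_cong[where f="(*) (\<beta> i)"]) linarith
  qed
  also have "\<dots> = (\<Sum>i=1..p. \<beta> i) * ?A + (\<Sum>i=1..p. \<beta> i * (\<Sum>l<i. u (- j - int l) - u (int n - j - int l)))"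
    by (simp add: distrib_left sum.distrib sum_distrib_right)
  finally have eq: "(1 - (\<Sum>i=1..p. \<beta> i)) * ?A = (\<Sum>t=1..int n. e (t - j))
     + (\<Sum>i=1..p. \<beta> i * (\<Sum>l<i. u (- j - int l) - u (int n - j - int l)))"
    unfolding left_diff_distrib by linarith
  have "\<bar>\<Sum>i=1..p. \<beta> i * (\<Sum>l<i. u (- j - int l) - u (int n - j - int l))\<bar>
      \<le> (\<Sum>i=1..p. \<bar>\<beta> i\<bar> * (\<Sum>l<i. \<bar>u (- j - int l)\<bar> + \<bar>u (int n - j - int l)\<bar>))"
    by (rule order_trans[OF sum_abs], rule sum_mono)
       (auto simp: abs_mult intro!: mult_left_mono order_trans[OF sum_abs] sum_mono abs_triangle_ineq4)
  then show ?thesis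
    unfolding abs_mult[symmetric] eq by (rule order_trans[OF abs_triangle_ineq add_left_mono])
qed

text \<open>The almost sure copy of \<open>u\<close>, reduced to what the later estimates use:
  dependence on past innovations, second moments, and a sqrt n bound for its sums, all with a single
  constant.\<close>

definition causal_version :: "real \<Rightarrow> 'a measure \<Rightarrow> (int \<Rightarrow> 'a \<Rightarrow> real) \<Rightarrow> (int \<Rightarrow> 'a \<Rightarrow> real) \<Rightarrow>
    (int \<Rightarrow> 'a \<Rightarrow> real) \<Rightarrow> (int \<Rightarrow> 'a \<Rightarrow> real) \<Rightarrow> bool" where
  "causal_version K M eps z xi v \<longleftrightarrow>
     (\<forall>t. v t \<in> borel_measurable (noise_algebra M eps z xi (Inl ` {..t}))) \<and>
     (\<forall>t. integrable M (\<lambda>\<omega>. (v t \<omega>)\<^sup>2) \<and> (\<integral>\<omega>. (v t \<omega>)\<^sup>2 \<partial>M) \<le> K) \<and>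
     (\<forall>n j. n \<ge> 1 \<longrightarrow> (\<integral>\<omega>. \<bar>\<Sum>t=1..int n. v (t - j) \<omega>\<bar> \<partial>M) \<le> K * sqrt (real n))"

text \<open>The order of quantifiers matters: \<open>K\<close> is chosen from p, \<beta> and
  \<open>S\<close> before the model, so it serves every model along a sequence whose innovation
  variances stay below \<open>S\<close>.\<close>

lemma AR_causal_representation:
  assumes causal: "causal_coeffs p \<beta>"
  shows "\<exists>K\<ge>0. \<forall>(M :: 'a measure) G GE g eps z xi u.
    AR_contam_model p \<beta> G GE g M eps z xi u \<longrightarrow> (\<integral>x. x\<^sup>2 \<partial>G) \<le> S \<longrightarrow>
    (\<exists>v. causal_version K M eps z xi v \<and> (AE \<omega> in M. \<forall>t. u t \<omega> = v t \<omega>))"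
proof -
  obtain \<psi> where neg: "\<And>k. k < 0 \<Longrightarrow> \<psi> k = 0" and zero: "\<psi> 0 = 1"
    and \<psi>: "\<And>k. k \<ge> 1 \<Longrightarrow> \<psi> k = (\<Sum>i=1..p. \<beta> i * \<psi> (k - int i))" and s: "summable (\<lambda>n. \<bar>\<psi> (int n)\<bar>)"
    using causal_coeffs_power_series[OF causal] by blast
  define K1 where "K1 = (\<Sum>n. \<bar>\<psi> (int n)\<bar>)\<^sup>2 * S"
  define d where "d = \<bar>1 - (\<Sum>i=1..p. \<beta> i)\<bar>"
  have d: "d > 0" using causal_coeffs_sum_ne_1[OF causal] by (simp add: d_def)
  define c where "c = (\<Sum>i=1..p. \<bar>\<beta> i\<bar> * (\<Sum>l<i. 2 * sqrt \<bar>K1\<bar>))"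
  have c: "c \<ge> 0" unfolding c_def by (intro sum_nonneg mult_nonneg_nonneg) auto
  \<comment> \<open>The first summand dominates the second moments; the second is the bound for the
    sums after division by \<open>d\<close>, with \<open>c\<close> covering the boundary
    terms.\<close>
  define K where "K = \<bar>K1\<bar> + (sqrt \<bar>S\<bar> + c) / d"
  show ?thesis
  proof (intro exI[of _ K] conjI allI impI)
    show "K \<ge> 0" unfolding K_def using d c by simp
    fix M :: "'a measure" and G GE g eps z xi u
    assume model: "AR_contam_model p \<beta> G GE g M eps z xi u" and S: "(\<integral>x. x\<^sup>2 \<partial>G) \<le> S"
    interpret contam_noise M G GE g eps z xi by (rule AR_contam_model_noise[OF model])
    have zm: "zero_mean_finite_var G" and st: "strictly_stationary M u"
      and um[measurable]: "\<And>t. u t \<in> borel_measurable M"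
      and rec: "\<And>t \<omega>. \<omega> \<in> space M \<Longrightarrow> u t \<omega> = (\<Sum>i=1..p. \<beta> i * u (t - int i) \<omega>) + eps t \<omega>"
      using model unfolding AR_contam_model_def by auto
    let ?v = "causal_sum \<psi>"
    have AE: "AE \<omega> in M. \<forall>t. u t \<omega> = ?v t \<omega>"
      unfolding AE_all_countable using AE_eq_causal_sum[OF s zm S rec st um neg zero \<psi>] by blast
    note v2 = causal_sum_second_moment[OF s zm S, folded K1_def]
    note vm[measurable] = causal_sum_measurable[OF s zm S]
    have v1: "integrable M (\<lambda>\<omega>. \<bar>?v t \<omega>\<bar>)" for t
      using square_integrable_imp_integrable[OF vm v2(1)] by simp
    have v1_le: "expectation (\<lambda>\<omega>. \<bar>?v t \<omega>\<bar>) \<le> sqrt \<bar>K1\<bar>" for t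
      using v2(2)[of t] by (intro order_trans[OF expectation_abs_le_sqrt[OF vm v2(1)]]) auto
    have lln: "expectation (\<lambda>\<omega>. \<bar>\<Sum>t=1..int n. ?v (t - j) \<omega>\<bar>) \<le> K * sqrt (real n)" if n: "n \<ge> 1" for n j
    proof -
      let ?R = "\<lambda>\<omega>. \<bar>\<Sum>t=1..int n. eps (t - j) \<omega>\<bar>
           + (\<Sum>i=1..p. \<bar>\<beta> i\<bar> * (\<Sum>l<i. \<bar>?v (- j - int l) \<omega>\<bar> + \<bar>?v (int n - j - int l) \<omega>\<bar>))"
      have sum_eq: "(\<Sum>t=1..int n. eps (t - j) \<omega>) = (\<Sum>t\<in>{1-j..int n-j}. eps t \<omega>)" for \<omega>
        by (rule sum.reindex_bij_witness[of _ "\<lambda>t. t + j" "\<lambda>t. t - j"]) auto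
      note e = eps_sum_abs_moment[OF s zm S, of "{1-j..int n-j}", folded sum_eq]
      have "d * expectation (\<lambda>\<omega>. \<bar>\<Sum>t=1..int n. ?v (t - j) \<omega>\<bar>) = expectation (\<lambda>\<omega>. d * \<bar>\<Sum>t=1..int n. ?v (t - j) \<omega>\<bar>)"
        by simp
      also have "\<dots> \<le> expectation ?R"
      proof (rule integral_mono_AE)
        show "integrable M (\<lambda>\<omega>. d * \<bar>\<Sum>t=1..int n. ?v (t - j) \<omega>\<bar>)"
          using v1 by (intro integrable_mult_right integrable_abs Bochner_Integration.integrable_sum) (simp add: integrable_abs_iff[OF vm])
        show "integrable M ?R"
          using e(2) v1 by (intro Bochner_Integration.integrable_add integrable_mult_right Bochner_Integration.integrable_sum) auto
        \<comment> \<open>The recursion holds everywhere for \<open>u\<close> but only almost surely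
          for the causal series, so the inequality is taken for \<open>u\<close> and
          transferred.\<close>
        show "AE \<omega> in M. d * \<bar>\<Sum>t=1..int n. ?v (t - j) \<omega>\<bar> \<le> ?R \<omega>"
          using AE AE_space
        proof eventually_elim
          case (elim \<omega>)
          then have eq: "(\<lambda>t. u t \<omega>) = (\<lambda>t. ?v t \<omega>)" by auto
          show ?case
            using AR_sum_abs_le[of "\<lambda>t. u t \<omega>" \<beta> p "\<lambda>t. eps t \<omega>" j n, OF rec[OF elim(2)]]
            unfolding d_def by (simp only: fun_cong[OF eq])
        qed
      qed
      also have "\<dots> = expectation (\<lambda>\<omega>. \<bar>\<Sum>t=1..int n. eps (t - j) \<omega>\<bar>)
          + (\<Sum>i=1..p. \<bar>\<beta> i\<bar> * (\<Sum>l<i. expectation (\<lambda>\<omega>. \<bar>?v (- j - int l) \<omega>\<bar>) + expectation (\<lambda>\<omega>. \<bar>?v (int n - j - int l) \<omega>\<bar>)))"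
        using e(2) v1 by (simp add: Bochner_Integration.integral_add Bochner_Integration.integral_sum)
      also have "\<dots> \<le> sqrt (real n * S) + (\<Sum>i=1..p. \<bar>\<beta> i\<bar> * (\<Sum>l<i. sqrt \<bar>K1\<bar> + sqrt \<bar>K1\<bar>))"
        using e(1) v1_le by (intro add_mono sum_mono mult_left_mono) auto
      also have "\<dots> \<le> sqrt (real n) * sqrt \<bar>S\<bar> + c * sqrt (real n)"
      proof (intro add_mono)
        show "sqrt (real n * S) \<le> sqrt (real n) * sqrt \<bar>S\<bar>"
          unfolding real_sqrt_mult[symmetric] by (intro real_sqrt_le_mono mult_left_mono) auto
        have "c * 1 \<le> c * sqrt (real n)" using n c by (intro mult_left_mono) auto
        then show "(\<Sum>i=1..p. \<bar>\<beta> i\<bar> * (\<Sum>l<i. sqrt \<bar>K1\<bar> + sqrt \<bar>K1\<bar>)) \<le> c * sqrt (real n)"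
          by (simp add: c_def)
      qed
      finally have "expectation (\<lambda>\<omega>. \<bar>\<Sum>t=1..int n. ?v (t - j) \<omega>\<bar>) \<le> (sqrt \<bar>S\<bar> + c) / d * sqrt (real n)"
        using d by (simp add: field_simps)
      also have "\<dots> \<le> K * sqrt (real n)"
        unfolding K_def by (intro mult_right_mono) auto
      finally show ?thesis .
    qed
    have "K1 \<le> K" unfolding K_def using d c by (smt (verit) divide_nonneg_pos real_sqrt_ge_zero)
    then have "causal_version K M eps z xi ?v"
      unfolding causal_version_def
      using causal_sum_measurable_past[OF s zm S] v2 lln by (auto intro: order_trans)
    with AE show "\<exists>v. causal_version K M eps z xi v \<and> (AE \<omega> in M. \<forall>t. u t \<omega> = v t \<omega>)"
      by blast
  qed
qed

section \<open>Shifted empirical processes\<close>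

definition below :: "real \<Rightarrow> real \<Rightarrow> real" where
  "below e a = (if e \<le> a then 1 else 0)"

lemma below_bounds[simp]: "0 \<le> below e a" "below e a \<le> 1" "\<bar>below e a\<bar> \<le> 1"
  by (auto simp: below_def)

lemma below_measurable[measurable]:
  assumes [measurable]: "f \<in> borel_measurable N" "h \<in> borel_measurable N"
  shows "(\<lambda>\<omega>. below (f \<omega>) (h \<omega>)) \<in> borel_measurable N"
  unfolding below_def by measurable

text \<open>By monotonicity in the threshold, the bound involves only the centre \<open>a0\<close>
  and the radius \<open>r\<close>; it therefore holds for all thresholds in the interval at once,
  however they depend on the sample.\<close>

lemma below_diff_le:
  assumes "\<bar>a - a0\<bar> \<le> r"
  shows "\<bar>below e a - below e a0\<bar> \<le> below e (a0 + r) - below e (a0 - r)"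
  using assms by (auto simp: below_def)

text \<open>One row of a triangular array. \<open>K\<close>, \<open>L\<close> and \<open>B\<close>
  are parameters so that the bounds obtained here can be read as uniform along a sequence of rows;
  \<open>b\<close> holds the coefficients with which gross errors enter the thresholds.\<close>

locale contam_array = contam_noise M G GE g eps z xi
  for M :: "'a measure" and G GE :: "real measure" and g :: real
    and eps z xi :: "int \<Rightarrow> 'a \<Rightarrow> real" +
  fixes v :: "int \<Rightarrow> 'a \<Rightarrow> real" and p :: nat and b :: "nat \<Rightarrow> real" and n :: nat
    and K L B :: real and f :: "real \<Rightarrow> real"
  assumes v: "causal_version K M eps z xi v" and K: "K \<ge> 0" and n: "n \<ge> 1"
    and L: "L \<ge> 0" and B: "B \<ge> 0"
    and G_lipschitz: "\<And>x y. \<bar>cdf G x - cdf G y\<bar> \<le> L * \<bar>x - y\<bar>"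
    and G_taylor: "\<And>x h. \<bar>cdf G (x + h) - cdf G x - f x * h\<bar> \<le> B * h\<^sup>2"
    and f_bound: "\<And>x. \<bar>f x\<bar> \<le> L"
begin

sublocale G: real_distribution G
  using G unfolding is_real_distr_def real_distribution_def real_distribution_axioms_def by auto

sublocale GE: real_distribution GE
  using GE unfolding is_real_distr_def real_distribution_def real_distribution_axioms_def by auto

lemma cdf_G_measurable[measurable]: "cdf G \<in> borel_measurable borel"
  by (intro borel_measurable_mono) (auto simp: mono_def intro: G.cdf_nondecreasing)

lemma cdf_G_01: "0 \<le> cdf G x" "cdf G x \<le> 1"
  using G.cdf_nonneg G.cdf_bounded_prob by auto

lemma cdf_G_diff_le_1: "\<bar>cdf G x - cdf G y\<bar> \<le> 1"
  using cdf_G_01[of x] cdf_G_01[of y] by linarith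

text \<open>Since \<open>eps t\<close> is independent of the noise with index in \<open>J\<close>,
  the threshold may be frozen while integrating over \<open>eps t\<close>: in effect,
  \<open>cdf G (a \<omega>)\<close> is the conditional probability of \<open>eps t\<close> being at
  most the threshold.\<close>

lemma expectation_below_eps:
  assumes J: "Inl t \<notin> J" and \<phi>: "\<phi> \<in> borel_measurable (\<F> J)" and a: "a \<in> borel_measurable (\<F> J)"
    and bd: "\<And>\<omega>. \<omega> \<in> space M \<Longrightarrow> \<bar>\<phi> \<omega>\<bar> \<le> C"
  shows "expectation (\<lambda>\<omega>. \<phi> \<omega> * below (eps t \<omega>) (a \<omega>)) = expectation (\<lambda>\<omega>. \<phi> \<omega> * cdf G (a \<omega>))"
proof -
  let ?N = "borel \<Otimes>\<^sub>M borel :: (real \<times> real) measure"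
  \<comment> \<open>The dummy second coordinate gives both pairs the same value type, which
    \<open>indep_var\<close> demands.\<close>
  let ?X = "\<lambda>\<omega>. (\<phi> \<omega>, a \<omega>)" and ?E = "\<lambda>\<omega>. (eps t \<omega>, 0 :: real)"
  let ?D = "distr M ?N ?X" and ?D' = "distr M ?N ?E"
  let ?h = "\<lambda>e w :: real \<times> real. fst w * below (fst e) (snd w)"
  have [measurable]: "\<phi> \<in> borel_measurable M" "a \<in> borel_measurable M"
    using \<phi> a by (auto intro: \<F>_measurable)
  have "indep_var ?N ?E ?N ?X"
    by (rule \<F>_indep[of "{Inl t}" J]) (use J \<phi> a in \<open>auto intro!: \<F>_eps measurable_Pair\<close>)
  then have eq: "?D' \<Otimes>\<^sub>M ?D = distr M (?N \<Otimes>\<^sub>M ?N) (\<lambda>\<omega>. (?E \<omega>, ?X \<omega>))"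
    unfolding indep_var_distribution_eq by simp
  interpret D: prob_space ?D by (rule prob_space_distr) measurable
  interpret D': prob_space ?D' by (rule prob_space_distr) measurable
  interpret P: pair_prob_space ?D' ?D ..
  have int: "integrable (?D' \<Otimes>\<^sub>M ?D) (case_prod ?h)"
    unfolding eq
  proof (subst integrable_distr_eq)
    show "integrable M (\<lambda>\<omega>. case (?E \<omega>, ?X \<omega>) of (e, w) \<Rightarrow> ?h e w)"
    proof (rule integrable_const_bound[of _ C])
      show "AE \<omega> in M. norm (case (?E \<omega>, ?X \<omega>) of (e, w) \<Rightarrow> ?h e w) \<le> C"
        by (intro AE_I2) (auto simp: below_def dest: bd intro: order_trans[OF abs_ge_zero bd])
    qed (simp only: prod.case fst_conv snd_conv, measurable)
  qed measurable
  have "expectation (\<lambda>\<omega>. \<phi> \<omega> * below (eps t \<omega>) (a \<omega>)) = integral\<^sup>L (?D' \<Otimes>\<^sub>M ?D) (case_prod ?h)"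
    unfolding eq by (subst integral_distr) auto
  also have "\<dots> = (\<integral>w. (\<integral>e. ?h e w \<partial>?D') \<partial>?D)"
    by (rule P.integral_snd[OF int, symmetric])
  also have "\<dots> = (\<integral>w. fst w * cdf G (snd w) \<partial>?D)"
  proof (rule Bochner_Integration.integral_cong, rule refl)
    fix w :: "real \<times> real"
    have "(\<integral>e. ?h e w \<partial>?D') = fst w * expectation (\<lambda>\<omega>. below (eps t \<omega>) (snd w))"
      by (subst integral_distr) auto
    also have "expectation (\<lambda>\<omega>. below (eps t \<omega>) (snd w)) = (\<integral>e. below e (snd w) \<partial>G)"
      unfolding eps_distr[of t, symmetric] by (subst integral_distr) auto
    also have "\<dots> = (\<integral>e. indicator {..snd w} e \<partial>G)"
      by (intro Bochner_Integration.integral_cong) (auto simp: below_def)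
    also have "\<dots> = cdf G (snd w)"
      by (simp add: cdf_def)
    finally show "(\<integral>e. ?h e w \<partial>?D') = fst w * cdf G (snd w)" .
  qed
  also have "\<dots> = expectation (\<lambda>\<omega>. \<phi> \<omega> * cdf G (a \<omega>))"
    by (subst integral_distr) auto
  finally show ?thesis .
qed

definition s :: "int \<Rightarrow> 'a \<Rightarrow> real" where "s t \<omega> = z t \<omega> * xi t \<omega>"

text \<open>The residual at time \<open>t\<close> is \<open>eps t - contam t - lin \<tau> t\<close>, where \<open>\<tau>\<close> is the estimation error
  multiplied by \<open>sqrt n\<close> and \<open>b 0 = -1\<close>, \<open>b j = \<beta> j\<close>.\<close>

definition contam :: "int \<Rightarrow> 'a \<Rightarrow> real" where
  "contam t \<omega> = (\<Sum>j=0..p. b j * s (t - int j) \<omega>)"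

definition lin :: "(nat \<Rightarrow> real) \<Rightarrow> int \<Rightarrow> 'a \<Rightarrow> real" where
  "lin \<tau> t \<omega> = (\<Sum>i=1..p. \<tau> i * (v (t - int i) \<omega> + s (t - int i) \<omega>)) / sqrt (real n)"

text \<open>All \<open>z\<close> and \<open>xi\<close> are included, future ones too: the
  contamination is independent of the innovations, so it can be treated as known from the start, and
  only the innovations are ordered in time.\<close>

definition nonanticip :: "int \<Rightarrow> (int + int + int) set" where
  "nonanticip t = Inl ` {..<t} \<union> range Inr"

lemma nonanticip[simp]: "Inl t \<notin> nonanticip t" "Inr k \<in> nonanticip t" "r < t \<Longrightarrow> Inl r \<in> nonanticip t"
  by (auto simp: nonanticip_def)

lemma v_nonanticip[measurable]: "r < t \<Longrightarrow> v r \<in> borel_measurable (\<F> (nonanticip t))"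
  by (rule \<F>_mono[of _ "Inl ` {..r}"]) (use v in \<open>auto simp: causal_version_def nonanticip_def\<close>)

lemma s_nonanticip: "s r \<in> borel_measurable (\<F> (nonanticip t))"
proof -
  have [measurable]: "z r \<in> borel_measurable (\<F> (nonanticip t))" "xi r \<in> borel_measurable (\<F> (nonanticip t))"
    by (auto intro!: \<F>_z \<F>_xi)
  show ?thesis unfolding s_def[abs_def] by measurable
qed

lemma contam_nonanticip: "contam r \<in> borel_measurable (\<F> (nonanticip t))"
proof -
  note s_nonanticip[measurable]
  show ?thesis unfolding contam_def[abs_def] by measurable
qed

lemma lin_nonanticip: "r \<le> t \<Longrightarrow> lin \<tau> r \<in> borel_measurable (\<F> (nonanticip t))"
proof -
  assume r: "r \<le> t"
  note s_nonanticip[measurable]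
  have [measurable]: "v (r - int i) \<in> borel_measurable (\<F> (nonanticip t))" if "i \<in> {1..p}" for i
    using r that by (intro v_nonanticip) auto
  show ?thesis unfolding lin_def[abs_def] by measurable
qed

lemma v_measurable[measurable]: "v t \<in> borel_measurable M"
  using v unfolding causal_version_def by (auto intro: \<F>_measurable)

lemma s_measurable[measurable]: "s t \<in> borel_measurable M"
  unfolding s_def[abs_def] by measurable

lemma contam_measurable[measurable]: "contam t \<in> borel_measurable M"
  unfolding contam_def[abs_def] by measurable

lemma lin_measurable[measurable]: "lin \<tau> t \<in> borel_measurable M"
  unfolding lin_def[abs_def] by measurable

lemma v_sq: "integrable M (\<lambda>\<omega>. (v t \<omega>)\<^sup>2)" "expectation (\<lambda>\<omega>. (v t \<omega>)\<^sup>2) \<le> K"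
  using v unfolding causal_version_def by auto

lemma v_integrable: "integrable M (v t)"
  by (rule square_integrable_imp_integrable[OF v_measurable v_sq(1)])

lemma v_abs: "integrable M (\<lambda>\<omega>. \<bar>v t \<omega>\<bar>)" "expectation (\<lambda>\<omega>. \<bar>v t \<omega>\<bar>) \<le> 1 + K"
proof -
  show int: "integrable M (\<lambda>\<omega>. \<bar>v t \<omega>\<bar>)" using v_integrable by simp
  have "\<bar>x\<bar> \<le> 1 + x\<^sup>2" for x :: real
    using zero_le_power2[of "\<bar>x\<bar> - 1"] zero_le_power2[of x] by (simp add: power2_eq_square algebra_simps)
  then have "expectation (\<lambda>\<omega>. \<bar>v t \<omega>\<bar>) \<le> expectation (\<lambda>\<omega>. 1 + (v t \<omega>)\<^sup>2)"
    using v_sq by (intro integral_mono int) auto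
  also have "\<dots> \<le> 1 + K" using v_sq by (simp add: prob_space)
  finally show "expectation (\<lambda>\<omega>. \<bar>v t \<omega>\<bar>) \<le> 1 + K" .
qed

lemma z_integrable: "integrable M (z t)"
proof (rule integrable_const_bound[of _ 1])
  show "AE \<omega> in M. norm (z t \<omega>) \<le> 1"
    using z01[of _ t] by (intro AE_I2) fastforce
qed measurable

lemma z_expectation: "expectation (z t) = g"
proof -
  have "expectation (z t) = expectation (indicator {\<omega>\<in>space M. z t \<omega> = 1})"
    by (intro Bochner_Integration.integral_cong refl) (auto simp: indicator_def dest: z01[of _ t])
  also have "\<dots> = measure M {\<omega>\<in>space M. z t \<omega> = 1}"
    by (subst Bochner_Integration.integral_indicator) (auto simp: Int_def intro!: arg_cong[where f="measure M"])
  finally show ?thesis by (simp add: z_prob)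
qed

lemma g_01: "0 \<le> g" "g \<le> 1"
  using measure_nonneg[of M "{\<omega>\<in>space M. z 0 \<omega> = 1}"] prob_le_1[of "{\<omega>\<in>space M. z 0 \<omega> = 1}"]
  unfolding z_prob by auto

lemma xi_expectation:
  assumes [measurable]: "h \<in> borel_measurable borel"
  shows "expectation (\<lambda>\<omega>. h (xi t \<omega>) :: real) = (\<integral>x. h x \<partial>GE)"
  unfolding xi_distr[of t, symmetric] by (subst integral_distr) auto

lemma z_times_xi:
  fixes h :: "real \<Rightarrow> real"
  assumes [measurable]: "h \<in> borel_measurable borel" and bd: "\<And>x. \<bar>h x\<bar> \<le> C"
  shows "integrable M (\<lambda>\<omega>. z t \<omega> * h (xi t \<omega>))"
    and "expectation (\<lambda>\<omega>. z t \<omega> * h (xi t \<omega>)) = g * (\<integral>x. h x \<partial>GE)"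
proof -
  have [measurable]: "xi t \<in> borel_measurable (\<F> {Inr (Inr t)})" by (rule \<F>_xi) simp
  have hx: "integrable M (\<lambda>\<omega>. h (xi t \<omega>))"
    using bd by (intro integrable_const_bound[of _ C]) auto
  have d: "{Inr (Inl t)} \<inter> {Inr (Inr t)} = {}" by auto
  have z: "z t \<in> borel_measurable (\<F> {Inr (Inl t)})" by (rule \<F>_z) simp
  have hm: "(\<lambda>\<omega>. h (xi t \<omega>)) \<in> borel_measurable (\<F> {Inr (Inr t)})" by measurable
  note * = indep_expectation_mult[OF d z hm z_integrable hx]
  show "integrable M (\<lambda>\<omega>. z t \<omega> * h (xi t \<omega>))"
    by (rule *(2))
  show "expectation (\<lambda>\<omega>. z t \<omega> * h (xi t \<omega>)) = g * (\<integral>x. h x \<partial>GE)"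
    unfolding *(1) z_expectation by (simp add: xi_expectation)
qed

text \<open>A truncated first moment of the gross errors, finite for every law; it stands in for the
  possibly infinite expectation of \<open>a * \<bar>xi t\<bar>\<close>.\<close>

definition \<kappa> :: "real \<Rightarrow> real" where "\<kappa> a = (\<integral>x. min 1 (a * \<bar>x\<bar>) \<partial>GE)"

lemma min_s:
  assumes a: "a \<ge> 0"
  shows "integrable M (\<lambda>\<omega>. min 1 (a * \<bar>s t \<omega>\<bar>))" "expectation (\<lambda>\<omega>. min 1 (a * \<bar>s t \<omega>\<bar>)) = g * \<kappa> a"
proof -
  have eq: "min 1 (a * \<bar>s t \<omega>\<bar>) = z t \<omega> * min 1 (a * \<bar>xi t \<omega>\<bar>)" if "\<omega> \<in> space M" for \<omega>
    using z01[OF that, of t] by (auto simp: s_def)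
  have bd: "\<bar>min 1 (a * \<bar>x\<bar>)\<bar> \<le> 1" for x using a by (auto simp: min_def)
  note * = z_times_xi[of "\<lambda>x. min 1 (a * \<bar>x\<bar>)" 1 t, OF _ bd]
  show "integrable M (\<lambda>\<omega>. min 1 (a * \<bar>s t \<omega>\<bar>))"
    using a by (intro integrable_const_bound[of _ 1]) auto
  have "expectation (\<lambda>\<omega>. min 1 (a * \<bar>s t \<omega>\<bar>)) = expectation (\<lambda>\<omega>. z t \<omega> * min 1 (a * \<bar>xi t \<omega>\<bar>))"
    by (intro Bochner_Integration.integral_cong refl eq)
  then show "expectation (\<lambda>\<omega>. min 1 (a * \<bar>s t \<omega>\<bar>)) = g * \<kappa> a"
    using *(2) by (simp add: \<kappa>_def)
qed

lemma z_times_v: 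
  "integrable M (\<lambda>\<omega>. z t \<omega> * \<bar>v r \<omega>\<bar>)" "expectation (\<lambda>\<omega>. z t \<omega> * \<bar>v r \<omega>\<bar>) \<le> g * (1 + K)"
proof -
  have [measurable]: "v r \<in> borel_measurable (\<F> (Inl ` {..r}))"
    using v by (simp add: causal_version_def)
  have d: "{Inr (Inl t)} \<inter> Inl ` {..r} = {}" by auto
  have z: "z t \<in> borel_measurable (\<F> {Inr (Inl t)})" by (rule \<F>_z) simp
  have av: "(\<lambda>\<omega>. \<bar>v r \<omega>\<bar>) \<in> borel_measurable (\<F> (Inl ` {..r}))" by measurable
  note * = indep_expectation_mult[OF d z av z_integrable v_abs(1)]
  show "integrable M (\<lambda>\<omega>. z t \<omega> * \<bar>v r \<omega>\<bar>)"
    by (rule *(2))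
  have "expectation (\<lambda>\<omega>. z t \<omega> * \<bar>v r \<omega>\<bar>) = g * expectation (\<lambda>\<omega>. \<bar>v r \<omega>\<bar>)"
    unfolding *(1) z_expectation ..
  also have "\<dots> \<le> g * (1 + K)"
    using v_abs(2) g_01 by (intro mult_left_mono) auto
  finally show "expectation (\<lambda>\<omega>. z t \<omega> * \<bar>v r \<omega>\<bar>) \<le> g * (1 + K)" .
qed

lemma z_times_z:
  assumes "r \<noteq> t"
  shows "integrable M (\<lambda>\<omega>. z r \<omega> * z t \<omega>)" "expectation (\<lambda>\<omega>. z r \<omega> * z t \<omega>) = g\<^sup>2"
proof -
  have d: "{Inr (Inl r)} \<inter> {Inr (Inl t)} = {}" using assms by auto
  have z: "z q \<in> borel_measurable (\<F> {Inr (Inl q)})" for q by (rule \<F>_z) simp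
  note * = indep_expectation_mult[OF d z z z_integrable z_integrable]
  show "integrable M (\<lambda>\<omega>. z r \<omega> * z t \<omega>)"
    by (rule *(2))
  show "expectation (\<lambda>\<omega>. z r \<omega> * z t \<omega>) = g\<^sup>2"
    unfolding *(1) z_expectation by (rule power2_eq_square[symmetric])
qed

lemma bounded_integrable:
  fixes h :: "'a \<Rightarrow> real"
  assumes "h \<in> borel_measurable M" "\<And>\<omega>. \<omega> \<in> space M \<Longrightarrow> \<bar>h \<omega>\<bar> \<le> C"
  shows "integrable M h"
  using assms by (intro integrable_const_bound[of _ C]) (auto intro!: AE_I2)

lemma sqrt_n: "sqrt (real n) > 0" "sqrt (real n) * sqrt (real n) = real n"
  using n by auto

lemma z_sum_integrable: "integrable M (\<lambda>\<omega>. \<Sum>j=0..p. z (t - int j) \<omega>)"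
  using z_integrable by auto

lemma z_sum_expectation: "expectation (\<lambda>\<omega>. \<Sum>j=0..p. z (t - int j) \<omega>) = (real p + 1) * g"
  using z_integrable by (simp add: z_expectation)

text \<open>In a clean window the thresholds reduce to uncontaminated ones. For a dirty window the
  sum of the \<open>z\<close> dominates the indicator of that event, and its expectation is (p + 1)
  g, which is of order 1 / sqrt n in the application.\<close>

lemma z_sum_cases:
  assumes "\<omega> \<in> space M"
  obtains (clean) "\<And>j. j \<in> {0..p} \<Longrightarrow> s (t - int j) \<omega> = 0" "\<And>j. j \<in> {0..p} \<Longrightarrow> z (t - int j) \<omega> = 0"
  | (dirty) "(\<Sum>j=0..p. z (t - int j) \<omega>) \<ge> 1"
proof (cases "\<forall>j\<in>{0..p}. z (t - int j) \<omega> = 0")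
  case True
  then show ?thesis by (intro clean) (auto simp: s_def)
next
  case False
  then obtain j where j: "j \<in> {0..p}" "z (t - int j) \<omega> \<noteq> 0" by auto
  have nn: "z r \<omega> \<ge> 0" for r using z01[OF assms, of r] by auto
  have "z (t - int j) \<omega> = 1" using j(2) z01[OF assms, of "t - int j"] by auto
  then have "1 \<le> (\<Sum>j\<in>{j}. z (t - int j) \<omega>)" by simp
  also have "\<dots> \<le> (\<Sum>j=0..p. z (t - int j) \<omega>)"
    using j(1) nn by (intro sum_mono2) auto
  finally show ?thesis by (rule dirty)
qed

lemma z_sum_nonneg: "\<omega> \<in> space M \<Longrightarrow> (\<Sum>j=0..p. z (t - int j) \<omega>) \<ge> 0"
proof (rule sum_nonneg)
  fix j assume "\<omega> \<in> space M"
  then show "0 \<le> z (t - int j) \<omega>" using z01[of \<omega> "t - int j"] by auto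
qed

section \<open>Martingale differences for nonanticipating thresholds\<close>

context
  fixes x :: real and a :: "int \<Rightarrow> 'a \<Rightarrow> real"
  assumes a: "\<And>t. a t \<in> borel_measurable (\<F> (nonanticip t))"
begin

definition gdrift :: "int \<Rightarrow> 'a \<Rightarrow> real" where "gdrift t \<omega> = cdf G (a t \<omega>) - cdf G x"

definition gmdiff :: "int \<Rightarrow> 'a \<Rightarrow> real" where
  "gmdiff t \<omega> = below (eps t \<omega>) (a t \<omega>) - below (eps t \<omega>) x - gdrift t \<omega>"

lemma a_nonanticip: "r \<le> t \<Longrightarrow> a r \<in> borel_measurable (\<F> (nonanticip t))"
  by (rule \<F>_mono[OF a]) (auto simp: nonanticip_def)

lemma gdrift_nonanticip: "r \<le> t \<Longrightarrow> gdrift r \<in> borel_measurable (\<F> (nonanticip t))"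
proof -
  assume r: "r \<le> t"
  note [measurable] = a_nonanticip[OF r]
  show ?thesis unfolding gdrift_def[abs_def] by measurable
qed

lemma gmdiff_nonanticip: "r < t \<Longrightarrow> gmdiff r \<in> borel_measurable (\<F> (nonanticip t))"
proof -
  assume r: "r < t"
  then have r': "r \<le> t" by simp
  have [measurable]: "eps r \<in> borel_measurable (\<F> (nonanticip t))"
    using r by (intro \<F>_eps) simp
  note [measurable] = a_nonanticip[OF r'] gdrift_nonanticip[OF r']
  show ?thesis unfolding gmdiff_def[abs_def] by measurable
qed

lemma a_measurable[measurable]: "a t \<in> borel_measurable M"
  by (rule \<F>_measurable[OF a])

lemma gdrift_measurable[measurable]: "gdrift t \<in> borel_measurable M"
  unfolding gdrift_def[abs_def] by measurable

lemma gmdiff_measurable[measurable]: "gmdiff t \<in> borel_measurable M"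
  unfolding gmdiff_def[abs_def] by measurable

lemma gdrift_le_1: "\<bar>gdrift t \<omega>\<bar> \<le> 1"
  unfolding gdrift_def by (rule cdf_G_diff_le_1)

lemma gmdiff_le_2: "\<bar>gmdiff t \<omega>\<bar> \<le> 2"
proof -
  have "\<bar>below (eps t \<omega>) (a t \<omega>) - below (eps t \<omega>) x\<bar> \<le> 1" by (auto simp: below_def)
  then show ?thesis using gdrift_le_1[of t \<omega>] unfolding gmdiff_def by linarith
qed

lemma expectation_below_diff:
  assumes \<phi>: "\<phi> \<in> borel_measurable (\<F> (nonanticip t))" and bd: "\<And>\<omega>. \<omega> \<in> space M \<Longrightarrow> \<bar>\<phi> \<omega>\<bar> \<le> D"
  shows "expectation (\<lambda>\<omega>. \<phi> \<omega> * (below (eps t \<omega>) (a t \<omega>) - below (eps t \<omega>) x))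
    = expectation (\<lambda>\<omega>. \<phi> \<omega> * gdrift t \<omega>)"
proof -
  have [measurable]: "\<phi> \<in> borel_measurable M" using \<phi> by (rule \<F>_measurable)
  have bb: "\<bar>\<phi> \<omega> * below e y\<bar> \<le> D" if "\<omega> \<in> space M" for \<omega> e y
    using bd[OF that] by (auto simp: below_def)
  have bc: "\<bar>\<phi> \<omega> * cdf G y\<bar> \<le> D" if "\<omega> \<in> space M" for \<omega> y
  proof -
    have "\<bar>\<phi> \<omega>\<bar> * \<bar>cdf G y\<bar> \<le> \<bar>\<phi> \<omega>\<bar> * 1" using cdf_G_01[of y] by (intro mult_left_mono) auto
    then show ?thesis using bd[OF that] by (simp add: abs_mult)
  qed
  have i: "integrable M (\<lambda>\<omega>. \<phi> \<omega> * below (eps t \<omega>) (h \<omega>))" "integrable M (\<lambda>\<omega>. \<phi> \<omega> * cdf G (h \<omega>))"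
    if [measurable]: "h \<in> borel_measurable M" for h
    by (rule bounded_integrable[of _ D], measurable, erule bb)
       (rule bounded_integrable[of _ D], measurable, erule bc)
  have c: "(\<lambda>_. x) \<in> borel_measurable (\<F> (nonanticip t))" by simp
  have "expectation (\<lambda>\<omega>. \<phi> \<omega> * (below (eps t \<omega>) (a t \<omega>) - below (eps t \<omega>) x))
    = expectation (\<lambda>\<omega>. \<phi> \<omega> * below (eps t \<omega>) (a t \<omega>)) - expectation (\<lambda>\<omega>. \<phi> \<omega> * below (eps t \<omega>) x)"
    unfolding right_diff_distrib by (rule Bochner_Integration.integral_diff; rule i; measurable)
  also have "\<dots> = expectation (\<lambda>\<omega>. \<phi> \<omega> * cdf G (a t \<omega>)) - expectation (\<lambda>\<omega>. \<phi> \<omega> * cdf G x)"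
    using expectation_below_eps[OF _ \<phi> a_nonanticip[OF order_refl] bd, of t]
      expectation_below_eps[OF _ \<phi> c bd, of t] by simp
  also have "\<dots> = expectation (\<lambda>\<omega>. \<phi> \<omega> * gdrift t \<omega>)"
    unfolding gdrift_def right_diff_distrib by (rule Bochner_Integration.integral_diff[symmetric]; rule i; measurable)
  finally show ?thesis .
qed

text \<open>The earlier factor is bounded and determined before the later innovation, and the
  compensator \<open>gdrift\<close> is exactly what gives the later factor conditional mean
  zero.\<close>

lemma gmdiff_orthogonal:
  assumes "r \<noteq> t"
  shows "expectation (\<lambda>\<omega>. gmdiff r \<omega> * gmdiff t \<omega>) = 0"
proof -
  have *: "expectation (\<lambda>\<omega>. gmdiff r \<omega> * gmdiff t \<omega>) = 0" if "r < t" for r t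
  proof -
    have i: "integrable M (\<lambda>\<omega>. gmdiff r \<omega> * (below (eps t \<omega>) (a t \<omega>) - below (eps t \<omega>) x))"
    proof (rule bounded_integrable[of _ "2 * 1"])
      fix \<omega>
      have "\<bar>below (eps t \<omega>) (a t \<omega>) - below (eps t \<omega>) x\<bar> \<le> 1" by (auto simp: below_def)
      then show "\<bar>gmdiff r \<omega> * (below (eps t \<omega>) (a t \<omega>) - below (eps t \<omega>) x)\<bar> \<le> 2 * 1"
        unfolding abs_mult using gmdiff_le_2[of r \<omega>] by (intro mult_mono) auto
    qed measurable
    have j: "integrable M (\<lambda>\<omega>. gmdiff r \<omega> * gdrift t \<omega>)"
    proof (rule bounded_integrable[of _ "2 * 1"])
      fix \<omega>
      show "\<bar>gmdiff r \<omega> * gdrift t \<omega>\<bar> \<le> 2 * 1"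
        unfolding abs_mult using gmdiff_le_2[of r \<omega>] gdrift_le_1[of t \<omega>] by (intro mult_mono) auto
    qed measurable
    have "expectation (\<lambda>\<omega>. gmdiff r \<omega> * gmdiff t \<omega>)
      = expectation (\<lambda>\<omega>. gmdiff r \<omega> * (below (eps t \<omega>) (a t \<omega>) - below (eps t \<omega>) x)) - expectation (\<lambda>\<omega>. gmdiff r \<omega> * gdrift t \<omega>)"
      unfolding gmdiff_def[of t] right_diff_distrib[of _ _ "gdrift t _"]
      by (rule Bochner_Integration.integral_diff[OF i j])
    then show ?thesis
      using expectation_below_diff[OF gmdiff_nonanticip[OF that] gmdiff_le_2] by simp
  qed
  show ?thesis
  proof (cases "r < t")
    case False
    then have "t < r" using assms by simp
    from *[OF this] show ?thesis by (simp add: mult.commute)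
  qed (rule *)
qed

text \<open>A difference of two indicators has the sign of a - x, so its square is that sign times
  itself, with expectation at most that of |gdrift|; subtracting the compensator only lowers the
  second moment. Thresholds close to \<open>x\<close> thus give small variances.\<close>

lemma gmdiff_second_moment: "expectation (\<lambda>\<omega>. (gmdiff t \<omega>)\<^sup>2) \<le> expectation (\<lambda>\<omega>. \<bar>gdrift t \<omega>\<bar>)"
proof -
  let ?I = "\<lambda>\<omega>. below (eps t \<omega>) (a t \<omega>) - below (eps t \<omega>) x"
  let ?\<sigma> = "\<lambda>\<omega>. sgn (a t \<omega> - x)"
  have I1: "\<bar>?I \<omega>\<bar> \<le> 1" for \<omega> by (auto simp: below_def)
  have s1: "\<bar>?\<sigma> \<omega>\<bar> \<le> 1" for \<omega> by (auto simp: sgn_if)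
  have \<sigma>m: "?\<sigma> \<in> borel_measurable (\<F> (nonanticip t))"
  proof -
    note [measurable] = a_nonanticip[OF order_refl, of t]
    show ?thesis by measurable
  qed
  have [measurable]: "?\<sigma> \<in> borel_measurable M" by measurable
  have prod_int: "integrable M (\<lambda>\<omega>. h \<omega> * k \<omega>)"
    if [measurable]: "h \<in> borel_measurable M" "k \<in> borel_measurable M"
      and "\<And>\<omega>. \<bar>h \<omega>\<bar> \<le> 1" "\<And>\<omega>. \<bar>k \<omega>\<bar> \<le> 1" for h k :: "'a \<Rightarrow> real"
  proof (rule bounded_integrable[of _ "1 * 1"])
    fix \<omega> show "\<bar>h \<omega> * k \<omega>\<bar> \<le> 1 * 1"
      unfolding abs_mult using that(3,4)[of \<omega>] by (intro mult_mono) auto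
  qed measurable
  have pw: "(gmdiff t \<omega>)\<^sup>2 = ?\<sigma> \<omega> * ?I \<omega> - 2 * (gdrift t \<omega> * ?I \<omega>) + gdrift t \<omega> * gdrift t \<omega>" for \<omega>
  proof -
    have "?\<sigma> \<omega> * ?I \<omega> = (?I \<omega>)\<^sup>2" by (auto simp: below_def sgn_if)
    then show ?thesis unfolding gmdiff_def by (simp add: power2_eq_square algebra_simps)
  qed
  have i1: "integrable M (\<lambda>\<omega>. ?\<sigma> \<omega> * ?I \<omega>)" by (rule prod_int) (use s1 I1 in auto)
  have i2: "integrable M (\<lambda>\<omega>. gdrift t \<omega> * ?I \<omega>)" by (rule prod_int) (use gdrift_le_1 I1 in auto)
  have i3: "integrable M (\<lambda>\<omega>. gdrift t \<omega> * gdrift t \<omega>)" by (rule prod_int) (use gdrift_le_1 in auto)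
  have i4: "integrable M (\<lambda>\<omega>. ?\<sigma> \<omega> * gdrift t \<omega>)" by (rule prod_int) (use gdrift_le_1 s1 in auto)
  have i5: "integrable M (\<lambda>\<omega>. \<bar>gdrift t \<omega>\<bar>)" by (rule bounded_integrable[of _ 1]) (use gdrift_le_1 in auto)
  have "expectation (\<lambda>\<omega>. (gmdiff t \<omega>)\<^sup>2) = expectation (\<lambda>\<omega>. ?\<sigma> \<omega> * ?I \<omega>) - 2 * expectation (\<lambda>\<omega>. gdrift t \<omega> * ?I \<omega>)
      + expectation (\<lambda>\<omega>. gdrift t \<omega> * gdrift t \<omega>)"
    unfolding pw using i1 i2 i3 by (simp only: Bochner_Integration.integral_add Bochner_Integration.integral_diff
      Bochner_Integration.integrable_diff integrable_mult_right integral_mult_right_zero)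
  also have "\<dots> = expectation (\<lambda>\<omega>. ?\<sigma> \<omega> * gdrift t \<omega>) - expectation (\<lambda>\<omega>. gdrift t \<omega> * gdrift t \<omega>)"
    using expectation_below_diff[OF \<sigma>m s1] expectation_below_diff[OF gdrift_nonanticip[OF order_refl] gdrift_le_1] by simp
  also have "\<dots> \<le> expectation (\<lambda>\<omega>. ?\<sigma> \<omega> * gdrift t \<omega>)"
    by (simp add: integral_nonneg)
  also have "\<dots> \<le> expectation (\<lambda>\<omega>. \<bar>gdrift t \<omega>\<bar>)"
    by (intro integral_mono i4 i5) (auto simp: sgn_if)
  finally show ?thesis .
qed

lemma gmdiff_sum_abs:
  assumes q: "\<And>t. expectation (\<lambda>\<omega>. \<bar>gdrift t \<omega>\<bar>) \<le> q"
  shows "integrable M (\<lambda>\<omega>. \<bar>\<Sum>t=1..int n. gmdiff t \<omega>\<bar>)"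
    and "expectation (\<lambda>\<omega>. \<bar>\<Sum>t=1..int n. gmdiff t \<omega>\<bar>) \<le> sqrt (real n) * sqrt q"
proof -
  have sq: "integrable M (\<lambda>\<omega>. (gmdiff t \<omega>)\<^sup>2)" for t
  proof (rule bounded_integrable[of _ "2\<^sup>2"])
    fix \<omega> show "\<bar>(gmdiff t \<omega>)\<^sup>2\<bar> \<le> 2\<^sup>2"
      using power_mono[OF gmdiff_le_2[of t \<omega>], of 2] by simp
  qed measurable
  note * = second_moment_orthogonal_sum[of "{1..int n}" gmdiff, OF _ gmdiff_measurable sq gmdiff_orthogonal, simplified]
  have "expectation (\<lambda>\<omega>. \<bar>\<Sum>t=1..int n. gmdiff t \<omega>\<bar>) \<le> sqrt (expectation (\<lambda>\<omega>. (\<Sum>t=1..int n. gmdiff t \<omega>)\<^sup>2))"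
    by (rule expectation_abs_le_sqrt) (auto intro: *)
  also have "\<dots> \<le> sqrt (\<Sum>t=1..int n. q)"
    unfolding *(1) by (intro real_sqrt_le_mono sum_mono order_trans[OF gmdiff_second_moment q])
  also have "\<dots> = sqrt (real n) * sqrt q"
    by (simp add: real_sqrt_mult[symmetric])
  finally show "expectation (\<lambda>\<omega>. \<bar>\<Sum>t=1..int n. gmdiff t \<omega>\<bar>) \<le> sqrt (real n) * sqrt q" .
  show "integrable M (\<lambda>\<omega>. \<bar>\<Sum>t=1..int n. gmdiff t \<omega>\<bar>)"
    by (intro integrable_abs Bochner_Integration.integrable_sum bounded_integrable[of _ 2] gmdiff_le_2) measurable
qed

declare a_measurable[measurable del]

end

section \<open>The shifted empirical process at a fixed estimation error\<close>

context
  fixes x C :: real and \<tau> :: "nat \<Rightarrow> real"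
  assumes C: "C \<ge> 0" and \<tau>: "\<And>i. i \<in> {1..p} \<Longrightarrow> \<bar>\<tau> i\<bar> \<le> C"
begin

definition thr :: "int \<Rightarrow> 'a \<Rightarrow> real" where "thr t \<omega> = x + contam t \<omega> + lin \<tau> t \<omega>"

abbreviation "drift \<equiv> gdrift x thr"

abbreviation "mdiff \<equiv> gmdiff x thr"

definition vlin :: "int \<Rightarrow> 'a \<Rightarrow> real" where
  "vlin t \<omega> = (\<Sum>i=1..p. \<tau> i * v (t - int i) \<omega>)"

lemma thr_nonanticip: "r \<le> t \<Longrightarrow> thr r \<in> borel_measurable (\<F> (nonanticip t))"
proof -
  assume r: "r \<le> t"
  note [measurable] = contam_nonanticip lin_nonanticip[OF r]
  show ?thesis unfolding thr_def[abs_def] by measurable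
qed

lemmas drift_def = gdrift_def[OF thr_nonanticip[OF order_refl]]

lemmas mdiff_def = gmdiff_def[OF thr_nonanticip[OF order_refl]]

lemma drift_le_1: "\<bar>drift t \<omega>\<bar> \<le> 1"
  by (rule gdrift_le_1[OF thr_nonanticip[OF order_refl]])

lemmas drift_measurable[measurable] = gdrift_measurable[OF thr_nonanticip[OF order_refl]]

lemmas mdiff_measurable[measurable] = gmdiff_measurable[OF thr_nonanticip[OF order_refl]]

lemma thr_measurable[measurable]: "thr t \<in> borel_measurable M"
  unfolding thr_def[abs_def] by measurable

lemma vlin_measurable[measurable]: "vlin t \<in> borel_measurable M"
  unfolding vlin_def[abs_def] by measurable

text \<open>The part with \<open>s\<close> is capped at 1 before any expectation is taken, as a
  distribution function changes by at most 1 and \<open>s\<close> may lack moments; the part with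
  \<open>v\<close> stays linear.\<close>

lemma lipschitz_sum_le:
  assumes "\<bar>a - a'\<bar> \<le> (\<bar>vlin t \<omega>\<bar> + C * (\<Sum>i=1..p. \<bar>s (t - int i) \<omega>\<bar>)) / sqrt (real n)"
  shows "\<bar>cdf G a - cdf G a'\<bar> \<le> L / sqrt (real n) * \<bar>vlin t \<omega>\<bar> + (\<Sum>i=1..p. min 1 (L * C / sqrt (real n) * \<bar>s (t - int i) \<omega>\<bar>))"
proof -
  let ?S = "(\<Sum>i=1..p. L * C / sqrt (real n) * \<bar>s (t - int i) \<omega>\<bar>)"
  have S0: "?S \<ge> 0" using L C by (intro sum_nonneg) auto
  have "\<bar>cdf G a - cdf G a'\<bar> \<le> L * \<bar>a - a'\<bar>" by (rule G_lipschitz)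
  also have "\<dots> \<le> L * ((\<bar>vlin t \<omega>\<bar> + C * (\<Sum>i=1..p. \<bar>s (t - int i) \<omega>\<bar>)) / sqrt (real n))"
    using assms L by (rule mult_left_mono)
  also have "\<dots> = L / sqrt (real n) * \<bar>vlin t \<omega>\<bar> + ?S"
    by (simp add: sum_distrib_left field_simps add_divide_distrib sum_divide_distrib)
  finally have "\<bar>cdf G a - cdf G a'\<bar> \<le> L / sqrt (real n) * \<bar>vlin t \<omega>\<bar> + ?S" .
  moreover have "L / sqrt (real n) * \<bar>vlin t \<omega>\<bar> \<ge> 0" using L by simp
  ultimately have "\<bar>cdf G a - cdf G a'\<bar> \<le> L / sqrt (real n) * \<bar>vlin t \<omega>\<bar> + min 1 ?S"
    using cdf_G_diff_le_1[of a a'] by (simp add: min_def)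
  also have "min 1 ?S = min 1 \<bar>?S\<bar>" using S0 by simp
  also have "\<dots> \<le> (\<Sum>i=1..p. min 1 \<bar>L * C / sqrt (real n) * \<bar>s (t - int i) \<omega>\<bar>\<bar>)"
    by (rule min_one_abs_sum_le) simp
  also have "\<dots> = (\<Sum>i=1..p. min 1 (L * C / sqrt (real n) * \<bar>s (t - int i) \<omega>\<bar>))"
    using L C by simp
  finally show ?thesis by simp
qed

lemma vlin_abs_le: "\<bar>vlin t \<omega>\<bar> \<le> C * (\<Sum>i=1..p. \<bar>v (t - int i) \<omega>\<bar>)"
  unfolding vlin_def sum_distrib_left
  by (rule order_trans[OF sum_abs]) (auto simp: abs_mult intro!: sum_mono mult_right_mono \<tau>)

lemma lin_abs_le: "\<bar>lin \<tau> t \<omega>\<bar> \<le> (\<bar>vlin t \<omega>\<bar> + C * (\<Sum>i=1..p. \<bar>s (t - int i) \<omega>\<bar>)) / sqrt (real n)"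
proof -
  have "\<bar>\<Sum>i=1..p. \<tau> i * s (t - int i) \<omega>\<bar> \<le> C * (\<Sum>i=1..p. \<bar>s (t - int i) \<omega>\<bar>)"
    unfolding sum_distrib_left
    by (rule order_trans[OF sum_abs]) (auto simp: abs_mult intro!: sum_mono mult_right_mono \<tau>)
  moreover have "lin \<tau> t \<omega> = (vlin t \<omega> + (\<Sum>i=1..p. \<tau> i * s (t - int i) \<omega>)) / sqrt (real n)"
    unfolding lin_def vlin_def by (simp add: distrib_left sum.distrib)
  ultimately show ?thesis
    by (auto intro!: divide_right_mono order_trans[OF abs_triangle_ineq])
qed

lemma clean_lin: "(\<And>j. j \<in> {0..p} \<Longrightarrow> s (t - int j) \<omega> = 0) \<Longrightarrow> lin \<tau> t \<omega> = vlin t \<omega> / sqrt (real n)"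
  unfolding lin_def vlin_def by (intro arg_cong2[where f="(/)"] sum.cong) auto

lemma clean_contam: "(\<And>j. j \<in> {0..p} \<Longrightarrow> s (t - int j) \<omega> = 0) \<Longrightarrow> contam t \<omega> = 0"
  unfolding contam_def by (intro sum.neutral) auto

lemma drift_abs_le:
  assumes \<omega>: "\<omega> \<in> space M"
  shows "\<bar>drift t \<omega>\<bar> \<le> (\<Sum>j=0..p. z (t - int j) \<omega>) + L * C / sqrt (real n) * (\<Sum>i=1..p. \<bar>v (t - int i) \<omega>\<bar>)"
  using \<omega>
proof (cases rule: z_sum_cases[of \<omega> t])
  case clean
  have eqs: "lin \<tau> t \<omega> = vlin t \<omega> / sqrt (real n)" "contam t \<omega> = 0"
    by (rule clean_lin, erule clean(1)) (rule clean_contam, erule clean(1))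
  have "\<bar>drift t \<omega>\<bar> \<le> L * \<bar>vlin t \<omega> / sqrt (real n)\<bar>"
    unfolding drift_def thr_def eqs
    using G_lipschitz[of "x + 0 + vlin t \<omega> / sqrt (real n)" x] by simp
  also have "\<dots> \<le> L * (C * (\<Sum>i=1..p. \<bar>v (t - int i) \<omega>\<bar>) / sqrt (real n))"
    using L vlin_abs_le[of t \<omega>] by (intro mult_left_mono) (auto simp: abs_divide intro!: divide_right_mono)
  finally show ?thesis using z_sum_nonneg[OF \<omega>, of t] by (simp add: field_simps)
next
  case dirty
  have "0 \<le> L * C / sqrt (real n) * (\<Sum>i=1..p. \<bar>v (t - int i) \<omega>\<bar>)"
    using L C by (intro mult_nonneg_nonneg sum_nonneg) auto
  with dirty drift_le_1[of t \<omega>] show ?thesis by linarith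
qed

text \<open>This is the variance bound for one martingale step. It tends to 0 together with
  \<open>g\<close> and 1 / sqrt n, so the martingale is of smaller order than sqrt n.\<close>

lemma drift_abs_expectation:
  "expectation (\<lambda>\<omega>. \<bar>drift t \<omega>\<bar>) \<le> (real p + 1) * g + L * C * real p * (1 + K) / sqrt (real n)"
proof -
  have "expectation (\<lambda>\<omega>. \<bar>drift t \<omega>\<bar>) \<le> expectation (\<lambda>\<omega>. (\<Sum>j=0..p. z (t - int j) \<omega>) + L * C / sqrt (real n) * (\<Sum>i=1..p. \<bar>v (t - int i) \<omega>\<bar>))"
  proof (rule integral_mono)
    show "integrable M (\<lambda>\<omega>. \<bar>drift t \<omega>\<bar>)" by (rule bounded_integrable[of _ 1]) (use drift_le_1 in auto)
    show "integrable M (\<lambda>\<omega>. (\<Sum>j=0..p. z (t - int j) \<omega>) + L * C / sqrt (real n) * (\<Sum>i=1..p. \<bar>v (t - int i) \<omega>\<bar>))"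
      by (intro Bochner_Integration.integrable_add z_sum_integrable integrable_mult_right
          Bochner_Integration.integrable_sum v_abs(1))
  qed (rule drift_abs_le)
  also have "\<dots> = (real p + 1) * g + L * C / sqrt (real n) * (\<Sum>i=1..p. expectation (\<lambda>\<omega>. \<bar>v (t - int i) \<omega>\<bar>))"
    using v_abs(1) z_sum_integrable z_sum_expectation by simp
  also have "\<dots> \<le> (real p + 1) * g + L * C / sqrt (real n) * (\<Sum>i=1..p. 1 + K)"
    using L C v_abs(2) by (intro add_left_mono mult_left_mono sum_mono) auto
  finally show ?thesis by (simp add: field_simps)
qed

lemmas mdiff_sum_abs = gmdiff_sum_abs[OF thr_nonanticip[OF order_refl] drift_abs_expectation]

text \<open>The effect of a single gross error \<open>y\<close> at lag \<open>j\<close> on the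
  probability of falling below the threshold. The means over the gross error law, summed over
  \<open>j\<close>, form \<open>Delta\<close> with \<open>G\<close> in place of
  \<open>P\<close>.\<close>

definition hit :: "nat \<Rightarrow> real \<Rightarrow> real" where "hit j y = cdf G (x + b j * y) - cdf G x"

definition hit_mean :: "nat \<Rightarrow> real" where "hit_mean j = (\<integral>y. hit j y \<partial>GE)"

lemma hit_measurable[measurable]: "hit j \<in> borel_measurable borel"
  unfolding hit_def[abs_def] by measurable

lemma hit_le_1: "\<bar>hit j y\<bar> \<le> 1"
  unfolding hit_def by (rule cdf_G_diff_le_1)

lemma hit_mean_le_1: "\<bar>hit_mean j\<bar> \<le> 1"
proof -
  have i: "integrable GE (hit j)"
    by (rule GE.integrable_const_bound[of _ 1]) (auto simp: hit_le_1)
  have "\<bar>hit_mean j\<bar> \<le> (\<integral>y. \<bar>hit j y\<bar> \<partial>GE)"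
    unfolding hit_mean_def by (rule integral_abs_bound)
  also have "\<dots> \<le> (\<integral>y. 1 \<partial>GE)"
    by (rule integral_mono) (use i hit_le_1 in auto)
  finally show ?thesis using GE.prob_space by simp
qed

text \<open>\<open>err1\<close> is the cost of separating the contamination from the estimation error in the drift, \<open>err2\<close> that of
  treating the contaminated positions one at a time; both need two rare events to coincide.\<close>

definition err1 :: "int \<Rightarrow> 'a \<Rightarrow> real" where
  "err1 t \<omega> = drift t \<omega> - (cdf G (x + contam t \<omega>) - cdf G x) - (cdf G (x + vlin t \<omega> / sqrt (real n)) - cdf G x)"

definition err2 :: "int \<Rightarrow> 'a \<Rightarrow> real" where
  "err2 t \<omega> = (cdf G (x + contam t \<omega>) - cdf G x) - (\<Sum>j=0..p. z (t - int j) \<omega> * hit j (xi (t - int j) \<omega>))"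

text \<open>On a clean window the error is exactly 0. On a dirty one the shift by
  \<open>vlin\<close> occurs twice, inside the full threshold and in the subtracted term, hence the
  factor 2; the sum of the \<open>z\<close>, at least 1 there, confines the bound to such
  windows.\<close>

lemma err1_le:
  assumes \<omega>: "\<omega> \<in> space M"
  shows "\<bar>err1 t \<omega>\<bar> \<le> 2 * L * C / sqrt (real n) * (\<Sum>j=0..p. \<Sum>i=1..p. z (t - int j) \<omega> * \<bar>v (t - int i) \<omega>\<bar>)
    + (\<Sum>i=1..p. min 1 (L * C / sqrt (real n) * \<bar>s (t - int i) \<omega>\<bar>))"
proof -
  let ?Z = "\<Sum>j=0..p. z (t - int j) \<omega>" and ?V = "\<Sum>i=1..p. \<bar>v (t - int i) \<omega>\<bar>"
  let ?m = "\<Sum>i=1..p. min 1 (L * C / sqrt (real n) * \<bar>s (t - int i) \<omega>\<bar>)"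
  have m0: "?m \<ge> 0" using L C by (intro sum_nonneg) auto
  have V0: "?V \<ge> 0" by (intro sum_nonneg) auto
  have eq: "(\<Sum>j=0..p. \<Sum>i=1..p. z (t - int j) \<omega> * \<bar>v (t - int i) \<omega>\<bar>) = ?Z * ?V"
    by (simp add: sum_product)
  have "\<bar>err1 t \<omega>\<bar> \<le> 2 * L * C / sqrt (real n) * (?Z * ?V) + ?m"
    using \<omega>
  proof (cases rule: z_sum_cases[of \<omega> t])
    case clean
    have eqs: "lin \<tau> t \<omega> = vlin t \<omega> / sqrt (real n)" "contam t \<omega> = 0"
      by (rule clean_lin, erule clean(1)) (rule clean_contam, erule clean(1))
    have "err1 t \<omega> = 0" unfolding err1_def drift_def thr_def eqs by simp
    moreover have "0 \<le> 2 * L * C / sqrt (real n) * (?Z * ?V)"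
      using L C V0 z_sum_nonneg[OF \<omega>, of t] by (intro mult_nonneg_nonneg) auto
    ultimately show ?thesis using m0 by simp
  next
    case dirty
    have lv: "L / sqrt (real n) * \<bar>vlin t \<omega>\<bar> \<le> L / sqrt (real n) * (C * ?V)"
      using L vlin_abs_le[of t \<omega>] by (intro mult_left_mono) auto
    have a: "\<bar>cdf G (thr t \<omega>) - cdf G (x + contam t \<omega>)\<bar> \<le> L / sqrt (real n) * \<bar>vlin t \<omega>\<bar> + ?m"
      by (rule lipschitz_sum_le) (simp add: thr_def lin_abs_le[simplified])
    have b: "\<bar>cdf G (x + vlin t \<omega> / sqrt (real n)) - cdf G x\<bar> \<le> L / sqrt (real n) * \<bar>vlin t \<omega>\<bar>"
      using G_lipschitz[of "x + vlin t \<omega> / sqrt (real n)" x] by simp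
    have "\<bar>err1 t \<omega>\<bar> \<le> 2 * (L / sqrt (real n) * (C * ?V)) + ?m"
      using a b lv unfolding err1_def drift_def by linarith
    also have "2 * (L / sqrt (real n) * (C * ?V)) = 2 * L * C / sqrt (real n) * (1 * ?V)"
      by simp
    also have "\<dots> \<le> 2 * L * C / sqrt (real n) * (?Z * ?V)"
      using L C dirty V0 by (intro mult_left_mono mult_right_mono) auto
    finally show ?thesis by simp
  qed
  then show ?thesis unfolding eq .
qed

lemma err1_measurable[measurable]: "err1 t \<in> borel_measurable M"
  unfolding err1_def[abs_def] by measurable

lemma err2_measurable[measurable]: "err2 t \<in> borel_measurable M"
  unfolding err2_def[abs_def] by measurable

lemma err1_expectation:
  "integrable M (\<lambda>\<omega>. \<bar>err1 t \<omega>\<bar>)"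
  "expectation (\<lambda>\<omega>. \<bar>err1 t \<omega>\<bar>) \<le> 2 * L * C * (real p + 1) * real p * (1 + K) * g / sqrt (real n)
     + real p * g * \<kappa> (L * C / sqrt (real n))"
proof -
  show i: "integrable M (\<lambda>\<omega>. \<bar>err1 t \<omega>\<bar>)"
  proof (rule bounded_integrable[of _ 3])
    fix \<omega> show "\<bar>\<bar>err1 t \<omega>\<bar>\<bar> \<le> 3"
      using drift_le_1[of t \<omega>] cdf_G_diff_le_1[of "x + contam t \<omega>" x] cdf_G_diff_le_1[of "x + vlin t \<omega> / sqrt (real n)" x]
      unfolding err1_def by linarith
  qed measurable
  have a0: "0 \<le> L * C / sqrt (real n)" using L C by simp
  note zv = z_times_v(1) and ms = min_s(1)[OF a0]
  have "expectation (\<lambda>\<omega>. \<bar>err1 t \<omega>\<bar>) \<le> expectation (\<lambda>\<omega>. 2 * L * C / sqrt (real n) * (\<Sum>j=0..p. \<Sum>i=1..p. z (t - int j) \<omega> * \<bar>v (t - int i) \<omega>\<bar>)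
    + (\<Sum>i=1..p. min 1 (L * C / sqrt (real n) * \<bar>s (t - int i) \<omega>\<bar>)))"
    by (rule integral_mono[OF i]) (intro Bochner_Integration.integrable_add integrable_mult_right
      Bochner_Integration.integrable_sum zv ms, erule err1_le)
  also have "\<dots> = 2 * L * C / sqrt (real n) * (\<Sum>j=0..p. \<Sum>i=1..p. expectation (\<lambda>\<omega>. z (t - int j) \<omega> * \<bar>v (t - int i) \<omega>\<bar>))
    + (\<Sum>i=1..p. expectation (\<lambda>\<omega>. min 1 (L * C / sqrt (real n) * \<bar>s (t - int i) \<omega>\<bar>)))"
    using zv ms by (simp only: Bochner_Integration.integral_add Bochner_Integration.integral_sum integral_mult_right_zero
       Bochner_Integration.integrable_sum integrable_mult_right)
  also have "\<dots> \<le> 2 * L * C / sqrt (real n) * (\<Sum>j=0..p. \<Sum>i=1..p. g * (1 + K)) + (\<Sum>i=1..p. g * \<kappa> (L * C / sqrt (real n)))"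
    using L C z_times_v(2) min_s(2)[OF a0] by (intro add_mono mult_left_mono sum_mono) auto
  also have "\<dots> = 2 * L * C * (real p + 1) * real p * (1 + K) * g / sqrt (real n) + real p * g * \<kappa> (L * C / sqrt (real n))"
    by (simp add: field_simps)
  finally show "expectation (\<lambda>\<omega>. \<bar>err1 t \<omega>\<bar>) \<le> 2 * L * C * (real p + 1) * real p * (1 + K) * g / sqrt (real n)
     + real p * g * \<kappa> (L * C / sqrt (real n))" .
qed

lemma vlin_square_expectation:
  "integrable M (\<lambda>\<omega>. (vlin t \<omega>)\<^sup>2)" "expectation (\<lambda>\<omega>. (vlin t \<omega>)\<^sup>2) \<le> C\<^sup>2 * (real p)\<^sup>2 * K"
proof -
  have pw: "(vlin t \<omega>)\<^sup>2 \<le> real p * C\<^sup>2 * (\<Sum>i=1..p. (v (t - int i) \<omega>)\<^sup>2)" for \<omega>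
  proof -
    have "(vlin t \<omega>)\<^sup>2 \<le> (\<Sum>i=1..p. (\<tau> i)\<^sup>2) * (\<Sum>i=1..p. (v (t - int i) \<omega>)\<^sup>2)"
      unfolding vlin_def by (rule Cauchy_Schwarz_ineq_sum)
    also have "\<dots> \<le> (\<Sum>i=1..p. C\<^sup>2) * (\<Sum>i=1..p. (v (t - int i) \<omega>)\<^sup>2)"
      using \<tau> C by (intro mult_right_mono sum_mono sum_nonneg) (auto simp: abs_le_square_iff[symmetric])
    finally show ?thesis by simp
  qed
  have i: "integrable M (\<lambda>\<omega>. real p * C\<^sup>2 * (\<Sum>i=1..p. (v (t - int i) \<omega>)\<^sup>2))"
    by (intro integrable_mult_right Bochner_Integration.integrable_sum v_sq)
  show i2: "integrable M (\<lambda>\<omega>. (vlin t \<omega>)\<^sup>2)"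
  proof (rule Bochner_Integration.integrable_bound[OF i])
    show "AE \<omega> in M. norm ((vlin t \<omega>)\<^sup>2) \<le> norm (real p * C\<^sup>2 * (\<Sum>i=1..p. (v (t - int i) \<omega>)\<^sup>2))"
    proof (intro AE_I2)
      fix \<omega> show "norm ((vlin t \<omega>)\<^sup>2) \<le> norm (real p * C\<^sup>2 * (\<Sum>i=1..p. (v (t - int i) \<omega>)\<^sup>2))"
        using pw[of \<omega>] zero_le_power2[of "vlin t \<omega>"] unfolding real_norm_def by linarith
    qed
  qed measurable
  have "expectation (\<lambda>\<omega>. (vlin t \<omega>)\<^sup>2) \<le> expectation (\<lambda>\<omega>. real p * C\<^sup>2 * (\<Sum>i=1..p. (v (t - int i) \<omega>)\<^sup>2))"
    by (rule integral_mono[OF i2 i pw])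
  also have "\<dots> = real p * C\<^sup>2 * (\<Sum>i=1..p. expectation (\<lambda>\<omega>. (v (t - int i) \<omega>)\<^sup>2))"
    using v_sq(1) by (simp only: integral_mult_right_zero Bochner_Integration.integral_sum)
  also have "\<dots> \<le> real p * C\<^sup>2 * (\<Sum>i=1..p. K)"
    using v_sq(2) by (intro mult_left_mono sum_mono) auto
  finally show "expectation (\<lambda>\<omega>. (vlin t \<omega>)\<^sup>2) \<le> C\<^sup>2 * (real p)\<^sup>2 * K"
    by (simp add: power2_eq_square mult_ac)
qed

text \<open>Expansion at the single point \<open>x\<close> turns the linear part into sums of
  \<open>v\<close>, of order sqrt n, divided by sqrt n; the quadratic part consists of n terms of
  order 1 / n. The total stays bounded and is negligible against sqrt n.\<close>

lemma taylor_sum_expectation: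
  "integrable M (\<lambda>\<omega>. \<bar>\<Sum>t=1..int n. cdf G (x + vlin t \<omega> / sqrt (real n)) - cdf G x\<bar>)"
  "expectation (\<lambda>\<omega>. \<bar>\<Sum>t=1..int n. cdf G (x + vlin t \<omega> / sqrt (real n)) - cdf G x\<bar>)
    \<le> L * real p * C * K + B * C\<^sup>2 * (real p)\<^sup>2 * K"
proof -
  let ?r = "sqrt (real n)"
  let ?T = "\<lambda>\<omega>. \<Sum>t=1..int n. cdf G (x + vlin t \<omega> / ?r) - cdf G x"
  let ?R = "\<lambda>\<omega>. L / ?r * (\<Sum>i=1..p. C * \<bar>\<Sum>t=1..int n. v (t - int i) \<omega>\<bar>) + B / real n * (\<Sum>t=1..int n. (vlin t \<omega>)\<^sup>2)"
  show i: "integrable M (\<lambda>\<omega>. \<bar>?T \<omega>\<bar>)"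
    by (intro integrable_abs Bochner_Integration.integrable_sum bounded_integrable[of _ 1] cdf_G_diff_le_1) measurable
  have pw: "\<bar>?T \<omega>\<bar> \<le> ?R \<omega>" for \<omega>
  proof -
    have "?T \<omega> = (\<Sum>t=1..int n. cdf G (x + vlin t \<omega> / ?r) - cdf G x - f x * (vlin t \<omega> / ?r)) + (\<Sum>t=1..int n. f x * (vlin t \<omega> / ?r))"
      by (simp add: sum_subtractf)
    moreover have "\<bar>\<Sum>t=1..int n. cdf G (x + vlin t \<omega> / ?r) - cdf G x - f x * (vlin t \<omega> / ?r)\<bar>
        \<le> (\<Sum>t=1..int n. B * (vlin t \<omega> / ?r)\<^sup>2)"
      by (rule order_trans[OF sum_abs]) (intro sum_mono G_taylor)
    moreover have "(\<Sum>t=1..int n. B * (vlin t \<omega> / ?r)\<^sup>2) = B / real n * (\<Sum>t=1..int n. (vlin t \<omega>)\<^sup>2)"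
      by (simp add: power_divide sum_distrib_left)
    moreover have "\<bar>\<Sum>t=1..int n. f x * (vlin t \<omega> / ?r)\<bar> \<le> L / ?r * (\<Sum>i=1..p. C * \<bar>\<Sum>t=1..int n. v (t - int i) \<omega>\<bar>)"
    proof -
      have "(\<Sum>t=1..int n. f x * (vlin t \<omega> / ?r)) = f x / ?r * (\<Sum>t=1..int n. vlin t \<omega>)"
        by (simp add: sum_distrib_left)
      also have "(\<Sum>t=1..int n. vlin t \<omega>) = (\<Sum>i=1..p. \<tau> i * (\<Sum>t=1..int n. v (t - int i) \<omega>))"
        unfolding vlin_def by (subst sum.swap) (simp add: sum_distrib_left)
      finally have "\<bar>\<Sum>t=1..int n. f x * (vlin t \<omega> / ?r)\<bar> = \<bar>f x\<bar> / ?r * \<bar>\<Sum>i=1..p. \<tau> i * (\<Sum>t=1..int n. v (t - int i) \<omega>)\<bar>"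
        by (simp add: abs_mult)
      also have "\<dots> \<le> L / ?r * (\<Sum>i=1..p. C * \<bar>\<Sum>t=1..int n. v (t - int i) \<omega>\<bar>)"
      proof (intro mult_mono divide_right_mono f_bound)
        show "\<bar>\<Sum>i=1..p. \<tau> i * (\<Sum>t=1..int n. v (t - int i) \<omega>)\<bar> \<le> (\<Sum>i=1..p. C * \<bar>\<Sum>t=1..int n. v (t - int i) \<omega>\<bar>)"
          by (rule order_trans[OF sum_abs]) (auto simp: abs_mult intro!: sum_mono mult_right_mono \<tau>)
      qed (use L in auto)
      finally show ?thesis .
    qed
    ultimately show ?thesis by linarith
  qed
  have vi: "integrable M (\<lambda>\<omega>. \<bar>\<Sum>t=1..int n. v (t - int i) \<omega>\<bar>)" for i
    by (intro integrable_abs Bochner_Integration.integrable_sum v_integrable)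
  have "expectation (\<lambda>\<omega>. \<bar>?T \<omega>\<bar>) \<le> expectation ?R"
    by (rule integral_mono[OF i _ pw]) (intro Bochner_Integration.integrable_add integrable_mult_right
      Bochner_Integration.integrable_sum vi vlin_square_expectation)
  also have "\<dots> = L / ?r * (\<Sum>i=1..p. C * expectation (\<lambda>\<omega>. \<bar>\<Sum>t=1..int n. v (t - int i) \<omega>\<bar>))
      + B / real n * (\<Sum>t=1..int n. expectation (\<lambda>\<omega>. (vlin t \<omega>)\<^sup>2))"
    using vi vlin_square_expectation(1)
    by (simp only: Bochner_Integration.integral_add Bochner_Integration.integral_sum integral_mult_right_zero
       Bochner_Integration.integrable_sum integrable_mult_right)
  also have "\<dots> \<le> L / ?r * (\<Sum>i=1..p. C * (K * ?r)) + B / real n * (\<Sum>t=1..int n. C\<^sup>2 * (real p)\<^sup>2 * K)"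
    using L B C v n vlin_square_expectation(2) unfolding causal_version_def
    by (intro add_mono mult_left_mono sum_mono) auto
  also have "\<dots> = L * real p * C * K + B * C\<^sup>2 * (real p)\<^sup>2 * K"
    using n by simp
  finally show "expectation (\<lambda>\<omega>. \<bar>?T \<omega>\<bar>) \<le> L * real p * C * K + B * C\<^sup>2 * (real p)\<^sup>2 * K" .
qed

text \<open>With at most one contaminated position in the window both expressions reduce to the same
  \<open>hit\<close>, or to 0. Otherwise the double sum is at least 1, and 1 + (p + 1) is a trivial
  bound for the error.\<close>

lemma err2_le:
  assumes \<omega>: "\<omega> \<in> space M"
  shows "\<bar>err2 t \<omega>\<bar> \<le> (real p + 2) * (\<Sum>j=0..p. \<Sum>k\<in>{0..p} - {j}. z (t - int j) \<omega> * z (t - int k) \<omega>)"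
proof -
  let ?P = "\<Sum>j=0..p. \<Sum>k\<in>{0..p} - {j}. z (t - int j) \<omega> * z (t - int k) \<omega>"
  have zz: "z r \<omega> = 0 \<or> z r \<omega> = 1" for r using z01[OF \<omega>, of r] by auto
  have nn: "0 \<le> z r \<omega> * z q \<omega>" for r q using zz[of r] zz[of q] by auto
  have P0: "?P \<ge> 0" by (intro sum_nonneg nn)
  show ?thesis
  proof (cases "\<exists>j\<in>{0..p}. \<exists>k\<in>{0..p} - {j}. z (t - int j) \<omega> = 1 \<and> z (t - int k) \<omega> = 1")
    case True
    then obtain j k where jk: "j \<in> {0..p}" "k \<in> {0..p} - {j}" "z (t - int j) \<omega> = 1" "z (t - int k) \<omega> = 1"
      by blast
    have "1 = (\<Sum>k\<in>{k}. z (t - int j) \<omega> * z (t - int k) \<omega>)" using jk by simp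
    also have "\<dots> \<le> (\<Sum>k\<in>{0..p} - {j}. z (t - int j) \<omega> * z (t - int k) \<omega>)"
      by (rule sum_mono2[OF _ _ nn]) (use jk in auto)
    also have "\<dots> = (\<Sum>j\<in>{j}. \<Sum>k\<in>{0..p} - {j}. z (t - int j) \<omega> * z (t - int k) \<omega>)" by simp
    also have "\<dots> \<le> ?P" using jk by (intro sum_mono2 sum_nonneg nn) auto
    finally have P1: "?P \<ge> 1" .
    have "\<bar>\<Sum>j=0..p. z (t - int j) \<omega> * hit j (xi (t - int j) \<omega>)\<bar> \<le> (\<Sum>j=0..p. 1)"
    proof (rule order_trans[OF sum_abs], rule sum_mono)
      fix j show "\<bar>z (t - int j) \<omega> * hit j (xi (t - int j) \<omega>)\<bar> \<le> 1"
        using zz[of "t - int j"] hit_le_1[of j "xi (t - int j) \<omega>"] by auto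
    qed
    then have "\<bar>err2 t \<omega>\<bar> \<le> real p + 2"
      using cdf_G_diff_le_1[of "x + contam t \<omega>" x] unfolding err2_def by simp
    also have "\<dots> = (real p + 2) * 1" by simp
    also have "\<dots> \<le> (real p + 2) * ?P" using P1 by (intro mult_left_mono) auto
    finally show ?thesis .
  next
    case False
    have "err2 t \<omega> = 0"
    proof (cases "\<forall>j\<in>{0..p}. z (t - int j) \<omega> = 0")
      case True
      then show ?thesis unfolding err2_def contam_def s_def by simp
    next
      case nz: False
      then obtain j where j: "j \<in> {0..p}" "z (t - int j) \<omega> = 1" using zz by blast
      have other: "z (t - int k) \<omega> = 0" if "k \<in> {0..p} - {j}" for k
        using False j that zz by blast
      have "contam t \<omega> = (\<Sum>j\<in>{j}. b j * s (t - int j) \<omega>)"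
        unfolding contam_def using j other by (intro sum.mono_neutral_right) (auto simp: s_def)
      moreover have "(\<Sum>j=0..p. z (t - int j) \<omega> * hit j (xi (t - int j) \<omega>)) = (\<Sum>j\<in>{j}. z (t - int j) \<omega> * hit j (xi (t - int j) \<omega>))"
        using j other by (intro sum.mono_neutral_right) auto
      ultimately show ?thesis unfolding err2_def using j by (simp add: s_def hit_def)
    qed
    then show ?thesis using P0 by simp
  qed
qed

lemma err2_expectation:
  "integrable M (\<lambda>\<omega>. \<bar>err2 t \<omega>\<bar>)"
  "expectation (\<lambda>\<omega>. \<bar>err2 t \<omega>\<bar>) \<le> (real p + 2) * (real p + 1) * real p * g\<^sup>2"
proof -
  let ?P = "\<lambda>\<omega>. (real p + 2) * (\<Sum>j=0..p. \<Sum>k\<in>{0..p} - {j}. z (t - int j) \<omega> * z (t - int k) \<omega>)"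
  have zi: "integrable M (\<lambda>\<omega>. z (t - int j) \<omega> * z (t - int k) \<omega>)" if "k \<in> {0..p} - {j}" for j k
    using that by (intro z_times_z) auto
  have Pi: "integrable M ?P"
    by (intro integrable_mult_right Bochner_Integration.integrable_sum zi)
  show i: "integrable M (\<lambda>\<omega>. \<bar>err2 t \<omega>\<bar>)"
  proof (rule Bochner_Integration.integrable_bound[OF Pi])
    show "AE \<omega> in M. norm \<bar>err2 t \<omega>\<bar> \<le> norm (?P \<omega>)"
    proof (intro AE_I2)
      fix \<omega> assume "\<omega> \<in> space M"
      from err2_le[OF this, of t] show "norm \<bar>err2 t \<omega>\<bar> \<le> norm (?P \<omega>)"
        unfolding real_norm_def by linarith
    qed
  qed measurable
  have "expectation (\<lambda>\<omega>. \<bar>err2 t \<omega>\<bar>) \<le> expectation ?P"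
    by (rule integral_mono[OF i Pi]) (erule err2_le)
  also have "\<dots> = (real p + 2) * (\<Sum>j=0..p. \<Sum>k\<in>{0..p} - {j}. expectation (\<lambda>\<omega>. z (t - int j) \<omega> * z (t - int k) \<omega>))"
    using zi by (simp only: integral_mult_right_zero Bochner_Integration.integral_sum Bochner_Integration.integrable_sum)
  also have "\<dots> = (real p + 2) * (\<Sum>j=0..p. \<Sum>k\<in>{0..p} - {j}. g\<^sup>2)"
    by (intro arg_cong2[where f="(*)"] refl sum.cong z_times_z) auto
  also have "\<dots> = (real p + 2) * (real p + 1) * real p * g\<^sup>2"
    by simp
  finally show "expectation (\<lambda>\<omega>. \<bar>err2 t \<omega>\<bar>) \<le> (real p + 2) * (real p + 1) * real p * g\<^sup>2" .
qed

text \<open>For a fixed lag the centred summands at different times use disjoint noise and are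
  uncorrelated; their variance is at most \<open>g\<close>, because \<open>hit\<close> is bounded by
  1 and \<open>z\<close> takes the values 0 and 1.\<close>

lemma hit_sum_abs:
  "integrable M (\<lambda>\<omega>. \<bar>\<Sum>t=1..int n. z (t - int j) \<omega> * hit j (xi (t - int j) \<omega>) - g * hit_mean j\<bar>)"
  "expectation (\<lambda>\<omega>. \<bar>\<Sum>t=1..int n. z (t - int j) \<omega> * hit j (xi (t - int j) \<omega>) - g * hit_mean j\<bar>)
    \<le> sqrt (real n) * sqrt g"
proof -
  define D where "D t \<omega> = z (t - int j) \<omega> * hit j (xi (t - int j) \<omega>) - g * hit_mean j" for t \<omega>
  have [measurable]: "D t \<in> borel_measurable M" for t unfolding D_def by measurable
  have D2: "\<bar>D t \<omega>\<bar> \<le> 2" if "\<omega> \<in> space M" for t \<omega>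
  proof -
    have "\<bar>z (t - int j) \<omega> * hit j (xi (t - int j) \<omega>)\<bar> \<le> 1"
      using z01[OF that, of "t - int j"] hit_le_1[of j "xi (t - int j) \<omega>"] by auto
    moreover have "\<bar>g * hit_mean j\<bar> \<le> 1 * 1"
      unfolding abs_mult using g_01 hit_mean_le_1[of j] by (intro mult_mono) auto
    ultimately show ?thesis unfolding D_def by linarith
  qed
  have Di: "integrable M (D t)" for t by (rule bounded_integrable[of _ 2]) (use D2 in auto)
  have sq: "integrable M (\<lambda>\<omega>. (D t \<omega>)\<^sup>2)" for t
  proof (rule bounded_integrable[of _ "2\<^sup>2"])
    fix \<omega> assume "\<omega> \<in> space M"
    from power_mono[OF D2[OF this, of t] abs_ge_zero, of 2] show "\<bar>(D t \<omega>)\<^sup>2\<bar> \<le> 2\<^sup>2" by simp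
  qed measurable
  note zh = z_times_xi[OF hit_measurable hit_le_1]
  have D0: "expectation (D t) = 0" for t
    unfolding D_def using zh[of "t - int j" j] by (simp add: hit_mean_def prob_space)
  have orth: "expectation (\<lambda>\<omega>. D r \<omega> * D t \<omega>) = 0" if "r \<noteq> t" for r t
  proof -
    have m: "D q \<in> borel_measurable (\<F> {Inr (Inl (q - int j)), Inr (Inr (q - int j))})" for q
    proof -
      have [measurable]: "z (q - int j) \<in> borel_measurable (\<F> {Inr (Inl (q - int j)), Inr (Inr (q - int j))})"
        "xi (q - int j) \<in> borel_measurable (\<F> {Inr (Inl (q - int j)), Inr (Inr (q - int j))})"
        by (auto intro: \<F>_z \<F>_xi)
      show ?thesis unfolding D_def by measurable
    qed
    have d: "{Inr (Inl (r - int j)), Inr (Inr (r - int j))} \<inter> {Inr (Inl (t - int j)), Inr (Inr (t - int j))} = {}"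
      using that by auto
    show ?thesis
      using indep_expectation_mult(1)[OF d m m Di Di] D0 by simp
  qed
  have var: "expectation (\<lambda>\<omega>. (D t \<omega>)\<^sup>2) \<le> g" for t
  proof -
    let ?X = "\<lambda>\<omega>. z (t - int j) \<omega> * hit j (xi (t - int j) \<omega>)"
    have X2: "(?X \<omega>)\<^sup>2 \<le> z (t - int j) \<omega>" if "\<omega> \<in> space M" for \<omega>
    proof -
      have "(hit j (xi (t - int j) \<omega>))\<^sup>2 \<le> 1\<^sup>2"
        using hit_le_1[of j "xi (t - int j) \<omega>"] by (simp add: abs_square_le_1)
      then show ?thesis using z01[OF that, of "t - int j"] by (auto simp: power_mult_distrib)
    qed
    have X2i: "integrable M (\<lambda>\<omega>. (?X \<omega>)\<^sup>2)"
    proof (rule bounded_integrable[of _ 1])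
      fix \<omega> assume \<omega>: "\<omega> \<in> space M"
      have "z (t - int j) \<omega> \<le> 1" using z01[OF \<omega>, of "t - int j"] by auto
      with X2[OF \<omega>] show "\<bar>(?X \<omega>)\<^sup>2\<bar> \<le> 1" by simp
    qed measurable
    have E: "expectation ?X = g * hit_mean j" using zh[of "t - int j" j] by (simp add: hit_mean_def)
    have "expectation (\<lambda>\<omega>. (D t \<omega>)\<^sup>2) = variance ?X"
      unfolding D_def E ..
    also have "\<dots> = expectation (\<lambda>\<omega>. (?X \<omega>)\<^sup>2) - (expectation ?X)\<^sup>2"
      by (rule variance_eq) (use zh X2i in auto)
    also have "\<dots> \<le> expectation (\<lambda>\<omega>. (?X \<omega>)\<^sup>2)" by simp
    also have "\<dots> \<le> expectation (z (t - int j))"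
      by (rule integral_mono[OF X2i z_integrable X2])
    finally show ?thesis by (simp add: z_expectation)
  qed
  note * = second_moment_orthogonal_sum[of "{1..int n}" D, OF _ _ sq orth, simplified]
  have "expectation (\<lambda>\<omega>. \<bar>\<Sum>t=1..int n. D t \<omega>\<bar>) \<le> sqrt (expectation (\<lambda>\<omega>. (\<Sum>t=1..int n. D t \<omega>)\<^sup>2))"
    by (rule expectation_abs_le_sqrt) (auto intro: *)
  also have "\<dots> \<le> sqrt (\<Sum>t=1..int n. g)"
    unfolding *(1) by (intro real_sqrt_le_mono sum_mono var)
  also have "\<dots> = sqrt (real n) * sqrt g"
    by (simp add: real_sqrt_mult)
  finally show "expectation (\<lambda>\<omega>. \<bar>\<Sum>t=1..int n. z (t - int j) \<omega> * hit j (xi (t - int j) \<omega>) - g * hit_mean j\<bar>)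
    \<le> sqrt (real n) * sqrt g" unfolding D_def .
  have "integrable M (\<lambda>\<omega>. \<bar>\<Sum>t=1..int n. D t \<omega>\<bar>)"
    by (intro integrable_abs Bochner_Integration.integrable_sum Di)
  then show "integrable M (\<lambda>\<omega>. \<bar>\<Sum>t=1..int n. z (t - int j) \<omega> * hit j (xi (t - int j) \<omega>) - g * hit_mean j\<bar>)"
    unfolding D_def .
qed

text \<open>The centring is the expected effect of the contamination on the normalised count; as
  sqrt n times \<open>g\<close> tends to a limit of the \<gamma>, it becomes that limit times
  \<open>Delta\<close>.\<close>

definition shift_dev :: "'a \<Rightarrow> real" where
  "shift_dev \<omega> = (\<Sum>t=1..int n. below (eps t \<omega>) (thr t \<omega>) - below (eps t \<omega>) x) / sqrt (real n)
     - sqrt (real n) * g * (\<Sum>j=0..p. hit_mean j)"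

lemma shift_dev_measurable[measurable]: "shift_dev \<in> borel_measurable M"
  unfolding shift_dev_def[abs_def] by measurable

text \<open>The count change splits exactly into martingale, two approximation errors, Taylor part
  and centred hits. In the bound, the square root belongs to the martingale, the next two summands
  to \<open>err1\<close>, and then follow the Taylor part, \<open>err2\<close> and the hits; each
  tends to 0 when \<open>g\<close> has order 1 / sqrt n.\<close>

lemma shift_dev_expectation:
  "integrable M (\<lambda>\<omega>. \<bar>shift_dev \<omega>\<bar>)"
  "expectation (\<lambda>\<omega>. \<bar>shift_dev \<omega>\<bar>) \<le>
    sqrt ((real p + 1) * g + L * C * real p * (1 + K) / sqrt (real n))
    + 2 * L * C * (real p + 1) * real p * (1 + K) * g
    + real p * (sqrt (real n) * g) * \<kappa> (L * C / sqrt (real n))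
    + (L * real p * C * K + B * C\<^sup>2 * (real p)\<^sup>2 * K) / sqrt (real n)
    + (real p + 2) * (real p + 1) * real p * (sqrt (real n) * g) * g
    + (real p + 1) * sqrt g"
proof -
  let ?r = "sqrt (real n)"
  let ?N = "\<lambda>j \<omega>. \<Sum>t=1..int n. z (t - int j) \<omega> * hit j (xi (t - int j) \<omega>) - g * hit_mean j"
  let ?T = "\<lambda>\<omega>. \<Sum>t=1..int n. cdf G (x + vlin t \<omega> / ?r) - cdf G x"
  let ?R = "\<lambda>\<omega>. \<bar>\<Sum>t=1..int n. mdiff t \<omega>\<bar> + (\<Sum>t=1..int n. \<bar>err1 t \<omega>\<bar>) + \<bar>?T \<omega>\<bar>
     + (\<Sum>t=1..int n. \<bar>err2 t \<omega>\<bar>) + (\<Sum>j=0..p. \<bar>?N j \<omega>\<bar>)"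
  have pw: "?r * \<bar>shift_dev \<omega>\<bar> \<le> ?R \<omega>" for \<omega>
  proof -
    have *: "below (eps t \<omega>) (thr t \<omega>) - below (eps t \<omega>) x = mdiff t \<omega> + err1 t \<omega>
       + (cdf G (x + vlin t \<omega> / ?r) - cdf G x) + err2 t \<omega>
       + (\<Sum>j=0..p. (z (t - int j) \<omega> * hit j (xi (t - int j) \<omega>) - g * hit_mean j)) + (\<Sum>j=0..p. g * hit_mean j)" for t
      unfolding mdiff_def err1_def err2_def by (simp add: sum_subtractf)
    have "(\<Sum>t=1..int n. below (eps t \<omega>) (thr t \<omega>) - below (eps t \<omega>) x)
      = (\<Sum>t=1..int n. mdiff t \<omega>) + (\<Sum>t=1..int n. err1 t \<omega>) + ?T \<omega> + (\<Sum>t=1..int n. err2 t \<omega>)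
       + (\<Sum>t=1..int n. \<Sum>j=0..p. (z (t - int j) \<omega> * hit j (xi (t - int j) \<omega>) - g * hit_mean j)) + real n * (\<Sum>j=0..p. g * hit_mean j)"
      unfolding * by (simp add: sum.distrib)
    also have "(\<Sum>t=1..int n. \<Sum>j=0..p. (z (t - int j) \<omega> * hit j (xi (t - int j) \<omega>) - g * hit_mean j)) = (\<Sum>j=0..p. ?N j \<omega>)"
      by (rule sum.swap)
    finally have eq: "(\<Sum>t=1..int n. below (eps t \<omega>) (thr t \<omega>) - below (eps t \<omega>) x) - real n * (\<Sum>j=0..p. g * hit_mean j)
      = (\<Sum>t=1..int n. mdiff t \<omega>) + (\<Sum>t=1..int n. err1 t \<omega>) + ?T \<omega> + (\<Sum>t=1..int n. err2 t \<omega>) + (\<Sum>j=0..p. ?N j \<omega>)"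
      by linarith
    have "?r * (S / ?r - ?r * g * H) = S - (?r * ?r) * (g * H)" for S H :: real
      using sqrt_n(1) by (simp add: right_diff_distrib)
    then have "?r * shift_dev \<omega> = (\<Sum>t=1..int n. below (eps t \<omega>) (thr t \<omega>) - below (eps t \<omega>) x) - real n * (\<Sum>j=0..p. g * hit_mean j)"
      unfolding shift_dev_def sqrt_n(2) sum_distrib_left[of g, symmetric] .
    then have "?r * \<bar>shift_dev \<omega>\<bar> = \<bar>(\<Sum>t=1..int n. mdiff t \<omega>) + (\<Sum>t=1..int n. err1 t \<omega>) + ?T \<omega> + (\<Sum>t=1..int n. err2 t \<omega>) + (\<Sum>j=0..p. ?N j \<omega>)\<bar>"
      unfolding eq[symmetric] using sqrt_n(1) by (metis abs_mult abs_of_pos)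
    moreover have "\<bar>\<Sum>t=1..int n. err1 t \<omega>\<bar> \<le> (\<Sum>t=1..int n. \<bar>err1 t \<omega>\<bar>)" "\<bar>\<Sum>t=1..int n. err2 t \<omega>\<bar> \<le> (\<Sum>t=1..int n. \<bar>err2 t \<omega>\<bar>)"
      "\<bar>\<Sum>j=0..p. ?N j \<omega>\<bar> \<le> (\<Sum>j=0..p. \<bar>?N j \<omega>\<bar>)"
      by (rule sum_abs)+
    ultimately show ?thesis by linarith
  qed
  have i1: "integrable M (\<lambda>\<omega>. \<bar>\<Sum>t=1..int n. mdiff t \<omega>\<bar>)"
    by (rule mdiff_sum_abs(1))
  have iR: "integrable M ?R"
    by (intro Bochner_Integration.integrable_add Bochner_Integration.integrable_sum i1 err1_expectation err2_expectation
       taylor_sum_expectation hit_sum_abs)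
  show i: "integrable M (\<lambda>\<omega>. \<bar>shift_dev \<omega>\<bar>)"
    unfolding shift_dev_def[abs_def]
    by (intro integrable_abs Bochner_Integration.integrable_diff integrable_const integrable_divide
        Bochner_Integration.integrable_sum; rule bounded_integrable[of _ 1]; simp)
  have "?r * expectation (\<lambda>\<omega>. \<bar>shift_dev \<omega>\<bar>) = expectation (\<lambda>\<omega>. ?r * \<bar>shift_dev \<omega>\<bar>)" by simp
  also have "\<dots> \<le> expectation ?R"
    by (rule integral_mono[OF integrable_mult_right[OF i] iR pw])
  also have "\<dots> = expectation (\<lambda>\<omega>. \<bar>\<Sum>t=1..int n. mdiff t \<omega>\<bar>) + (\<Sum>t=1..int n. expectation (\<lambda>\<omega>. \<bar>err1 t \<omega>\<bar>)) + expectation (\<lambda>\<omega>. \<bar>?T \<omega>\<bar>)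
     + (\<Sum>t=1..int n. expectation (\<lambda>\<omega>. \<bar>err2 t \<omega>\<bar>)) + (\<Sum>j=0..p. expectation (\<lambda>\<omega>. \<bar>?N j \<omega>\<bar>))"
    using i1 err1_expectation(1) err2_expectation(1) taylor_sum_expectation(1) hit_sum_abs(1)
    by (simp only: Bochner_Integration.integral_add Bochner_Integration.integral_sum
       Bochner_Integration.integrable_sum Bochner_Integration.integrable_add)
  also have "\<dots> \<le> ?r * sqrt ((real p + 1) * g + L * C * real p * (1 + K) / ?r)
    + (\<Sum>t=1..int n. 2 * L * C * (real p + 1) * real p * (1 + K) * g / ?r + real p * g * \<kappa> (L * C / ?r))
    + (L * real p * C * K + B * C\<^sup>2 * (real p)\<^sup>2 * K)
    + (\<Sum>t=1..int n. (real p + 2) * (real p + 1) * real p * g\<^sup>2) + (\<Sum>j=0..p. ?r * sqrt g)"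
    by (intro add_mono sum_mono mdiff_sum_abs(2) err1_expectation err2_expectation
       taylor_sum_expectation hit_sum_abs)
  also have "\<dots> = ?r * (sqrt ((real p + 1) * g + L * C * real p * (1 + K) / ?r)
    + 2 * L * C * (real p + 1) * real p * (1 + K) * g
    + real p * (?r * g) * \<kappa> (L * C / ?r)
    + (L * real p * C * K + B * C\<^sup>2 * (real p)\<^sup>2 * K) / ?r
    + (real p + 2) * (real p + 1) * real p * (?r * g) * g
    + (real p + 1) * sqrt g)"
  proof -
    have a: "(\<Sum>t=1..int n. a / ?r + a') = ?r * a + ?r * ?r * a'" for a a'
    proof -
      have "(\<Sum>t=1..int n. a / ?r + a') = (?r * ?r) * (a / ?r + a')" unfolding sqrt_n(2) by simp
      also have "r * r * (a / r + a') = r * a + r * r * a'" if "r > 0" for r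
        using that by (simp add: field_simps)
      from this[OF sqrt_n(1)] have "(?r * ?r) * (a / ?r + a') = ?r * a + ?r * ?r * a'" .
      finally show ?thesis .
    qed
    have b: "(\<Sum>t=1..int n. a) = ?r * ?r * a" for a
      using sqrt_n by simp
    have c: "(\<Sum>j=0..p. ?r * sqrt g) = ?r * ((real p + 1) * sqrt g)" by simp
    have d: "L * real p * C * K + B * C\<^sup>2 * (real p)\<^sup>2 * K = ?r * ((L * real p * C * K + B * C\<^sup>2 * (real p)\<^sup>2 * K) / ?r)"
      using sqrt_n(1) by simp
    show ?thesis
      unfolding a b c by (subst d) (simp only: distrib_left power2_eq_square mult_ac)
  qed
  finally show "expectation (\<lambda>\<omega>. \<bar>shift_dev \<omega>\<bar>) \<le>
    sqrt ((real p + 1) * g + L * C * real p * (1 + K) / ?r)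
    + 2 * L * C * (real p + 1) * real p * (1 + K) * g
    + real p * (?r * g) * \<kappa> (L * C / ?r)
    + (L * real p * C * K + B * C\<^sup>2 * (real p)\<^sup>2 * K) / ?r
    + (real p + 2) * (real p + 1) * real p * (?r * g) * g
    + (real p + 1) * sqrt g"
    using sqrt_n(1) by (simp only: mult_le_cancel_left_pos)
qed

text \<open>Replacing \<open>\<tau>\<close> by a point at distance at most \<open>\<eta>\<close> moves the threshold by at most \<open>osc \<eta>\<close>, so that
  by monotonicity \<open>near \<eta>\<close> bounds the change of the empirical process simultaneously for all such points.\<close>

definition osc :: "real \<Rightarrow> int \<Rightarrow> 'a \<Rightarrow> real" where
  "osc \<eta> t \<omega> = \<eta> * (\<Sum>i=1..p. \<bar>v (t - int i) \<omega>\<bar> + \<bar>s (t - int i) \<omega>\<bar>) / sqrt (real n)"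

definition near :: "real \<Rightarrow> 'a \<Rightarrow> real" where
  "near \<eta> \<omega> = (\<Sum>t=1..int n. below (eps t \<omega>) (thr t \<omega> + osc \<eta> t \<omega>) - below (eps t \<omega>) (thr t \<omega> - osc \<eta> t \<omega>)) / sqrt (real n)"

text \<open>Dominates the compensator of \<open>near\<close>. The bound for its expectation retains
  a multiple of \<eta> however large n is, so \<eta> has to be fixed small first; on the other hand
  it is the same for all \<tau>.\<close>

definition comp :: "real \<Rightarrow> 'a \<Rightarrow> real" where
  "comp \<eta> \<omega> = (\<Sum>t=1..int n. 2 * L * \<eta> / sqrt (real n) * (\<Sum>i=1..p. \<bar>v (t - int i) \<omega>\<bar>)
     + (\<Sum>i=1..p. min 1 (2 * L * \<eta> / sqrt (real n) * \<bar>s (t - int i) \<omega>\<bar>))) / sqrt (real n)"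

definition near_mart :: "real \<Rightarrow> 'a \<Rightarrow> real" where
  "near_mart \<eta> \<omega> = (\<bar>\<Sum>t=1..int n. gmdiff x (\<lambda>t \<omega>. thr t \<omega> + osc \<eta> t \<omega>) t \<omega>\<bar>
     + \<bar>\<Sum>t=1..int n. gmdiff x (\<lambda>t \<omega>. thr t \<omega> - osc \<eta> t \<omega>) t \<omega>\<bar>) / sqrt (real n)"

context
  fixes \<eta> :: real
  assumes \<eta>: "\<eta> \<ge> 0"
begin

lemma osc_nonneg: "osc \<eta> t \<omega> \<ge> 0"
  unfolding osc_def using \<eta> by (intro divide_nonneg_nonneg mult_nonneg_nonneg sum_nonneg) auto

lemma osc_nonanticip: "osc \<eta> t \<in> borel_measurable (\<F> (nonanticip t))"
proof -
  note s_nonanticip[measurable]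
  have [measurable]: "v (t - int i) \<in> borel_measurable (\<F> (nonanticip t))" if "i \<in> {1..p}" for i
    using that by (intro v_nonanticip) auto
  show ?thesis unfolding osc_def[abs_def] by measurable
qed

lemma thr_osc_nonanticip:
  "(\<lambda>\<omega>. thr t \<omega> + osc \<eta> t \<omega>) \<in> borel_measurable (\<F> (nonanticip t))"
  "(\<lambda>\<omega>. thr t \<omega> - osc \<eta> t \<omega>) \<in> borel_measurable (\<F> (nonanticip t))"
proof -
  note [measurable] = thr_nonanticip[OF order_refl, of t] osc_nonanticip[of t]
  show "(\<lambda>\<omega>. thr t \<omega> + osc \<eta> t \<omega>) \<in> borel_measurable (\<F> (nonanticip t))" by measurable
  show "(\<lambda>\<omega>. thr t \<omega> - osc \<eta> t \<omega>) \<in> borel_measurable (\<F> (nonanticip t))" by measurable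
qed

text \<open>The dichotomy of clean and dirty windows again; widening the threshold by
  \<open>osc\<close> replaces \<open>C\<close> by C + \<eta>.\<close>

lemma drift_osc_abs_expectation:
  assumes a: "\<And>t \<omega>. \<bar>a t \<omega> - thr t \<omega>\<bar> \<le> osc \<eta> t \<omega>" and am: "\<And>t. a t \<in> borel_measurable (\<F> (nonanticip t))"
  shows "expectation (\<lambda>\<omega>. \<bar>gdrift x a t \<omega>\<bar>) \<le> (real p + 1) * g + L * (C + \<eta>) * real p * (1 + K) / sqrt (real n)"
proof -
  let ?r = "sqrt (real n)"
  have pw: "\<bar>gdrift x a t \<omega>\<bar> \<le> (\<Sum>j=0..p. z (t - int j) \<omega>) + L * (C + \<eta>) / ?r * (\<Sum>i=1..p. \<bar>v (t - int i) \<omega>\<bar>)"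
    if \<omega>: "\<omega> \<in> space M" for \<omega>
    using \<omega>
  proof (cases rule: z_sum_cases[of \<omega> t])
    case clean
    let ?V = "\<Sum>i=1..p. \<bar>v (t - int i) \<omega>\<bar>"
    have eqs: "lin \<tau> t \<omega> = vlin t \<omega> / ?r" "contam t \<omega> = 0"
      by (rule clean_lin, erule clean(1)) (rule clean_contam, erule clean(1))
    have o: "osc \<eta> t \<omega> = \<eta> * ?V / ?r"
      unfolding osc_def using clean(1) by (intro arg_cong2[where f="(/)"] arg_cong2[where f="(*)"] sum.cong) auto
    have "\<bar>a t \<omega> - x\<bar> \<le> \<bar>vlin t \<omega> / ?r\<bar> + \<eta> * ?V / ?r"
      using a[of t \<omega>] unfolding o thr_def eqs by linarith
    also have "\<dots> \<le> C * ?V / ?r + \<eta> * ?V / ?r"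
      using vlin_abs_le[of t \<omega>] by (auto simp: abs_divide intro!: divide_right_mono)
    finally have "L * \<bar>a t \<omega> - x\<bar> \<le> L * (C * ?V / ?r + \<eta> * ?V / ?r)" using L by (rule mult_left_mono)
    also have "\<dots> = L * (C + \<eta>) / ?r * ?V"
      by (simp add: add_divide_distrib distrib_left distrib_right)
    finally show ?thesis
      using G_lipschitz[of "a t \<omega>" x] z_sum_nonneg[OF \<omega>, of t] unfolding gdrift_def[OF am] by linarith
  next
    case dirty
    have "0 \<le> L * (C + \<eta>) / ?r * (\<Sum>i=1..p. \<bar>v (t - int i) \<omega>\<bar>)"
      using L C \<eta> by (intro mult_nonneg_nonneg sum_nonneg) auto
    with dirty gdrift_le_1[OF am, of x t \<omega>] show ?thesis by linarith
  qed
  have "expectation (\<lambda>\<omega>. \<bar>gdrift x a t \<omega>\<bar>) \<le> expectation (\<lambda>\<omega>. (\<Sum>j=0..p. z (t - int j) \<omega>) + L * (C + \<eta>) / ?r * (\<Sum>i=1..p. \<bar>v (t - int i) \<omega>\<bar>))"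
  proof (rule integral_mono)
    show "integrable M (\<lambda>\<omega>. \<bar>gdrift x a t \<omega>\<bar>)"
      by (rule bounded_integrable[of _ 1]) (use gdrift_le_1[OF am] gdrift_measurable[OF am] in auto)
    show "integrable M (\<lambda>\<omega>. (\<Sum>j=0..p. z (t - int j) \<omega>) + L * (C + \<eta>) / ?r * (\<Sum>i=1..p. \<bar>v (t - int i) \<omega>\<bar>))"
      by (intro Bochner_Integration.integrable_add z_sum_integrable integrable_mult_right
          Bochner_Integration.integrable_sum v_abs(1))
  qed (rule pw)
  also have "\<dots> = (real p + 1) * g + L * (C + \<eta>) / ?r * (\<Sum>i=1..p. expectation (\<lambda>\<omega>. \<bar>v (t - int i) \<omega>\<bar>))"
    using v_abs(1) z_sum_integrable z_sum_expectation by simp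
  also have "\<dots> \<le> (real p + 1) * g + L * (C + \<eta>) / ?r * (\<Sum>i=1..p. 1 + K)"
    using L C \<eta> v_abs(2) by (intro add_left_mono mult_left_mono sum_mono) auto
  finally show ?thesis by (simp add: field_simps)
qed

lemma near_mart_expectation:
  "integrable M (near_mart \<eta>)"
  "expectation (near_mart \<eta>) \<le> 2 * sqrt ((real p + 1) * g + L * (C + \<eta>) * real p * (1 + K) / sqrt (real n))"
proof -
  let ?q = "(real p + 1) * g + L * (C + \<eta>) * real p * (1 + K) / sqrt (real n)"
  have d1: "\<bar>thr t \<omega> + osc \<eta> t \<omega> - thr t \<omega>\<bar> \<le> osc \<eta> t \<omega>" for t \<omega> using osc_nonneg by simp
  have d2: "\<bar>thr t \<omega> - osc \<eta> t \<omega> - thr t \<omega>\<bar> \<le> osc \<eta> t \<omega>" for t \<omega> using osc_nonneg by simp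
  note p1 = gmdiff_sum_abs[OF thr_osc_nonanticip(1) drift_osc_abs_expectation[OF d1 thr_osc_nonanticip(1)]]
  note p2 = gmdiff_sum_abs[OF thr_osc_nonanticip(2) drift_osc_abs_expectation[OF d2 thr_osc_nonanticip(2)]]
  show "integrable M (near_mart \<eta>)"
    unfolding near_mart_def[abs_def] by (intro integrable_divide Bochner_Integration.integrable_add p1(1) p2(1))
  have "expectation (near_mart \<eta>) = (expectation (\<lambda>\<omega>. \<bar>\<Sum>t=1..int n. gmdiff x (\<lambda>t \<omega>. thr t \<omega> + osc \<eta> t \<omega>) t \<omega>\<bar>)
     + expectation (\<lambda>\<omega>. \<bar>\<Sum>t=1..int n. gmdiff x (\<lambda>t \<omega>. thr t \<omega> - osc \<eta> t \<omega>) t \<omega>\<bar>)) / sqrt (real n)"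
    unfolding near_mart_def[abs_def] integral_divide_zero using p1(1) p2(1)
    by (simp only: Bochner_Integration.integral_add)
  also have "\<dots> \<le> (sqrt (real n) * sqrt ?q + sqrt (real n) * sqrt ?q) / sqrt (real n)"
    using p1(2) p2(2) by (intro divide_right_mono add_mono) auto
  also have "\<dots> = 2 * sqrt ?q" using sqrt_n(1) by simp
  finally show "expectation (near_mart \<eta>) \<le> 2 * sqrt ?q" .
qed

text \<open>The innovations counted by \<open>near\<close> lie between two nonanticipating
  thresholds, so the count is again a martingale part plus a compensator; the latter is bounded by
  the Lipschitz property, with the contaminated part capped at 1.\<close>

lemma near_le: "near \<eta> \<omega> \<le> near_mart \<eta> \<omega> + comp \<eta> \<omega>"
proof -
  let ?r = "sqrt (real n)"
  let ?a = "2 * L * \<eta> / ?r"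
  let ?up = "\<lambda>t \<omega>. thr t \<omega> + osc \<eta> t \<omega>" and ?dn = "\<lambda>t \<omega>. thr t \<omega> - osc \<eta> t \<omega>"
  have a0: "0 \<le> ?a" using L \<eta> by simp
  have one: "cdf G (?up t \<omega>) - cdf G (?dn t \<omega>) \<le> ?a * (\<Sum>i=1..p. \<bar>v (t - int i) \<omega>\<bar>) + (\<Sum>i=1..p. min 1 (?a * \<bar>s (t - int i) \<omega>\<bar>))" for t
  proof -
    let ?V = "?a * (\<Sum>i=1..p. \<bar>v (t - int i) \<omega>\<bar>)" and ?S = "\<Sum>i=1..p. ?a * \<bar>s (t - int i) \<omega>\<bar>"
    have V0: "?V \<ge> 0" using a0 by (intro mult_nonneg_nonneg sum_nonneg) auto
    have S0: "?S \<ge> 0" using a0 by (intro mult_nonneg_nonneg sum_nonneg) auto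
    have "\<bar>cdf G (?up t \<omega>) - cdf G (?dn t \<omega>)\<bar> \<le> L * \<bar>?up t \<omega> - ?dn t \<omega>\<bar>"
      by (rule G_lipschitz)
    also have "\<dots> = L * (2 * osc \<eta> t \<omega>)" using osc_nonneg[of t \<omega>] by simp
    also have "\<dots> = ?V + ?S"
      unfolding osc_def by (simp add: sum.distrib sum_distrib_left field_simps add_divide_distrib sum_divide_distrib)
    finally have "\<bar>cdf G (?up t \<omega>) - cdf G (?dn t \<omega>)\<bar> \<le> ?V + min 1 ?S"
      using cdf_G_diff_le_1[of "?up t \<omega>" "?dn t \<omega>"] V0 by (simp add: min_def)
    also have "min 1 ?S = min 1 \<bar>?S\<bar>" using S0 by simp
    also have "\<dots> \<le> (\<Sum>i=1..p. min 1 \<bar>?a * \<bar>s (t - int i) \<omega>\<bar>\<bar>)"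
      by (rule min_one_abs_sum_le) simp
    also have "\<dots> = (\<Sum>i=1..p. min 1 (?a * \<bar>s (t - int i) \<omega>\<bar>))"
      using a0 by (intro sum.cong refl arg_cong[where f="min 1"] abs_of_nonneg mult_nonneg_nonneg) auto
    finally show ?thesis by simp
  qed
  have "below (eps t \<omega>) (?up t \<omega>) - below (eps t \<omega>) (?dn t \<omega>)
     = gmdiff x ?up t \<omega> - gmdiff x ?dn t \<omega> + (cdf G (?up t \<omega>) - cdf G (?dn t \<omega>))" for t
    unfolding gmdiff_def[OF thr_osc_nonanticip(1)] gmdiff_def[OF thr_osc_nonanticip(2)]
      gdrift_def[OF thr_osc_nonanticip(1)] gdrift_def[OF thr_osc_nonanticip(2)] by simp
  then have "(\<Sum>t=1..int n. below (eps t \<omega>) (?up t \<omega>) - below (eps t \<omega>) (?dn t \<omega>))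
    = (\<Sum>t=1..int n. gmdiff x ?up t \<omega>) - (\<Sum>t=1..int n. gmdiff x ?dn t \<omega>) + (\<Sum>t=1..int n. cdf G (?up t \<omega>) - cdf G (?dn t \<omega>))"
    by (simp only: sum.distrib sum_subtractf)
  moreover have "(\<Sum>t=1..int n. cdf G (?up t \<omega>) - cdf G (?dn t \<omega>))
     \<le> (\<Sum>t=1..int n. ?a * (\<Sum>i=1..p. \<bar>v (t - int i) \<omega>\<bar>) + (\<Sum>i=1..p. min 1 (?a * \<bar>s (t - int i) \<omega>\<bar>)))"
    by (rule sum_mono[OF one])
  ultimately have "(\<Sum>t=1..int n. below (eps t \<omega>) (?up t \<omega>) - below (eps t \<omega>) (?dn t \<omega>))
     \<le> \<bar>\<Sum>t=1..int n. gmdiff x ?up t \<omega>\<bar> + \<bar>\<Sum>t=1..int n. gmdiff x ?dn t \<omega>\<bar>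
     + (\<Sum>t=1..int n. ?a * (\<Sum>i=1..p. \<bar>v (t - int i) \<omega>\<bar>) + (\<Sum>i=1..p. min 1 (?a * \<bar>s (t - int i) \<omega>\<bar>)))"
    by linarith
  then show ?thesis
    unfolding near_def near_mart_def comp_def add_divide_distrib[symmetric]
    by (rule divide_right_mono) simp
qed

lemma comp_expectation:
  "integrable M (comp \<eta>)"
  "expectation (comp \<eta>) \<le> 2 * L * \<eta> * real p * (1 + K) + real p * (sqrt (real n) * g) * \<kappa> (2 * L * \<eta> / sqrt (real n))"
  "comp \<eta> \<omega> \<ge> 0"
proof -
  let ?r = "sqrt (real n)"
  have a0: "0 \<le> 2 * L * \<eta> / ?r" using L \<eta> by simp
  have m0: "0 \<le> min 1 (2 * L * \<eta> / ?r * \<bar>y\<bar>)" for y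
    by (rule min.boundedI) (simp, rule mult_nonneg_nonneg[OF a0 abs_ge_zero])
  show "comp \<eta> \<omega> \<ge> 0"
    unfolding comp_def
    by (intro divide_nonneg_nonneg sum_nonneg add_nonneg_nonneg m0 mult_nonneg_nonneg[OF a0]) auto
  show "integrable M (comp \<eta>)"
    unfolding comp_def[abs_def]
    by (intro integrable_divide Bochner_Integration.integrable_add integrable_mult_right Bochner_Integration.integrable_sum v_abs(1) min_s(1)[OF a0])
  have "expectation (comp \<eta>) = (\<Sum>t=1..int n. 2 * L * \<eta> / ?r * (\<Sum>i=1..p. expectation (\<lambda>\<omega>. \<bar>v (t - int i) \<omega>\<bar>))
      + (\<Sum>i=1..p. expectation (\<lambda>\<omega>. min 1 (2 * L * \<eta> / ?r * \<bar>s (t - int i) \<omega>\<bar>)))) / ?r"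
    unfolding comp_def[abs_def] using v_abs(1) min_s(1)[OF a0]
    by (simp only: integral_divide_zero Bochner_Integration.integral_add Bochner_Integration.integral_sum integral_mult_right_zero
         Bochner_Integration.integrable_sum integrable_mult_right Bochner_Integration.integrable_add)
  also have "\<dots> \<le> (\<Sum>t=1..int n. 2 * L * \<eta> / ?r * (\<Sum>i=1..p. 1 + K) + (\<Sum>i=1..p. g * \<kappa> (2 * L * \<eta> / ?r))) / ?r"
    using a0 v_abs(2) min_s(2)[OF a0] by (intro divide_right_mono add_mono mult_left_mono sum_mono) auto
  also have "\<dots> = (\<Sum>t=1..int n. 2 * L * \<eta> / ?r * (real p * (1 + K)) + real p * (g * \<kappa> (2 * L * \<eta> / ?r))) / ?r"
    by simp
  also have "\<dots> = 2 * L * \<eta> * real p * (1 + K) + real p * (?r * g) * \<kappa> (2 * L * \<eta> / ?r)"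
  proof -
    have "(\<Sum>t=1..int n. c) = (?r * ?r) * c" for c :: real
      unfolding sqrt_n(2) by simp
    moreover have "r * r * (2 * L * \<eta> / r * (real p * (1 + K)) + real p * (g * c)) / r
      = 2 * L * \<eta> * real p * (1 + K) + real p * (r * g) * c" if "r > 0" for r c
      using that by (simp add: field_simps)
    note this[OF sqrt_n(1)]
    ultimately show ?thesis by metis
  qed
  finally show "expectation (comp \<eta>) \<le> 2 * L * \<eta> * real p * (1 + K) + real p * (?r * g) * \<kappa> (2 * L * \<eta> / ?r)" .
qed

end

end

text \<open>A pathwise comparison: \<tau>' may be chosen after the sample point, which is how the
  estimator enters although all moment bounds concern fixed \<tau>. The two centrings agree and
  cancel.\<close>

lemma shift_dev_le_near:
  assumes C: "C \<ge> 0" and \<tau>: "\<And>i. i \<in> {1..p} \<Longrightarrow> \<bar>\<tau> i\<bar> \<le> C" and \<tau>': "\<And>i. i \<in> {1..p} \<Longrightarrow> \<bar>\<tau>' i\<bar> \<le> C"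
    and close: "\<And>i. i \<in> {1..p} \<Longrightarrow> \<bar>\<tau>' i - \<tau> i\<bar> \<le> \<eta>"
  shows "\<bar>shift_dev x \<tau>' \<omega>\<bar> \<le> \<bar>shift_dev x \<tau> \<omega>\<bar> + near x \<tau> \<eta> \<omega>"
proof -
  have thrs: "thr x \<tau> t \<omega> = x + contam t \<omega> + lin \<tau> t \<omega>" "thr x \<tau>' t \<omega> = x + contam t \<omega> + lin \<tau>' t \<omega>" for t
    by (rule thr_def[OF C \<tau>], assumption) (rule thr_def[OF C \<tau>'])
  have osc: "osc \<eta> t \<omega> = \<eta> * (\<Sum>i=1..p. \<bar>v (t - int i) \<omega>\<bar> + \<bar>s (t - int i) \<omega>\<bar>) / sqrt (real n)" for t
    by (rule osc_def[OF C \<tau>])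
  have sd: "shift_dev x \<tau>'' \<omega> = (\<Sum>t=1..int n. below (eps t \<omega>) (thr x \<tau>'' t \<omega>) - below (eps t \<omega>) x) / sqrt (real n)
     - sqrt (real n) * g * (\<Sum>j=0..p. hit_mean x j)" if "\<And>i. i \<in> {1..p} \<Longrightarrow> \<bar>\<tau>'' i\<bar> \<le> C" for \<tau>''
    by (rule shift_dev_def[OF C that])
  have d: "\<bar>thr x \<tau>' t \<omega> - thr x \<tau> t \<omega>\<bar> \<le> osc \<eta> t \<omega>" for t
  proof -
    have "thr x \<tau>' t \<omega> - thr x \<tau> t \<omega> = (\<Sum>i=1..p. (\<tau>' i - \<tau> i) * (v (t - int i) \<omega> + s (t - int i) \<omega>)) / sqrt (real n)"
      unfolding thrs lin_def
      by (simp add: left_diff_distrib sum_subtractf diff_divide_distrib)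
    moreover have "\<bar>\<Sum>i=1..p. (\<tau>' i - \<tau> i) * (v (t - int i) \<omega> + s (t - int i) \<omega>)\<bar> \<le> \<eta> * (\<Sum>i=1..p. \<bar>v (t - int i) \<omega>\<bar> + \<bar>s (t - int i) \<omega>\<bar>)"
      unfolding sum_distrib_left
      by (rule order_trans[OF sum_abs], rule sum_mono) (unfold abs_mult, intro mult_mono close abs_triangle_ineq order_trans[OF abs_ge_zero close], auto)
    ultimately show ?thesis
      unfolding osc by (simp add: abs_divide divide_right_mono)
  qed
  have "shift_dev x \<tau>' \<omega> - shift_dev x \<tau> \<omega> = (\<Sum>t=1..int n. below (eps t \<omega>) (thr x \<tau>' t \<omega>) - below (eps t \<omega>) (thr x \<tau> t \<omega>)) / sqrt (real n)"
    using sd[OF \<tau>] sd[OF \<tau>'] by (simp add: sum_subtractf diff_divide_distrib)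
  then have "\<bar>shift_dev x \<tau>' \<omega> - shift_dev x \<tau> \<omega>\<bar>
    = \<bar>\<Sum>t=1..int n. below (eps t \<omega>) (thr x \<tau>' t \<omega>) - below (eps t \<omega>) (thr x \<tau> t \<omega>)\<bar> / sqrt (real n)"
    using sqrt_n(1) by simp
  also have "\<dots> \<le> (\<Sum>t=1..int n. below (eps t \<omega>) (thr x \<tau> t \<omega> + osc \<eta> t \<omega>) - below (eps t \<omega>) (thr x \<tau> t \<omega> - osc \<eta> t \<omega>)) / sqrt (real n)"
    by (intro divide_right_mono order_trans[OF sum_abs sum_mono[OF below_diff_le[OF d]]]) simp
  also have "\<dots> = near x \<tau> \<eta> \<omega>"
    by (rule near_def[OF C \<tau>, symmetric])
  finally show ?thesis by linarith
qed

end

section \<open>Convergence and boundedness in probability\<close>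

text \<open>Convergence to 0 in probability. The exceptional set only has to cover the large values
  of \<open>X\<close>, which admits processes whose measurability has not been established; the
  probability space may change with \<open>k\<close>.\<close>

definition oprob :: "(nat \<Rightarrow> 'a measure) \<Rightarrow> (nat \<Rightarrow> 'a \<Rightarrow> real) \<Rightarrow> bool" where
  "oprob M X \<longleftrightarrow> (\<forall>e>0. \<forall>\<^sub>F k in sequentially. \<exists>E\<in>sets (M k). measure (M k) E < e \<and>
     (\<forall>\<omega>\<in>space (M k) - E. \<bar>X k \<omega>\<bar> \<le> e))"

definition Oprob :: "(nat \<Rightarrow> 'a measure) \<Rightarrow> (nat \<Rightarrow> 'a \<Rightarrow> real) \<Rightarrow> bool" where
  "Oprob M X \<longleftrightarrow> (\<forall>e>0. \<exists>C. \<forall>\<^sub>F k in sequentially. \<exists>E\<in>sets (M k). measure (M k) E < e \<and>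
     (\<forall>\<omega>\<in>space (M k) - E. \<bar>X k \<omega>\<bar> \<le> C))"

context
  fixes M :: "nat \<Rightarrow> 'a measure"
  assumes M: "\<And>k. prob_space (M k)"
begin

lemma measure_Un_less:
  assumes "E \<in> sets (M k)" "F \<in> sets (M k)" "measure (M k) E < a" "measure (M k) F < b"
  shows "measure (M k) (E \<union> F) < a + b"
proof -
  interpret prob_space "M k" by (rule M)
  have "measure (M k) (E \<union> F) \<le> measure (M k) E + measure (M k) F"
    using assms by (intro measure_Un_le)
  then show ?thesis using assms by linarith
qed

lemma oprob_Oprob: "oprob M X \<Longrightarrow> Oprob M X"
  unfolding oprob_def Oprob_def by blast

lemma oprob_cong:
  assumes "oprob M X" "\<And>k. AE \<omega> in M k. X k \<omega> = Y k \<omega>"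
  shows "oprob M Y"
  unfolding oprob_def
proof (intro allI impI)
  fix e :: real assume "e > 0"
  with assms(1) have "\<forall>\<^sub>F k in sequentially. \<exists>E\<in>sets (M k). measure (M k) E < e \<and>
     (\<forall>\<omega>\<in>space (M k) - E. \<bar>X k \<omega>\<bar> \<le> e)" unfolding oprob_def by blast
  then show "\<forall>\<^sub>F k in sequentially. \<exists>E\<in>sets (M k). measure (M k) E < e \<and>
     (\<forall>\<omega>\<in>space (M k) - E. \<bar>Y k \<omega>\<bar> \<le> e)"
  proof eventually_elim
    case (elim k)
    then obtain E where E: "E \<in> sets (M k)" "measure (M k) E < e" "\<And>\<omega>. \<omega> \<in> space (M k) - E \<Longrightarrow> \<bar>X k \<omega>\<bar> \<le> e"
      by blast
    obtain Z where Z: "Z \<in> null_sets (M k)" "{\<omega> \<in> space (M k). X k \<omega> \<noteq> Y k \<omega>} \<subseteq> Z"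
      using assms(2)[of k] by (auto elim!: AE_E)
    have "measure (M k) (E \<union> Z) = measure (M k) E"
      using E(1) Z(1) by (simp add: measure_Un_null_set)
    moreover have "\<bar>Y k \<omega>\<bar> \<le> e" if "\<omega> \<in> space (M k) - (E \<union> Z)" for \<omega>
      using that Z(2) E(3)[of \<omega>] by (cases "X k \<omega> = Y k \<omega>") auto
    ultimately show ?case
      using E Z by (intro bexI[of _ "E \<union> Z"]) auto
  qed
qed

lemma oprob_add:
  assumes "oprob M X" "oprob M Y"
  shows "oprob M (\<lambda>k \<omega>. X k \<omega> + Y k \<omega>)"
  unfolding oprob_def
proof (intro allI impI)
  fix e :: real assume "e > 0"
  then have e: "e / 2 > 0" by simp
  from assms(1)[unfolded oprob_def, rule_format, OF e] assms(2)[unfolded oprob_def, rule_format, OF e]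
  show "\<forall>\<^sub>F k in sequentially. \<exists>E\<in>sets (M k). measure (M k) E < e \<and>
     (\<forall>\<omega>\<in>space (M k) - E. \<bar>X k \<omega> + Y k \<omega>\<bar> \<le> e)"
  proof eventually_elim
    case (elim k)
    then obtain E F where E: "E \<in> sets (M k)" "measure (M k) E < e / 2" "\<And>\<omega>. \<omega> \<in> space (M k) - E \<Longrightarrow> \<bar>X k \<omega>\<bar> \<le> e / 2"
      and F: "F \<in> sets (M k)" "measure (M k) F < e / 2" "\<And>\<omega>. \<omega> \<in> space (M k) - F \<Longrightarrow> \<bar>Y k \<omega>\<bar> \<le> e / 2"
      by blast
    have "measure (M k) (E \<union> F) < e" using measure_Un_less[OF E(1) F(1) E(2) F(2)] by simp
    moreover have "\<bar>X k \<omega> + Y k \<omega>\<bar> \<le> e" if "\<omega> \<in> space (M k) - (E \<union> F)" for \<omega>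
      using that E(3)[of \<omega>] F(3)[of \<omega>] by auto
    ultimately show ?case using E F by (intro bexI[of _ "E \<union> F"]) auto
  qed
qed

lemma Oprob_add:
  assumes "Oprob M X" "Oprob M Y"
  shows "Oprob M (\<lambda>k \<omega>. X k \<omega> + Y k \<omega>)"
  unfolding Oprob_def
proof (intro allI impI)
  fix e :: real assume "e > 0"
  then have e: "e / 2 > 0" by simp
  from assms(1)[unfolded Oprob_def, rule_format, OF e] assms(2)[unfolded Oprob_def, rule_format, OF e]
  obtain C D where C: "\<forall>\<^sub>F k in sequentially. \<exists>E\<in>sets (M k). measure (M k) E < e / 2 \<and> (\<forall>\<omega>\<in>space (M k) - E. \<bar>X k \<omega>\<bar> \<le> C)"
    and D: "\<forall>\<^sub>F k in sequentially. \<exists>E\<in>sets (M k). measure (M k) E < e / 2 \<and> (\<forall>\<omega>\<in>space (M k) - E. \<bar>Y k \<omega>\<bar> \<le> D)"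
    by blast
  from C D have "\<forall>\<^sub>F k in sequentially. \<exists>E\<in>sets (M k). measure (M k) E < e \<and>
     (\<forall>\<omega>\<in>space (M k) - E. \<bar>X k \<omega> + Y k \<omega>\<bar> \<le> C + D)"
  proof eventually_elim
    case (elim k)
    then obtain E F where E: "E \<in> sets (M k)" "measure (M k) E < e / 2" "\<And>\<omega>. \<omega> \<in> space (M k) - E \<Longrightarrow> \<bar>X k \<omega>\<bar> \<le> C"
      and F: "F \<in> sets (M k)" "measure (M k) F < e / 2" "\<And>\<omega>. \<omega> \<in> space (M k) - F \<Longrightarrow> \<bar>Y k \<omega>\<bar> \<le> D"
      by blast
    have "measure (M k) (E \<union> F) < e" using measure_Un_less[OF E(1) F(1) E(2) F(2)] by simp
    moreover have "\<bar>X k \<omega> + Y k \<omega>\<bar> \<le> C + D" if "\<omega> \<in> space (M k) - (E \<union> F)" for \<omega>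
      using that E(3)[of \<omega>] F(3)[of \<omega>] by auto
    ultimately show ?case using E F by (intro bexI[of _ "E \<union> F"]) auto
  qed
  then show "\<exists>C. \<forall>\<^sub>F k in sequentially. \<exists>E\<in>sets (M k). measure (M k) E < e \<and>
     (\<forall>\<omega>\<in>space (M k) - E. \<bar>X k \<omega> + Y k \<omega>\<bar> \<le> C)" by blast
qed

lemma Oprob_mult:
  assumes "Oprob M X" "Oprob M Y"
  shows "Oprob M (\<lambda>k \<omega>. X k \<omega> * Y k \<omega>)"
  unfolding Oprob_def
proof (intro allI impI)
  fix e :: real assume "e > 0"
  then have e: "e / 2 > 0" by simp
  from assms(1)[unfolded Oprob_def, rule_format, OF e] assms(2)[unfolded Oprob_def, rule_format, OF e]
  obtain C D where C: "\<forall>\<^sub>F k in sequentially. \<exists>E\<in>sets (M k). measure (M k) E < e / 2 \<and> (\<forall>\<omega>\<in>space (M k) - E. \<bar>X k \<omega>\<bar> \<le> C)"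
    and D: "\<forall>\<^sub>F k in sequentially. \<exists>E\<in>sets (M k). measure (M k) E < e / 2 \<and> (\<forall>\<omega>\<in>space (M k) - E. \<bar>Y k \<omega>\<bar> \<le> D)"
    by blast
  from C D have "\<forall>\<^sub>F k in sequentially. \<exists>E\<in>sets (M k). measure (M k) E < e \<and>
     (\<forall>\<omega>\<in>space (M k) - E. \<bar>X k \<omega> * Y k \<omega>\<bar> \<le> \<bar>C\<bar> * \<bar>D\<bar>)"
  proof eventually_elim
    case (elim k)
    then obtain E F where E: "E \<in> sets (M k)" "measure (M k) E < e / 2" "\<And>\<omega>. \<omega> \<in> space (M k) - E \<Longrightarrow> \<bar>X k \<omega>\<bar> \<le> C"
      and F: "F \<in> sets (M k)" "measure (M k) F < e / 2" "\<And>\<omega>. \<omega> \<in> space (M k) - F \<Longrightarrow> \<bar>Y k \<omega>\<bar> \<le> D"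
      by blast
    have "measure (M k) (E \<union> F) < e" using measure_Un_less[OF E(1) F(1) E(2) F(2)] by simp
    moreover have "\<bar>X k \<omega> * Y k \<omega>\<bar> \<le> \<bar>C\<bar> * \<bar>D\<bar>" if "\<omega> \<in> space (M k) - (E \<union> F)" for \<omega>
      unfolding abs_mult using that E(3)[of \<omega>] F(3)[of \<omega>] by (intro mult_mono) auto
    ultimately show ?case using E F by (intro bexI[of _ "E \<union> F"]) auto
  qed
  then show "\<exists>C. \<forall>\<^sub>F k in sequentially. \<exists>E\<in>sets (M k). measure (M k) E < e \<and>
     (\<forall>\<omega>\<in>space (M k) - E. \<bar>X k \<omega> * Y k \<omega>\<bar> \<le> C)" by blast
qed

lemma oprob_mult:
  assumes "Oprob M X" "oprob M Y"
  shows "oprob M (\<lambda>k \<omega>. X k \<omega> * Y k \<omega>)"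
  unfolding oprob_def
proof (intro allI impI)
  fix e :: real assume e: "e > 0"
  then have e2: "e / 2 > 0" by simp
  from assms(1)[unfolded Oprob_def, rule_format, OF e2]
  obtain C where C: "\<forall>\<^sub>F k in sequentially. \<exists>E\<in>sets (M k). measure (M k) E < e / 2 \<and> (\<forall>\<omega>\<in>space (M k) - E. \<bar>X k \<omega>\<bar> \<le> C)"
    by blast
  define d where "d = min (e / 2) (e / (\<bar>C\<bar> + 1))"
  have d: "d > 0" "d \<le> e / 2" "d \<le> e / (\<bar>C\<bar> + 1)"
    unfolding d_def by (use e in \<open>simp add: divide_pos_pos add_nonneg_pos\<close>) (rule min.cobounded1 min.cobounded2)+
  have Cd: "\<bar>C\<bar> * d \<le> e"
  proof -
    have "\<bar>C\<bar> * d \<le> (\<bar>C\<bar> + 1) * (e / (\<bar>C\<bar> + 1))" using d by (intro mult_mono) auto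
    then show ?thesis by simp
  qed
  from C assms(2)[unfolded oprob_def, rule_format, OF d(1)]
  show "\<forall>\<^sub>F k in sequentially. \<exists>E\<in>sets (M k). measure (M k) E < e \<and>
     (\<forall>\<omega>\<in>space (M k) - E. \<bar>X k \<omega> * Y k \<omega>\<bar> \<le> e)"
  proof eventually_elim
    case (elim k)
    then obtain E F where E: "E \<in> sets (M k)" "measure (M k) E < e / 2" "\<And>\<omega>. \<omega> \<in> space (M k) - E \<Longrightarrow> \<bar>X k \<omega>\<bar> \<le> C"
      and F: "F \<in> sets (M k)" "measure (M k) F < d" "\<And>\<omega>. \<omega> \<in> space (M k) - F \<Longrightarrow> \<bar>Y k \<omega>\<bar> \<le> d"
      by blast
    have "measure (M k) (E \<union> F) < e" using measure_Un_less[OF E(1) F(1) E(2) F(2)] d by simp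
    moreover have "\<bar>X k \<omega> * Y k \<omega>\<bar> \<le> e" if "\<omega> \<in> space (M k) - (E \<union> F)" for \<omega>
    proof -
      have "\<bar>X k \<omega>\<bar> * \<bar>Y k \<omega>\<bar> \<le> \<bar>C\<bar> * d" using that E(3)[of \<omega>] F(3)[of \<omega>] by (intro mult_mono) auto
      then show ?thesis using Cd by (simp add: abs_mult)
    qed
    ultimately show ?case using E F by (intro bexI[of _ "E \<union> F"]) auto
  qed
qed

lemma oprob_const:
  assumes "c \<longlonglongrightarrow> 0"
  shows "oprob M (\<lambda>k \<omega>. c k)"
  unfolding oprob_def
proof (intro allI impI)
  fix e :: real assume "e > 0"
  with assms have "\<forall>\<^sub>F k in sequentially. \<bar>c k\<bar> < e" by (auto dest!: tendstoD simp: dist_real_def)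
  then show "\<forall>\<^sub>F k in sequentially. \<exists>E\<in>sets (M k). measure (M k) E < e \<and> (\<forall>\<omega>\<in>space (M k) - E. \<bar>c k\<bar> \<le> e)"
    by eventually_elim (use \<open>e > 0\<close> in \<open>auto intro!: bexI[of _ "{}"]\<close>)
qed

lemma Oprob_const: "Oprob M (\<lambda>k \<omega>. c)"
  unfolding Oprob_def
proof (intro allI impI exI[of _ "\<bar>c\<bar>"] always_eventually)
  fix e :: real and k assume "e > 0"
  then show "\<exists>E\<in>sets (M k). measure (M k) E < e \<and> (\<forall>\<omega>\<in>space (M k) - E. \<bar>c\<bar> \<le> \<bar>c\<bar>)"
    by (intro bexI[of _ "{}"]) auto
qed

lemma oprob_uminus: "oprob M X \<Longrightarrow> oprob M (\<lambda>k \<omega>. - X k \<omega>)"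
  unfolding oprob_def by simp

lemma oprob_diff: "oprob M X \<Longrightarrow> oprob M Y \<Longrightarrow> oprob M (\<lambda>k \<omega>. X k \<omega> - Y k \<omega>)"
  using oprob_add[OF _ oprob_uminus, of X Y] by simp

lemma oprob_sum:
  assumes "finite J" "\<And>j. j \<in> J \<Longrightarrow> oprob M (X j)"
  shows "oprob M (\<lambda>k \<omega>. \<Sum>j\<in>J. X j k \<omega>)"
  using assms by (induction J rule: finite_induct) (auto intro: oprob_add oprob_const)

lemma Oprob_of_expectation:
  assumes int: "\<And>k. integrable (M k) (\<lambda>\<omega>. \<bar>X k \<omega>\<bar>)" and bd: "\<And>k. (\<integral>\<omega>. \<bar>X k \<omega>\<bar> \<partial>M k) \<le> B"
  shows "Oprob M X"
  unfolding Oprob_def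
proof (intro allI impI)
  fix e :: real assume e: "e > 0"
  define c where "c = (\<bar>B\<bar> + 1) / e"
  have c: "c > 0" using e by (simp add: c_def add_nonneg_pos)
  have "\<exists>E\<in>sets (M k). measure (M k) E < e \<and> (\<forall>\<omega>\<in>space (M k) - E. \<bar>X k \<omega>\<bar> \<le> c)" for k
  proof -
    let ?E = "{\<omega> \<in> space (M k). \<bar>X k \<omega>\<bar> \<ge> c}"
    have [measurable]: "(\<lambda>\<omega>. \<bar>X k \<omega>\<bar>) \<in> borel_measurable (M k)" using int by auto
    have "measure (M k) ?E \<le> (\<integral>\<omega>. \<bar>X k \<omega>\<bar> \<partial>M k) / c"
      by (rule integral_Markov_inequality_measure[OF int]) (use c in auto)
    also have "\<dots> \<le> \<bar>B\<bar> / c" using bd[of k] c by (intro divide_right_mono) auto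
    also have "\<dots> < e" using e unfolding c_def by (simp add: field_simps add_nonneg_pos)
    finally show ?thesis by (intro bexI[of _ ?E]) auto
  qed
  then show "\<exists>C. \<forall>\<^sub>F k in sequentially. \<exists>E\<in>sets (M k). measure (M k) E < e \<and> (\<forall>\<omega>\<in>space (M k) - E. \<bar>X k \<omega>\<bar> \<le> C)"
    by (intro exI[of _ c] always_eventually allI)
qed

lemma oprob_continuous_map:
  assumes X: "oprob M (\<lambda>k \<omega>. X k \<omega> - c)" and h: "isCont h c"
  shows "oprob M (\<lambda>k \<omega>. h (X k \<omega>) - h c)"
  unfolding oprob_def
proof (intro allI impI)
  fix e :: real assume e: "e > 0"
  obtain d where d: "d > 0" "\<And>y. \<bar>y - c\<bar> < d \<Longrightarrow> \<bar>h y - h c\<bar> < e"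
    using h e unfolding continuous_at_eps_delta dist_real_def by meson
  define d' where "d' = min (d / 2) e"
  have "d' > 0" using d e by (simp add: d'_def)
  from X[unfolded oprob_def, rule_format, OF this]
  show "\<forall>\<^sub>F k in sequentially. \<exists>E\<in>sets (M k). measure (M k) E < e \<and> (\<forall>\<omega>\<in>space (M k) - E. \<bar>h (X k \<omega>) - h c\<bar> \<le> e)"
  proof eventually_elim
    case (elim k)
    then obtain E where E: "E \<in> sets (M k)" "measure (M k) E < d'" "\<And>\<omega>. \<omega> \<in> space (M k) - E \<Longrightarrow> \<bar>X k \<omega> - c\<bar> \<le> d'"
      by blast
    have "\<bar>h (X k \<omega>) - h c\<bar> \<le> e" if "\<omega> \<in> space (M k) - E" for \<omega>
    proof -
      have "\<bar>X k \<omega> - c\<bar> < d" using E(3)[OF that] d(1) by (auto simp: d'_def)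
      from d(2)[OF this] show ?thesis by simp
    qed
    then show ?case using E by (intro bexI[of _ E]) (auto simp: d'_def)
  qed
qed

text \<open>On the nonnegative half-line exp (- a y) is bounded by 1 and Lipschitz with constant
  \<open>a\<close>, so the expectations differ by at most a e' plus the probability of the
  exceptional set.\<close>

lemma oprob_laplace_diff:
  assumes V[measurable]: "\<And>k. V k \<in> borel_measurable (M k)" and W[measurable]: "\<And>k. W k \<in> borel_measurable (M k)"
    and V0: "\<And>k \<omega>. V k \<omega> \<ge> 0" and W0: "\<And>k \<omega>. W k \<omega> \<ge> 0"
    and d: "oprob M (\<lambda>k \<omega>. V k \<omega> - W k \<omega>)" and a: "a \<ge> 0"
  shows "(\<lambda>k. (\<integral>\<omega>. exp (- (a * V k \<omega>)) \<partial>M k) - (\<integral>\<omega>. exp (- (a * W k \<omega>)) \<partial>M k)) \<longlonglongrightarrow> 0"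
proof (rule tendstoI)
  fix e :: real assume e: "e > 0"
  \<comment> \<open>Chosen so that (a + 2) e' = e / 2.\<close>
  define e' where "e' = e / (2 * (a + 2))"
  have e': "e' > 0" using e a by (auto simp: e'_def intro!: divide_pos_pos)
  have lip: "\<bar>exp (- (a * x)) - exp (- (a * y))\<bar> \<le> a * \<bar>x - y\<bar>" if "x \<ge> 0" "y \<ge> 0" for x y :: real
  proof -
    have *: "exp (- (a * x)) - exp (- (a * y)) \<le> a * (y - x)" if "0 \<le> x" "x \<le> y" for x y
    proof -
      have "1 + - (a * (y - x)) \<le> exp (- (a * (y - x)))" by (rule exp_ge_add_one_self)
      then have 1: "1 - exp (- (a * (y - x))) \<le> a * (y - x)" by linarith
      have "exp (- (a * x)) - exp (- (a * y)) = exp (- (a * x)) * (1 - exp (- (a * (y - x))))"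
        by (simp add: algebra_simps exp_add[symmetric])
      also have "\<dots> \<le> 1 * (1 - exp (- (a * (y - x))))"
        using that a by (intro mult_right_mono) auto
      finally show ?thesis using 1 by simp
    qed
    have mono: "exp (- (a * y)) \<le> exp (- (a * x))" if "x \<le> y" for x y
      using that a by (simp add: mult_left_mono)
    show ?thesis
    proof (cases "x \<le> y")
      case True
      with *[OF \<open>x \<ge> 0\<close> True] mono[OF True] show ?thesis by (simp add: abs_if)
    next
      case False
      then have yx: "y \<le> x" by simp
      with *[OF \<open>y \<ge> 0\<close> yx] mono[OF yx] show ?thesis by (simp add: abs_if)
    qed
  qed
  from d[unfolded oprob_def, rule_format, OF e']
  show "\<forall>\<^sub>F k in sequentially. dist ((\<integral>\<omega>. exp (- (a * V k \<omega>)) \<partial>M k) - (\<integral>\<omega>. exp (- (a * W k \<omega>)) \<partial>M k)) 0 < e"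
  proof eventually_elim
    case (elim k)
    then obtain E where E[measurable]: "E \<in> sets (M k)" and E1: "measure (M k) E < e'"
      and E2: "\<And>\<omega>. \<omega> \<in> space (M k) - E \<Longrightarrow> \<bar>V k \<omega> - W k \<omega>\<bar> \<le> e'" by blast
    interpret prob_space "M k" by (rule M)
    have iV: "integrable (M k) (\<lambda>\<omega>. exp (- (a * V k \<omega>)))" using V0 a by (intro integrable_const_bound[of _ 1]) auto
    have iW: "integrable (M k) (\<lambda>\<omega>. exp (- (a * W k \<omega>)))" using W0 a by (intro integrable_const_bound[of _ 1]) auto
    have iE: "integrable (M k) (\<lambda>\<omega>. indicator E \<omega> :: real)" by (intro integrable_const_bound[of _ 1]) auto
    have "\<bar>(\<integral>\<omega>. exp (- (a * V k \<omega>)) \<partial>M k) - (\<integral>\<omega>. exp (- (a * W k \<omega>)) \<partial>M k)\<bar>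
        = \<bar>\<integral>\<omega>. exp (- (a * V k \<omega>)) - exp (- (a * W k \<omega>)) \<partial>M k\<bar>"
      using iV iW by simp
    also have "\<dots> \<le> (\<integral>\<omega>. \<bar>exp (- (a * V k \<omega>)) - exp (- (a * W k \<omega>))\<bar> \<partial>M k)"
      by (rule integral_abs_bound)
    also have "\<dots> \<le> (\<integral>\<omega>. a * e' + indicator E \<omega> \<partial>M k)"
    proof (rule integral_mono)
      show "integrable (M k) (\<lambda>\<omega>. \<bar>exp (- (a * V k \<omega>)) - exp (- (a * W k \<omega>))\<bar>)" using iV iW by auto
      show "integrable (M k) (\<lambda>\<omega>. a * e' + indicator E \<omega>)" using iE by auto
      fix \<omega> assume \<omega>: "\<omega> \<in> space (M k)"
      show "\<bar>exp (- (a * V k \<omega>)) - exp (- (a * W k \<omega>))\<bar> \<le> a * e' + indicator E \<omega>"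
      proof (cases "\<omega> \<in> E")
        case True
        have "0 < exp (- (a * V k \<omega>))" "0 < exp (- (a * W k \<omega>))" "exp (- (a * V k \<omega>)) \<le> 1" "exp (- (a * W k \<omega>)) \<le> 1"
          using V0[of k \<omega>] W0[of k \<omega>] a by auto
        moreover have "0 \<le> a * e'" using a e' by simp
        moreover have "indicator E \<omega> = (1 :: real)" using True by simp
        ultimately show ?thesis by linarith
      next
        case False
        have "a * \<bar>V k \<omega> - W k \<omega>\<bar> \<le> a * e'" using E2[of \<omega>] \<omega> False a by (intro mult_left_mono) auto
        with lip[OF V0 W0, of k \<omega> k \<omega>] False show ?thesis by simp
      qed
    qed
    also have "\<dots> = a * e' + measure (M k) E"
      using iE prob_space by simp
    also have "\<dots> < a * e' + 2 * e'" using E1 e' by simp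
    also have "\<dots> = (a + 2) * e'" by (simp add: distrib_right)
    also have "\<dots> = e / 2"
    proof -
      have "y * (e / (2 * y)) = e / 2" if "y \<noteq> 0" for y using that by simp
      from this[of "a + 2"] show ?thesis using a unfolding e'_def by simp
    qed
    also have "\<dots> < e" using e by simp
    finally show ?case by (simp add: dist_real_def)
  qed
qed

end

text \<open>Compare \<open>c k\<close> with exp (a / N k), whose power with exponent
  \<open>N k\<close> is exactly exp a: powers of two numbers in the closed unit disk differ by at
  most the exponent times the distance of the bases. The condition on Re a places the comparison
  value in that disk.\<close>

lemma power_limit_exp:
  fixes c :: "nat \<Rightarrow> complex"
  assumes N: "filterlim N at_top sequentially" and Npos: "\<And>k. N k \<ge> 1"
    and c: "\<And>k. norm (c k) \<le> 1" and lim: "(\<lambda>k. of_nat (N k) * (c k - 1)) \<longlonglongrightarrow> a" and a: "Re a \<le> 0"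
  shows "(\<lambda>k. c k ^ N k) \<longlonglongrightarrow> exp a"
proof -
  let ?n = "\<lambda>k. of_nat (N k) :: complex"
  define w where "w k = exp (a / ?n k)" for k
  have w1: "norm (w k) \<le> 1" for k
  proof -
    have "Re (a / ?n k) = Re a / real (N k)" by (simp add: Re_divide_of_nat)
    also have "\<dots> \<le> 0" using a by (simp add: divide_nonpos_nonneg)
    finally show ?thesis by (simp add: w_def)
  qed
  have wN: "w k ^ N k = exp a" for k
  proof -
    have "N k \<noteq> 0" using Npos[of k] by simp
    then show ?thesis by (simp add: w_def exp_of_nat_mult[symmetric])
  qed
  have bound: "norm (c k ^ N k - exp a) \<le> norm (?n k * (c k - 1) - a) + exp (norm a) * (norm a)\<^sup>2 / real (N k)" for k
  proof -
    have N0: "real (N k) \<ge> 1" using Npos[of k] by simp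
    have "norm (c k ^ N k - exp a) \<le> real (N k) * norm (c k - w k)"
      using norm_power_diff[OF c[of k] w1[of k], of "N k"] by (simp add: wN)
    also have "norm (c k - w k) \<le> norm ((c k - 1) - a / ?n k) + norm (w k - 1 - a / ?n k)"
    proof -
      have "c k - w k = ((c k - 1) - a / ?n k) - (w k - 1 - a / ?n k)" by simp
      then show ?thesis by (metis norm_triangle_ineq4)
    qed
    also have "norm (w k - 1 - a / ?n k) \<le> exp (norm a) * (norm (a / ?n k))\<^sup>2"
    proof -
      have "norm (w k - (\<Sum>i\<le>1. (a / ?n k) ^ i / fact i)) \<le> exp (norm (a / ?n k)) * norm (a / ?n k) ^ Suc 1 / fact 1"
        unfolding w_def by (rule Taylor_exp_field)
      then have "norm (w k - 1 - a / ?n k) \<le> exp (norm (a / ?n k)) * (norm (a / ?n k))\<^sup>2"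
        by (simp add: power2_eq_square diff_diff_eq)
      also have "\<dots> \<le> exp (norm a) * (norm (a / ?n k))\<^sup>2"
      proof (intro mult_right_mono)
        have "norm (a / ?n k) = norm a / real (N k)" by (simp add: norm_divide)
        also have "\<dots> \<le> norm a / 1" using N0 by (intro divide_left_mono) auto
        finally show "exp (norm (a / ?n k)) \<le> exp (norm a)" by simp
      qed simp
      finally show ?thesis .
    qed
    finally have "norm (c k ^ N k - exp a) \<le> real (N k) * (norm ((c k - 1) - a / ?n k) + exp (norm a) * (norm (a / ?n k))\<^sup>2)"
      using N0 by (simp add: mult_left_mono)
    also have "\<dots> = norm (?n k * (c k - 1) - a) + exp (norm a) * (norm a)\<^sup>2 / real (N k)"
    proof -
      have "real (N k) * norm ((c k - 1) - a / ?n k) = norm (?n k * ((c k - 1) - a / ?n k))"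
        by (simp add: norm_mult)
      also have "?n k * ((c k - 1) - a / ?n k) = ?n k * (c k - 1) - a"
        using N0 by (simp add: right_diff_distrib)
      finally have 1: "real (N k) * norm ((c k - 1) - a / ?n k) = norm (?n k * (c k - 1) - a)" .
      have 2: "real (N k) * (exp (norm a) * (norm (a / ?n k))\<^sup>2) = exp (norm a) * (norm a)\<^sup>2 / real (N k)"
        using N0 by (simp add: norm_divide power2_eq_square field_simps)
      show ?thesis unfolding distrib_left 1 2 ..
    qed
    finally show ?thesis .
  qed
  have "(\<lambda>k. norm (?n k * (c k - 1) - a) + exp (norm a) * (norm a)\<^sup>2 / real (N k)) \<longlonglongrightarrow> 0 + 0"
  proof (rule tendsto_add)
    show "(\<lambda>k. norm (?n k * (c k - 1) - a)) \<longlonglongrightarrow> 0"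
      using lim by (simp add: LIM_zero_iff tendsto_norm_zero_iff)
    show "(\<lambda>k. exp (norm a) * (norm a)\<^sup>2 / real (N k)) \<longlonglongrightarrow> 0"
      by (rule real_tendsto_divide_at_top[OF tendsto_const])
         (rule filterlim_compose[OF filterlim_real_sequentially N])
  qed
  then have lim0: "(\<lambda>k. norm (?n k * (c k - 1) - a) + exp (norm a) * (norm a)\<^sup>2 / real (N k)) \<longlonglongrightarrow> 0"
    by simp
  have "(\<lambda>k. c k ^ N k - exp a) \<longlonglongrightarrow> 0"
    by (rule Lim_null_comparison[OF always_eventually[OF allI[OF bound]] lim0])
  then show ?thesis by (simp add: LIM_zero_iff)
qed

section \<open>Mixtures, rates and cells\<close>

text \<open>The bound on f' makes \<open>f\<close> Lipschitz, and the mean value inequality for the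
  distribution function minus a linear function of slope f x yields the quadratic error.\<close>

lemma twice_diff_bounded_smooth:
  assumes D: "is_real_distr D" and t: "twice_diff_bounded D"
  obtains f L B where "L \<ge> 0" "B \<ge> 0" "\<And>x y. \<bar>cdf D x - cdf D y\<bar> \<le> L * \<bar>x - y\<bar>"
    "\<And>x h. \<bar>cdf D (x + h) - cdf D x - f x * h\<bar> \<le> B * h\<^sup>2" "\<And>x. \<bar>f x\<bar> \<le> L"
proof -
  interpret real_distribution D
    using D unfolding is_real_distr_def real_distribution_def real_distribution_axioms_def by auto
  obtain f f' B where F: "\<And>x. (cdf D has_real_derivative f x) (at x)"
    and f: "\<And>x. (f has_real_derivative f' x) (at x)" and B: "\<And>x. \<bar>f' x\<bar> \<le> B"
    using t unfolding twice_diff_bounded_def by blast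
  have B0: "B \<ge> 0" using order_trans[OF abs_ge_zero B] .
  have flip: "\<bar>f x - f y\<bar> \<le> B * \<bar>x - y\<bar>" for x y
    using field_differentiable_bound[of UNIV f f' B x y] f B by auto
  have taylor: "\<bar>cdf D (x + h) - cdf D x - f x * h\<bar> \<le> B * h\<^sup>2" for x h
  proof -
    have "norm ((cdf D (x + h) - f x * (x + h)) - (cdf D x - f x * x)) \<le> (B * \<bar>h\<bar>) * norm (x + h - x)"
    proof (rule field_differentiable_bound[where S="closed_segment x (x + h)" and f'="\<lambda>y. f y - f x"])
      fix y assume y: "y \<in> closed_segment x (x + h)"
      show "((\<lambda>y. cdf D y - f x * y) has_real_derivative f y - f x) (at y within closed_segment x (x + h))"
        by (rule has_field_derivative_at_within) (auto intro!: derivative_eq_intros F)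
      have "\<bar>y - x\<bar> \<le> \<bar>h\<bar>" using y by (auto simp: closed_segment_eq_real_ivl split: if_splits)
      then show "norm (f y - f x) \<le> B * \<bar>h\<bar>"
        using flip[of y x] B0 by (auto intro: order_trans mult_left_mono)
    qed auto
    then show ?thesis by (simp add: power2_eq_square algebra_simps)
  qed
  \<comment> \<open>The expansion at h = 1: an increment of a distribution function has modulus at
    most 1.\<close>
  have fb: "\<bar>f x\<bar> \<le> 1 + B" for x
  proof -
    have "0 \<le> cdf D x" "cdf D x \<le> 1" "0 \<le> cdf D (x + 1)" "cdf D (x + 1) \<le> 1"
      using cdf_nonneg cdf_bounded_prob by auto
    then show ?thesis using taylor[of x 1] by simp
  qed
  have "\<bar>cdf D x - cdf D y\<bar> \<le> (1 + B) * \<bar>x - y\<bar>" for x y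
    using field_differentiable_bound[of UNIV "cdf D" f "1 + B" x y] F fb by auto
  then show thesis using that[of "1 + B" B f] B0 taylor fb by auto
qed

context
  fixes P Q :: "real measure" and r :: real
  assumes P: "is_real_distr P" and Q: "is_real_distr Q" and r: "0 \<le> r" "r \<le> 1"
begin

lemma sets_mix_distr: "sets (mix_distr r P Q) = sets borel"
  unfolding mix_distr_def by (simp add: sets.sigma_sets_eq[of borel, simplified])

lemma emeasure_mix_distr:
  assumes "A \<in> sets borel"
  shows "emeasure (mix_distr r P Q) A = ennreal (1 - r) * emeasure P A + ennreal r * emeasure Q A"
proof -
  interpret P: prob_space P using P by (simp add: is_real_distr_def)
  interpret Q: prob_space Q using Q by (simp add: is_real_distr_def)
  have sP: "sets P = sets borel" and sQ: "sets Q = sets borel" using P Q by (auto simp: is_real_distr_def)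
  let ?\<mu> = "\<lambda>A. ennreal ((1 - r) * measure P A + r * measure Q A)"
  have eq: "?\<mu> A = ennreal (1 - r) * emeasure P A + ennreal r * emeasure Q A" for A
    using r by (simp add: P.emeasure_eq_measure Q.emeasure_eq_measure ennreal_mult' ennreal_plus)
  have "emeasure (mix_distr r P Q) A = ?\<mu> A"
    unfolding mix_distr_def
  proof (rule emeasure_measure_of_sigma)
    show "sigma_algebra UNIV (sets borel :: real set set)"
      using sets.sigma_algebra_axioms[of "borel :: real measure"] by simp
    show "positive (sets borel) ?\<mu>" by (simp add: positive_def)
    show "countably_additive (sets borel) ?\<mu>"
    proof (rule countably_additiveI)
      fix A :: "nat \<Rightarrow> real set" assume A: "range A \<subseteq> sets borel" "disjoint_family A"
      show "(\<Sum>i. ?\<mu> (A i)) = ?\<mu> (\<Union> (range A))"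
        unfolding eq using A sP sQ
        by (simp add: suminf_add[symmetric] ennreal_suminf_cmult suminf_emeasure)
    qed
  qed fact
  then show ?thesis by (simp add: eq)
qed

lemma measure_mix_distr:
  assumes "A \<in> sets borel"
  shows "measure (mix_distr r P Q) A = (1 - r) * measure P A + r * measure Q A"
proof -
  interpret P: prob_space P using P by (simp add: is_real_distr_def)
  interpret Q: prob_space Q using Q by (simp add: is_real_distr_def)
  have "emeasure (mix_distr r P Q) A = ennreal ((1 - r) * measure P A + r * measure Q A)"
    using r by (simp add: emeasure_mix_distr[OF assms] P.emeasure_eq_measure Q.emeasure_eq_measure ennreal_mult' ennreal_plus)
  then show ?thesis
    using r by (intro measure_eq_emeasure_eq_ennreal) auto
qed

lemma cdf_mix_distr: "cdf (mix_distr r P Q) x = (1 - r) * cdf P x + r * cdf Q x"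
  unfolding cdf_def by (rule measure_mix_distr) auto

lemma nn_integral_mix_distr:
  assumes "f \<in> borel_measurable borel"
  shows "(\<integral>\<^sup>+x. f x \<partial>mix_distr r P Q) = ennreal (1 - r) * (\<integral>\<^sup>+x. f x \<partial>P) + ennreal r * (\<integral>\<^sup>+x. f x \<partial>Q)"
  using assms
proof (induction rule: borel_measurable_induct)
  have sP[measurable_cong]: "sets P = sets borel" and sQ[measurable_cong]: "sets Q = sets borel" using P Q by (auto simp: is_real_distr_def)
  note sM[measurable_cong] = sets_mix_distr
  case (cong f g)
  then have "f = g" by (auto simp: fun_eq_iff)
  with cong show ?case by simp
next
  note sets_eq = sets_mix_distr P[unfolded is_real_distr_def] Q[unfolded is_real_distr_def]
  case (set A)
  then show ?case using sets_eq by (simp add: emeasure_mix_distr)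
next
  note [measurable_cong] = sets_mix_distr P[unfolded is_real_distr_def, THEN conjunct2] Q[unfolded is_real_distr_def, THEN conjunct2]
  case (mult u c)
  note [measurable] = \<open>u \<in> borel_measurable borel\<close>
  show ?case
    by (subst (1 2 3) nn_integral_cmult) (auto simp: mult.IH distrib_left mult_ac mult(4))
next
  note [measurable_cong] = sets_mix_distr P[unfolded is_real_distr_def, THEN conjunct2] Q[unfolded is_real_distr_def, THEN conjunct2]
  case (add u v)
  note [measurable] = \<open>u \<in> borel_measurable borel\<close> \<open>v \<in> borel_measurable borel\<close>
  show ?case
    by (subst (1 2 3) nn_integral_add) (auto simp: add.IH distrib_left add_ac)
next
  note [measurable_cong] = sets_mix_distr P[unfolded is_real_distr_def, THEN conjunct2] Q[unfolded is_real_distr_def, THEN conjunct2]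
  case (seq U)
  note [measurable] = seq(1)
  have inc: "incseq (\<lambda>i. \<integral>\<^sup>+x. U i x \<partial>N)" for N
    using seq(3) by (auto simp: incseq_def le_fun_def intro!: nn_integral_mono)
  have S: "(\<integral>\<^sup>+x. (SUP i. U i) x \<partial>N) = (SUP i. \<integral>\<^sup>+x. U i x \<partial>N)" if "sets N = sets borel" for N
    using nn_integral_monotone_convergence_SUP[OF seq(3), of N] that seq(1)
    by (simp add: SUP_apply image_comp measurable_cong_sets[OF that refl])
  have "(SUP i. ennreal (1 - r) * (\<integral>\<^sup>+x. U i x \<partial>P) + ennreal r * (\<integral>\<^sup>+x. U i x \<partial>Q))
     = (SUP i. ennreal (1 - r) * (\<integral>\<^sup>+x. U i x \<partial>P)) + (SUP i. ennreal r * (\<integral>\<^sup>+x. U i x \<partial>Q))"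
    using inc[of P] inc[of Q] by (intro ennreal_SUP_add) (auto simp: incseq_def intro!: mult_left_mono)
  then have *: "(SUP i. ennreal (1 - r) * (\<integral>\<^sup>+x. U i x \<partial>P) + ennreal r * (\<integral>\<^sup>+x. U i x \<partial>Q))
     = ennreal (1 - r) * (SUP i. \<integral>\<^sup>+x. U i x \<partial>P) + ennreal r * (SUP i. \<integral>\<^sup>+x. U i x \<partial>Q)"
    by (simp only: SUP_mult_left_ennreal)
  have "(\<integral>\<^sup>+x. (SUP i. U i) x \<partial>mix_distr r P Q) = (SUP i. \<integral>\<^sup>+x. U i x \<partial>mix_distr r P Q)"
    by (rule S[OF sets_mix_distr])
  also have "\<dots> = (SUP i. ennreal (1 - r) * (\<integral>\<^sup>+x. U i x \<partial>P) + ennreal r * (\<integral>\<^sup>+x. U i x \<partial>Q))"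
    by (intro SUP_cong refl seq.IH)
  also note *
  also have "(SUP i. \<integral>\<^sup>+x. U i x \<partial>P) = (\<integral>\<^sup>+x. (SUP i. U i) x \<partial>P)"
    by (rule S[symmetric]) (use P in \<open>simp add: is_real_distr_def\<close>)
  also have "(SUP i. \<integral>\<^sup>+x. U i x \<partial>Q) = (\<integral>\<^sup>+x. (SUP i. U i) x \<partial>Q)"
    by (rule S[symmetric]) (use Q in \<open>simp add: is_real_distr_def\<close>)
  finally show ?case .
qed

text \<open>The bound is free of the mixing weight, so one constant serves all innovation laws along
  a sequence.\<close>

lemma mix_distr_second_moment:
  assumes "zero_mean_finite_var P" "zero_mean_finite_var Q"
    and G: "zero_mean_finite_var (mix_distr r P Q)"
  shows "(\<integral>x. x\<^sup>2 \<partial>mix_distr r P Q) \<le> (\<integral>x. x\<^sup>2 \<partial>P) + (\<integral>x. x\<^sup>2 \<partial>Q)"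
proof -
  have nn: "(\<integral>\<^sup>+x. ennreal (x\<^sup>2) \<partial>N) = ennreal (\<integral>x. x\<^sup>2 \<partial>N)" if "zero_mean_finite_var N" for N :: "real measure"
    using that by (intro nn_integral_eq_integral) (auto simp: zero_mean_finite_var_def)
  have "ennreal (\<integral>x. x\<^sup>2 \<partial>mix_distr r P Q) = ennreal (1 - r) * ennreal (\<integral>x. x\<^sup>2 \<partial>P) + ennreal r * ennreal (\<integral>x. x\<^sup>2 \<partial>Q)"
    using nn_integral_mix_distr[of "\<lambda>x. ennreal (x\<^sup>2)"] by (simp add: nn assms)
  also have "\<dots> = ennreal ((1 - r) * (\<integral>x. x\<^sup>2 \<partial>P) + r * (\<integral>x. x\<^sup>2 \<partial>Q))"
    using r by (simp add: ennreal_mult' ennreal_plus)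
  finally have "(\<integral>x. x\<^sup>2 \<partial>mix_distr r P Q) = (1 - r) * (\<integral>x. x\<^sup>2 \<partial>P) + r * (\<integral>x. x\<^sup>2 \<partial>Q)"
    using r by (subst (asm) ennreal_inj) auto
  also have "\<dots> \<le> 1 * (\<integral>x. x\<^sup>2 \<partial>P) + 1 * (\<integral>x. x\<^sup>2 \<partial>Q)"
    using r by (intro add_mono mult_right_mono) auto
  finally show ?thesis by simp
qed

end

text \<open>Lets the symmetry hypothesis be treated as a mixture model with Q = P and weight
  0.\<close>

lemma mix_distr_0: "is_real_distr P \<Longrightarrow> mix_distr 0 P P = P"
proof (rule measure_eqI)
  assume P: "is_real_distr P"
  then show "sets (mix_distr 0 P P) = sets P"
    using sets_mix_distr[of P P 0] by (simp add: is_real_distr_def)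
  fix A assume "A \<in> sets (mix_distr 0 P P)"
  then show "emeasure (mix_distr 0 P P) A = emeasure P A"
    using emeasure_mix_distr[OF P P, of 0 A] sets_mix_distr[OF P P, of 0] by simp
qed

text \<open>The cap at 1 in \<open>rate\<close> is eventually inactive, because c k / sqrt (N k)
  tends to 0.\<close>

lemma rate_limits:
  assumes N: "filterlim N at_top sequentially" and c: "c \<longlonglongrightarrow> C" and pos: "\<And>k. c k \<ge> 0"
  shows "(\<lambda>k. sqrt (real (N k)) * rate (c k) (N k)) \<longlonglongrightarrow> C" "(\<lambda>k. rate (c k) (N k)) \<longlonglongrightarrow> 0"
    "0 \<le> rate (c k) (N k)" "rate (c k) (N k) \<le> 1"
proof -
  have sN: "filterlim (\<lambda>k. sqrt (real (N k))) at_top sequentially"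
    by (intro filterlim_compose[OF sqrt_at_top] filterlim_compose[OF filterlim_real_sequentially N])
  have div: "(\<lambda>k. c k / sqrt (real (N k))) \<longlonglongrightarrow> 0"
    by (rule real_tendsto_divide_at_top[OF c sN])
  have ev: "\<forall>\<^sub>F k in sequentially. rate (c k) (N k) = c k / sqrt (real (N k))"
    using order_tendstoD(2)[OF div, of 1] by (auto elim!: eventually_mono simp: rate_def)
  have "\<forall>\<^sub>F k in sequentially. sqrt (real (N k)) > 0"
    using sN by (rule filterlim_at_top_dense[THEN iffD1, rule_format])
  with ev have "\<forall>\<^sub>F k in sequentially. sqrt (real (N k)) * rate (c k) (N k) = c k"
    by eventually_elim auto
  with c show "(\<lambda>k. sqrt (real (N k)) * rate (c k) (N k)) \<longlonglongrightarrow> C"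
    by (simp add: tendsto_cong)
  show "(\<lambda>k. rate (c k) (N k)) \<longlonglongrightarrow> 0" using div ev by (simp add: tendsto_cong)
  show "0 \<le> rate (c k) (N k)" "rate (c k) (N k) \<le> 1" using pos[of k] by (auto simp: rate_def)
qed

section \<open>Independent innovations: products and the empirical distribution function\<close>

context contam_noise
begin

lemma expectation_prod_eps:
  fixes \<phi> :: "real \<Rightarrow> complex"
  assumes \<phi>[measurable]: "\<phi> \<in> borel_measurable borel" and bd: "\<And>y. norm (\<phi> y) \<le> 1" and "finite T"
  shows "expectation (\<lambda>\<omega>. \<Prod>t\<in>T. \<phi> (eps t \<omega>)) = (\<integral>y. \<phi> y \<partial>G) ^ card T"
  using \<open>finite T\<close>
proof (induction T rule: finite_induct)
  case (insert t T)
  have m1: "(\<lambda>\<omega>. \<phi> (eps t \<omega>)) \<in> borel_measurable (\<F> {Inl t})"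
    using \<F>_eps[of t "{Inl t}"] by simp
  have m2: "(\<lambda>\<omega>. \<Prod>t\<in>T. \<phi> (eps t \<omega>)) \<in> borel_measurable (\<F> (Inl ` T))"
    using \<F>_eps[of _ "Inl ` T"] by (intro borel_measurable_prod) simp
  have d: "{Inl t} \<inter> Inl ` T = {}" using insert by auto
  have i1: "integrable M (\<lambda>\<omega>. \<phi> (eps t \<omega>))"
    by (rule integrable_const_bound[of _ 1]) (use bd in auto)
  have i2: "integrable M (\<lambda>\<omega>. \<Prod>t\<in>T. \<phi> (eps t \<omega>))"
    by (rule integrable_const_bound[of _ 1]) (use bd in \<open>auto simp: prod_norm[symmetric] intro!: prod_le_1\<close>)
  have "expectation (\<lambda>\<omega>. \<phi> (eps t \<omega>) * (\<Prod>t\<in>T. \<phi> (eps t \<omega>))) = expectation (\<lambda>\<omega>. \<phi> (eps t \<omega>)) * expectation (\<lambda>\<omega>. \<Prod>t\<in>T. \<phi> (eps t \<omega>))"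
    by (rule indep_var_lebesgue_integral[OF \<F>_indep[OF d m1 m2] i1 i2])
  also have "expectation (\<lambda>\<omega>. \<phi> (eps t \<omega>)) = (\<integral>y. \<phi> y \<partial>G)"
    unfolding eps_distr[of t, symmetric] by (subst integral_distr) auto
  finally show ?case using insert by simp
qed (simp add: prob_space)

lemma ecdf_deviation:
  "integrable M (\<lambda>\<omega>. \<bar>\<Sum>t=1..int n. below (eps t \<omega>) y - cdf G y\<bar>)"
  "expectation (\<lambda>\<omega>. \<bar>\<Sum>t=1..int n. below (eps t \<omega>) y - cdf G y\<bar>) \<le> sqrt (real n)"
proof -
  interpret G: real_distribution G
    using G unfolding is_real_distr_def real_distribution_def real_distribution_axioms_def by auto
  define D where "D t \<omega> = below (eps t \<omega>) y - cdf G y" for t \<omega>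
  have [measurable]: "D t \<in> borel_measurable M" for t unfolding D_def by measurable
  have D1: "\<bar>D t \<omega>\<bar> \<le> 1" for t \<omega>
    using G.cdf_nonneg[of y] G.cdf_bounded_prob[of y] unfolding D_def below_def by auto
  have bdi: "integrable M h" if "h \<in> borel_measurable M" "\<And>\<omega>. \<bar>h \<omega>\<bar> \<le> 1" for h :: "'a \<Rightarrow> real"
    using that by (intro integrable_const_bound[of _ 1]) auto
  have Di: "integrable M (D t)" for t by (rule bdi) (use D1 in auto)
  have sq1: "(D t \<omega>)\<^sup>2 \<le> 1" for t \<omega> using D1[of t \<omega>] by (simp add: abs_square_le_1)
  have sq: "integrable M (\<lambda>\<omega>. (D t \<omega>)\<^sup>2)" for t by (rule bdi) (use sq1 in auto)
  have b: "expectation (\<lambda>\<omega>. below (eps t \<omega>) y) = cdf G y" for t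
  proof -
    have "expectation (\<lambda>\<omega>. below (eps t \<omega>) y) = (\<integral>e. below e y \<partial>G)"
      unfolding eps_distr[of t, symmetric] by (subst integral_distr) auto
    also have "\<dots> = (\<integral>e. indicator {..y} e \<partial>G)"
      by (intro Bochner_Integration.integral_cong) (auto simp: below_def)
    finally show ?thesis by (simp add: cdf_def)
  qed
  have bi: "integrable M (\<lambda>\<omega>. below (eps t \<omega>) y)" for t by (rule bdi) auto
  have D0: "expectation (D t) = 0" for t
    unfolding D_def using b bi by (simp add: prob_space)
  have orth: "expectation (\<lambda>\<omega>. D r \<omega> * D t \<omega>) = 0" if "r \<noteq> t" for r t
  proof -
    have m: "D q \<in> borel_measurable (\<F> {Inl q})" for q
    proof -
      have [measurable]: "eps q \<in> borel_measurable (\<F> {Inl q})" by (rule \<F>_eps) simp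
      show ?thesis unfolding D_def by measurable
    qed
    have d: "{Inl r} \<inter> {Inl t} = {}" using that by auto
    show ?thesis using indep_expectation_mult(1)[OF d m m Di Di] D0 by simp
  qed
  note * = second_moment_orthogonal_sum[of "{1..int n}" D, OF _ _ sq orth, simplified]
  have "expectation (\<lambda>\<omega>. \<bar>\<Sum>t=1..int n. D t \<omega>\<bar>) \<le> sqrt (expectation (\<lambda>\<omega>. (\<Sum>t=1..int n. D t \<omega>)\<^sup>2))"
    by (rule expectation_abs_le_sqrt) (auto intro: *)
  also have "\<dots> \<le> sqrt (\<Sum>t=1..int n. 1)"
    unfolding *(1)
  proof (intro real_sqrt_le_mono sum_mono)
    fix t
    have "expectation (\<lambda>\<omega>. (D t \<omega>)\<^sup>2) \<le> expectation (\<lambda>\<omega>. 1)"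
      by (rule integral_mono[OF sq _ sq1]) simp
    then show "expectation (\<lambda>\<omega>. (D t \<omega>)\<^sup>2) \<le> 1" by (simp add: prob_space)
  qed
  finally show "expectation (\<lambda>\<omega>. \<bar>\<Sum>t=1..int n. below (eps t \<omega>) y - cdf G y\<bar>) \<le> sqrt (real n)"
    unfolding D_def by simp
  have "integrable M (\<lambda>\<omega>. \<bar>\<Sum>t=1..int n. D t \<omega>\<bar>)"
    by (intro integrable_abs Bochner_Integration.integrable_sum Di)
  then show "integrable M (\<lambda>\<omega>. \<bar>\<Sum>t=1..int n. below (eps t \<omega>) y - cdf G y\<bar>)" unfolding D_def .
qed

end

text \<open>The argument \<open>w\<close> is the value of \<open>F\<close> at infinity, the position
  of the last cell boundary: 1 for indicators and distribution functions, the sample size for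
  counts, 0 for \<open>Delta\<close>. At minus infinity the value is 0 in each of these cases, so
  \<open>incr_minus\<close> has no such argument.\<close>

definition incr_plus :: "(nat \<Rightarrow> real) \<Rightarrow> nat \<Rightarrow> (real \<Rightarrow> real) \<Rightarrow> real \<Rightarrow> nat \<Rightarrow> real" where
  "incr_plus x m F w j = (if j = m then w else F (x j)) - F (x (j - 1))"

definition incr_minus :: "(nat \<Rightarrow> real) \<Rightarrow> nat \<Rightarrow> (real \<Rightarrow> real) \<Rightarrow> nat \<Rightarrow> real" where
  "incr_minus x m F j = F (- x (j - 1)) - (if j = m then 0 else F (- x j))"

lemma incr_sum:
  "incr_plus x m (\<lambda>y. \<Sum>t\<in>T. F t y) (\<Sum>t\<in>T. w t) j = (\<Sum>t\<in>T. incr_plus x m (F t) (w t) j)"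
  "incr_minus x m (\<lambda>y. \<Sum>t\<in>T. F t y) j = (\<Sum>t\<in>T. incr_minus x m (F t) j)"
  by (auto simp: incr_plus_def incr_minus_def sum_subtractf)

lemma delta_j_incr: "delta_j p \<beta> P GE x m j = incr_plus x m (Delta p \<beta> P GE) 0 j - incr_minus x m (Delta p \<beta> P GE) j"
  by (auto simp: delta_j_def incr_plus_def incr_minus_def)

locale bins =
  fixes x :: "nat \<Rightarrow> real" and m :: nat
  assumes m: "m \<ge> 1" and x0: "x 0 = 0" and xmono: "\<And>j. j + 1 < m \<Longrightarrow> x j < x (j + 1)"
begin

lemma x_mono: "i \<le> j \<Longrightarrow> j < m \<Longrightarrow> x i \<le> x j"
proof (induction rule: dec_induct)
  case (step k)
  then show ?case using xmono[of k] by simp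
qed simp

lemma x_nonneg: "j < m \<Longrightarrow> x j \<ge> 0"
  using x_mono[of 0 j] x0 by simp

lemma bin_plus_pos:
  assumes "e \<in> bin_plus x m j" "j \<in> {1..m}"
  shows "e > 0"
proof -
  have "x (j - 1) \<ge> 0" using assms by (intro x_nonneg) auto
  with assms show ?thesis by (auto simp: bin_plus_def split: if_splits)
qed

lemma bin_minus_nonpos:
  assumes "e \<in> bin_minus x m j" "j \<in> {1..m}"
  shows "e \<le> 0"
proof -
  have "x (j - 1) \<ge> 0" using assms by (intro x_nonneg) auto
  with assms show ?thesis by (auto simp: bin_minus_def split: if_splits)
qed

text \<open>Reduces cells to half-lines: cell counts and cell probabilities become linear in
  \<open>below\<close> at the finitely many cell boundaries.\<close>

lemma indicator_bin_plus:
  assumes "j \<in> {1..m}"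
  shows "indicator (bin_plus x m j) e = incr_plus x m (below e) 1 j"
proof -
  have "j \<noteq> m \<Longrightarrow> x (j - 1) \<le> x j" using assms by (intro x_mono) auto
  then show ?thesis by (cases "j = m") (auto simp: bin_plus_def incr_plus_def below_def indicator_def)
qed

lemma indicator_bin_minus:
  assumes "j \<in> {1..m}"
  shows "indicator (bin_minus x m j) e = incr_minus x m (below e) j"
proof -
  have "j \<noteq> m \<Longrightarrow> x (j - 1) \<le> x j" using assms by (intro x_mono) auto
  then show ?thesis by (cases "j = m") (auto simp: bin_minus_def incr_minus_def below_def indicator_def)
qed

lemma bins_borel[measurable]: "bin_plus x m j \<in> sets borel" "bin_minus x m j \<in> sets borel"
  by (auto simp: bin_plus_def bin_minus_def)

lemma measure_bins:
  assumes "real_distribution D" "j \<in> {1..m}"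
  shows "measure D (bin_plus x m j) = incr_plus x m (cdf D) 1 j" "measure D (bin_minus x m j) = incr_minus x m (cdf D) j"
proof -
  interpret real_distribution D by fact
  have b: "integrable D (\<lambda>e. below e y)" for y
    by (rule integrable_const_bound[of _ 1]) auto
  have c: "(\<integral>e. below e y \<partial>D) = cdf D y" for y
  proof -
    have "(\<integral>e. below e y \<partial>D) = (\<integral>e. indicator {..y} e \<partial>D)"
      by (intro Bochner_Integration.integral_cong) (auto simp: below_def)
    then show ?thesis by (simp add: cdf_def)
  qed
  have "measure D (bin_plus x m j) = (\<integral>e. indicator (bin_plus x m j) e \<partial>D)" by simp
  also have "\<dots> = (\<integral>e. incr_plus x m (below e) 1 j \<partial>D)"
    unfolding indicator_bin_plus[OF assms(2)] ..
  also have "\<dots> = incr_plus x m (cdf D) 1 j"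
    using b c prob_space by (simp add: incr_plus_def)
  finally show "measure D (bin_plus x m j) = incr_plus x m (cdf D) 1 j" .
  have "measure D (bin_minus x m j) = (\<integral>e. indicator (bin_minus x m j) e \<partial>D)" by simp
  also have "\<dots> = (\<integral>e. incr_minus x m (below e) j \<partial>D)"
    unfolding indicator_bin_minus[OF assms(2)] ..
  also have "\<dots> = incr_minus x m (cdf D) j"
    using b c by (simp add: incr_minus_def)
  finally show "measure D (bin_minus x m j) = incr_minus x m (cdf D) j" .
qed

lemma card_bins:
  fixes R :: "'t \<Rightarrow> real"
  assumes T: "finite T" and j: "j \<in> {1..m}"
  shows "real (card {t\<in>T. R t \<in> bin_plus x m j}) = incr_plus x m (\<lambda>y. \<Sum>t\<in>T. below (R t) y) (real (card T)) j"
    "real (card {t\<in>T. R t \<in> bin_minus x m j}) = incr_minus x m (\<lambda>y. \<Sum>t\<in>T. below (R t) y) j"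
proof -
  have c: "real (card {t\<in>T. R t \<in> S}) = (\<Sum>t\<in>T. indicator S (R t))" for S
  proof -
    have "(\<Sum>t\<in>T. indicator S (R t)) = (\<Sum>t\<in>{t\<in>T. R t \<in> S}. 1 :: real)"
      using T by (intro sum.mono_neutral_cong_right) auto
    then show ?thesis by simp
  qed
  have t: "real (card T) = (\<Sum>t\<in>T. 1)" by simp
  show "real (card {t\<in>T. R t \<in> bin_plus x m j}) = incr_plus x m (\<lambda>y. \<Sum>t\<in>T. below (R t) y) (real (card T)) j"
    unfolding c t incr_sum indicator_bin_plus[OF j] ..
  show "real (card {t\<in>T. R t \<in> bin_minus x m j}) = incr_minus x m (\<lambda>y. \<Sum>t\<in>T. below (R t) y) j"
    unfolding c incr_sum indicator_bin_minus[OF j] ..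
qed

abbreviation bin_sign :: "nat \<Rightarrow> real \<Rightarrow> real" where
  "bin_sign j e \<equiv> indicator (bin_plus x m j) e - indicator (bin_minus x m j) e"

text \<open>The 2 m cells are pairwise disjoint. Mixed second moments of the cell signs therefore
  vanish, which makes the limiting covariance matrix diagonal.\<close>

lemma bin_sign_orthogonal:
  assumes i: "i \<in> {1..m}" and j: "j \<in> {1..m}" and "i \<noteq> j"
  shows "bin_sign i e * bin_sign j e = 0"
proof -
  note pos = bin_plus_pos[of e] and neg = bin_minus_nonpos[of e]
  have dp: "\<not> (e \<in> bin_plus x m a \<and> e \<in> bin_plus x m b)" if "a < b" "a \<in> {1..m}" "b \<in> {1..m}" for a b
    proof -
    have "x a \<le> x (b - 1)" using that by (intro x_mono) auto
    then show ?thesis using that by (auto simp: bin_plus_def split: if_splits)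
  qed
  have dm: "\<not> (e \<in> bin_minus x m a \<and> e \<in> bin_minus x m b)" if "a < b" "a \<in> {1..m}" "b \<in> {1..m}" for a b
    proof -
    have "x a \<le> x (b - 1)" using that by (intro x_mono) auto
    then show ?thesis using that by (auto simp: bin_minus_def split: if_splits)
  qed
  show ?thesis
    using pos[OF _ i] pos[OF _ j] neg[OF _ i] neg[OF _ j] dp[of i j] dp[of j i] dm[of i j] dm[of j i] i j \<open>i \<noteq> j\<close>
    by (cases "i < j"; force simp: indicator_def)
qed

lemma bin_sign_square:
  assumes j: "j \<in> {1..m}"
  shows "bin_sign j e * bin_sign j e = indicator (bin_plus x m j) e + indicator (bin_minus x m j) e"
  using bin_plus_pos[OF _ j, of e] bin_minus_nonpos[OF _ j, of e] by (auto simp: indicator_def)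

end

text \<open>Reflection turns the half-line up to y into the closed half-line from - y on; continuity
  discards the boundary point.\<close>

lemma symmetric_distr_cdf:
  assumes D: "is_real_distr D" and sym: "symmetric_distr D" and cont: "isCont (cdf D) (- y)"
  shows "cdf D (- y) = 1 - cdf D y"
proof -
  interpret real_distribution D
    using D unfolding is_real_distr_def real_distribution_def real_distribution_axioms_def by auto
  have "measure D {- y} = 0" using cont by (simp add: isCont_cdf)
  have "cdf D y = measure (distr D borel uminus) {..y}"
    using sym unfolding cdf_def symmetric_distr_def by simp
  also have "\<dots> = measure D {- y..}"
    by (subst measure_distr) (auto intro!: arg_cong[where f="measure D"])
  also have "\<dots> = measure D ({- y} \<union> {- y<..})"
    by (intro arg_cong[where f="measure D"]) auto
  also have "\<dots> = measure D {- y<..}"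
    using \<open>measure D {- y} = 0\<close> by (subst finite_measure_Union) auto
  also have "\<dots> = measure D (space D - {..- y})"
    by (intro arg_cong[where f="measure D"]) auto
  also have "\<dots> = 1 - cdf D (- y)"
    unfolding cdf_def by (rule prob_compl) auto
  finally show ?thesis by simp
qed

section \<open>Limits along a sequence of models\<close>

text \<open>Sample sizes \<open>N k\<close> tend to infinity while \<open>cs k\<close> and \<open>rs k\<close> (the \<open>\<gamma>\<close> and \<open>\<rho>\<close> of the \<open>k\<close>-th model) converge.\<close>

locale AR_seq = bins x m
  for x :: "nat \<Rightarrow> real" and m :: nat +
  fixes p :: nat and \<beta> :: "nat \<Rightarrow> real" and P Q GE :: "real measure"
    and N :: "nat \<Rightarrow> nat" and cs rs :: "nat \<Rightarrow> real" and c r :: real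
    and M :: "nat \<Rightarrow> 'a measure" and eps z xi u :: "nat \<Rightarrow> int \<Rightarrow> 'a \<Rightarrow> real"
    and bh :: "nat \<Rightarrow> 'a \<Rightarrow> nat \<Rightarrow> real"
  assumes causal: "causal_coeffs p \<beta>"
    and P: "is_real_distr P" and Q: "is_real_distr Q" and GE: "is_real_distr GE"
    and sym: "symmetric_distr P"
    and P_mom: "zero_mean_finite_var P" and Q_mom: "zero_mean_finite_var Q"
    and P_smooth: "twice_diff_bounded P" and Q_smooth: "twice_diff_bounded Q"
    and pplus: "\<And>j. j \<in> {1..m} \<Longrightarrow> measure P (bin_plus x m j) > 0"
    and N: "filterlim N at_top sequentially" and N1: "\<And>k. N k \<ge> 1"
    and cs: "cs \<longlonglongrightarrow> c" "\<And>k. cs k \<ge> 0" and rs: "rs \<longlonglongrightarrow> r" "\<And>k. rs k \<ge> 0"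
    and model: "\<And>k. AR_contam_model p \<beta> (mix_distr (rate (rs k) (N k)) P Q) GE (rate (cs k) (N k))
        (M k) (eps k) (z k) (xi k) (u k)"
    and bh_meas: "\<And>k i. (\<lambda>\<omega>. bh k \<omega> i) \<in> borel_measurable (M k)"
    and bh_tight: "\<And>e. e > 0 \<Longrightarrow> \<exists>C. \<forall>\<^sub>F k in sequentially. measure (M k) {\<omega>\<in>space (M k).
        sqrt (real (N k)) * sqrt (\<Sum>i=1..p. (bh k \<omega> i - \<beta> i)\<^sup>2) > C} < e"
begin

abbreviation "G k \<equiv> mix_distr (rate (rs k) (N k)) P Q"
abbreviation "g k \<equiv> rate (cs k) (N k)"
abbreviation "q k \<equiv> rate (rs k) (N k)"
abbreviation "rN k \<equiv> sqrt (real (N k))"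

definition b :: "nat \<Rightarrow> real" where "b j = (if j = 0 then -1 else \<beta> j)"

lemma M: "prob_space (M k)"
  using model[of k] by (simp add: AR_contam_model_def)

lemmas g_lim = rate_limits[OF N cs] and q_lim = rate_limits[OF N rs]

lemma rN_pos: "rN k > 0" using N1[of k] by simp

lemma rN_lim: "filterlim rN at_top sequentially"
  by (intro filterlim_compose[OF sqrt_at_top] filterlim_compose[OF filterlim_real_sequentially N])

lemma inv_rN: "(\<lambda>k. a / rN k) \<longlonglongrightarrow> 0"
  by (rule real_tendsto_divide_at_top[OF tendsto_const rN_lim])

lemma cdf_G: "cdf (G k) y = (1 - q k) * cdf P y + q k * cdf Q y"
  by (rule cdf_mix_distr[OF P Q q_lim(3,4)])

lemma real_distrs: "real_distribution P" "real_distribution Q" "real_distribution GE" "real_distribution (G k)"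
  using P Q GE model[of k] unfolding AR_contam_model_def is_real_distr_def real_distribution_def real_distribution_axioms_def by auto

lemma cdf_G_lim: "(\<lambda>k. cdf (G k) y) \<longlonglongrightarrow> cdf P y"
proof -
  have "(\<lambda>k. (1 - q k) * cdf P y + q k * cdf Q y) \<longlonglongrightarrow> (1 - 0) * cdf P y + 0 * cdf Q y"
    by (intro tendsto_intros q_lim)
  then show ?thesis unfolding cdf_G by simp
qed

text \<open>Every innovation law is a convex combination of \<open>P\<close> and \<open>Q\<close>,
  so the sums of their smoothness constants serve all \<open>k\<close>; a common variance bound
  likewise yields a common \<open>K\<close>.\<close>

lemma arrays:
  obtains v K L B f where "\<And>k. contam_array (M k) (G k) GE (g k) (eps k) (z k) (xi k) (v k) (N k) K L B (f k)"
    "\<And>k. AE \<omega> in M k. \<forall>t. u k t \<omega> = v k t \<omega>"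
proof -
  obtain fP LP BP where fP: "LP \<ge> 0" "BP \<ge> 0" "\<And>x y. \<bar>cdf P x - cdf P y\<bar> \<le> LP * \<bar>x - y\<bar>"
    "\<And>x h. \<bar>cdf P (x + h) - cdf P x - fP x * h\<bar> \<le> BP * h\<^sup>2" "\<And>x. \<bar>fP x\<bar> \<le> LP"
    using twice_diff_bounded_smooth[OF P P_smooth] by metis
  obtain fQ LQ BQ where fQ: "LQ \<ge> 0" "BQ \<ge> 0" "\<And>x y. \<bar>cdf Q x - cdf Q y\<bar> \<le> LQ * \<bar>x - y\<bar>"
    "\<And>x h. \<bar>cdf Q (x + h) - cdf Q x - fQ x * h\<bar> \<le> BQ * h\<^sup>2" "\<And>x. \<bar>fQ x\<bar> \<le> LQ"
    using twice_diff_bounded_smooth[OF Q Q_smooth] by metis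
  define S where "S = (\<integral>x. x\<^sup>2 \<partial>P) + (\<integral>x. x\<^sup>2 \<partial>Q)"
  obtain K where K: "K \<ge> 0" "\<And>(M :: 'a measure) G GE g eps z xi u. AR_contam_model p \<beta> G GE g M eps z xi u \<Longrightarrow> (\<integral>x. x\<^sup>2 \<partial>G) \<le> S \<Longrightarrow>
      (\<exists>v. causal_version K M eps z xi v \<and> (AE \<omega> in M. \<forall>t. u t \<omega> = v t \<omega>))"
    using AR_causal_representation[OF causal, of S] by blast
  have "(\<integral>x. x\<^sup>2 \<partial>G k) \<le> S" for k
    unfolding S_def by (rule mix_distr_second_moment[OF P Q q_lim(3,4) P_mom Q_mom])
      (use model[of k] in \<open>simp add: AR_contam_model_def\<close>)
  from K(2)[OF model this] obtain v where v: "\<And>k. causal_version K (M k) (eps k) (z k) (xi k) (v k)"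
    "\<And>k. AE \<omega> in M k. \<forall>t. u k t \<omega> = v k t \<omega>" by metis
  define f where "f k y = (1 - q k) * fP y + q k * fQ y" for k y
  have mix: "\<bar>(1 - q k) * a + q k * b'\<bar> \<le> A + B'" if "\<bar>a\<bar> \<le> A" "\<bar>b'\<bar> \<le> B'" for k a b' A B'
  proof -
    have "\<bar>(1 - q k) * a\<bar> \<le> 1 * A" "\<bar>q k * b'\<bar> \<le> 1 * B'"
      unfolding abs_mult using that q_lim(3,4)[of k] by (intro mult_mono; simp)+
    then show ?thesis by linarith
  qed
  show thesis
  proof (rule that[of v K "LP + LQ" "BP + BQ" f])
    fix k
    interpret contam_noise "M k" "G k" GE "g k" "eps k" "z k" "xi k"
      by (rule AR_contam_model_noise[OF model])
    show "contam_array (M k) (G k) GE (g k) (eps k) (z k) (xi k) (v k) (N k) K (LP + LQ) (BP + BQ) (f k)"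
    proof (unfold_locales)
      show "causal_version K (M k) (eps k) (z k) (xi k) (v k)" by (rule v)
      show "K \<ge> 0" "1 \<le> N k" "0 \<le> LP + LQ" "0 \<le> BP + BQ" using K N1 fP fQ by auto
      fix y y' h :: real
      have "cdf (G k) y - cdf (G k) y' = (1 - q k) * (cdf P y - cdf P y') + q k * (cdf Q y - cdf Q y')"
        unfolding cdf_G by (simp add: algebra_simps)
      then show "\<bar>cdf (G k) y - cdf (G k) y'\<bar> \<le> (LP + LQ) * \<bar>y - y'\<bar>"
        using mix[OF fP(3)[of y y'] fQ(3)[of y y']] by (simp add: distrib_right)
      have "cdf (G k) (y + h) - cdf (G k) y - f k y * h
        = (1 - q k) * (cdf P (y + h) - cdf P y - fP y * h) + q k * (cdf Q (y + h) - cdf Q y - fQ y * h)"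
        unfolding cdf_G f_def by (simp add: algebra_simps)
      then show "\<bar>cdf (G k) (y + h) - cdf (G k) y - f k y * h\<bar> \<le> (BP + BQ) * h\<^sup>2"
        using mix[OF fP(4)[of y h] fQ(4)[of y h]] by (simp add: distrib_right)
      show "\<bar>f k y\<bar> \<le> LP + LQ" unfolding f_def by (rule mix[OF fP(5) fQ(5)])
    qed
  qed (rule v(2))
qed

definition kap :: "real \<Rightarrow> real" where "kap a = (\<integral>w. min 1 (a * \<bar>w\<bar>) \<partial>GE)"

text \<open>Dominated convergence with the bound 1, which the truncation supplies for any gross
  error law.\<close>

lemma kap_lim: "(\<lambda>k. kap (a / rN k)) \<longlonglongrightarrow> 0" if "a \<ge> 0"
proof -
  interpret GE: real_distribution GE by (rule real_distrs)
  have "(\<lambda>k. kap (a / rN k)) \<longlonglongrightarrow> (\<integral>w. 0 \<partial>GE)"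
    unfolding kap_def
  proof (rule integral_dominated_convergence[where w="\<lambda>_. 1"])
    have "(\<lambda>k. min 1 (a / rN k * \<bar>w\<bar>)) \<longlonglongrightarrow> min 1 (0 * \<bar>w\<bar>)" for w
      by (intro tendsto_intros inv_rN)
    then show "AE w in GE. (\<lambda>k. min 1 (a / rN k * \<bar>w\<bar>)) \<longlonglongrightarrow> 0" by simp
    show "AE w in GE. norm (min 1 (a / rN k * \<bar>w\<bar>)) \<le> 1" for k
      using that rN_pos[of k] by (intro AE_I2) (auto simp: min_def)
  qed auto
  then show ?thesis by simp
qed

text \<open>\<open>Delta\<close> is formed with \<open>P\<close>, the hit means with the mixture;
  the difference disappears because the mixing weight tends to 0.\<close>

lemma hit_mean_lim:
  "(\<lambda>k. \<Sum>j=0..p. \<integral>w. cdf (G k) (y + b j * w) - cdf (G k) y \<partial>GE) \<longlonglongrightarrow> Delta p \<beta> P GE y"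
proof -
  interpret GE: real_distribution GE by (rule real_distrs)
  interpret P: real_distribution P by (rule real_distrs)
  have cm: "cdf D \<in> borel_measurable borel" if "real_distribution D" for D
  proof -
    interpret real_distribution D by fact
    show ?thesis by (intro borel_measurable_mono) (auto simp: mono_def intro: cdf_nondecreasing)
  qed
  note [measurable] = cm[OF real_distrs(1)] cm[OF real_distrs(4)]
  have "(\<lambda>k. \<integral>w. cdf (G k) (y + b j * w) - cdf (G k) y \<partial>GE) \<longlonglongrightarrow> (\<integral>w. cdf P (y + b j * w) - cdf P y \<partial>GE)" for j
  proof (rule integral_dominated_convergence[where w="\<lambda>_. 1"])
    show "AE w in GE. (\<lambda>k. cdf (G k) (y + b j * w) - cdf (G k) y) \<longlonglongrightarrow> cdf P (y + b j * w) - cdf P y"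
      by (intro AE_I2 tendsto_intros cdf_G_lim)
    show "AE w in GE. norm (cdf (G k) (y + b j * w) - cdf (G k) y) \<le> 1" for k
    proof (intro AE_I2)
      fix w
      interpret real_distribution "G k" by (rule real_distrs)
      show "norm (cdf (G k) (y + b j * w) - cdf (G k) y) \<le> 1"
        using cdf_nonneg[of y] cdf_nonneg[of "y + b j * w"] cdf_bounded_prob[of y] cdf_bounded_prob[of "y + b j * w"]
        by simp
    qed
  qed auto
  then have "(\<lambda>k. \<Sum>j=0..p. \<integral>w. cdf (G k) (y + b j * w) - cdf (G k) y \<partial>GE) \<longlonglongrightarrow> (\<Sum>j=0..p. \<integral>w. cdf P (y + b j * w) - cdf P y \<partial>GE)"
    by (intro tendsto_sum)
  moreover have "(\<integral>w. cdf P (y + b j * w) - cdf P y \<partial>GE) = (\<integral>w. cdf P (y + b j * w) \<partial>GE) - cdf P y" for j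
  proof -
    have "integrable GE (\<lambda>w. cdf P (y + b j * w))"
      using P.cdf_nonneg P.cdf_bounded_prob by (intro GE.integrable_const_bound[of _ 1]) auto
    then show ?thesis using GE.prob_space by simp
  qed
  ultimately show ?thesis
    unfolding Delta_def b_def by simp
qed

abbreviation "yo k \<omega> \<equiv> \<lambda>t. yobs (u k) (z k) (xi k) t \<omega>"

definition resid :: "nat \<Rightarrow> int \<Rightarrow> 'a \<Rightarrow> real" where
  "resid k t \<omega> = residual p (bh k \<omega>) (yo k \<omega>) t"

lemma finite_interval_net:
  fixes C \<eta> :: real
  assumes "\<eta> > 0" "C \<ge> 0"
  obtains T :: "(nat \<Rightarrow> real) set" where "finite T" "\<And>\<tau> i. \<tau> \<in> T \<Longrightarrow> i \<in> {1..p} \<Longrightarrow> \<bar>\<tau> i\<bar> \<le> C"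
    "\<And>\<tau>. (\<And>i. i \<in> {1..p} \<Longrightarrow> \<bar>\<tau> i\<bar> \<le> C) \<Longrightarrow> \<exists>\<tau>'\<in>T. \<forall>i\<in>{1..p}. \<bar>\<tau> i - \<tau>' i\<bar> \<le> \<eta>"
proof -
  obtain F where F: "finite F" "F \<subseteq> {-C..C}" "{-C..C} \<subseteq> (\<Union>y\<in>F. ball y \<eta>)"
    using seq_compact_imp_totally_bounded[of "{-C..C}"] assms(1) compact_imp_seq_compact[of "{-C..C}"] by auto
  show thesis
  proof (rule that[of "PiE {1..p} (\<lambda>_. F)"])
    show "finite (PiE {1..p} (\<lambda>_. F))" using F by (intro finite_PiE) auto
    fix \<tau> i assume "\<tau> \<in> PiE {1..p} (\<lambda>_. F)" "i \<in> {1..p}"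
    then have "\<tau> i \<in> F" by (rule PiE_mem)
    then have "\<tau> i \<in> {-C..C}" using F by blast
    then show "\<bar>\<tau> i\<bar> \<le> C" by auto
  next
    fix \<tau> :: "nat \<Rightarrow> real" assume \<tau>: "\<And>i. i \<in> {1..p} \<Longrightarrow> \<bar>\<tau> i\<bar> \<le> C"
    have "\<exists>y\<in>F. \<bar>\<tau> i - y\<bar> \<le> \<eta>" if "i \<in> {1..p}" for i
    proof -
      have "\<tau> i \<in> {-C..C}" using \<tau>[OF that] by auto
      then obtain y where "y \<in> F" "\<tau> i \<in> ball y \<eta>" using F by blast
      then show ?thesis by (intro bexI[of _ y]) (auto simp: dist_real_def)
    qed
    then obtain h where h: "\<And>i. i \<in> {1..p} \<Longrightarrow> h i \<in> F \<and> \<bar>\<tau> i - h i\<bar> \<le> \<eta>" by metis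
    show "\<exists>\<tau>'\<in>PiE {1..p} (\<lambda>_. F). \<forall>i\<in>{1..p}. \<bar>\<tau> i - \<tau>' i\<bar> \<le> \<eta>"
      using h by (intro bexI[of _ "restrict h {1..p}"]) auto
  qed
qed

text \<open>Tightness confines the rescaled estimation error to a cube, where a net point at
  distance at most \<eta> replaces it; the finitely many net points are controlled together in mean.
  The order of choices is the size of the cube, then \<eta>, then the net, then
  \<open>k\<close>.\<close>

lemma resid_count_shift:
  "oprob M (\<lambda>k \<omega>. (\<Sum>t=1..int (N k). below (resid k t \<omega>) y - below (eps k t \<omega>) y) / rN k - c * Delta p \<beta> P GE y)"
proof -
  obtain v K L B f where arr: "\<And>k. contam_array (M k) (G k) GE (g k) (eps k) (z k) (xi k) (v k) (N k) K L B (f k)"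
    and uv: "\<And>k. AE \<omega> in M k. \<forall>t. u k t \<omega> = v k t \<omega>"
    by (rule arrays) (rule that)
  interpret A: contam_array "M k" "G k" GE "g k" "eps k" "z k" "xi k" "v k" p b "N k" K L B "f k" for k
    by (rule arr)
  have K0: "K \<ge> 0" and L0: "L \<ge> 0" using A.K A.L by auto
  have kap: "A.\<kappa> = kap" by (auto simp: A.\<kappa>_def kap_def fun_eq_iff)
  \<comment> \<open>The rescaled estimation error depends on the sample point, so it occurs in
    pathwise statements only, never under an expectation.\<close>
  define \<tau> where "\<tau> k \<omega> i = rN k * (bh k \<omega> i - \<beta> i)" for k \<omega> i
  let ?dev = "\<lambda>k \<omega>. A.shift_dev k y (\<tau> k \<omega>) \<omega>"
  \<comment> \<open>The constructions for bounded \<tau> carry the bound as a premise; at a single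
    sample point some bound always exists.\<close>
  have bnd: "\<exists>C\<ge>0. \<forall>i\<in>{1..p}. \<bar>\<tau>' i\<bar> \<le> C" for \<tau>' :: "nat \<Rightarrow> real"
    by (intro exI[of _ "\<Sum>i=1..p. \<bar>\<tau>' i\<bar>"]) (auto intro!: sum_nonneg member_le_sum)
  \<comment> \<open>Exact outside the null set where \<open>u\<close> differs from its causal
    version: a residual is at most \<open>y\<close> iff the innovation is at most the shifted
    threshold. The second summand is the deterministic error of the centring.\<close>
  have dev_eq: "AE \<omega> in M k. ?dev k \<omega> + (rN k * g k * (\<Sum>j=0..p. \<integral>w. cdf (G k) (y + b j * w) - cdf (G k) y \<partial>GE) - c * Delta p \<beta> P GE y)
     = (\<Sum>t=1..int (N k). below (resid k t \<omega>) y - below (eps k t \<omega>) y) / rN k - c * Delta p \<beta> P GE y" for k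
    using uv[of k] AE_space
  proof eventually_elim
    case (elim \<omega>)
    obtain C where C: "C \<ge> 0" "\<And>i. i \<in> {1..p} \<Longrightarrow> \<bar>\<tau> k \<omega> i\<bar> \<le> C" using bnd[of "\<tau> k \<omega>"] by blast
    have rec: "u k t \<omega> = (\<Sum>i=1..p. \<beta> i * u k (t - int i) \<omega>) + eps k t \<omega>" for t
      using model[of k] elim(2) unfolding AR_contam_model_def by blast
    have bel: "below (resid k t \<omega>) y = below (eps k t \<omega>) (A.thr k y (\<tau> k \<omega>) t \<omega>)" for t
    proof -
      have s: "A.s k t \<omega> = z k t \<omega> * xi k t \<omega>" for t by (rule A.s_def)
      have lin: "A.lin k (\<tau> k \<omega>) t \<omega> = (\<Sum>i=1..p. (bh k \<omega> i - \<beta> i) * yo k \<omega> (t - int i))"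
      proof -
        have "A.lin k (\<tau> k \<omega>) t \<omega> = (\<Sum>i=1..p. \<tau> k \<omega> i * (v k (t - int i) \<omega> + A.s k (t - int i) \<omega>)) / rN k"
          by (rule A.lin_def)
        also have "\<dots> = (\<Sum>i=1..p. (bh k \<omega> i - \<beta> i) * yo k \<omega> (t - int i))"
          unfolding sum_divide_distrib using rN_pos[of k] elim(1)
          by (intro sum.cong refl) (simp add: \<tau>_def yobs_def s)
        finally show ?thesis .
      qed
      have contam: "A.contam k t \<omega> = - A.s k t \<omega> + (\<Sum>i=1..p. \<beta> i * A.s k (t - int i) \<omega>)"
        unfolding A.contam_def by (simp add: sum.atLeast_Suc_atMost b_def)
      have "(\<Sum>i=1..p. bh k \<omega> i * yo k \<omega> (t - int i)) = (\<Sum>i=1..p. (bh k \<omega> i - \<beta> i) * yo k \<omega> (t - int i))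
         + (\<Sum>i=1..p. \<beta> i * u k (t - int i) \<omega>) + (\<Sum>i=1..p. \<beta> i * A.s k (t - int i) \<omega>)"
        unfolding sum.distrib[symmetric] by (intro sum.cong refl) (simp add: yobs_def s algebra_simps)
      then have "resid k t \<omega> = eps k t \<omega> - A.contam k t \<omega> - A.lin k (\<tau> k \<omega>) t \<omega>"
        unfolding resid_def residual_def lin contam using rec[of t] by (simp add: yobs_def s)
      moreover have "A.thr k y (\<tau> k \<omega>) t \<omega> = y + A.contam k t \<omega> + A.lin k (\<tau> k \<omega>) t \<omega>"
        by (rule A.thr_def[OF C])
      ultimately show ?thesis by (simp add: below_def)
    qed
    have "?dev k \<omega> = (\<Sum>t=1..int (N k). below (eps k t \<omega>) (A.thr k y (\<tau> k \<omega>) t \<omega>) - below (eps k t \<omega>) y) / rN k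
       - rN k * g k * (\<Sum>j=0..p. A.hit_mean k y j)"
      by (rule A.shift_dev_def[OF C])
    moreover have "A.hit_mean k y j = (\<integral>w. cdf (G k) (y + b j * w) - cdf (G k) y \<partial>GE)" for j
    proof -
      have "A.hit k y j w = cdf (G k) (y + b j * w) - cdf (G k) y" for w
        by (rule A.hit_def[OF C])
      moreover have "A.hit_mean k y j = (\<integral>w. A.hit k y j w \<partial>GE)"
        by (rule A.hit_mean_def[OF C])
      ultimately show ?thesis by simp
    qed
    ultimately show ?case unfolding bel by simp
  qed
  have const: "oprob M (\<lambda>k \<omega>. rN k * g k * (\<Sum>j=0..p. \<integral>w. cdf (G k) (y + b j * w) - cdf (G k) y \<partial>GE) - c * Delta p \<beta> P GE y)"
  proof (rule oprob_const[OF M])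
    have "(\<lambda>k. rN k * g k * (\<Sum>j=0..p. \<integral>w. cdf (G k) (y + b j * w) - cdf (G k) y \<partial>GE) - c * Delta p \<beta> P GE y)
       \<longlonglongrightarrow> c * Delta p \<beta> P GE y - c * Delta p \<beta> P GE y"
      by (intro tendsto_diff tendsto_mult g_lim(1) hit_mean_lim tendsto_const)
    then show "(\<lambda>k. rN k * g k * (\<Sum>j=0..p. \<integral>w. cdf (G k) (y + b j * w) - cdf (G k) y \<partial>GE) - c * Delta p \<beta> P GE y) \<longlonglongrightarrow> 0"
      by simp
  qed
  have sd_lim: "(\<lambda>k. \<integral>\<omega>. \<bar>A.shift_dev k y \<tau>' \<omega>\<bar> \<partial>M k) \<longlonglongrightarrow> 0"
    if C: "C \<ge> 0" and \<tau>': "\<And>i. i \<in> {1..p} \<Longrightarrow> \<bar>\<tau>' i\<bar> \<le> C" for \<tau>' C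
  proof (rule tendsto_sandwich[OF _ _ tendsto_const])
    let ?bd = "\<lambda>k. sqrt ((real p + 1) * g k + L * C * real p * (1 + K) / rN k)
      + 2 * L * C * (real p + 1) * real p * (1 + K) * g k
      + real p * (rN k * g k) * kap (L * C / rN k)
      + (L * real p * C * K + B * C\<^sup>2 * (real p)\<^sup>2 * K) / rN k
      + (real p + 2) * (real p + 1) * real p * (rN k * g k) * g k
      + (real p + 1) * sqrt (g k)"
    have LC: "L * C \<ge> 0" using L0 C by simp
    have "?bd \<longlonglongrightarrow> sqrt ((real p + 1) * 0 + 0) + 2 * L * C * (real p + 1) * real p * (1 + K) * 0
      + real p * c * 0 + 0 + (real p + 2) * (real p + 1) * real p * c * 0 + (real p + 1) * sqrt 0"
      by (intro tendsto_intros g_lim inv_rN kap_lim LC)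
    then show "?bd \<longlonglongrightarrow> 0" by simp
    show "\<forall>\<^sub>F k in sequentially. (\<integral>\<omega>. \<bar>A.shift_dev k y \<tau>' \<omega>\<bar> \<partial>M k) \<le> ?bd k"
      by (intro always_eventually allI A.shift_dev_expectation(2)[OF C, unfolded kap] \<tau>')
  qed simp
  have nm_nonneg: "0 \<le> A.near_mart k y \<tau>' \<eta> \<omega>"
    if C: "C \<ge> 0" and \<tau>': "\<And>i. i \<in> {1..p} \<Longrightarrow> \<bar>\<tau>' i\<bar> \<le> C" for k \<tau>' C \<eta> \<omega>
    by (subst A.near_mart_def[OF C \<tau>']) (use rN_pos[of k] in auto)
  have nm_lim: "(\<lambda>k. \<integral>\<omega>. A.near_mart k y \<tau>' \<eta> \<omega> \<partial>M k) \<longlonglongrightarrow> 0"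
    if C: "C \<ge> 0" and \<tau>': "\<And>i. i \<in> {1..p} \<Longrightarrow> \<bar>\<tau>' i\<bar> \<le> C" and \<eta>: "\<eta> \<ge> 0" for \<tau>' C \<eta>
  proof (rule tendsto_sandwich[OF _ _ tendsto_const])
    let ?bd = "\<lambda>k. 2 * sqrt ((real p + 1) * g k + L * (C + \<eta>) * real p * (1 + K) / rN k)"
    have "?bd \<longlonglongrightarrow> 2 * sqrt ((real p + 1) * 0 + 0)"
      by (intro tendsto_intros g_lim inv_rN)
    then show "?bd \<longlonglongrightarrow> 0" by simp
    show "\<forall>\<^sub>F k in sequentially. (\<integral>\<omega>. A.near_mart k y \<tau>' \<eta> \<omega> \<partial>M k) \<le> ?bd k"
      by (intro always_eventually allI A.near_mart_expectation(2)[OF C _ \<eta>] \<tau>')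
    show "\<forall>\<^sub>F k in sequentially. 0 \<le> (\<integral>\<omega>. A.near_mart k y \<tau>' \<eta> \<omega> \<partial>M k)"
      by (intro always_eventually allI Bochner_Integration.integral_nonneg nm_nonneg[OF C \<tau>'])
  qed
  have "oprob M ?dev"
    unfolding oprob_def
  proof (intro allI impI)
    fix e :: real assume e: "e > 0"
    \<comment> \<open>Three exceptional events of probability below \<open>e1\<close>, and two
      errors of size \<open>e1\<close> outside of them, fit into \<open>e\<close>.\<close>
    define e1 where "e1 = e / 4"
    have e1: "e1 > 0" using e by (simp add: e1_def)
    obtain C0 where C0: "\<forall>\<^sub>F k in sequentially. measure (M k) {\<omega>\<in>space (M k). rN k * sqrt (\<Sum>i=1..p. (bh k \<omega> i - \<beta> i)\<^sup>2) > C0} < e1"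
      using bh_tight[OF e1] by blast
    define C where "C = max C0 0"
    have C: "C \<ge> 0" by (simp add: C_def)
    \<comment> \<open>Makes the part of the expectation of \<open>comp\<close> that persists for
      large \<open>k\<close> at most half of e1 squared, so that Markov's inequality at level
      \<open>e1\<close> gives a probability below \<open>e1\<close>. The added 1 keeps the
      denominator positive.\<close>
    define \<eta> where "\<eta> = e1\<^sup>2 / (2 * (2 * L * real p * (1 + K) + 1))"
    have den: "2 * L * real p * (1 + K) + 1 > 0" using L0 K0 by (intro add_nonneg_pos mult_nonneg_nonneg) auto
    have \<eta>: "\<eta> > 0" unfolding \<eta>_def using e1 den by (intro divide_pos_pos mult_pos_pos) auto
    have \<eta>_small: "2 * L * \<eta> * real p * (1 + K) \<le> e1\<^sup>2 / 2"
    proof -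
      have "2 * L * \<eta> * real p * (1 + K) = \<eta> * (2 * L * real p * (1 + K))" by simp
      also have "\<dots> \<le> \<eta> * (2 * L * real p * (1 + K) + 1)" using \<eta> by (intro mult_left_mono) auto
      also have "\<dots> = e1\<^sup>2 / 2"
      proof -
        have "a / (2 * d) * d = a / 2" if "d > 0" for a d :: real using that by simp
        from this[OF den] show ?thesis unfolding \<eta>_def .
      qed
      finally show ?thesis .
    qed
    obtain T :: "(nat \<Rightarrow> real) set" where T: "finite T" "\<And>\<tau> i. \<tau> \<in> T \<Longrightarrow> i \<in> {1..p} \<Longrightarrow> \<bar>\<tau> i\<bar> \<le> C"
      "\<And>\<tau>. (\<And>i. i \<in> {1..p} \<Longrightarrow> \<bar>\<tau> i\<bar> \<le> C) \<Longrightarrow> \<exists>\<tau>'\<in>T. \<forall>i\<in>{1..p}. \<bar>\<tau> i - \<tau>' i\<bar> \<le> \<eta>"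
      using finite_interval_net[OF \<eta> C] by metis
    let ?X = "\<lambda>k \<omega>. \<Sum>\<tau>'\<in>T. \<bar>A.shift_dev k y \<tau>' \<omega>\<bar> + A.near_mart k y \<tau>' \<eta> \<omega>"
    have nm0: "0 \<le> A.near_mart k y \<tau>' \<eta> \<omega>" if "\<tau>' \<in> T" for k \<tau>' \<omega>
      by (rule nm_nonneg[OF C T(2)[OF that]])
    have sdi: "integrable (M k) (\<lambda>\<omega>. \<bar>A.shift_dev k y \<tau>' \<omega>\<bar>)" if "\<tau>' \<in> T" for k \<tau>'
      by (rule A.shift_dev_expectation(1)[OF C T(2)[OF that]])
    have nmi: "integrable (M k) (A.near_mart k y \<tau>' \<eta>)" if "\<tau>' \<in> T" for k \<tau>'
      by (rule A.near_mart_expectation(1)[OF C T(2)[OF that]]) (use \<eta> in auto)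
    have Xi: "integrable (M k) (?X k)" for k
      by (intro Bochner_Integration.integrable_sum Bochner_Integration.integrable_add sdi nmi)
    have "(\<lambda>k. \<Sum>\<tau>'\<in>T. (\<integral>\<omega>. \<bar>A.shift_dev k y \<tau>' \<omega>\<bar> \<partial>M k) + (\<integral>\<omega>. A.near_mart k y \<tau>' \<eta> \<omega> \<partial>M k)) \<longlonglongrightarrow> (\<Sum>\<tau>'\<in>T. 0 + 0)"
    proof (intro tendsto_sum tendsto_add)
      fix \<tau>' assume t: "\<tau>' \<in> T"
      show "(\<lambda>k. \<integral>\<omega>. \<bar>A.shift_dev k y \<tau>' \<omega>\<bar> \<partial>M k) \<longlonglongrightarrow> 0" by (rule sd_lim[OF C T(2)[OF t]])
      show "(\<lambda>k. \<integral>\<omega>. A.near_mart k y \<tau>' \<eta> \<omega> \<partial>M k) \<longlonglongrightarrow> 0" by (rule nm_lim[OF C T(2)[OF t]]) (use \<eta> in auto)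
    qed
    moreover have "(\<integral>\<omega>. ?X k \<omega> \<partial>M k) = (\<Sum>\<tau>'\<in>T. (\<integral>\<omega>. \<bar>A.shift_dev k y \<tau>' \<omega>\<bar> \<partial>M k) + (\<integral>\<omega>. A.near_mart k y \<tau>' \<eta> \<omega> \<partial>M k))" for k
      using sdi nmi by (subst Bochner_Integration.integral_sum) (auto intro!: sum.cong Bochner_Integration.integral_add)
    ultimately have "(\<lambda>k. \<integral>\<omega>. ?X k \<omega> \<partial>M k) \<longlonglongrightarrow> 0" by simp
    then have X_ev: "\<forall>\<^sub>F k in sequentially. (\<integral>\<omega>. ?X k \<omega> \<partial>M k) < e1 * e1"
      using e1 by (intro order_tendstoD(2)) auto
    have "(\<lambda>k. real p * (rN k * g k) * kap (2 * L * \<eta> / rN k)) \<longlonglongrightarrow> real p * c * 0"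
      by (intro tendsto_intros g_lim kap_lim) (use L0 \<eta> in auto)
    then have comp_ev: "\<forall>\<^sub>F k in sequentially. real p * (rN k * g k) * kap (2 * L * \<eta> / rN k) < e1\<^sup>2 / 2"
      using e1 by (intro order_tendstoD(2)) auto
    from C0 X_ev comp_ev
    show "\<forall>\<^sub>F k in sequentially. \<exists>E\<in>sets (M k). measure (M k) E < e \<and> (\<forall>\<omega>\<in>space (M k) - E. \<bar>?dev k \<omega>\<bar> \<le> e)"
    proof eventually_elim
      case (elim k)
      note [measurable] = bh_meas
      \<comment> \<open>The exceptional events: an estimator outside the cube, a large deviation at
        the net points, and a large compensator, which is common to all net points.\<close>
      let ?E1 = "{\<omega>\<in>space (M k). rN k * sqrt (\<Sum>i=1..p. (bh k \<omega> i - \<beta> i)\<^sup>2) > C0}"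
      let ?E2 = "{\<omega>\<in>space (M k). ?X k \<omega> \<ge> e1}"
      let ?E3 = "{\<omega>\<in>space (M k). A.comp k \<eta> \<omega> \<ge> e1}"
      have \<eta>0: "\<eta> \<ge> 0" using \<eta> by simp
      \<comment> \<open>The quantity \<open>comp\<close> contains no \<tau>, so its bounds are
        instantiated at \<tau> = 0.\<close>
      have comp: "integrable (M k) (A.comp k \<eta>)"
        "(\<integral>\<omega>. A.comp k \<eta> \<omega> \<partial>M k) \<le> 2 * L * \<eta> * real p * (1 + K) + real p * (rN k * g k) * kap (2 * L * \<eta> / rN k)"
        "A.comp k \<eta> \<omega> \<ge> 0" for \<omega>
        using A.comp_expectation[of 0 "\<lambda>_. 0" \<eta> k, unfolded kap] \<eta>0 by auto
      have [measurable]: "?X k \<in> borel_measurable (M k)" "A.comp k \<eta> \<in> borel_measurable (M k)"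
        using Xi[of k] comp(1) by auto
      have s: "?E1 \<in> sets (M k)" "?E2 \<in> sets (M k)" "?E3 \<in> sets (M k)" by measurable
      have "measure (M k) ?E2 \<le> (\<integral>\<omega>. ?X k \<omega> \<partial>M k) / e1"
        by (rule integral_Markov_inequality_measure[OF Xi]) (use e1 nm0 in \<open>auto intro!: AE_I2 sum_nonneg add_nonneg_nonneg\<close>)
      also have "\<dots> < e1" using elim(2) e1 by (simp add: field_simps)
      finally have E2: "measure (M k) ?E2 < e1" .
      have "measure (M k) ?E3 \<le> (\<integral>\<omega>. A.comp k \<eta> \<omega> \<partial>M k) / e1"
        by (rule integral_Markov_inequality_measure[OF comp(1)]) (use e1 comp(3) in auto)
      also have "\<dots> < e1 * e1 / e1"
        using comp(2) \<eta>_small elim(3) e1 by (intro divide_strict_right_mono) (auto simp: power2_eq_square)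
      finally have E3: "measure (M k) ?E3 < e1" using e1 by simp
      have "measure (M k) (?E1 \<union> (?E2 \<union> ?E3)) < e1 + (e1 + e1)"
        using s elim(1) E2 E3 by (intro measure_Un_less[OF M]) auto
      then have "measure (M k) (?E1 \<union> (?E2 \<union> ?E3)) < e" using e by (simp add: e1_def)
      moreover have "\<bar>?dev k \<omega>\<bar> \<le> e" if \<omega>: "\<omega> \<in> space (M k) - (?E1 \<union> (?E2 \<union> ?E3))" for \<omega>
      proof -
        have sq: "rN k * sqrt (\<Sum>i=1..p. (bh k \<omega> i - \<beta> i)\<^sup>2) \<le> C" using \<omega> by (auto simp: C_def)
        have \<tau>C: "\<bar>\<tau> k \<omega> i\<bar> \<le> C" if "i \<in> {1..p}" for i
        proof -
          have "\<bar>bh k \<omega> i - \<beta> i\<bar> = sqrt ((bh k \<omega> i - \<beta> i)\<^sup>2)" by simp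
          also have "\<dots> \<le> sqrt (\<Sum>i=1..p. (bh k \<omega> i - \<beta> i)\<^sup>2)"
            using that by (intro real_sqrt_le_mono member_le_sum) auto
          finally have "rN k * \<bar>bh k \<omega> i - \<beta> i\<bar> \<le> rN k * sqrt (\<Sum>i=1..p. (bh k \<omega> i - \<beta> i)\<^sup>2)"
            using rN_pos[of k] by (intro mult_left_mono) auto
          from order_trans[OF this sq] show ?thesis
            unfolding \<tau>_def abs_mult using rN_pos[of k] by (simp only: abs_of_pos)
        qed
        obtain \<tau>' where \<tau>': "\<tau>' \<in> T" "\<And>i. i \<in> {1..p} \<Longrightarrow> \<bar>\<tau> k \<omega> i - \<tau>' i\<bar> \<le> \<eta>"
          using T(3)[of "\<tau> k \<omega>"] \<tau>C by blast
        have "\<bar>?dev k \<omega>\<bar> \<le> \<bar>A.shift_dev k y \<tau>' \<omega>\<bar> + A.near k y \<tau>' \<eta> \<omega>"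
          by (rule A.shift_dev_le_near[OF C T(2)[OF \<tau>'(1)] \<tau>C \<tau>'(2)])
        also have "A.near k y \<tau>' \<eta> \<omega> \<le> A.near_mart k y \<tau>' \<eta> \<omega> + A.comp k \<eta> \<omega>"
          by (rule A.near_le[OF C T(2)[OF \<tau>'(1)] \<eta>0])
        finally have "\<bar>?dev k \<omega>\<bar> \<le> (\<bar>A.shift_dev k y \<tau>' \<omega>\<bar> + A.near_mart k y \<tau>' \<eta> \<omega>) + A.comp k \<eta> \<omega>" by simp
        also have "\<bar>A.shift_dev k y \<tau>' \<omega>\<bar> + A.near_mart k y \<tau>' \<eta> \<omega> \<le> ?X k \<omega>"
          using \<tau>'(1) T(1) nm0 by (intro member_le_sum) auto
        finally have "\<bar>?dev k \<omega>\<bar> \<le> ?X k \<omega> + A.comp k \<eta> \<omega>" by simp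
        moreover have "?X k \<omega> < e1" "A.comp k \<eta> \<omega> < e1" using \<omega> by auto
        ultimately have "\<bar>?dev k \<omega>\<bar> \<le> e1 + e1" by linarith
        then show ?thesis using e by (simp add: e1_def)
      qed
      ultimately show ?case using s by (intro bexI[of _ "?E1 \<union> (?E2 \<union> ?E3)"]) auto
    qed
  qed
  from oprob_add[OF M this const] show ?thesis
    by (rule oprob_cong[OF M]) (rule dev_eq)
qed

section \<open>Limit law of the normalised count differences\<close>

abbreviation "pp j \<equiv> measure P (bin_plus x m j)"

abbreviation "dl j \<equiv> delta_j p \<beta> P GE x m j"

definition dq :: "nat \<Rightarrow> real" where "dq j = measure Q (bin_plus x m j) - measure Q (bin_minus x m j)"

text \<open>The mean of the limiting Gaussian vector after standardisation; its squared length is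
  the noncentrality parameter, because the matrix in the noncentrality is diagonal with entries 2 pp
  j.\<close>

definition \<mu> :: "nat \<Rightarrow> real" where "\<mu> j = (r * dq j + c * dl j) / sqrt (2 * pp j)"

text \<open>Formed from the innovations, not from the residuals. The alternative shows in its mean,
  which is close to \<open>r * dq j\<close>, whereas the contamination shift \<open>c * dl j\<close>
  is added separately.\<close>

definition S :: "nat \<Rightarrow> nat \<Rightarrow> 'a \<Rightarrow> real" where
  "S k j \<omega> = (\<Sum>t=1..int (N k). bin_sign j (eps k t \<omega>)) / rN k"

lemma noise: "contam_noise (M k) (G k) GE (g k) (eps k) (z k) (xi k)"
  by (rule AR_contam_model_noise[OF model])

lemma eps_meas[measurable]: "eps k t \<in> borel_measurable (M k)"
  using contam_noise.eps_measurable[OF noise] .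

text \<open>Symmetry enters here. Under the mixture the mean of \<open>bin_sign j\<close> is then
  only \<open>q k * dq j\<close>, of order 1 / sqrt n, and the count differences stay bounded after
  normalisation.\<close>

lemma P_bin_minus:
  assumes j: "j \<in> {1..m}"
  shows "measure P (bin_minus x m j) = pp j"
proof -
  have "isCont (cdf P) y" for y
    using P_smooth unfolding twice_diff_bounded_def by (meson DERIV_isCont)
  then have "cdf P (- y) = 1 - cdf P y" for y
    by (intro symmetric_distr_cdf[OF P sym])
  then show ?thesis
    unfolding measure_bins[OF real_distrs(1) j] incr_plus_def incr_minus_def by simp
qed

lemma G_bins:
  "measure (G k) (bin_plus x m j) = (1 - q k) * pp j + q k * measure Q (bin_plus x m j)"
  "measure (G k) (bin_minus x m j) = (1 - q k) * measure P (bin_minus x m j) + q k * measure Q (bin_minus x m j)"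
  by (rule measure_mix_distr[OF P Q q_lim(3,4)], measurable)+

text \<open>Independence turns the characteristic function into a power of the one-step function
  \<open>cc k\<close>, to which \<open>power_limit_exp\<close> applies. The first moment of a step
  gives the drift with \<open>r * dq j\<close>, the second the Gaussian factor; disjoint cells and
  the scaling by sqrt (2 pp j) make the covariance the identity.\<close>

lemma char_S_lim:
  "(\<lambda>k. \<integral>\<omega>. iexp (\<Sum>j\<in>{1..m}. \<theta> j * ((S k j \<omega> + c * dl j) / sqrt (2 * pp j))) \<partial>M k)
    \<longlonglongrightarrow> exp (complex_of_real (- (\<Sum>j\<in>{1..m}. (\<theta> j)\<^sup>2) / 2) + \<i> * complex_of_real (\<Sum>j\<in>{1..m}. \<theta> j * \<mu> j))"
proof -
  \<comment> \<open>The standardisation is moved into the argument, so that one bounded function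
    \<open>h\<close> of a single innovation carries the whole linear combination.\<close>
  define \<theta>' where "\<theta>' j = \<theta> j / sqrt (2 * pp j)" for j
  define h where "h e = (\<Sum>j\<in>{1..m}. \<theta>' j * bin_sign j e)" for e
  define H where "H = (\<Sum>j\<in>{1..m}. \<bar>\<theta>' j\<bar>)"
  define \<kappa>0 where "\<kappa>0 = (\<Sum>j\<in>{1..m}. \<theta>' j * (c * dl j))"
  have [measurable]: "h \<in> borel_measurable borel" unfolding h_def by measurable
  have bs1: "\<bar>bin_sign j e\<bar> \<le> 1" for j e by (auto simp: indicator_def)
  have hH: "\<bar>h e\<bar> \<le> H" for e
    unfolding h_def H_def
  proof (rule order_trans[OF sum_abs], rule sum_mono)
    fix j show "\<bar>\<theta>' j * bin_sign j e\<bar> \<le> \<bar>\<theta>' j\<bar>"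
      unfolding abs_mult using bs1[of j e] by (intro mult_left_le) auto
  qed
  have H0: "H \<ge> 0" unfolding H_def by (intro sum_nonneg) auto
  define cc where "cc k = (\<integral>e. iexp (h e / rN k) \<partial>G k)" for k
  have split: "(\<integral>\<omega>. iexp (\<Sum>j\<in>{1..m}. \<theta> j * ((S k j \<omega> + c * dl j) / sqrt (2 * pp j))) \<partial>M k) = iexp \<kappa>0 * cc k ^ N k" for k
  proof -
    interpret contam_noise "M k" "G k" GE "g k" "eps k" "z k" "xi k" by (rule noise)
    have lin: "(\<Sum>j\<in>{1..m}. \<theta> j * ((S k j \<omega> + c * dl j) / sqrt (2 * pp j))) = \<kappa>0 + (\<Sum>t\<in>{1..int (N k)}. h (eps k t \<omega>) / rN k)" for \<omega>
    proof -
      have "(\<Sum>j\<in>{1..m}. \<theta> j * ((S k j \<omega> + c * dl j) / sqrt (2 * pp j))) = (\<Sum>j\<in>{1..m}. \<theta>' j * (c * dl j) + \<theta>' j * S k j \<omega>)"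
        by (intro sum.cong refl) (simp add: \<theta>'_def algebra_simps add_divide_distrib)
      also have "\<dots> = \<kappa>0 + (\<Sum>j\<in>{1..m}. \<theta>' j * S k j \<omega>)" by (simp add: sum.distrib \<kappa>0_def)
      also have "(\<Sum>j\<in>{1..m}. \<theta>' j * S k j \<omega>) = (\<Sum>j\<in>{1..m}. \<Sum>t\<in>{1..int (N k)}. \<theta>' j * bin_sign j (eps k t \<omega>) / rN k)"
        by (intro sum.cong refl) (simp add: S_def sum_distrib_left sum_divide_distrib)
      also have "\<dots> = (\<Sum>t\<in>{1..int (N k)}. \<Sum>j\<in>{1..m}. \<theta>' j * bin_sign j (eps k t \<omega>) / rN k)"
        by (rule sum.swap)
      also have "\<dots> = (\<Sum>t\<in>{1..int (N k)}. h (eps k t \<omega>) / rN k)"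
        by (simp add: h_def sum_divide_distrib)
      finally show ?thesis .
    qed
    have "(\<integral>\<omega>. iexp (\<Sum>j\<in>{1..m}. \<theta> j * ((S k j \<omega> + c * dl j) / sqrt (2 * pp j))) \<partial>M k)
       = (\<integral>\<omega>. iexp \<kappa>0 * (\<Prod>t\<in>{1..int (N k)}. iexp (h (eps k t \<omega>) / rN k)) \<partial>M k)"
    proof (rule Bochner_Integration.integral_cong, rule refl)
      fix \<omega>
      have "iexp (\<kappa>0 + (\<Sum>t\<in>{1..int (N k)}. h (eps k t \<omega>) / rN k)) = iexp \<kappa>0 * iexp (\<Sum>t\<in>{1..int (N k)}. h (eps k t \<omega>) / rN k)"
        by (simp add: distrib_left exp_add)
      also have "iexp (\<Sum>t\<in>{1..int (N k)}. h (eps k t \<omega>) / rN k) = (\<Prod>t\<in>{1..int (N k)}. iexp (h (eps k t \<omega>) / rN k))"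
        by (rule sum_iexp_prod) simp
      finally show "iexp (\<Sum>j\<in>{1..m}. \<theta> j * ((S k j \<omega> + c * dl j) / sqrt (2 * pp j))) = iexp \<kappa>0 * (\<Prod>t\<in>{1..int (N k)}. iexp (h (eps k t \<omega>) / rN k))"
        unfolding lin .
    qed
    also have "\<dots> = iexp \<kappa>0 * (\<integral>\<omega>. (\<Prod>t\<in>{1..int (N k)}. iexp (h (eps k t \<omega>) / rN k)) \<partial>M k)"
      by (rule integral_mult_right_zero)
    also have "(\<integral>\<omega>. (\<Prod>t\<in>{1..int (N k)}. iexp (h (eps k t \<omega>) / rN k)) \<partial>M k) = cc k ^ card {1..int (N k)}"
      unfolding cc_def by (rule expectation_prod_eps) auto
    finally show ?thesis by simp
  qed
  have cc1: "norm (cc k) \<le> 1" for k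
  proof -
    interpret real_distribution "G k" by (rule real_distrs)
    have "norm (cc k) \<le> (\<integral>e. norm (iexp (h e / rN k)) \<partial>G k)"
      unfolding cc_def by (rule integral_norm_bound)
    also have "\<dots> = 1" using prob_space by simp
    finally show ?thesis .
  qed
  define m1 where "m1 k = q k * (\<Sum>j\<in>{1..m}. \<theta>' j * dq j)" for k
  define m2 where "m2 k = (\<Sum>j\<in>{1..m}. (\<theta>' j)\<^sup>2 * (measure (G k) (bin_plus x m j) + measure (G k) (bin_minus x m j)))" for k
  have moments: "(\<integral>e. h e \<partial>G k) = m1 k" "(\<integral>e. (h e)\<^sup>2 \<partial>G k) = m2 k" for k
  proof -
    interpret real_distribution "G k" by (rule real_distrs)
    have ii: "integrable (G k) (\<lambda>e. indicator A e :: real)" if [measurable]: "A \<in> sets borel" for A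
      by (rule integrable_const_bound[of _ 1]) auto
    have ie: "(\<integral>e. indicator A e \<partial>G k) = measure (G k) A" if "A \<in> sets borel" for A by simp
    have "(\<integral>e. h e \<partial>G k) = (\<Sum>j\<in>{1..m}. \<theta>' j * (measure (G k) (bin_plus x m j) - measure (G k) (bin_minus x m j)))"
      unfolding h_def using ii[OF bins_borel(1)] ii[OF bins_borel(2)] by (simp add: ie)
    also have "\<dots> = m1 k"
      unfolding m1_def sum_distrib_left
    proof (intro sum.cong refl)
      fix j assume "j \<in> {1..m}"
      then show "\<theta>' j * (measure (G k) (bin_plus x m j) - measure (G k) (bin_minus x m j)) = q k * (\<theta>' j * dq j)"
        unfolding G_bins dq_def by (simp add: P_bin_minus algebra_simps)
    qed
    finally show "(\<integral>e. h e \<partial>G k) = m1 k" .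
    have "(h e)\<^sup>2 = (\<Sum>j\<in>{1..m}. (\<theta>' j)\<^sup>2 * (indicator (bin_plus x m j) e + indicator (bin_minus x m j) e))" for e
    proof -
      have "(h e)\<^sup>2 = (\<Sum>i\<in>{1..m}. \<Sum>j\<in>{1..m}. (\<theta>' i * bin_sign i e) * (\<theta>' j * bin_sign j e))"
        unfolding h_def power2_eq_square by (rule sum_product)
      also have "\<dots> = (\<Sum>i\<in>{1..m}. \<Sum>j\<in>{1..m}. if j = i then (\<theta>' i)\<^sup>2 * (indicator (bin_plus x m i) e + indicator (bin_minus x m i) e) else 0)"
      proof (intro sum.cong refl)
        fix i j assume ij: "i \<in> {1..m}" "j \<in> {1..m}"
        have "(\<theta>' i * bin_sign i e) * (\<theta>' j * bin_sign j e) = \<theta>' i * \<theta>' j * (bin_sign i e * bin_sign j e)" by (simp add: mult_ac)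
        also have "\<dots> = (if j = i then (\<theta>' i)\<^sup>2 * (indicator (bin_plus x m i) e + indicator (bin_minus x m i) e) else 0)"
        proof (cases "j = i")
          case True
          then show ?thesis using bin_sign_square[OF ij(1), of e] by (simp only: power2_eq_square if_True simp_thms)
        next
          case False
          then have "bin_sign i e * bin_sign j e = 0" using bin_sign_orthogonal[OF ij] by auto
          then show ?thesis using False by (simp only: mult_zero_right if_False)
        qed
        finally show "(\<theta>' i * bin_sign i e) * (\<theta>' j * bin_sign j e) = (if j = i then (\<theta>' i)\<^sup>2 * (indicator (bin_plus x m i) e + indicator (bin_minus x m i) e) else 0)" .
      qed
      also have "\<dots> = (\<Sum>j\<in>{1..m}. (\<theta>' j)\<^sup>2 * (indicator (bin_plus x m j) e + indicator (bin_minus x m j) e))" by simp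
      finally show ?thesis .
    qed
    then show "(\<integral>e. (h e)\<^sup>2 \<partial>G k) = m2 k"
      unfolding m2_def using ii[OF bins_borel(1)] ii[OF bins_borel(2)] by (simp add: ie)
  qed
  \<comment> \<open>Second-order expansion of \<open>cc k\<close>: since \<open>h\<close> is bounded
    by \<open>H\<close>, the cubic remainder of a step, multiplied by the number of steps, is of
    order 1 / sqrt n.\<close>
  have expand: "norm (of_nat (N k) * (cc k - 1) - (\<i> * (rN k * m1 k) - m2 k / 2)) \<le> H ^ 3 / 6 / rN k" for k
  proof -
    interpret real_distribution "G k" by (rule real_distrs)
    let ?X = "\<lambda>e. h e / rN k"
    have r2: "rN k * rN k = real (N k)" by simp
    let ?R = "\<lambda>e. iexp (?X e) - (1 + \<i> * ?X e - complex_of_real ((?X e)\<^sup>2 / 2))"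
    have pw: "norm (?R e) \<le> H ^ 3 / 6 / rN k ^ 3" for e
    proof -
      have gen: "norm (iexp X - (1 + \<i> * X - complex_of_real (X\<^sup>2 / 2))) \<le> \<bar>X\<bar> ^ 3 / 6" for X
      proof -
        have "{..2::nat} = {0, 1, 2}" by auto
        then have s1: "(\<Sum>k\<le>2. (\<i> * complex_of_real X) ^ k / fact k) = 1 + \<i> * X - complex_of_real (X\<^sup>2 / 2)"
          by (simp add: power_mult_distrib)
        have s2: "\<bar>X\<bar> ^ Suc 2 / fact (Suc 2) = \<bar>X\<bar> ^ 3 / 6" by (simp add: eval_nat_numeral)
        show ?thesis using iexp_approx1[of X 2] unfolding s1 s2 .
      qed
      have "norm (?R e) \<le> \<bar>?X e\<bar> ^ 3 / 6" by (rule gen)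
      also have "\<bar>?X e\<bar> ^ 3 \<le> (H / rN k) ^ 3"
        using hH[of e] rN_pos[of k] by (intro power_mono) (auto simp: abs_divide intro!: divide_right_mono)
      finally show ?thesis by (simp add: power_divide)
    qed
    have i1: "integrable (G k) (\<lambda>e. iexp (?X e))" by (rule integrable_const_bound[of _ 1]) auto
    have ih: "integrable (G k) h" by (rule integrable_const_bound[of _ H]) (use hH in auto)
    have ih2: "integrable (G k) (\<lambda>e. (h e)\<^sup>2)"
    proof (rule integrable_const_bound[of _ "H\<^sup>2"])
      show "AE e in G k. norm ((h e)\<^sup>2) \<le> H\<^sup>2"
      proof (rule AE_I2)
        fix e show "norm ((h e)\<^sup>2) \<le> H\<^sup>2" using power_mono[OF hH[of e] abs_ge_zero, of 2] by simp
      qed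
    qed measurable
    have iX: "integrable (G k) (\<lambda>e. complex_of_real (?X e))" "(\<integral>e. complex_of_real (?X e) \<partial>G k) = m1 k / rN k"
      using ih by (auto simp: moments(1)[of k, symmetric])
    have iX2: "integrable (G k) (\<lambda>e. complex_of_real ((?X e)\<^sup>2 / 2))" "(\<integral>e. complex_of_real ((?X e)\<^sup>2 / 2) \<partial>G k) = complex_of_real (m2 k / real (N k) / 2)"
    proof -
      have ir: "integrable (G k) (\<lambda>e. (?X e)\<^sup>2 / 2)" "(\<integral>e. (?X e)\<^sup>2 / 2 \<partial>G k) = m2 k / real (N k) / 2"
        using ih2 by (auto simp: moments(2)[of k, symmetric] power_divide)
      show "integrable (G k) (\<lambda>e. complex_of_real ((?X e)\<^sup>2 / 2))"
        by (rule integrable_of_real[OF ir(1)])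
      show "(\<integral>e. complex_of_real ((?X e)\<^sup>2 / 2) \<partial>G k) = complex_of_real (m2 k / real (N k) / 2)"
        unfolding integral_complex_of_real ir(2) ..
    qed
    have iR: "integrable (G k) ?R"
      by (intro Bochner_Integration.integrable_diff Bochner_Integration.integrable_add i1 iX2 integrable_mult_right iX integrable_const)
    have eq: "(\<integral>e. ?R e \<partial>G k) = cc k - (1 + \<i> * (m1 k / rN k) - m2 k / real (N k) / 2)"
    proof -
      have "(\<integral>e. ?R e \<partial>G k) = (\<integral>e. iexp (?X e) \<partial>G k) - ((\<integral>e. 1 \<partial>G k) + \<i> * (\<integral>e. complex_of_real (?X e) \<partial>G k) - (\<integral>e. complex_of_real ((?X e)\<^sup>2 / 2) \<partial>G k))"
        using i1 iX(1) iX2(1)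
        by (simp only: Bochner_Integration.integral_diff Bochner_Integration.integral_add Bochner_Integration.integrable_diff
           Bochner_Integration.integrable_add integrable_mult_right integral_mult_right_zero integrable_const)
      then show ?thesis unfolding iX(2) iX2(2) cc_def using prob_space by simp
    qed
    have "of_nat (N k) * (cc k - 1) - (\<i> * (rN k * m1 k) - m2 k / 2) = of_nat (N k) * (\<integral>e. ?R e \<partial>G k)"
    proof -
      have "a * a * (d / a) = a * d" if "a > 0" for a d :: real
        using that by simp
      from this[OF rN_pos[of k]] have n1: "real (N k) * (m1 k / rN k) = rN k * m1 k" unfolding r2 .
      have n2: "real (N k) * (m2 k / real (N k) / 2) = m2 k / 2"
        using N1[of k] by simp
      have "of_nat (N k) * (\<integral>e. ?R e \<partial>G k) = of_nat (N k) * (cc k - 1) - (\<i> * complex_of_real (real (N k) * (m1 k / rN k)) - complex_of_real (real (N k) * (m2 k / real (N k) / 2)))"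
        unfolding eq by (simp add: algebra_simps)
      then show ?thesis unfolding n1 n2 by simp
    qed
    then have "norm (of_nat (N k) * (cc k - 1) - (\<i> * (rN k * m1 k) - m2 k / 2)) = real (N k) * norm (\<integral>e. ?R e \<partial>G k)"
      by (simp add: norm_mult)
    also have "\<dots> \<le> real (N k) * (\<integral>e. norm (?R e) \<partial>G k)"
      by (intro mult_left_mono integral_norm_bound) simp
    also have "\<dots> \<le> real (N k) * (\<integral>e. H ^ 3 / 6 / rN k ^ 3 \<partial>G k)"
      by (intro mult_left_mono integral_mono integrable_norm iR integrable_const pw) simp
    also have "\<dots> = real (N k) * (H ^ 3 / 6 / rN k ^ 3)" using prob_space by simp
    also have "\<dots> = H ^ 3 / 6 / rN k"
    proof -
      have "a * a * (d / a ^ 3) = d / a" if "a > 0" for a d :: real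
        using that by (simp add: power3_eq_cube)
      from this[OF rN_pos[of k]] show ?thesis unfolding r2 .
    qed
    finally show ?thesis .
  qed
  \<comment> \<open>The limiting exponent without the deterministic contamination shift
    \<open>\<kappa>0\<close>, which is put back at the end.\<close>
  let ?a = "- complex_of_real (\<Sum>j\<in>{1..m}. (\<theta> j)\<^sup>2) / 2 + \<i> * complex_of_real (r * (\<Sum>j\<in>{1..m}. \<theta>' j * dq j))"
  have lim: "(\<lambda>k. of_nat (N k) * (cc k - 1)) \<longlonglongrightarrow> ?a"
  proof -
    have l1: "(\<lambda>k. rN k * m1 k) \<longlonglongrightarrow> r * (\<Sum>j\<in>{1..m}. \<theta>' j * dq j)"
      unfolding m1_def mult.assoc[symmetric] by (intro tendsto_mult q_lim(1) tendsto_const)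
    have "m2 \<longlonglongrightarrow> (\<Sum>j\<in>{1..m}. (\<theta>' j)\<^sup>2 * (((1 - 0) * pp j + 0 * measure Q (bin_plus x m j)) + ((1 - 0) * measure P (bin_minus x m j) + 0 * measure Q (bin_minus x m j))))"
      unfolding m2_def G_bins by (intro tendsto_intros q_lim(2))
    also have "(\<Sum>j\<in>{1..m}. (\<theta>' j)\<^sup>2 * (((1 - 0) * pp j + 0 * measure Q (bin_plus x m j)) + ((1 - 0) * measure P (bin_minus x m j) + 0 * measure Q (bin_minus x m j)))) = (\<Sum>j\<in>{1..m}. (\<theta> j)\<^sup>2)"
    proof (intro sum.cong refl)
      fix j assume j: "j \<in> {1..m}"
      have "(\<theta>' j)\<^sup>2 * (2 * pp j) = (\<theta> j)\<^sup>2"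
        using pplus[OF j] by (simp add: \<theta>'_def power_divide)
      then show "(\<theta>' j)\<^sup>2 * (((1 - 0) * pp j + 0 * measure Q (bin_plus x m j)) + ((1 - 0) * measure P (bin_minus x m j) + 0 * measure Q (bin_minus x m j))) = (\<theta> j)\<^sup>2"
        using P_bin_minus[OF j] by simp
    qed
    finally have l2: "m2 \<longlonglongrightarrow> (\<Sum>j\<in>{1..m}. (\<theta> j)\<^sup>2)" .
    have d: "(\<lambda>k. of_nat (N k) * (cc k - 1) - (\<i> * (rN k * m1 k) - m2 k / 2)) \<longlonglongrightarrow> 0"
      by (rule Lim_null_comparison[OF always_eventually[OF allI[OF expand]] inv_rN])
    have "(\<lambda>k. \<i> * complex_of_real (rN k * m1 k) - complex_of_real (m2 k / 2)) \<longlonglongrightarrow> \<i> * complex_of_real (r * (\<Sum>j\<in>{1..m}. \<theta>' j * dq j)) - complex_of_real ((\<Sum>j\<in>{1..m}. (\<theta> j)\<^sup>2) / 2)"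
      by (intro tendsto_intros l1 l2) simp
    then have "(\<lambda>k. \<i> * (rN k * m1 k) - m2 k / 2) \<longlonglongrightarrow> ?a" by simp
    from tendsto_add[OF d this] show ?thesis by simp
  qed
  have "(\<lambda>k. cc k ^ N k) \<longlonglongrightarrow> exp ?a"
    by (rule power_limit_exp[OF N N1 cc1 lim]) (simp add: sum_nonneg)
  then have "(\<lambda>k. iexp \<kappa>0 * cc k ^ N k) \<longlonglongrightarrow> iexp \<kappa>0 * exp ?a" by (intro tendsto_mult tendsto_const)
  also have "iexp \<kappa>0 * exp ?a = exp (- (\<Sum>j\<in>{1..m}. (\<theta> j)\<^sup>2) / 2 + \<i> * (\<Sum>j\<in>{1..m}. \<theta> j * \<mu> j))"
  proof -
    have "(\<Sum>j\<in>{1..m}. \<theta> j * \<mu> j) = \<kappa>0 + r * (\<Sum>j\<in>{1..m}. \<theta>' j * dq j)"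
      unfolding \<kappa>0_def sum_distrib_left sum.distrib[symmetric]
      by (intro sum.cong refl) (simp add: \<mu>_def \<theta>'_def algebra_simps add_divide_distrib)
    then show ?thesis by (simp add: exp_add[symmetric] algebra_simps)
  qed
  finally show ?thesis unfolding split .
qed

lemma S_measurable[measurable]: "S k j \<in> borel_measurable (M k)"
  unfolding S_def[abs_def] by measurable

lemma laplace_S_lim:
  assumes a: "a \<ge> 0"
  shows "(\<lambda>k. \<integral>\<omega>. exp (- (a * (\<Sum>j\<in>{1..m}. ((S k j \<omega> + c * dl j) / sqrt (2 * pp j))\<^sup>2))) \<partial>M k)
    \<longlonglongrightarrow> exp (- (a * (\<Sum>j\<in>{1..m}. (\<mu> j)\<^sup>2) / (1 + 2 * a))) / sqrt (1 + 2 * a) ^ m"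
proof -
  interpret Nd: real_distribution std_normal_distribution by (rule real_dist_normal_dist)
  let ?L = "PiM {1..m} (\<lambda>_. std_normal_distribution)"
  have L: "prob_space ?L" by (rule prob_space_PiM) (rule Nd.prob_space_axioms)
  have "(\<lambda>k. \<integral>\<omega>. exp (- (a * (\<Sum>j\<in>{1..m}. ((S k j \<omega> + c * dl j) / sqrt (2 * pp j))\<^sup>2))) \<partial>M k)
    \<longlonglongrightarrow> (\<integral>w. exp (- (a * (\<Sum>j\<in>{1..m}. (w j + \<mu> j)\<^sup>2))) \<partial>?L)"
  proof (rule char_conv_imp_laplace_square_norm_conv[OF M L _ a])
    fix \<theta>
    show "(\<lambda>k. \<integral>\<omega>. iexp (\<Sum>j\<in>{1..m}. \<theta> j * ((S k j \<omega> + c * dl j) / sqrt (2 * pp j))) \<partial>M k)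
      \<longlonglongrightarrow> (\<integral>w. iexp (\<Sum>j\<in>{1..m}. \<theta> j * (w j + \<mu> j)) \<partial>?L)"
      unfolding char_shifted_std_normal_vector[OF finite_atLeastAtMost] by (rule char_S_lim)
  qed auto
  then show ?thesis
    by (simp add: laplace_shifted_square_norm_std_normal[OF _ a])
qed

section \<open>From count differences to the statistic\<close>

definition dev :: "nat \<Rightarrow> real \<Rightarrow> 'a \<Rightarrow> real" where
  "dev k y \<omega> = (\<Sum>t=1..int (N k). below (resid k t \<omega>) y - below (eps k t \<omega>) y) / rN k - c * Delta p \<beta> P GE y"

definition ecdf_dev :: "nat \<Rightarrow> real \<Rightarrow> 'a \<Rightarrow> real" where
  "ecdf_dev k y \<omega> = (\<Sum>t=1..int (N k). below (eps k t \<omega>) y - cdf (G k) y) / rN k"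

definition cnt :: "nat \<Rightarrow> real \<Rightarrow> 'a \<Rightarrow> real" where
  "cnt k y \<omega> = (\<Sum>t=1..int (N k). below (resid k t \<omega>) y)"

definition nup :: "nat \<Rightarrow> nat \<Rightarrow> 'a \<Rightarrow> real" where
  "nup k j \<omega> = real (card {t\<in>{1..int (N k)}. resid k t \<omega> \<in> bin_plus x m j})"

definition num :: "nat \<Rightarrow> nat \<Rightarrow> 'a \<Rightarrow> real" where
  "num k j \<omega> = real (card {t\<in>{1..int (N k)}. resid k t \<omega> \<in> bin_minus x m j})"

abbreviation "T k j \<omega> \<equiv> (nup k j \<omega> - num k j \<omega>) / rN k"

lemma rN_sq: "rN k * rN k = real (N k)" by simp

lemma dev_oprob: "oprob M (\<lambda>k \<omega>. dev k y \<omega>)"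
  unfolding dev_def by (rule resid_count_shift)

lemma ecdf_dev_Oprob: "Oprob M (\<lambda>k \<omega>. ecdf_dev k y \<omega>)"
proof (rule Oprob_of_expectation[OF M])
  fix k
  interpret contam_noise "M k" "G k" GE "g k" "eps k" "z k" "xi k" by (rule noise)
  have e: "\<bar>ecdf_dev k y \<omega>\<bar> = \<bar>\<Sum>t=1..int (N k). below (eps k t \<omega>) y - cdf (G k) y\<bar> / rN k" for \<omega>
    using rN_pos[of k] by (simp add: ecdf_dev_def abs_divide)
  show "integrable (M k) (\<lambda>\<omega>. \<bar>ecdf_dev k y \<omega>\<bar>)"
    unfolding e by (intro integrable_divide ecdf_deviation)
  have "(\<integral>\<omega>. \<bar>ecdf_dev k y \<omega>\<bar> \<partial>M k) = (\<integral>\<omega>. \<bar>\<Sum>t=1..int (N k). below (eps k t \<omega>) y - cdf (G k) y\<bar> \<partial>M k) / rN k"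
    unfolding e by simp
  also have "\<dots> \<le> rN k / rN k" by (intro divide_right_mono ecdf_deviation) simp
  finally show "(\<integral>\<omega>. \<bar>ecdf_dev k y \<omega>\<bar> \<partial>M k) \<le> 1" using rN_pos[of k] by simp
qed

lemma nup_num_incr:
  assumes "j \<in> {1..m}"
  shows "nup k j \<omega> = incr_plus x m (\<lambda>y. cnt k y \<omega>) (real (N k)) j" "num k j \<omega> = incr_minus x m (\<lambda>y. cnt k y \<omega>) j"
  using card_bins[of "{1..int (N k)}" j "\<lambda>t. resid k t \<omega>"] assms by (auto simp: nup_def num_def cnt_def)

lemma S_incr:
  assumes j: "j \<in> {1..m}"
  shows "S k j \<omega> = (incr_plus x m (\<lambda>y. \<Sum>t=1..int (N k). below (eps k t \<omega>) y) (real (N k)) j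
    - incr_minus x m (\<lambda>y. \<Sum>t=1..int (N k). below (eps k t \<omega>) y) j) / rN k"
proof -
  have n: "real (N k) = (\<Sum>t=1..int (N k). 1)" by simp
  have "(\<Sum>t=1..int (N k). bin_sign j (eps k t \<omega>)) = incr_plus x m (\<lambda>y. \<Sum>t=1..int (N k). below (eps k t \<omega>) y) (\<Sum>t=1..int (N k). 1) j
    - incr_minus x m (\<lambda>y. \<Sum>t=1..int (N k). below (eps k t \<omega>) y) j"
    unfolding incr_sum sum_subtractf indicator_bin_plus[OF j] indicator_bin_minus[OF j] ..
  then show ?thesis unfolding S_def n[symmetric] by simp
qed

text \<open>Both kinds of counts are increments of counts below fixed points, so their difference is
  a combination of \<open>dev\<close> at the cell boundaries. At the infinite boundary residual and
  innovation counts both equal the sample size, so j = m contributes no error there.\<close>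

lemma T_approx:
  assumes j: "j \<in> {1..m}"
  shows "oprob M (\<lambda>k \<omega>. T k j \<omega> - (S k j \<omega> + c * dl j))"
proof -
  have eq: "T k j \<omega> - (S k j \<omega> + c * dl j) = ((if j = m then 0 else dev k (x j) \<omega>) - dev k (x (j - 1)) \<omega>)
      - (dev k (- x (j - 1)) \<omega> - (if j = m then 0 else dev k (- x j) \<omega>))" for k \<omega>
  proof -
    have d: "dev k y \<omega> = (cnt k y \<omega> - (\<Sum>t=1..int (N k). below (eps k t \<omega>) y)) / rN k - c * Delta p \<beta> P GE y" for y
      by (simp add: dev_def cnt_def sum_subtractf)
    show ?thesis
      unfolding nup_num_incr[OF j] S_incr[OF j] delta_j_incr incr_plus_def incr_minus_def d
      by (simp add: diff_divide_distrib add_divide_distrib algebra_simps)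
  qed
  have z: "oprob M (\<lambda>k \<omega>. 0)" using oprob_const[OF M, of "\<lambda>_. 0"] by simp
  have i: "oprob M (\<lambda>k \<omega>. if j = m then 0 else dev k y \<omega>)" for y
    using z dev_oprob by (cases "j = m") auto
  show ?thesis unfolding eq by (intro oprob_diff[OF M] i dev_oprob)
qed

text \<open>The shift of the residual counts and the empirical fluctuation are both bounded in
  probability at scale sqrt n; one more division by sqrt n removes them, and the mixture tends to
  \<open>P\<close>.\<close>

lemma ratio_lim:
  assumes j: "j \<in> {1..m}"
  shows "oprob M (\<lambda>k \<omega>. nup k j \<omega> / real (N k) - pp j)"
proof -
  have cnt: "oprob M (\<lambda>k \<omega>. cnt k y \<omega> / real (N k) - cdf P y)" for y
  proof -
    have eq: "cnt k y \<omega> / real (N k) - cdf P y = (dev k y \<omega> + c * Delta p \<beta> P GE y) * (1 / rN k) + ecdf_dev k y \<omega> * (1 / rN k) + (cdf (G k) y - cdf P y)" for k \<omega>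
    proof -
      have N0: "real (N k) > 0" using N1[of k] by simp
      have "(dev k y \<omega> + c * Delta p \<beta> P GE y) * (1 / rN k) + ecdf_dev k y \<omega> * (1 / rN k)
        = ((cnt k y \<omega> - (\<Sum>t=1..int (N k). below (eps k t \<omega>) y)) + ((\<Sum>t=1..int (N k). below (eps k t \<omega>) y) - real (N k) * cdf (G k) y)) / (rN k * rN k)"
        unfolding dev_def ecdf_dev_def cnt_def by (simp only: sum_subtractf) (simp add: add_divide_distrib diff_divide_distrib)
      also have "\<dots> = cnt k y \<omega> / real (N k) - cdf (G k) y"
        unfolding rN_sq using N0 by (simp add: diff_divide_distrib)
      finally show ?thesis by simp
    qed
    have r: "oprob M (\<lambda>k \<omega>. 1 / rN k)" by (rule oprob_const[OF M inv_rN])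
    have "oprob M (\<lambda>k \<omega>. cdf (G k) y - cdf P y)"
      by (rule oprob_const[OF M LIM_zero[OF cdf_G_lim]])
    then show ?thesis unfolding eq
      by (intro oprob_add[OF M] oprob_mult[OF M Oprob_add[OF M oprob_Oprob[OF M dev_oprob] Oprob_const[OF M]] r]
          oprob_mult[OF M ecdf_dev_Oprob r])
  qed
  have eq: "nup k j \<omega> / real (N k) - pp j = (if j = m then 0 else cnt k (x j) \<omega> / real (N k) - cdf P (x j))
     - (cnt k (x (j - 1)) \<omega> / real (N k) - cdf P (x (j - 1)))" for k \<omega>
    unfolding nup_num_incr[OF j] measure_bins[OF real_distrs(1) j] incr_plus_def using N1[of k]
    by (simp add: diff_divide_distrib)
  have z: "oprob M (\<lambda>k \<omega>. 0)" using oprob_const[OF M, of "\<lambda>_. 0"] by simp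
  have i: "oprob M (\<lambda>k \<omega>. if j = m then 0 else cnt k y \<omega> / real (N k) - cdf P y)" for y
    using z cnt by (cases "j = m") auto
  show ?thesis unfolding eq by (intro oprob_diff[OF M] i cnt)
qed

text \<open>After centring, \<open>S\<close> is a combination of empirical deviations with bounded
  first moments; its mean is sqrt n times a difference of mirrored cell probabilities and converges
  to \<open>r * dq j\<close>.\<close>

lemma S_Oprob:
  assumes j: "j \<in> {1..m}"
  shows "Oprob M (\<lambda>k \<omega>. S k j \<omega>)"
proof -
  have eq: "S k j \<omega> = ((if j = m then 0 else ecdf_dev k (x j) \<omega>) + (- 1) * ecdf_dev k (x (j - 1)) \<omega>)
      + ((- 1) * ecdf_dev k (- x (j - 1)) \<omega> + (if j = m then 0 else ecdf_dev k (- x j) \<omega>)) + (rN k * q k * dq j - r * dq j) + r * dq j" for k \<omega>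
  proof -
    have d: "ecdf_dev k y \<omega> = ((\<Sum>t=1..int (N k). below (eps k t \<omega>) y) - real (N k) * cdf (G k) y) / rN k" for y
      by (simp add: ecdf_dev_def sum_subtractf)
    have "measure (G k) (bin_plus x m j) - measure (G k) (bin_minus x m j) = q k * dq j"
      unfolding G_bins dq_def using P_bin_minus[OF j] by (simp add: algebra_simps)
    then have "rN k * q k * dq j = rN k * (incr_plus x m (cdf (G k)) 1 j - incr_minus x m (cdf (G k)) j)"
      unfolding measure_bins[OF real_distrs(4) j] by simp
    also have "\<dots> = real (N k) * (incr_plus x m (cdf (G k)) 1 j - incr_minus x m (cdf (G k)) j) / rN k"
      by (simp add: real_div_sqrt flip: times_divide_eq_left)
    finally have e: "rN k * q k * dq j = real (N k) * (incr_plus x m (cdf (G k)) 1 j - incr_minus x m (cdf (G k)) j) / rN k" .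
    show ?thesis
      unfolding e S_incr[OF j] incr_plus_def incr_minus_def d
      by (simp add: diff_divide_distrib add_divide_distrib right_diff_distrib distrib_left)
  qed
  have i: "Oprob M (\<lambda>k \<omega>. if j = m then 0 else ecdf_dev k y \<omega>)" for y
    using Oprob_const[OF M] ecdf_dev_Oprob by (cases "j = m") auto
  have l: "oprob M (\<lambda>k \<omega>. rN k * q k * dq j - r * dq j)"
  proof (rule oprob_const[OF M])
    have "(\<lambda>k. rN k * q k * dq j - r * dq j) \<longlonglongrightarrow> r * dq j - r * dq j"
      by (intro tendsto_intros q_lim(1))
    then show "(\<lambda>k. rN k * q k * dq j - r * dq j) \<longlonglongrightarrow> 0" by simp
  qed
  show ?thesis unfolding eq
    by (intro Oprob_add[OF M] Oprob_mult[OF M Oprob_const[OF M] ecdf_dev_Oprob] i Oprob_const[OF M] oprob_Oprob[OF M l])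
qed

abbreviation "stat k \<omega> \<equiv> chi2_stat p m x (N k) (bh k \<omega>) (yo k \<omega>)"

lemma stat_eq: "stat k \<omega> = (\<Sum>j=1..m. (nup k j \<omega> - num k j \<omega>)\<^sup>2 / (2 * nup k j \<omega>))"
  by (simp add: chi2_stat_def nup_def num_def resid_def Let_def)

lemma stat_nonneg: "stat k \<omega> \<ge> 0"
  unfolding stat_eq nup_def by (intro sum_nonneg divide_nonneg_nonneg) auto

lemma stat_measurable[measurable]: "(\<lambda>\<omega>. stat k \<omega>) \<in> borel_measurable (M k)"
proof -
  interpret contam_noise "M k" "G k" GE "g k" "eps k" "z k" "xi k" by (rule noise)
  note [measurable] = bh_meas
  have [measurable]: "u k t \<in> borel_measurable (M k)" for t
    using model[of k] by (simp add: AR_contam_model_def)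
  have [measurable]: "resid k t \<in> borel_measurable (M k)" for t
    unfolding resid_def[abs_def] residual_def yobs_def by measurable
  have [measurable]: "cnt k y \<in> borel_measurable (M k)" for y
    unfolding cnt_def[abs_def] by measurable
  have m: "(\<lambda>\<omega>. \<Sum>j=1..m. (nup k j \<omega> - num k j \<omega>)\<^sup>2 / (2 * nup k j \<omega>)) \<in> borel_measurable (M k)"
  proof (rule borel_measurable_sum)
    fix j assume j: "j \<in> {1..m}"
    have [measurable]: "nup k j \<in> borel_measurable (M k)" "num k j \<in> borel_measurable (M k)"
      unfolding nup_num_incr[OF j, abs_def] incr_plus_def incr_minus_def by measurable
    show "(\<lambda>\<omega>. (nup k j \<omega> - num k j \<omega>)\<^sup>2 / (2 * nup k j \<omega>)) \<in> borel_measurable (M k)" by measurable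
  qed
  then show ?thesis unfolding stat_eq .
qed

text \<open>The random denominators are replaced by their limits at the cost of a factor bounded in
  probability times a vanishing one; then the squares for residuals and innovations are compared by
  factoring the difference of squares.\<close>

lemma stat_approx:
  "oprob M (\<lambda>k \<omega>. stat k \<omega> - (\<Sum>j\<in>{1..m}. ((S k j \<omega> + c * dl j) / sqrt (2 * pp j))\<^sup>2))"
proof -
  have one: "oprob M (\<lambda>k \<omega>. (nup k j \<omega> - num k j \<omega>)\<^sup>2 / (2 * nup k j \<omega>) - ((S k j \<omega> + c * dl j) / sqrt (2 * pp j))\<^sup>2)"
    if j: "j \<in> {1..m}" for j
  proof -
    have pj: "pp j > 0" by (rule pplus[OF j])
    let ?S = "\<lambda>k \<omega>. S k j \<omega> + c * dl j"
    have SO: "Oprob M ?S" by (intro Oprob_add[OF M] S_Oprob[OF j] Oprob_const[OF M])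
    have TO: "Oprob M (\<lambda>k \<omega>. T k j \<omega>)"
      using Oprob_add[OF M SO oprob_Oprob[OF M T_approx[OF j]]] by simp
    have inv: "oprob M (\<lambda>k \<omega>. 1 / (2 * (nup k j \<omega> / real (N k))) - 1 / (2 * pp j))"
      by (rule oprob_continuous_map[OF M ratio_lim[OF j], of "\<lambda>y. 1 / (2 * y)"])
         (use pj in \<open>auto intro!: continuous_intros\<close>)
    have eq: "(nup k j \<omega> - num k j \<omega>)\<^sup>2 / (2 * nup k j \<omega>) - ((S k j \<omega> + c * dl j) / sqrt (2 * pp j))\<^sup>2
      = (T k j \<omega> * T k j \<omega>) * (1 / (2 * (nup k j \<omega> / real (N k))) - 1 / (2 * pp j))
        + (1 / (2 * pp j) * (T k j \<omega> + ?S k \<omega>)) * (T k j \<omega> - ?S k \<omega>)" for k \<omega>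
    proof -
      have N0: "real (N k) > 0" using N1[of k] by simp
      have "T k j \<omega> * T k j \<omega> = (nup k j \<omega> - num k j \<omega>)\<^sup>2 / real (N k)"
        unfolding times_divide_times_eq rN_sq power2_eq_square ..
      \<comment> \<open>Also true when no residual falls into the cell: both quotients are then 0 by
        the convention for division by zero.\<close>
      then have e1: "(nup k j \<omega> - num k j \<omega>)\<^sup>2 / (2 * nup k j \<omega>) = (T k j \<omega> * T k j \<omega>) * (1 / (2 * (nup k j \<omega> / real (N k))))"
        using N0 by simp
      have e2: "((S k j \<omega> + c * dl j) / sqrt (2 * pp j))\<^sup>2 = ?S k \<omega> * ?S k \<omega> / (2 * pp j)"
        using pj by (simp add: power_divide power2_eq_square)
      have e3: "e * e * y1 - d * d / h = e * e * (y1 - 1 / h) + 1 / h * (e + d) * (e - d)" for y1 d h e :: real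
        by (simp add: algebra_simps diff_divide_distrib)
      show ?thesis unfolding e1 e2 by (rule e3)
    qed
    show ?thesis unfolding eq
      by (rule oprob_add[OF M oprob_mult[OF M Oprob_mult[OF M TO TO] inv]
          oprob_mult[OF M Oprob_mult[OF M Oprob_const[OF M] Oprob_add[OF M TO SO]] T_approx[OF j]]])
  qed
  have eq: "stat k \<omega> - (\<Sum>j\<in>{1..m}. ((S k j \<omega> + c * dl j) / sqrt (2 * pp j))\<^sup>2)
    = (\<Sum>j\<in>{1..m}. (nup k j \<omega> - num k j \<omega>)\<^sup>2 / (2 * nup k j \<omega>) - ((S k j \<omega> + c * dl j) / sqrt (2 * pp j))\<^sup>2)" for k \<omega>
    unfolding stat_eq by (simp add: sum_subtractf)
  show ?thesis unfolding eq by (rule oprob_sum[OF M _ one]) simp_all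
qed

lemma laplace_stat_lim:
  assumes a: "a \<ge> 0"
  shows "(\<lambda>k. \<integral>\<omega>. exp (- (a * stat k \<omega>)) \<partial>M k)
    \<longlonglongrightarrow> exp (- (a * (\<Sum>j\<in>{1..m}. (\<mu> j)\<^sup>2) / (1 + 2 * a))) / sqrt (1 + 2 * a) ^ m"
proof -
  have "(\<lambda>k. (\<integral>\<omega>. exp (- (a * stat k \<omega>)) \<partial>M k) - (\<integral>\<omega>. exp (- (a * (\<Sum>j\<in>{1..m}. ((S k j \<omega> + c * dl j) / sqrt (2 * pp j))\<^sup>2))) \<partial>M k)) \<longlonglongrightarrow> 0"
    by (rule oprob_laplace_diff[OF M _ _ stat_nonneg _ stat_approx a]) (auto intro!: sum_nonneg)
  from tendsto_add[OF this laplace_S_lim[OF a]] show ?thesis by simp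
qed

lemma noncentrality: "(\<Sum>j\<in>{1..m}. (\<mu> j)\<^sup>2) = (\<Sum>j\<in>{1..m}. (r * dq j + c * dl j)\<^sup>2 / (2 * pp j))"
proof (intro sum.cong refl)
  fix j assume "j \<in> {1..m}"
  from pplus[OF this] show "(\<mu> j)\<^sup>2 = (r * dq j + c * dl j)\<^sup>2 / (2 * pp j)"
    by (simp add: \<mu>_def power_divide)
qed

end

section \<open>The noncentral chi-square limit\<close>

abbreviation ncchisq_vector :: "nat \<Rightarrow> (nat \<Rightarrow> real) measure" where
  "ncchisq_vector m \<equiv> PiM {..<m} (\<lambda>_. std_normal_distribution)"

definition ncchisq_form :: "nat \<Rightarrow> real \<Rightarrow> (nat \<Rightarrow> real) \<Rightarrow> real" where
  "ncchisq_form m lam v = (\<Sum>i<m. (v i + (if i = 0 then sqrt lam else 0))\<^sup>2)"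

lemma ncchisq_form_measurable[measurable]: "ncchisq_form m lam \<in> borel_measurable (ncchisq_vector m)"
  unfolding ncchisq_form_def[abs_def] by measurable

lemma ncchisq_form_nonneg: "ncchisq_form m lam v \<ge> 0"
  unfolding ncchisq_form_def by (intro sum_nonneg) auto

lemma prob_space_ncchisq_vector: "prob_space (ncchisq_vector m)"
proof -
  interpret N: real_distribution std_normal_distribution by (rule real_dist_normal_dist)
  show ?thesis by (rule prob_space_PiM) (rule N.prob_space_axioms)
qed

text \<open>As m is positive, coordinate 0 is present and carries the whole noncentrality; the value
  has the form found for the limit of the statistic.\<close>

lemma laplace_ncchisq_form:
  assumes "m \<ge> 1" "lam \<ge> 0" "a \<ge> 0"
  shows "(\<integral>v. exp (- (a * ncchisq_form m lam v)) \<partial>ncchisq_vector m)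
    = exp (- (a * lam / (1 + 2 * a))) / sqrt (1 + 2 * a) ^ m"
proof -
  have "(\<Sum>i<m. (if i = 0 then sqrt lam else 0)\<^sup>2) = (\<Sum>i<m. if i = 0 then lam else 0)"
    using assms by (intro sum.cong) auto
  also have "\<dots> = lam" using assms by (subst sum.delta) auto
  finally show ?thesis
    using laplace_shifted_square_norm_std_normal[of "{..<m}" a "\<lambda>i. if i = 0 then sqrt lam else 0"] assms
    by (simp add: ncchisq_form_def)
qed

text \<open>Since the statistic is nonnegative, its law is that of the \<open>[0,1]\<close>-valued variable \<open>exp (- T)\<close>,
  whose moments are values of the Laplace transform; the cut-off at 2 keeps the thresholds in a compact set
  when \<open>y\<close> tends to \<open>-\<infinity>\<close>.\<close>

lemma laplace_imp_ncchisq_limit: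
  fixes M :: "nat \<Rightarrow> 'a measure" and T :: "nat \<Rightarrow> 'a \<Rightarrow> real"
  assumes M: "\<And>k. prob_space (M k)" and T[measurable]: "\<And>k. T k \<in> borel_measurable (M k)"
    and T0: "\<And>k \<omega>. T k \<omega> \<ge> 0" and m: "m \<ge> 1" and lam: "lam \<ge> 0"
    and lap: "\<And>a. a \<ge> 0 \<Longrightarrow> (\<lambda>k. \<integral>\<omega>. exp (- (a * T k \<omega>)) \<partial>M k)
      \<longlonglongrightarrow> exp (- (a * lam / (1 + 2 * a))) / sqrt (1 + 2 * a) ^ m"
    and c: "(\<lambda>k. min (exp (- y k)) 2) \<longlonglongrightarrow> c"
  shows "(\<lambda>k. measure (M k) {\<omega> \<in> space (M k). T k \<omega> \<le> y k})
    \<longlonglongrightarrow> measure (ncchisq_vector m) {v \<in> space (ncchisq_vector m). exp (- ncchisq_form m lam v) \<ge> c}"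
proof -
  have eq: "(T k \<omega> \<le> y k) = (exp (- T k \<omega>) \<ge> min (exp (- y k)) 2)" for k \<omega>
  proof -
    have "exp (- T k \<omega>) < 2" using T0[of k \<omega>] by (simp add: le_less_trans[of _ 1])
    then show ?thesis by (auto simp: min_le_iff_disj)
  qed
  show ?thesis unfolding eq
  proof (rule moments_imp_prob_ge[OF M prob_space_ncchisq_vector _ _ _ _ _ _ c])
    fix a :: nat
    have pow: "exp (- s) ^ a = exp (- (real a * s))" for s :: real
      by (simp add: exp_of_nat_mult[symmetric])
    show "(\<lambda>k. \<integral>\<omega>. exp (- T k \<omega>) ^ a \<partial>M k) \<longlonglongrightarrow> (\<integral>v. exp (- ncchisq_form m lam v) ^ a \<partial>ncchisq_vector m)"
      unfolding pow laplace_ncchisq_form[OF m lam of_nat_0_le_iff] by (rule lap) simp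
  next
    show "measure (ncchisq_vector m) {v \<in> space (ncchisq_vector m). exp (- ncchisq_form m lam v) = c} = 0"
    \<comment> \<open>The limit level is 0 when the thresholds tend to infinity; an exponential
      never takes that value.\<close>
    proof (cases "c > 0")
      case True
      then have "(exp (- ncchisq_form m lam v) = c) = (ncchisq_form m lam v = - ln c)" for v
        using ln_exp[of "- ncchisq_form m lam v"] exp_ln[of c] by (auto simp del: ln_exp exp_ln_iff)
      then show ?thesis
        using shifted_square_norm_std_normal_no_atom[of "{..<m}" "\<lambda>i. if i = 0 then sqrt lam else 0" "- ln c"] m
        by (simp add: ncchisq_form_def lessThan_empty_iff)
    next
      case False
      then have "exp (- ncchisq_form m lam v) \<noteq> c" for v using exp_gt_zero[of "- ncchisq_form m lam v"] by linarith
      then show ?thesis by simp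
    qed
  qed (use T0 ncchisq_form_nonneg in auto)
qed

text \<open>The approximating law varies with \<open>k\<close> as well, through its noncentrality.
  The statistic and the noncentral chi-square variables with parameter \<open>lam k\<close> satisfy
  the same Laplace criterion with the same limit and the same levels, so both distribution functions
  tend to \<open>?p\<close>.\<close>

lemma (in AR_seq) stat_cdf_lim:
  assumes c: "(\<lambda>k. min (exp (- y k)) 2) \<longlonglongrightarrow> C"
  shows "(\<lambda>k. measure (M k) {\<omega> \<in> space (M k). stat k \<omega> \<le> y k}
    - ncchisq_cdf m (\<Sum>j=1..m. (rs k * dq j + cs k * dl j)\<^sup>2 / (2 * pp j)) (y k)) \<longlonglongrightarrow> 0"
proof -
  define lam where "lam k = (\<Sum>j=1..m. (rs k * dq j + cs k * dl j)\<^sup>2 / (2 * pp j))" for k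
  define lam0 where "lam0 = (\<Sum>j=1..m. (r * dq j + c * dl j)\<^sup>2 / (2 * pp j))"
  have lam_lim: "lam \<longlonglongrightarrow> lam0"
    unfolding lam_def lam0_def using pplus by (intro tendsto_intros cs rs) fastforce
  have lam_nn: "lam k \<ge> 0" "lam0 \<ge> 0" for k
    unfolding lam_def lam0_def by (intro sum_nonneg; simp)+
  let ?p = "measure (ncchisq_vector m) {v \<in> space (ncchisq_vector m). exp (- ncchisq_form m lam0 v) \<ge> C}"
  have 1: "(\<lambda>k. measure (M k) {\<omega> \<in> space (M k). stat k \<omega> \<le> y k}) \<longlonglongrightarrow> ?p"
    using laplace_stat_lim unfolding noncentrality lam0_def[symmetric]
    by (intro laplace_imp_ncchisq_limit[OF M stat_measurable stat_nonneg m lam_nn(2) _ c])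
  have 2: "(\<lambda>k. measure (ncchisq_vector m) {v \<in> space (ncchisq_vector m). ncchisq_form m (lam k) v \<le> y k}) \<longlonglongrightarrow> ?p"
  proof (rule laplace_imp_ncchisq_limit[OF prob_space_ncchisq_vector ncchisq_form_measurable ncchisq_form_nonneg m lam_nn(2) _ c])
    fix a :: real assume a: "a \<ge> 0"
    have "sqrt (1 + 2 * a) ^ m \<noteq> 0" using a by simp
    then show "(\<lambda>k. \<integral>v. exp (- (a * ncchisq_form m (lam k) v)) \<partial>ncchisq_vector m)
      \<longlonglongrightarrow> exp (- (a * lam0 / (1 + 2 * a))) / sqrt (1 + 2 * a) ^ m"
      unfolding laplace_ncchisq_form[OF m lam_nn(1) a] using a by (intro tendsto_intros lam_lim) auto
  qed
  from tendsto_diff[OF 1 2] show ?thesis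
    by (simp add: ncchisq_cdf_def ncchisq_form_def lam_def)
qed

text \<open>One statement for hypothesis and alternatives: the pairs in \<open>A\<close> have either
  \<rho> = 0 or 0 < \<rho> <= R. Boundedness of \<open>A\<close> suffices, since limits of the
  parameters may leave \<open>A\<close> while the models are used only along the sequence
  itself.\<close>

lemma chi2_stat_uniform_limit:
  fixes M :: "nat \<Rightarrow> real \<Rightarrow> real \<Rightarrow> 'a measure"
    and eps z xi u :: "nat \<Rightarrow> real \<Rightarrow> real \<Rightarrow> int \<Rightarrow> 'a \<Rightarrow> real"
    and est :: "nat \<Rightarrow> (int \<Rightarrow> real) \<Rightarrow> nat \<Rightarrow> real" and A :: "(real \<times> real) set"
  defines "yo \<equiv> \<lambda>n \<gamma> \<rho> \<omega> t. yobs (u n \<gamma> \<rho>) (z n \<gamma> \<rho>) (xi n \<gamma> \<rho>) t \<omega>"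
  assumes bins: "bins x m" and causal: "causal_coeffs p \<beta>"
    and distrs: "is_real_distr P" "is_real_distr Q" "is_real_distr GE"
    and sym: "symmetric_distr P"
    and mom: "zero_mean_finite_var P" "zero_mean_finite_var Q"
    and smooth: "twice_diff_bounded P" "twice_diff_bounded Q"
    and pplus: "\<And>j. j \<in> {1..m} \<Longrightarrow> measure P (bin_plus x m j) > 0"
    and est_meas: "\<And>n i. (\<lambda>v. est n v i) \<in> borel_measurable (PiM {1 - int p..int n} (\<lambda>_. borel))"
    and A: "bounded A" "\<And>\<gamma> \<rho>. (\<gamma>, \<rho>) \<in> A \<Longrightarrow> \<gamma> \<ge> 0 \<and> \<rho> \<ge> 0"
    and model: "\<And>n \<gamma> \<rho>. (\<gamma>, \<rho>) \<in> A \<Longrightarrow> AR_contam_model p \<beta> (mix_distr (rate \<rho> n) P Q) GE (rate \<gamma> n) (M n \<gamma> \<rho>)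
          (eps n \<gamma> \<rho>) (z n \<gamma> \<rho>) (xi n \<gamma> \<rho>) (u n \<gamma> \<rho>)"
    and tight: "\<And>e. e > 0 \<Longrightarrow> \<exists>C N. \<forall>n\<ge>N. \<forall>(\<gamma>, \<rho>)\<in>A. measure (M n \<gamma> \<rho>) {\<omega>\<in>space (M n \<gamma> \<rho>).
          sqrt (real n) * sqrt (\<Sum>i=1..p. (est_of p n est (yo n \<gamma> \<rho> \<omega>) i - \<beta> i)\<^sup>2) > C} < e"
    and e: "e > 0"
  shows "\<exists>N. \<forall>n\<ge>N. \<forall>y. \<forall>(\<gamma>, \<rho>)\<in>A. \<bar>measure (M n \<gamma> \<rho>) {\<omega>\<in>space (M n \<gamma> \<rho>).
            chi2_stat p m x n (est_of p n est (yo n \<gamma> \<rho> \<omega>)) (yo n \<gamma> \<rho> \<omega>) \<le> y}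
         - ncchisq_cdf m (\<Sum>j=1..m. (\<rho> * (measure Q (bin_plus x m j) - measure Q (bin_minus x m j))
               + \<gamma> * delta_j p \<beta> P GE x m j)\<^sup>2 / (2 * measure P (bin_plus x m j))) y\<bar> < e"
proof (rule ccontr)
  define dif where "dif n y \<gamma> \<rho> = measure (M n \<gamma> \<rho>) {\<omega>\<in>space (M n \<gamma> \<rho>).
            chi2_stat p m x n (est_of p n est (yo n \<gamma> \<rho> \<omega>)) (yo n \<gamma> \<rho> \<omega>) \<le> y}
         - ncchisq_cdf m (\<Sum>j=1..m. (\<rho> * (measure Q (bin_plus x m j) - measure Q (bin_minus x m j))
               + \<gamma> * delta_j p \<beta> P GE x m j)\<^sup>2 / (2 * measure P (bin_plus x m j))) y" for n y \<gamma> \<rho>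
  assume "\<not> ?thesis"
  \<comment> \<open>The condition n >= Suc K makes the bad sample sizes positive and forces them to
    infinity.\<close>
  then have "\<forall>K. \<exists>n y \<gamma> \<rho>. n \<ge> Suc K \<and> (\<gamma>, \<rho>) \<in> A \<and> \<bar>dif n y \<gamma> \<rho>\<bar> \<ge> e"
    unfolding dif_def by (fastforce simp: not_less)
  then obtain n y \<gamma> \<rho> where bad: "\<And>k. n k \<ge> Suc k" "\<And>k. (\<gamma> k, \<rho> k) \<in> A" "\<And>k. \<bar>dif (n k) (y k) (\<gamma> k) (\<rho> k)\<bar> \<ge> e"
    by metis
  \<comment> \<open>The levels range over the whole line; the cut-off exponential maps them into a
    compact interval, so one subsequence makes parameters and levels converge together.\<close>
  define f where "f k = ((\<gamma> k, \<rho> k), min (exp (- y k)) 2)" for k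
  have "range f \<subseteq> A \<times> {0..2}" using bad(2) by (auto simp: f_def min_def)
  then have "bounded (range f)"
    by (rule bounded_subset[OF bounded_Times[OF A(1) bounded_closed_interval]])
  then obtain l s where s: "strict_mono s" and l: "(f \<circ> s) \<longlonglongrightarrow> l"
    using bounded_imp_convergent_subsequence by blast
  obtain c r C where lcr: "l = ((c, r), C)" by (cases l) auto
  have lim: "(\<lambda>k. \<gamma> (s k)) \<longlonglongrightarrow> c" "(\<lambda>k. \<rho> (s k)) \<longlonglongrightarrow> r" "(\<lambda>k. min (exp (- y (s k))) 2) \<longlonglongrightarrow> C"
    using tendsto_fst[OF tendsto_fst[OF l]] tendsto_snd[OF tendsto_fst[OF l]] tendsto_snd[OF l]
    by (auto simp: f_def lcr o_def)
  have n_top: "filterlim (\<lambda>k. n (s k)) at_top sequentially"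
  proof (rule filterlim_at_top_mono[OF filterlim_ident])
    show "\<forall>\<^sub>F k in sequentially. k \<le> n (s k)"
      using bad(1) seq_suble[OF s] by (intro always_eventually allI) (meson Suc_leD le_trans)
  qed
  interpret bins x m by (rule bins)
  interpret AR_seq x m p \<beta> P Q GE "\<lambda>k. n (s k)" "\<lambda>k. \<gamma> (s k)" "\<lambda>k. \<rho> (s k)" c r
    "\<lambda>k. M (n (s k)) (\<gamma> (s k)) (\<rho> (s k))" "\<lambda>k. eps (n (s k)) (\<gamma> (s k)) (\<rho> (s k))"
    "\<lambda>k. z (n (s k)) (\<gamma> (s k)) (\<rho> (s k))" "\<lambda>k. xi (n (s k)) (\<gamma> (s k)) (\<rho> (s k))"
    "\<lambda>k. u (n (s k)) (\<gamma> (s k)) (\<rho> (s k))"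
    "\<lambda>k \<omega>. est_of p (n (s k)) est (yo (n (s k)) (\<gamma> (s k)) (\<rho> (s k)) \<omega>)"
  proof (unfold_locales)
    show "causal_coeffs p \<beta>" "is_real_distr P" "is_real_distr Q" "is_real_distr GE" "symmetric_distr P"
      "zero_mean_finite_var P" "zero_mean_finite_var Q" "twice_diff_bounded P" "twice_diff_bounded Q"
      by fact+
    show "0 < measure P (bin_plus x m j)" if "j \<in> {1..m}" for j using pplus that by simp
    show "filterlim (\<lambda>k. n (s k)) at_top sequentially" "(\<lambda>k. \<gamma> (s k)) \<longlonglongrightarrow> c" "(\<lambda>k. \<rho> (s k)) \<longlonglongrightarrow> r"
      by fact+
    show "1 \<le> n (s k)" for k using bad(1)[of "s k"] by simp
    show "0 \<le> \<gamma> (s k)" "0 \<le> \<rho> (s k)" for k using A(2)[OF bad(2)] by auto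
    show mod: "AR_contam_model p \<beta> (mix_distr (rate (\<rho> (s k)) (n (s k))) P Q) GE (rate (\<gamma> (s k)) (n (s k)))
        (M (n (s k)) (\<gamma> (s k)) (\<rho> (s k))) (eps (n (s k)) (\<gamma> (s k)) (\<rho> (s k)))
        (z (n (s k)) (\<gamma> (s k)) (\<rho> (s k))) (xi (n (s k)) (\<gamma> (s k)) (\<rho> (s k))) (u (n (s k)) (\<gamma> (s k)) (\<rho> (s k)))" for k
      by (rule model[OF bad(2)])
    show "(\<lambda>\<omega>. est_of p (n (s k)) est (yo (n (s k)) (\<gamma> (s k)) (\<rho> (s k)) \<omega>) i) \<in> borel_measurable (M (n (s k)) (\<gamma> (s k)) (\<rho> (s k)))" for k i
    proof -
      interpret contam_noise "M (n (s k)) (\<gamma> (s k)) (\<rho> (s k))" "mix_distr (rate (\<rho> (s k)) (n (s k))) P Q" GE "rate (\<gamma> (s k)) (n (s k))"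
        "eps (n (s k)) (\<gamma> (s k)) (\<rho> (s k))" "z (n (s k)) (\<gamma> (s k)) (\<rho> (s k))" "xi (n (s k)) (\<gamma> (s k)) (\<rho> (s k))"
        by (rule AR_contam_model_noise[OF mod])
      have [measurable]: "u (n (s k)) (\<gamma> (s k)) (\<rho> (s k)) t \<in> borel_measurable (M (n (s k)) (\<gamma> (s k)) (\<rho> (s k)))" for t
        using mod[of k] by (simp add: AR_contam_model_def)
      have "(\<lambda>\<omega>. restrict (yo (n (s k)) (\<gamma> (s k)) (\<rho> (s k)) \<omega>) {1 - int p..int (n (s k))})
          \<in> measurable (M (n (s k)) (\<gamma> (s k)) (\<rho> (s k))) (PiM {1 - int p..int (n (s k))} (\<lambda>_. borel))"
        unfolding yo_def yobs_def by (intro measurable_restrict) measurable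
      from measurable_compose[OF this est_meas] show ?thesis unfolding est_of_def .
    qed
    fix e :: real assume "e > 0"
    from tight[OF this] obtain B N where BN: "\<And>n \<gamma> \<rho>. n \<ge> N \<Longrightarrow> (\<gamma>, \<rho>) \<in> A \<Longrightarrow> measure (M n \<gamma> \<rho>) {\<omega>\<in>space (M n \<gamma> \<rho>).
          sqrt (real n) * sqrt (\<Sum>i=1..p. (est_of p n est (yo n \<gamma> \<rho> \<omega>) i - \<beta> i)\<^sup>2) > B} < e"
      by fast
    have "\<forall>\<^sub>F k in sequentially. N \<le> n (s k)" using n_top by (simp add: filterlim_at_top)
    then show "\<exists>B. \<forall>\<^sub>F k in sequentially. measure (M (n (s k)) (\<gamma> (s k)) (\<rho> (s k))) {\<omega>\<in>space (M (n (s k)) (\<gamma> (s k)) (\<rho> (s k))).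
        sqrt (real (n (s k))) * sqrt (\<Sum>i=1..p. (est_of p (n (s k)) est (yo (n (s k)) (\<gamma> (s k)) (\<rho> (s k)) \<omega>) i - \<beta> i)\<^sup>2) > B} < e"
      by (intro exI[of _ B]) (elim eventually_mono, rule BN[OF _ bad(2)])
  qed
  have "(\<lambda>k. dif (n (s k)) (y (s k)) (\<gamma> (s k)) (\<rho> (s k))) \<longlonglongrightarrow> 0"
    using stat_cdf_lim[OF lim(3)] unfolding dif_def dq_def yo_def .
  then have "\<forall>\<^sub>F k in sequentially. \<bar>dif (n (s k)) (y (s k)) (\<gamma> (s k)) (\<rho> (s k))\<bar> < e"
    using e by (auto dest!: tendstoD simp: dist_real_def)
  then obtain k where "\<bar>dif (n (s k)) (y (s k)) (\<gamma> (s k)) (\<rho> (s k))\<bar> < e"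
    by (auto simp: eventually_sequentially)
  then show False using bad(3)[of "s k"] by simp
qed

theorem theorem3p1:
  fixes p m :: nat and \<beta> x :: "nat \<Rightarrow> real"
    and P Q GE :: "real measure" and R \<Gamma> :: real
    and M :: "nat \<Rightarrow> real \<Rightarrow> real \<Rightarrow> 'a measure"
    and eps z xi u :: "nat \<Rightarrow> real \<Rightarrow> real \<Rightarrow> int \<Rightarrow> 'a \<Rightarrow> real"
    and est :: "nat \<Rightarrow> (int \<Rightarrow> real) \<Rightarrow> nat \<Rightarrow> real"
  assumes beta: "causal_coeffs p \<beta>"
    and m: "m \<ge> 1"
    and x0: "x 0 = 0"
    and xmono: "\<forall>j. j + 1 < m \<longrightarrow> x j < x (j + 1)"
    and Pdistr: "is_real_distr P"
    and Pi_distr: "is_real_distr GE"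
    and pplus: "\<forall>j\<in>{1..m}. measure P (bin_plus x m j) > 0"
    and est_meas: "\<forall>n i. (\<lambda>v. est n v i) \<in> borel_measurable (PiM {1 - int p..int n} (\<lambda>_. borel))"
    and R: "R \<ge> 0" and \<Gamma>: "\<Gamma> \<ge> 0"
  shows
   "(symmetric_distr P \<and> zero_mean_finite_var P \<and> twice_diff_bounded P \<and>
     (\<forall>n \<gamma>. \<gamma> \<ge> 0 \<longrightarrow>
        AR_contam_model p \<beta> P GE (rate \<gamma> n) (M n \<gamma> 0)
          (eps n \<gamma> 0) (z n \<gamma> 0) (xi n \<gamma> 0) (u n \<gamma> 0)) \<and>
     (\<forall>\<Gamma>'\<ge>0. \<forall>e>0. \<exists>C N. \<forall>n\<ge>N. \<forall>\<gamma>\<in>{0..\<Gamma>'}.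
        measure (M n \<gamma> 0) {\<omega>\<in>space (M n \<gamma> 0).
          sqrt (real n) * sqrt (\<Sum>i=1..p.
            (est_of p n est (\<lambda>t. yobs (u n \<gamma> 0) (z n \<gamma> 0) (xi n \<gamma> 0) t \<omega>) i - \<beta> i)\<^sup>2) > C} < e)
    \<longrightarrow>
     (\<forall>e>0. \<exists>N. \<forall>n\<ge>N. \<forall>y. \<forall>\<gamma>\<in>{0..\<Gamma>}.
        \<bar>measure (M n \<gamma> 0) {\<omega>\<in>space (M n \<gamma> 0).
            chi2_stat p m x n
              (est_of p n est (\<lambda>t. yobs (u n \<gamma> 0) (z n \<gamma> 0) (xi n \<gamma> 0) t \<omega>))
              (\<lambda>t. yobs (u n \<gamma> 0) (z n \<gamma> 0) (xi n \<gamma> 0) t \<omega>) \<le> y}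
         - ncchisq_cdf m (\<gamma>\<^sup>2 * (\<Sum>j=1..m. (delta_j p \<beta> P GE x m j)\<^sup>2 / (2 * measure P (bin_plus x m j)))) y\<bar>
        < e))
  \<and>
   (symmetric_distr P \<and> is_real_distr Q \<and> \<not> symmetric_distr Q \<and>
     zero_mean_finite_var P \<and> zero_mean_finite_var Q \<and>
     twice_diff_bounded P \<and> twice_diff_bounded Q \<and>
     (\<forall>n \<gamma> \<rho>. \<gamma> \<ge> 0 \<longrightarrow> \<rho> > 0 \<longrightarrow>
        AR_contam_model p \<beta> (mix_distr (rate \<rho> n) P Q) GE (rate \<gamma> n) (M n \<gamma> \<rho>)
          (eps n \<gamma> \<rho>) (z n \<gamma> \<rho>) (xi n \<gamma> \<rho>) (u n \<gamma> \<rho>)) \<and>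
     (\<forall>R'\<ge>0. \<forall>\<Gamma>'\<ge>0. \<forall>e>0. \<exists>C N. \<forall>n\<ge>N. \<forall>\<gamma>\<in>{0..\<Gamma>'}. \<forall>\<rho>\<in>{0<..R'}.
        measure (M n \<gamma> \<rho>) {\<omega>\<in>space (M n \<gamma> \<rho>).
          sqrt (real n) * sqrt (\<Sum>i=1..p.
            (est_of p n est (\<lambda>t. yobs (u n \<gamma> \<rho>) (z n \<gamma> \<rho>) (xi n \<gamma> \<rho>) t \<omega>) i - \<beta> i)\<^sup>2) > C} < e)
    \<longrightarrow>
     (\<forall>e>0. \<exists>N. \<forall>n\<ge>N. \<forall>y. \<forall>\<gamma>\<in>{0..\<Gamma>}. \<forall>\<rho>\<in>{0<..R}.
        \<bar>measure (M n \<gamma> \<rho>) {\<omega>\<in>space (M n \<gamma> \<rho>).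
            chi2_stat p m x n
              (est_of p n est (\<lambda>t. yobs (u n \<gamma> \<rho>) (z n \<gamma> \<rho>) (xi n \<gamma> \<rho>) t \<omega>))
              (\<lambda>t. yobs (u n \<gamma> \<rho>) (z n \<gamma> \<rho>) (xi n \<gamma> \<rho>) t \<omega>) \<le> y}
         - ncchisq_cdf m (\<Sum>j=1..m.
              (\<rho> * (measure Q (bin_plus x m j) - measure Q (bin_minus x m j))
               + \<gamma> * delta_j p \<beta> P GE x m j)\<^sup>2 / (2 * measure P (bin_plus x m j))) y\<bar>
        < e))"
proof (intro conjI impI allI)
  have bins: "bins x m" using m x0 xmono by unfold_locales auto
  {
    fix e :: real
    assume H: "symmetric_distr P \<and> zero_mean_finite_var P \<and> twice_diff_bounded P \<and>
     (\<forall>n \<gamma>. \<gamma> \<ge> 0 \<longrightarrow>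
        AR_contam_model p \<beta> P GE (rate \<gamma> n) (M n \<gamma> 0)
          (eps n \<gamma> 0) (z n \<gamma> 0) (xi n \<gamma> 0) (u n \<gamma> 0)) \<and>
     (\<forall>\<Gamma>'\<ge>0. \<forall>e>0. \<exists>C N. \<forall>n\<ge>N. \<forall>\<gamma>\<in>{0..\<Gamma>'}.
        measure (M n \<gamma> 0) {\<omega>\<in>space (M n \<gamma> 0).
          sqrt (real n) * sqrt (\<Sum>i=1..p.
            (est_of p n est (\<lambda>t. yobs (u n \<gamma> 0) (z n \<gamma> 0) (xi n \<gamma> 0) t \<omega>) i - \<beta> i)\<^sup>2) > C} < e)"
      and e: "e > 0"
    have rate0: "rate 0 n = 0" for n by (simp add: rate_def)
    \<comment> \<open>The hypothesis is the case Q = P with \<rho> = 0: the mixture is then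
      \<open>P\<close>, and the first summand of the noncentrality vanishes.\<close>
    note L = chi2_stat_uniform_limit[where A = "{0..\<Gamma>} \<times> {0}" and Q = P and M = M and eps = eps and z = z and xi = xi
      and u = u and est = est, OF bins beta Pdistr Pdistr Pi_distr]
    have "\<exists>N. \<forall>n\<ge>N. \<forall>y. \<forall>(\<gamma>, \<rho>)\<in>{0..\<Gamma>} \<times> {0}. \<bar>measure (M n \<gamma> \<rho>) {\<omega>\<in>space (M n \<gamma> \<rho>).
            chi2_stat p m x n (est_of p n est (\<lambda>t. yobs (u n \<gamma> \<rho>) (z n \<gamma> \<rho>) (xi n \<gamma> \<rho>) t \<omega>)) (\<lambda>t. yobs (u n \<gamma> \<rho>) (z n \<gamma> \<rho>) (xi n \<gamma> \<rho>) t \<omega>) \<le> y}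
         - ncchisq_cdf m (\<Sum>j=1..m. (\<rho> * (measure P (bin_plus x m j) - measure P (bin_minus x m j))
               + \<gamma> * delta_j p \<beta> P GE x m j)\<^sup>2 / (2 * measure P (bin_plus x m j))) y\<bar> < e"
    proof (rule L)
      show "AR_contam_model p \<beta> (mix_distr (rate \<rho> n) P P) GE (rate \<gamma> n) (M n \<gamma> \<rho>)
          (eps n \<gamma> \<rho>) (z n \<gamma> \<rho>) (xi n \<gamma> \<rho>) (u n \<gamma> \<rho>)" if "(\<gamma>, \<rho>) \<in> {0..\<Gamma>} \<times> {0}" for n \<gamma> \<rho>
        using that H by (auto simp: rate0 mix_distr_0[OF Pdistr])
      show "\<exists>C N. \<forall>n\<ge>N. \<forall>(\<gamma>, \<rho>)\<in>{0..\<Gamma>} \<times> {0}. measure (M n \<gamma> \<rho>) {\<omega>\<in>space (M n \<gamma> \<rho>).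
          sqrt (real n) * sqrt (\<Sum>i=1..p. (est_of p n est (\<lambda>t. yobs (u n \<gamma> \<rho>) (z n \<gamma> \<rho>) (xi n \<gamma> \<rho>) t \<omega>) i - \<beta> i)\<^sup>2) > C} < e'"
        if e': "e' > 0" for e'
      proof -
        from H \<Gamma> e' obtain C N where "\<forall>n\<ge>N. \<forall>\<gamma>\<in>{0..\<Gamma>}. measure (M n \<gamma> 0) {\<omega>\<in>space (M n \<gamma> 0).
          sqrt (real n) * sqrt (\<Sum>i=1..p.
            (est_of p n est (\<lambda>t. yobs (u n \<gamma> 0) (z n \<gamma> 0) (xi n \<gamma> 0) t \<omega>) i - \<beta> i)\<^sup>2) > C} < e'" by meson
        then show ?thesis by (intro exI[of _ C] exI[of _ N]) auto
      qed
    qed (use H e pplus est_meas in \<open>auto intro!: bounded_Times\<close>)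
    moreover have "(\<Sum>j=1..m. (0 * (measure P (bin_plus x m j) - measure P (bin_minus x m j))
          + \<gamma> * delta_j p \<beta> P GE x m j)\<^sup>2 / (2 * measure P (bin_plus x m j)))
      = \<gamma>\<^sup>2 * (\<Sum>j=1..m. (delta_j p \<beta> P GE x m j)\<^sup>2 / (2 * measure P (bin_plus x m j)))" for \<gamma>
      by (simp add: power_mult_distrib sum_distrib_left)
    ultimately show "\<exists>N. \<forall>n\<ge>N. \<forall>y. \<forall>\<gamma>\<in>{0..\<Gamma>}.
        \<bar>measure (M n \<gamma> 0) {\<omega>\<in>space (M n \<gamma> 0).
            chi2_stat p m x n
              (est_of p n est (\<lambda>t. yobs (u n \<gamma> 0) (z n \<gamma> 0) (xi n \<gamma> 0) t \<omega>))
              (\<lambda>t. yobs (u n \<gamma> 0) (z n \<gamma> 0) (xi n \<gamma> 0) t \<omega>) \<le> y}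
         - ncchisq_cdf m (\<gamma>\<^sup>2 * (\<Sum>j=1..m. (delta_j p \<beta> P GE x m j)\<^sup>2 / (2 * measure P (bin_plus x m j)))) y\<bar>
        < e" by simp
  next
    fix e :: real
    assume H: "symmetric_distr P \<and> is_real_distr Q \<and> \<not> symmetric_distr Q \<and>
     zero_mean_finite_var P \<and> zero_mean_finite_var Q \<and>
     twice_diff_bounded P \<and> twice_diff_bounded Q \<and>
     (\<forall>n \<gamma> \<rho>. \<gamma> \<ge> 0 \<longrightarrow> \<rho> > 0 \<longrightarrow>
        AR_contam_model p \<beta> (mix_distr (rate \<rho> n) P Q) GE (rate \<gamma> n) (M n \<gamma> \<rho>)
          (eps n \<gamma> \<rho>) (z n \<gamma> \<rho>) (xi n \<gamma> \<rho>) (u n \<gamma> \<rho>)) \<and>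
     (\<forall>R'\<ge>0. \<forall>\<Gamma>'\<ge>0. \<forall>e>0. \<exists>C N. \<forall>n\<ge>N. \<forall>\<gamma>\<in>{0..\<Gamma>'}. \<forall>\<rho>\<in>{0<..R'}.
        measure (M n \<gamma> \<rho>) {\<omega>\<in>space (M n \<gamma> \<rho>).
          sqrt (real n) * sqrt (\<Sum>i=1..p.
            (est_of p n est (\<lambda>t. yobs (u n \<gamma> \<rho>) (z n \<gamma> \<rho>) (xi n \<gamma> \<rho>) t \<omega>) i - \<beta> i)\<^sup>2) > C} < e)"
      and e: "e > 0"
    then have Qdistr: "is_real_distr Q" by simp
    \<comment> \<open>The interval for \<rho> is open at 0 because the models of this part are given
      for positive \<rho> only.\<close>
    note L = chi2_stat_uniform_limit[where A = "{0..\<Gamma>} \<times> {0<..R}" and M = M and eps = eps and z = z and xi = xi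
      and u = u and est = est, OF bins beta Pdistr Qdistr Pi_distr]
    have "\<exists>N. \<forall>n\<ge>N. \<forall>y. \<forall>(\<gamma>, \<rho>)\<in>{0..\<Gamma>} \<times> {0<..R}. \<bar>measure (M n \<gamma> \<rho>) {\<omega>\<in>space (M n \<gamma> \<rho>).
            chi2_stat p m x n (est_of p n est (\<lambda>t. yobs (u n \<gamma> \<rho>) (z n \<gamma> \<rho>) (xi n \<gamma> \<rho>) t \<omega>)) (\<lambda>t. yobs (u n \<gamma> \<rho>) (z n \<gamma> \<rho>) (xi n \<gamma> \<rho>) t \<omega>) \<le> y}
         - ncchisq_cdf m (\<Sum>j=1..m. (\<rho> * (measure Q (bin_plus x m j) - measure Q (bin_minus x m j))
               + \<gamma> * delta_j p \<beta> P GE x m j)\<^sup>2 / (2 * measure P (bin_plus x m j))) y\<bar> < e"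
    proof (rule L)
      show "\<exists>C N. \<forall>n\<ge>N. \<forall>(\<gamma>, \<rho>)\<in>{0..\<Gamma>} \<times> {0<..R}. measure (M n \<gamma> \<rho>) {\<omega>\<in>space (M n \<gamma> \<rho>).
          sqrt (real n) * sqrt (\<Sum>i=1..p. (est_of p n est (\<lambda>t. yobs (u n \<gamma> \<rho>) (z n \<gamma> \<rho>) (xi n \<gamma> \<rho>) t \<omega>) i - \<beta> i)\<^sup>2) > C} < e'"
        if e': "e' > 0" for e'
      proof -
        from H R \<Gamma> e' obtain C N where "\<forall>n\<ge>N. \<forall>\<gamma>\<in>{0..\<Gamma>}. \<forall>\<rho>\<in>{0<..R}. measure (M n \<gamma> \<rho>) {\<omega>\<in>space (M n \<gamma> \<rho>).
          sqrt (real n) * sqrt (\<Sum>i=1..p.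
            (est_of p n est (\<lambda>t. yobs (u n \<gamma> \<rho>) (z n \<gamma> \<rho>) (xi n \<gamma> \<rho>) t \<omega>) i - \<beta> i)\<^sup>2) > C} < e'" by meson
        then show ?thesis by (intro exI[of _ C] exI[of _ N]) auto
      qed
      have "{0<..R} \<subseteq> {0..R}" by auto
      then show "bounded ({0..\<Gamma>} \<times> {0<..R})"
        by (intro bounded_Times bounded_subset[OF bounded_closed_interval]) auto
    qed (use H e pplus est_meas in auto)
    then show "\<exists>N. \<forall>n\<ge>N. \<forall>y. \<forall>\<gamma>\<in>{0..\<Gamma>}. \<forall>\<rho>\<in>{0<..R}.
        \<bar>measure (M n \<gamma> \<rho>) {\<omega>\<in>space (M n \<gamma> \<rho>).
            chi2_stat p m x n
              (est_of p n est (\<lambda>t. yobs (u n \<gamma> \<rho>) (z n \<gamma> \<rho>) (xi n \<gamma> \<rho>) t \<omega>))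
              (\<lambda>t. yobs (u n \<gamma> \<rho>) (z n \<gamma> \<rho>) (xi n \<gamma> \<rho>) t \<omega>) \<le> y}
         - ncchisq_cdf m (\<Sum>j=1..m.
              (\<rho> * (measure Q (bin_plus x m j) - measure Q (bin_minus x m j))
               + \<gamma> * delta_j p \<beta> P GE x m j)\<^sup>2 / (2 * measure P (bin_plus x m j))) y\<bar>
        < e" by simp
  }
qed

end
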